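(* Let $X$ be a spectrally negative Lévy process (no positive jumps, not a.s. a non-increasing process), observed at the arrival times $T_1<T_2<\cdots$ of an independent Poisson process of rate $\lambda>0$. Let $\psi_q,\Phi_q,W_q,Z_q,\tilde Z_q$, the reflected laws $\mathbb E_x^0,\mathbb E_x^a$, the regulator $R$, and the times $T_0^-,T_a^+$ be as defined in the context. Then for all $a>0$, $\theta,\vartheta\ge 0$, $q\ge 0$ and $x\le a$: $$\mathbb E_x^0\big(e^{-qT_a^+-\vartheta R(T_a^+)-\theta(X(T_a^+)-a)};\,T_a^+<\infty\big)=\frac{\lambda(\vartheta-\Phi_{\lambda+q})Z_q(x,\vartheta)}{(\Phi_{\lambda+q}+\theta)\big(\psi_q(\vartheta)Z_q(a,\Phi_{\lambda+q})-\lambda Z_q(a,\vartheta)\big)}=\frac{\lambda}{\Phi_{\lambda+q}+\theta}\,\frac{Z_q(x,\vartheta)}{\tilde Z_q(a,\vartheta,\Phi_{\lambda+q})},$$ $$\mathbb E_x^a\big(e^{-qT_0^--\vartheta R(T_0^-)+\theta X(T_0^-)};\,T_0^-<\infty\big)=\frac{\lambda}{\lambda-\psi_q(\theta)}\left(Z_q(x,\theta)+Z_q(x,\Phi_{\lambda+q})\frac{W_q(a)\psi_q(\theta)-(\theta+\vartheta)Z_q(a,\theta)}{Z_q'(a,\Phi_{\lambda+q})+\vartheta Z_q(a,\Phi_{\lambda+q})}\right),$$ where $Z_q'$ denotes the derivative of $Z_q$ with respect to its first argument, and any quotient of the form $0/0$ (at $\vartheta=\Phi_{\lambda+q}$ in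 the first line, at $\theta=\Phi_{\lambda+q}$ in the second, or at $\vartheta=0$ in the second when $q=0$ and $X$ is a deterministic positive drift) is interpreted as the corresponding limit in that parameter.
   Context: $X$ is a spectrally negative Lévy process: a real-valued Lévy process with only negative jumps whose paths are not a.s. non-increasing. $\mathbb P_x,\mathbb E_x$ denote law and expectation when $X(0)=x$ (with an independent Poisson process of rate $\lambda>0$ with arrival times $T_i$, $i\ge1$, also defined). For any expectation, $\mathbb E(Y;A)$ means $\mathbb E(Y\mathbf 1_A)$. Laplace exponent: $\psi(\theta)=\log\mathbb E_0 e^{\theta X(1)}$, $\theta\ge0$; for $q\ge0$, $\psi_q(\theta)=\psi(\theta)-q$, and $\Phi_q\ge0$ is the right-most non-negative solution of $\psi_q(\theta)=0$. Thus $\psi_q(\Phi_{\lambda+q})=\lambda$. Scale functions: $W_q:\mathbb R\to[0,\infty)$ is zero on $(-\infty,0)$, continuous on $[0,\infty)$, positive on $(0,\infty)$, and determined by $\int_0^\infty e^{-\theta x}W_q(x)\,dx=1/\psi_q(\theta)$ for $\theta>\Phi_q$. For $\theta\ge0$, $Z_q(x,\theta)=e^{\theta x}\big(1-\psi_q(\theta)\int_0^x e^{-\theta y}W_q(y)\,dy\big)$ for $x\ge0$ and $Z_q(x,\theta)=e^{\theta x}$ for $x<0$. For $\alpha,\beta\ge0$, $$\tilde Z_q(x,\alpha,\beta)=\frac{\psi_q(\alpha)Z_q(x,\beta)-\psi_q(\beta)Z_q(x,\alpha)}{\alpha-\beta}\quad(\alpha\ne\beta),$$ and for $\alpha=\beta$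 it is the limit, $\tilde Z_q(x,\alpha,\alpha)=\psi_q'(\alpha)Z_q(x,\alpha)-\psi_q(\alpha)\,\partial_\alpha Z_q(x,\alpha)$ (derivative in the second argument). Reflected processes: let $\underline X(t)=\inf_{0\le s\le t}X(s)$, $\overline X(t)=\sup_{0\le s\le t}X(s)$, $y^+=\max(y,0)$. Under $\mathbb E_x^0$ (reflection at $0$ from below), the pair $(X(t),R(t))_{t\ge0}$ has the law of $\big(X(t)+(-\underline X(t))^+,\,(-\underline X(t))^+\big)_{t\ge0}$ under $\mathbb E_x$. Under $\mathbb E_x^a$ (reflection at $a$ from above), $(X(t),R(t))_{t\ge0}$ has the law of $\big(X(t)-(\overline X(t)-a)^+,\,(\overline X(t)-a)^+\big)_{t\ge0}$ under $\mathbb E_x$. In both cases the Poisson process with arrival times $T_i$ is independent. Passage times ($\min\varnothing=\infty$), evaluated for the reflected process $X$ under the respective law: $T_0^-=\min\{T_i: X(T_i)<0\}$, $T_a^+=\min\{T_i:X(T_i)>a\}$. The discount rate $q$ is equivalent to killing the process at an independent exponential time of rate $q$. *)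

theory Defs
  imports "HOL-Probability.Probability"
begin

text \<open>
  \<open>X t \<omega>\<close> is the process under \<open>\<P>\<^sub>0\<close>; the law \<open>\<P>\<^sub>x\<close> is that of \<open>x + X\<close>. Only times
  \<open>t \<ge> 0\<close> are constrained. Right-continuity and left limits hold on every path (and not just on
  almost every path), so that running extrema and values at random times are measurable although
  \<open>M\<close> need not be complete.
\<close>

locale spectrally_negative_Levy = prob_space M for M :: "'a measure" +
  fixes X :: "real \<Rightarrow> 'a \<Rightarrow> real"
  assumes measurable_X: "\<And>t. 0 \<le> t \<Longrightarrow> random_variable borel (X t)"
    and X_0: "AE \<omega> in M. X 0 \<omega> = 0"
    and indep_increments:
      "\<And>(t :: nat \<Rightarrow> real) n. 0 \<le> t 0 \<Longrightarrow> (\<And>i. i < n \<Longrightarrow> t i \<le> t (Suc i)) \<Longrightarrow>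
         indep_vars (\<lambda>_. borel) (\<lambda>i \<omega>. X (t (Suc i)) \<omega> - X (t i) \<omega>) {..<n}"
    and stationary_increments:
      "\<And>s h. 0 \<le> s \<Longrightarrow> 0 \<le> h \<Longrightarrow>
         distr M borel (\<lambda>\<omega>. X (s + h) \<omega> - X s \<omega>) = distr M borel (X h)"
    and right_cont:
      "\<And>\<omega> t. \<omega> \<in> space M \<Longrightarrow> 0 \<le> t \<Longrightarrow> continuous (at_right t) (\<lambda>s. X s \<omega>)"
    and left_limits:
      "\<And>\<omega> t. \<omega> \<in> space M \<Longrightarrow> 0 < t \<Longrightarrow> \<exists>l. ((\<lambda>s. X s \<omega>) \<longlongrightarrow> l) (at_left t)"
    and no_positive_jumps:
      "AE \<omega> in M. \<forall>t>0. X t \<omega> \<le> Lim (at_left t) (\<lambda>s. X s \<omega>)"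
    and not_nonincreasing:
      "\<not> (AE \<omega> in M. \<forall>s t. 0 \<le> s \<longrightarrow> s \<le> t \<longrightarrow> X t \<omega> \<le> X s \<omega>)"

text \<open>
  Arrival times of a Poisson process. \<open>T 0 = 0\<close> is only a convention: the arrivals are \<open>T i\<close> with
  \<open>i \<ge> 1\<close>. They are strictly increasing on every path, so that all \<open>T i\<close> with \<open>i \<ge> 1\<close> are positive.
\<close>

locale Poisson_arrivals = prob_space M for M :: "'a measure" +
  fixes l :: real and T :: "nat \<Rightarrow> 'a \<Rightarrow> real"
  assumes rate_pos: "0 < l"
    and T_0: "\<And>\<omega>. \<omega> \<in> space M \<Longrightarrow> T 0 \<omega> = 0"
    and T_less: "\<And>\<omega> i. \<omega> \<in> space M \<Longrightarrow> T i \<omega> < T (Suc i) \<omega>"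
    and exponential_gaps:
      "\<And>i. distributed M lborel (\<lambda>\<omega>. T (Suc i) \<omega> - T i \<omega>) (exponential_density l)"
    and indep_gaps: "indep_vars (\<lambda>_. borel) (\<lambda>i \<omega>. T (Suc i) \<omega> - T i \<omega>) UNIV"

definition indep_of_arrivals ::
    "'a measure \<Rightarrow> (real \<Rightarrow> 'a \<Rightarrow> real) \<Rightarrow> (nat \<Rightarrow> 'a \<Rightarrow> real) \<Rightarrow> bool" where
  "indep_of_arrivals M X T \<longleftrightarrow> prob_space.indep_set M
     (sigma_sets (space M) {X t -` B \<inter> space M | t B. 0 \<le> t \<and> B \<in> sets borel})
     (sigma_sets (space M) {T i -` B \<inter> space M | i B. B \<in> sets borel})"

definition Laplace_exponent :: "'a measure \<Rightarrow> (real \<Rightarrow> 'a \<Rightarrow> real) \<Rightarrow> real \<Rightarrow> real" where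
  "Laplace_exponent M X \<theta> = ln (\<integral>\<omega>. exp (\<theta> * X 1 \<omega>) \<partial>M)"

definition psi_q :: "(real \<Rightarrow> real) \<Rightarrow> real \<Rightarrow> real \<Rightarrow> real" where
  "psi_q \<psi> q \<theta> = \<psi> \<theta> - q"

definition Phi :: "(real \<Rightarrow> real) \<Rightarrow> real \<Rightarrow> real" where
  "Phi \<psi> q = (GREATEST \<theta>. 0 \<le> \<theta> \<and> psi_q \<psi> q \<theta> = 0)"

text \<open>
  The properties that determine the scale function \<open>W\<^sub>q\<close> uniquely. The integral is a
  Henstock--Kurzweil integral; as \<open>W \<ge> 0\<close> it agrees with the Lebesgue integral.
\<close>

definition is_scale_function :: "(real \<Rightarrow> real) \<Rightarrow> real \<Rightarrow> (real \<Rightarrow> real) \<Rightarrow> bool" where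
  "is_scale_function \<psi> q W \<longleftrightarrow>
     (\<forall>x<0. W x = 0) \<and> continuous_on {0..} W \<and> (\<forall>x. 0 \<le> W x) \<and> (\<forall>x>0. 0 < W x) \<and>
     (\<forall>\<theta>>Phi \<psi> q. ((\<lambda>x. exp (- \<theta> * x) * W x) has_integral (1 / psi_q \<psi> q \<theta>)) {0..})"

definition scale_Z :: "(real \<Rightarrow> real) \<Rightarrow> real \<Rightarrow> (real \<Rightarrow> real) \<Rightarrow> real \<Rightarrow> real \<Rightarrow> real" where
  "scale_Z \<psi> q W x \<theta> =
     (if x < 0 then exp (\<theta> * x)
      else exp (\<theta> * x) * (1 - psi_q \<psi> q \<theta> * integral {0..x} (\<lambda>y. exp (- \<theta> * y) * W y)))"

text \<open>
  Derivatives are taken within \<open>{0..}\<close>, where \<open>\<psi>\<close> is meaningful; at \<open>\<alpha> > 0\<close> these are the ordinary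
  derivatives.
\<close>

definition scale_Z_tilde ::
    "(real \<Rightarrow> real) \<Rightarrow> real \<Rightarrow> (real \<Rightarrow> real) \<Rightarrow> real \<Rightarrow> real \<Rightarrow> real \<Rightarrow> real" where
  "scale_Z_tilde \<psi> q W x \<alpha> \<beta> =
     (if \<alpha> \<noteq> \<beta>
      then (psi_q \<psi> q \<alpha> * scale_Z \<psi> q W x \<beta> - psi_q \<psi> q \<beta> * scale_Z \<psi> q W x \<alpha>) / (\<alpha> - \<beta>)
      else vector_derivative (psi_q \<psi> q) (at \<alpha> within {0..}) * scale_Z \<psi> q W x \<alpha>
         - psi_q \<psi> q \<alpha> * vector_derivative (scale_Z \<psi> q W x) (at \<alpha> within {0..}))"

text \<open>Reflection of a path \<open>w\<close> at \<open>0\<close> from below and at \<open>a\<close> from above, with the regulators.\<close>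

definition reg_below :: "(real \<Rightarrow> real) \<Rightarrow> real \<Rightarrow> real" where
  "reg_below w t = max (- (INF s\<in>{0..t}. w s)) 0"

definition refl_below :: "(real \<Rightarrow> real) \<Rightarrow> real \<Rightarrow> real" where
  "refl_below w t = w t + reg_below w t"

definition reg_above :: "real \<Rightarrow> (real \<Rightarrow> real) \<Rightarrow> real \<Rightarrow> real" where
  "reg_above a w t = max ((SUP s\<in>{0..t}. w s) - a) 0"

definition refl_above :: "real \<Rightarrow> (real \<Rightarrow> real) \<Rightarrow> real \<Rightarrow> real" where
  "refl_above a w t = w t - reg_above a w t"

text \<open>
  First arrival time \<open>\<tau> i\<close>, \<open>i \<ge> 1\<close>, at which the path \<open>y\<close> is in \<open>A\<close>. Almost surely \<open>\<tau>\<close> increases to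
  infinity and the infimum is a minimum; it is \<open>\<infinity>\<close> if there is no such arrival.
\<close>

definition obs_time :: "(nat \<Rightarrow> real) \<Rightarrow> real set \<Rightarrow> (real \<Rightarrow> real) \<Rightarrow> ereal" where
  "obs_time \<tau> A y = (INF i\<in>{i. 1 \<le> i \<and> y (\<tau> i) \<in> A}. ereal (\<tau> i))"

text \<open>
  \<open>\<eta>\<close> is the exponent of the regulator \<open>R\<close>.
  \<open>E_below\<close> is \<open>\<E>\<^sub>x\<^sup>0(exp (- q T - \<eta> R(T) - \<theta> (X(T) - a)); T < \<infinity>)\<close> with \<open>T\<close> the first observed
  passage above \<open>a\<close>, and \<open>E_above\<close> is \<open>\<E>\<^sub>x\<^sup>a(exp (- q T - \<eta> R(T) + \<theta> X(T)); T < \<infinity>)\<close> with \<open>T\<close> the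
  first observed passage below \<open>0\<close>.
\<close>

definition E_below ::
    "'a measure \<Rightarrow> (real \<Rightarrow> 'a \<Rightarrow> real) \<Rightarrow> (nat \<Rightarrow> 'a \<Rightarrow> real) \<Rightarrow>
     real \<Rightarrow> real \<Rightarrow> real \<Rightarrow> real \<Rightarrow> real \<Rightarrow> real" where
  "E_below M X T a q \<eta> \<theta> x =
     (let w = (\<lambda>\<omega> t. x + X t \<omega>);
          Ta = (\<lambda>\<omega>. obs_time (\<lambda>i. T i \<omega>) {a<..} (refl_below (w \<omega>)))
      in LINT \<omega>:{\<omega> \<in> space M. Ta \<omega> < \<infinity>}|M.
           (let t = real_of_ereal (Ta \<omega>)
            in exp (- q * t - \<eta> * reg_below (w \<omega>) t - \<theta> * (refl_below (w \<omega>) t - a))))"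

definition E_above ::
    "'a measure \<Rightarrow> (real \<Rightarrow> 'a \<Rightarrow> real) \<Rightarrow> (nat \<Rightarrow> 'a \<Rightarrow> real) \<Rightarrow>
     real \<Rightarrow> real \<Rightarrow> real \<Rightarrow> real \<Rightarrow> real \<Rightarrow> real" where
  "E_above M X T a q \<eta> \<theta> x =
     (let w = (\<lambda>\<omega> t. x + X t \<omega>);
          T0 = (\<lambda>\<omega>. obs_time (\<lambda>i. T i \<omega>) {..<0} (refl_above a (w \<omega>)))
      in LINT \<omega>:{\<omega> \<in> space M. T0 \<omega> < \<infinity>}|M.
           (let t = real_of_ereal (T0 \<omega>)
            in exp (- q * t - \<eta> * reg_above a (w \<omega>) t + \<theta> * refl_above a (w \<omega>) t)))"

text \<open>
  The quotient \<open>n v / d v\<close>, where \<open>0/0\<close> is read as the limit in the parameter \<open>v \<ge> 0\<close>.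
\<close>

definition quot_lim :: "(real \<Rightarrow> real) \<Rightarrow> (real \<Rightarrow> real) \<Rightarrow> real \<Rightarrow> real" where
  "quot_lim n d v =
     (if n v = 0 \<and> d v = 0 then Lim (at v within {0..}) (\<lambda>u. n u / d u) else n v / d v)"

end

theory Submission
  imports Defs
begin

text \<open>
  Let \<open>p = \<lambda> + q\<close>. For each interval between consecutive arrivals record its length, the depth of the
  minimum below the initial value, and the rise from the minimum to the final value. These blocks are
  independent and identically distributed, and they drive the reflected process observed at the
  arrivals, so both expectations are determined by renewal equations that are contractions. Weighting a
  block with \<open>exp (- q gap)\<close> replaces it, up to the factor \<open>\<lambda> / p\<close>, by \<open>X\<close> run for an \<open>Exp p\<close> time,
  where depth and rise are independent: for a random walk stopped at a geometric time this is the
  decomposition at the first minimum, and \<open>X\<close> is the limit of its restrictions to grids. The rise is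
  exponential with parameter \<open>\<Phi>\<^sub>p\<close>, because without positive jumps there is no overshoot, and the
  transform \<open>\<kappa>\<close> of the depth satisfies \<open>(p - \<psi>(\<theta>)) \<kappa>(\<theta>) = p (1 - \<theta> / \<Phi>\<^sub>p)\<close>. Laplace inversion of this
  identity evaluates the mean of \<open>Z\<^sub>q(x - depth, \<theta>)\<close> through \<open>Z\<^sub>q\<close> and \<open>W\<^sub>q\<close>, and the mean over the
  exponential rise amounts to a linear differential equation of first order; so combinations of
  \<open>Z\<^sub>q(\<cdot>, \<theta>)\<close> and \<open>Z\<^sub>q(\<cdot>, \<Phi>\<^sub>p)\<close> solve the renewal equations. Reflection of \<open>X\<close> at \<open>a\<close> from above is
  reflection of \<open>a - X\<close> at \<open>0\<close> from below. Uniqueness for the homogeneous equations shows that the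
  denominators do not vanish for generic parameters, and the remaining cases follow because the
  expectations are continuous in \<open>\<eta>\<close> and \<open>\<theta>\<close>.
\<close>

section \<open>Paths\<close>

text \<open>Three obstacles shape the proof. An infimum over a continuum of times is not visibly
  measurable, and the independence of finitely many increments does not reach it; so every statement
  about \<open>dip\<close> and \<open>rise\<close> is first made on dyadic grids and then carried to
  the limit by right-continuity. For \<theta> \<ge> \<open>rate p\<close> the mean of
  \<open>exp (\<theta> X)\<close> at an \<open>Exp p\<close> time is infinite, so the factorisation
  yields the identity for \<open>kappa\<close> only for small \<theta>; it extends because, for
  fixed \<theta>, it is a relation between Laplace transforms in \<open>p\<close> that holds for all
  large \<open>p\<close>. Under reflection from above the passage below \<open>0\<close> may never
  be observed (a positive drift with \<open>q = 0\<close>), so the renewal operator there is a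
  contraction only thanks to a discount \<eta> > 0 of the regulator, and \<eta> = 0 is reached as a
  limit. A scalar \<beta> multiplies the payoff throughout: \<beta> = 1 gives the expectation, and
  \<beta> = 0 the homogeneous equation, whose only solution is zero; hence the denominators do not
  vanish.\<close>

lemma cadlag_bounded_on_cbox:
  fixes w :: "real \<Rightarrow> real"
  assumes rc: "\<And>s. 0 \<le> s \<Longrightarrow> continuous (at_right s) w"
    and ll: "\<And>s. 0 < s \<Longrightarrow> \<exists>l. (w \<longlongrightarrow> l) (at_left s)"
  shows "bounded (w ` {0..t})"
proof -
  \<comment> \<open>Right-continuity controls the path after \<open>s\<close> and the left limit
    controls it before \<open>s\<close>, so near \<open>s\<close> it stays in two unit balls.
    Compactness of the interval leaves finitely many such neighbourhoods.\<close>
  have loc: "\<exists>d>0. bounded (w ` ({0..t} \<inter> {s-d<..<s+d}))" if s: "s \<in> {0..t}" for s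
  proof -
    have "(w \<longlongrightarrow> w s) (at_right s)" using rc[of s] s by (simp add: continuous_within)
    then have "\<forall>\<^sub>F u in at_right s. dist (w u) (w s) < 1" by (rule tendstoD) simp
    then obtain d1 where d1: "d1 > s" "\<And>u. s < u \<Longrightarrow> u < d1 \<Longrightarrow> dist (w u) (w s) < 1"
      by (auto simp: eventually_at_right_field)
    have "\<exists>d2<s. \<exists>l. \<forall>u. d2 < u \<and> u < s \<and> 0 \<le> u \<longrightarrow> dist (w u) l < 1"
    proof (cases "s = 0")
      case True
      \<comment> \<open>No left limit is assumed at \<open>0\<close>; with the witness
        \<open>-1\<close> the claim is empty because of \<open>0 \<le> u\<close>.\<close>
      then show ?thesis by (intro exI[of _ "-1"]) auto
    next
      case False
      then obtain l where "(w \<longlongrightarrow> l) (at_left s)" using ll[of s] s by auto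
      then have "\<forall>\<^sub>F u in at_left s. dist (w u) l < 1" by (rule tendstoD) simp
      then show ?thesis by (auto simp: eventually_at_left_field)
    qed
    then obtain d2 l where d2: "d2 < s" "\<And>u. d2 < u \<Longrightarrow> u < s \<Longrightarrow> 0 \<le> u \<Longrightarrow> dist (w u) l < 1" by blast
    define d where "d = min (d1 - s) (s - d2)"
    have "w ` ({0..t} \<inter> {s-d<..<s+d}) \<subseteq> cball (w s) 1 \<union> cball l 1"
    proof
      fix y assume "y \<in> w ` ({0..t} \<inter> {s-d<..<s+d})"
      then obtain u where u: "y = w u" "0 \<le> u" "s - d < u" "u < s + d" by auto
      consider "u < s" | "u = s" | "u > s" by linarith
      then show "y \<in> cball (w s) 1 \<union> cball l 1"
        using d1(2)[of u] d2(2)[of u] u by cases (auto simp: d_def dist_commute less_imp_le)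
    qed
    moreover have "bounded (cball (w s) 1 \<union> cball l 1)" by (rule bounded_Un[THEN iffD2]) auto
    ultimately have "bounded (w ` ({0..t} \<inter> {s-d<..<s+d}))" by (blast intro: bounded_subset)
    moreover have "d > 0" using d1(1) d2(1) by (simp add: d_def)
    ultimately show ?thesis by blast
  qed
  then obtain d where d: "\<And>s. s \<in> {0..t} \<Longrightarrow> d s > 0"
      "\<And>s. s \<in> {0..t} \<Longrightarrow> bounded (w ` ({0..t} \<inter> {s - d s<..<s + d s}))" by metis
  have "compact {0..t}" by simp
  then obtain C where C: "C \<subseteq> {0..t}" "finite C" "{0..t} \<subseteq> (\<Union>s\<in>C. {s - d s<..<s + d s})"
  proof (rule compactE_image[of "{0..t}" "{0..t}" "\<lambda>s. {s - d s<..<s + d s}"])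
    show "{0..t} \<subseteq> (\<Union>s\<in>{0..t}. {s - d s<..<s + d s})" using d(1) by (intro subsetI UN_I) auto
  qed auto
  have "bounded (\<Union>s\<in>C. w ` ({0..t} \<inter> {s - d s<..<s + d s}))" using C d(2) by (intro bounded_UN) auto
  moreover have "w ` {0..t} \<subseteq> (\<Union>s\<in>C. w ` ({0..t} \<inter> {s - d s<..<s + d s}))" using C(3) by blast
  ultimately show ?thesis by (rule bounded_subset)
qed

text \<open>The grids may run past \<open>t\<close> by \<open>e k\<close>, since a dyadic grid need
  not contain \<open>t\<close>. Right-continuity is used twice: at a near-minimiser
  \<open>s\<close>, to find a good grid point just after it, and at \<open>t\<close>, so that grid
  values beyond \<open>t\<close> cannot undercut the infimum in the limit.\<close>

lemma tendsto_Min_grid_INF: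
  fixes w :: "real \<Rightarrow> real"
  assumes rc: "\<And>s. 0 \<le> s \<Longrightarrow> continuous (at_right s) w" and t: "0 \<le> t"
    and bdd: "bdd_below (w ` {0..t})"
    and D: "\<And>k. finite (D k)" "\<And>k. D k \<subseteq> {0..t + e k}" "\<And>k. D k \<noteq> {}"
    and e: "e \<longlonglongrightarrow> 0"
    and fine: "\<And>s k. s \<in> {0..t} \<Longrightarrow> \<exists>u\<in>D k. s \<le> u \<and> u \<le> s + e k"
  shows "(\<lambda>k. Min (w ` D k)) \<longlonglongrightarrow> (INF s\<in>{0..t}. w s)"
proof (rule LIMSEQ_I)
  fix r :: real assume r: "0 < r"
  let ?I = "INF s\<in>{0..t}. w s"
  have near: "\<exists>d>0. \<forall>u. s \<le> u \<and> u < s + d \<longrightarrow> \<bar>w u - w s\<bar> < r/2" if "0 \<le> s" for s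
  proof -
    have "(w \<longlongrightarrow> w s) (at_right s)" using rc[of s] that by (simp add: continuous_within)
    then have "\<forall>\<^sub>F u in at_right s. dist (w u) (w s) < r/2" using r by (intro tendstoD) auto
    then obtain b where "b > s" "\<And>u. s < u \<Longrightarrow> u < b \<Longrightarrow> dist (w u) (w s) < r/2"
      by (auto simp: eventually_at_right_field)
    then show ?thesis using r by (intro exI[of _ "b - s"]) (auto simp: dist_real_def le_less)
  qed
  have "\<exists>x\<in>w ` {0..t}. x < ?I + r/2" by (rule cInf_lessD) (use t r in auto)
  then obtain s where s: "s \<in> {0..t}" "w s < ?I + r/2" by auto
  obtain d where d: "d > 0" "\<And>u. s \<le> u \<Longrightarrow> u < s + d \<Longrightarrow> \<bar>w u - w s\<bar> < r/2" using near[of s] s by auto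
  obtain d' where d': "d' > 0" "\<And>u. t \<le> u \<Longrightarrow> u < t + d' \<Longrightarrow> \<bar>w u - w t\<bar> < r/2" using near[of t] t by auto
  obtain N where N: "\<And>k. k \<ge> N \<Longrightarrow> \<bar>e k\<bar> < min d d'" using LIMSEQ_D[OF e, of "min d d'"] d d' by auto
  have "\<bar>Min (w ` D k) - ?I\<bar> < r" if k: "k \<ge> N" for k
  proof -
    obtain u where u: "u \<in> D k" "s \<le> u" "u \<le> s + e k" using fine[OF s(1)] by blast
    have "Min (w ` D k) \<le> w u" using u D by auto
    moreover have "\<bar>w u - w s\<bar> < r/2" using d(2)[of u] u N[OF k] by auto
    ultimately have 1: "Min (w ` D k) < ?I + r" using s(2) by linarith
    have "Min (w ` D k) \<in> w ` D k" using D by (intro Min_in) auto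
    then obtain v where v: "v \<in> D k" "Min (w ` D k) = w v" by auto
    have "?I - r < w v"
    proof (cases "v \<le> t")
      case True
      then have "?I \<le> w v" using D(2)[of k] v by (intro cINF_lower bdd) auto
      then show ?thesis using r by simp
    next
      case False
      have "?I \<le> w t" using t by (intro cINF_lower bdd) auto
      moreover have "\<bar>w v - w t\<bar> < r/2" using False D(2)[of k] v N[OF k] by (intro d'(2)) auto
      ultimately show ?thesis using r by linarith
    qed
    then show ?thesis using 1 v by linarith
  qed
  then show "\<exists>no. \<forall>n\<ge>no. norm (Min (w ` D n) - ?I) < r" by auto
qed

text \<open>Cauchy's equation with a local bound: subtracting \<open>x * f 1\<close> leaves an
  additive function that vanishes at \<open>1\<close>, hence has period \<open>1\<close>, hence is
  bounded everywhere. As \<open>g (n x) = n g x\<close>, a bounded additive function is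
  zero.\<close>

lemma additive_bounded_linear:
  fixes f :: "real \<Rightarrow> real"
  assumes add: "\<And>x y. 0 < x \<Longrightarrow> 0 < y \<Longrightarrow> f (x + y) = f x + f y"
    and bdd: "\<And>x. 0 < x \<Longrightarrow> x \<le> 1 \<Longrightarrow> \<bar>f x\<bar> \<le> B"
    and x: "0 < x"
  shows "f x = x * f 1"
proof -
  define g where "g x = f x - x * f 1" for x
  have gadd: "g (x + y) = g x + g y" if "0 < x" "0 < y" for x y
    using add[OF that] by (simp add: g_def algebra_simps)
  have g1: "g 1 = 0" by (simp add: g_def)
  have gn: "g (real n * x) = real n * g x" if "0 < x" "0 < n" for n x using that(2)
  proof (induction n)
    case (Suc n)
    then show ?case by (cases "n = 0") (use gadd[of "real n * x" x] that in \<open>auto simp: algebra_simps\<close>)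
  qed simp
  define C where "C = B + \<bar>f 1\<bar>"
  have small: "\<bar>g x\<bar> \<le> C" if "0 < x" "x \<le> 1" for x
  proof -
    have "\<bar>x * f 1\<bar> \<le> \<bar>f 1\<bar>" using that by (simp add: abs_mult mult_left_le_one_le)
    then show ?thesis using bdd[OF that] by (simp add: g_def C_def)
  qed
  have all: "\<bar>g x\<bar> \<le> C" if "0 < x" for x
  proof -
    \<comment> \<open>This \<open>n\<close> puts \<open>x - n\<close> into the half-open interval
      from \<open>0\<close> to \<open>1\<close> with \<open>1\<close> included, where the bound is
      assumed.\<close>
    define n where "n = nat (\<lceil>x\<rceil> - 1)"
    have n: "real n < x" "x \<le> real n + 1" using that ceiling_correct[of x] by (simp_all add: n_def)
    have "g x = g (x - real n)"
    proof (cases "n = 0")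
      case False
      then show ?thesis using gadd[of "x - real n" "real n * 1"] gn[of 1 n] g1 n by auto
    qed simp
    then show ?thesis using small[of "x - real n"] n by simp
  qed
  have "g x = 0"
  proof (rule ccontr)
    assume "g x \<noteq> 0"
    then obtain n :: nat where n: "C < real n * \<bar>g x\<bar>" using reals_Archimedean3[of "\<bar>g x\<bar>"] by auto
    have "n > 0" using n small[of 1] by (cases n) auto
    then have "\<bar>g (real n * x)\<bar> = real n * \<bar>g x\<bar>" using gn[OF x] by (simp add: abs_mult)
    then show False using all[of "real n * x"] n \<open>n > 0\<close> x by simp
  qed
  then show ?thesis by (simp add: g_def)
qed

section \<open>Increments on grids\<close>

lemma right_cont_seq:
  fixes w :: "real \<Rightarrow> real"
  assumes "continuous (at_right t) w" "u \<longlonglongrightarrow> t" "\<And>k. t \<le> u k"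
  shows "(\<lambda>k. w (u k)) \<longlonglongrightarrow> w t"
proof (rule LIMSEQ_I)
  fix r :: real assume r: "0 < r"
  have "(w \<longlongrightarrow> w t) (at_right t)" using assms(1) by (simp add: continuous_within)
  then have "\<forall>\<^sub>F u in at_right t. dist (w u) (w t) < r" using r by (intro tendstoD) auto
  then obtain b where b: "b > t" "\<And>u. t < u \<Longrightarrow> u < b \<Longrightarrow> dist (w u) (w t) < r"
    by (auto simp: eventually_at_right_field)
  have "\<forall>\<^sub>F k in sequentially. u k < b" using order_tendstoD(2)[OF assms(2) b(1)] .
  then obtain N where N: "\<And>k. k \<ge> N \<Longrightarrow> u k < b" by (auto simp: eventually_sequentially)
  have "norm (w (u k) - w t) < r" if "k \<ge> N" for k using b(2)[of "u k"] N[OF that] assms(3)[of k] r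
    by (cases "u k = t") (auto simp: dist_norm)
  then show "\<exists>no. \<forall>n\<ge>no. norm (w (u n) - w t) < r" by blast
qed

abbreviation (input) neg :: "(real \<Rightarrow> 'a \<Rightarrow> real) \<Rightarrow> real \<Rightarrow> 'a \<Rightarrow> real" where
  "neg X \<equiv> (\<lambda>t \<omega>. - X t \<omega>)"

text \<open>These are the assumptions of \<open>spectrally_negative_Levy\<close> that survive a
  change of sign. What is proved here applies to \<open>X\<close> and to \<open>neg X\<close>, so
  that suprema and reflection from above come for free.\<close>

locale cadlag_Levy = prob_space M for M :: "'a measure" +
  fixes X :: "real \<Rightarrow> 'a \<Rightarrow> real"
  assumes measurable_X: "\<And>t. 0 \<le> t \<Longrightarrow> random_variable borel (X t)"
    and X_0: "AE \<omega> in M. X 0 \<omega> = 0"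
    and indep_increments:
      "\<And>(t :: nat \<Rightarrow> real) n. 0 \<le> t 0 \<Longrightarrow> (\<And>i. i < n \<Longrightarrow> t i \<le> t (Suc i)) \<Longrightarrow>
         indep_vars (\<lambda>_. borel) (\<lambda>i \<omega>. X (t (Suc i)) \<omega> - X (t i) \<omega>) {..<n}"
    and stationary_increments:
      "\<And>s h. 0 \<le> s \<Longrightarrow> 0 \<le> h \<Longrightarrow>
         distr M borel (\<lambda>\<omega>. X (s + h) \<omega> - X s \<omega>) = distr M borel (X h)"
    and right_cont:
      "\<And>\<omega> t. \<omega> \<in> space M \<Longrightarrow> 0 \<le> t \<Longrightarrow> continuous (at_right t) (\<lambda>s. X s \<omega>)"
    and left_limits:
      "\<And>\<omega> t. \<omega> \<in> space M \<Longrightarrow> 0 < t \<Longrightarrow> \<exists>l. ((\<lambda>s. X s \<omega>) \<longlongrightarrow> l) (at_left t)"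

lemma (in spectrally_negative_Levy) cadlag_Levy: "cadlag_Levy M X"
  by unfold_locales
    (fact measurable_X X_0 indep_increments stationary_increments right_cont left_limits)+

lemma (in cadlag_Levy) uminus: "cadlag_Levy M (neg X)"
proof unfold_locales
  show "random_variable borel (\<lambda>\<omega>. - X t \<omega>)" if "0 \<le> t" for t using measurable_X[OF that] by simp
  show "AE \<omega> in M. - X 0 \<omega> = 0" using X_0 by simp
  show "indep_vars (\<lambda>_. borel) (\<lambda>i \<omega>. - X (t (Suc i)) \<omega> - - X (t i) \<omega>) {..<n}"
    if "0 \<le> t 0" "\<And>i. i < n \<Longrightarrow> t i \<le> t (Suc i)" for t :: "nat \<Rightarrow> real" and n
    using indep_vars_compose2[where M'="\<lambda>_. borel" and N="\<lambda>_. borel" and Y="\<lambda>_ x. - x :: real",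
        OF indep_increments[of t n]] that by simp
  show "distr M borel (\<lambda>\<omega>. - X (s + h) \<omega> - - X s \<omega>) = distr M borel (\<lambda>\<omega>. - X h \<omega>)"
    if "0 \<le> s" "0 \<le> h" for s h
  proof -
    have [measurable]: "X s \<in> borel_measurable M" "X (s + h) \<in> borel_measurable M" "X h \<in> borel_measurable M"
      using that by (auto intro: measurable_X)
    have "distr M borel (\<lambda>\<omega>. - X (s + h) \<omega> - - X s \<omega>)
        = distr (distr M borel (\<lambda>\<omega>. X (s + h) \<omega> - X s \<omega>)) borel (\<lambda>x. - x)"
      by (subst distr_distr) (auto simp: comp_def uminus_add_conv_diff)
    also have "\<dots> = distr (distr M borel (X h)) borel (\<lambda>x. - x)" by (simp add: stationary_increments that)
    also have "\<dots> = distr M borel (\<lambda>\<omega>. - X h \<omega>)" by (subst distr_distr) (auto simp: comp_def)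
    finally show ?thesis .
  qed
  show "continuous (at_right t) (\<lambda>s. - X s \<omega>)" if "\<omega> \<in> space M" "0 \<le> t" for \<omega> t
    using right_cont[OF that] by (intro continuous_minus)
  show "\<exists>l. ((\<lambda>s. - X s \<omega>) \<longlongrightarrow> l) (at_left t)" if "\<omega> \<in> space M" "0 < t" for \<omega> t
    using left_limits[OF that] by (auto intro: tendsto_minus)
qed

definition dip :: "(real \<Rightarrow> 'a \<Rightarrow> real) \<Rightarrow> real \<Rightarrow> real \<Rightarrow> 'a \<Rightarrow> real" where
  "dip X s g \<omega> = X s \<omega> - (INF u\<in>{s..s+g}. X u \<omega>)"

definition rise :: "(real \<Rightarrow> 'a \<Rightarrow> real) \<Rightarrow> real \<Rightarrow> real \<Rightarrow> 'a \<Rightarrow> real" where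
  "rise X s g \<omega> = X (s + g) \<omega> - (INF u\<in>{s..s+g}. X u \<omega>)"

context cadlag_Levy
begin

lemma path_bounded: "\<omega> \<in> space M \<Longrightarrow> bounded ((\<lambda>s. X s \<omega>) ` {0..t})"
  by (rule cadlag_bounded_on_cbox) (auto intro: right_cont left_limits)

lemma path_bdd_below: "\<omega> \<in> space M \<Longrightarrow> 0 \<le> s \<Longrightarrow> bdd_below ((\<lambda>u. X u \<omega>) ` {s..t})"
  by (rule bdd_below_mono[OF bounded_imp_bdd_below[OF path_bounded[of \<omega> t]]]) auto

lemma path_seq:
  "\<omega> \<in> space M \<Longrightarrow> 0 \<le> t \<Longrightarrow> u \<longlonglongrightarrow> t \<Longrightarrow> (\<And>k. t \<le> u k) \<Longrightarrow> (\<lambda>k. X (u k) \<omega>) \<longlonglongrightarrow> X t \<omega>"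
  by (rule right_cont_seq[where w="\<lambda>s. X s \<omega>"]) (auto intro: right_cont)

text \<open>Every time of the interval is a limit from the right of dyadic points (rounding up by a
  ceiling), so right-continuity carries the closed condition \<open>c \<le> _\<close> from the
  dyadic points to all times. All measurability of \<open>dip\<close> and \<open>rise\<close> comes
  from this countable condition.\<close>

lemma INF_ge_iff_dyadic:
  assumes \<omega>: "\<omega> \<in> space M" and s: "0 \<le> s" and g: "0 \<le> g"
  shows "c \<le> (INF u\<in>{s..s+g}. X u \<omega>) \<longleftrightarrow> (\<forall>k. \<forall>j\<le>2^k. c \<le> X (s + g * (real j / 2^k)) \<omega>)"
    (is "?L \<longleftrightarrow> ?R")
proof
  assume L: ?L
  show ?R
  proof (intro allI impI)
    fix k j :: nat assume "j \<le> 2^k"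
    then have "real j / 2^k \<le> 1"
      by (metis (mono_tags) divide_le_eq_1_pos of_nat_le_iff of_nat_numeral of_nat_power zero_less_numeral zero_less_power)
    then have "g * (real j / 2^k) \<le> g" using g by (intro mult_left_le)
    then have "s + g * (real j / 2^k) \<in> {s..s+g}" using g by simp
    then have "(INF u\<in>{s..s+g}. X u \<omega>) \<le> X (s + g * (real j / 2^k)) \<omega>"
      by (rule cINF_lower[OF path_bdd_below[OF \<omega> s]])
    with L show "c \<le> X (s + g * (real j / 2^k)) \<omega>" by simp
  qed
next
  assume R: ?R
  show ?L
  proof (rule cINF_greatest)
    show "{s..s+g} \<noteq> {}" using g by simp
    fix u assume u: "u \<in> {s..s+g}"
    show "c \<le> X u \<omega>"
    proof (cases "g = 0")
      case True
      then show ?thesis using R[rule_format, of 0 0] u by simp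
    next
      case False
      then have g0: "g > 0" using g by simp
      define v where "v = (u - s) / g"
      have v: "0 \<le> v" "v \<le> 1" "u = s + g * v" using u g0 by (auto simp: v_def)
      define j where "j k = nat \<lceil>v * 2^k\<rceil>" for k :: nat
      have j: "v * 2^k \<le> real (j k)" "real (j k) \<le> v * 2^k + 1" for k
      proof -
        have "0 \<le> v * 2^k" using v by simp
        then have "real (j k) = of_int \<lceil>v * 2^k\<rceil>"
          unfolding j_def by (metis ceiling_mono ceiling_zero of_nat_nat of_int_of_nat_eq)
        then show "v * 2^k \<le> real (j k)" "real (j k) \<le> v * 2^k + 1"
          using ceiling_correct[of "v * 2^k"] by linarith+
      qed
      have jle: "j k \<le> 2^k" for k
      proof -
        have "v * 2^k \<le> 2^k" using v by (simp add: mult_left_le_one_le)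
        then have "\<lceil>v * 2^k\<rceil> \<le> 2^k" by (simp add: ceiling_le_iff)
        then show ?thesis unfolding j_def by (simp add: nat_le_iff)
      qed
      have lo: "v \<le> real (j k) / 2^k" and hi: "real (j k) / 2^k \<le> v + (1/2)^k" for k
        using j[of k] by (simp_all add: field_simps power_divide)
      have "(\<lambda>k. real (j k) / 2^k) \<longlonglongrightarrow> v"
      proof (rule tendsto_sandwich[where f="\<lambda>_. v"])
        show "(\<lambda>k. v + (1/2)^k) \<longlonglongrightarrow> v"
          using tendsto_add[OF tendsto_const[of v] LIMSEQ_power_zero[of "1/2::real"]] by simp
      qed (use lo hi in auto)
      then have "(\<lambda>k. s + g * (real (j k) / 2^k)) \<longlonglongrightarrow> u" unfolding v(3) by (intro tendsto_intros)
      moreover have "u \<le> s + g * (real (j k) / 2^k)" for k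
        unfolding v(3) using lo[of k] g by (intro add_left_mono mult_left_mono) auto
      ultimately have "(\<lambda>k. X (s + g * (real (j k) / 2^k)) \<omega>) \<longlonglongrightarrow> X u \<omega>" using u s by (intro path_seq \<omega>) auto
      then show ?thesis by (rule LIMSEQ_le_const) (use R jle in auto)
    qed
  qed
qed

lemma dip_le_iff:
  assumes "\<omega> \<in> space M" "0 \<le> s" "0 \<le> g"
  shows "dip X s g \<omega> \<le> a \<longleftrightarrow> (\<forall>k. \<forall>j\<le>2^k. X s \<omega> - X (s + g * (real j / 2^k)) \<omega> \<le> a)"
  using INF_ge_iff_dyadic[OF assms, of "X s \<omega> - a"] unfolding dip_def by (auto simp: algebra_simps)

lemma rise_le_iff:
  assumes "\<omega> \<in> space M" "0 \<le> s" "0 \<le> g"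
  shows "rise X s g \<omega> \<le> a \<longleftrightarrow> (\<forall>k. \<forall>j\<le>2^k. X (s+g) \<omega> - X (s + g * (real j / 2^k)) \<omega> \<le> a)"
  using INF_ge_iff_dyadic[OF assms, of "X (s+g) \<omega> - a"] unfolding rise_def by (auto simp: algebra_simps)

lemma dip_nonneg: "\<omega> \<in> space M \<Longrightarrow> 0 \<le> s \<Longrightarrow> 0 \<le> g \<Longrightarrow> 0 \<le> dip X s g \<omega>"
  unfolding dip_def by (simp add: cINF_lower[OF path_bdd_below])

lemma rise_nonneg: "\<omega> \<in> space M \<Longrightarrow> 0 \<le> s \<Longrightarrow> 0 \<le> g \<Longrightarrow> 0 \<le> rise X s g \<omega>"
  unfolding rise_def by (simp add: cINF_lower[OF path_bdd_below])

lemma borel_measurable_dip [measurable]: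
  assumes "0 \<le> s" "0 \<le> g" shows "dip X s g \<in> borel_measurable M"
proof -
  have eq: "{\<omega> \<in> space M. dip X s g \<omega> \<le> a}
      = {\<omega> \<in> space M. \<forall>k. \<forall>j\<le>2^k. X s \<omega> - X (s + g * (real j / 2^k)) \<omega> \<le> a}" for a
    using dip_le_iff[OF _ assms] by auto
  have [measurable]: "X (s + g * (real j / 2^k)) \<in> borel_measurable M" for j k :: nat
    using assms by (intro measurable_X) auto
  have [measurable]: "X s \<in> borel_measurable M" "X (s+g) \<in> borel_measurable M"
    using assms by (auto intro: measurable_X)
  have "{\<omega> \<in> space M. \<forall>k. \<forall>j\<le>2^k. X s \<omega> - X (s + g * (real j / 2^k)) \<omega> \<le> a} \<in> sets M" for a by measurable
  then show ?thesis unfolding borel_measurable_iff_le eq by blast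
qed

lemma borel_measurable_rise [measurable]:
  assumes "0 \<le> s" "0 \<le> g" shows "rise X s g \<in> borel_measurable M"
proof -
  have eq: "{\<omega> \<in> space M. rise X s g \<omega> \<le> a}
      = {\<omega> \<in> space M. \<forall>k. \<forall>j\<le>2^k. X (s+g) \<omega> - X (s + g * (real j / 2^k)) \<omega> \<le> a}" for a
    using rise_le_iff[OF _ assms] by auto
  have [measurable]: "X (s + g * (real j / 2^k)) \<in> borel_measurable M" for j k :: nat
    using assms by (intro measurable_X) auto
  have [measurable]: "X s \<in> borel_measurable M" "X (s+g) \<in> borel_measurable M"
    using assms by (auto intro: measurable_X)
  have "{\<omega> \<in> space M. \<forall>k. \<forall>j\<le>2^k. X (s+g) \<omega> - X (s + g * (real j / 2^k)) \<omega> \<le> a} \<in> sets M" for a by measurable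
  then show ?thesis unfolding borel_measurable_iff_le eq by blast
qed

text \<open>The increments are packed into one extensional function, so that a whole grid path is a
  single random element of a product space. Its law is a product measure that does not depend on the
  starting time \<open>s\<close>.\<close>

definition incr :: "real \<Rightarrow> real \<Rightarrow> nat \<Rightarrow> 'a \<Rightarrow> nat \<Rightarrow> real" where
  "incr s h n \<omega> = (\<lambda>j\<in>{..<n}. X (s + real (Suc j) * h) \<omega> - X (s + real j * h) \<omega>)"

definition grid_law :: "real \<Rightarrow> nat \<Rightarrow> (nat \<Rightarrow> real) measure" where
  "grid_law h n = PiM {..<n} (\<lambda>_. distr M borel (X h))"

lemma sets_grid_law [measurable_cong]: "sets (grid_law h n) = sets (PiM {..<n} (\<lambda>_. borel))"
  unfolding grid_law_def by (intro sets_PiM_cong) auto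

lemma measurable_incr [measurable]:
  "0 \<le> s \<Longrightarrow> 0 \<le> h \<Longrightarrow> incr s h n \<in> measurable M (PiM {..<n} (\<lambda>_. borel))"
  unfolding incr_def by (rule measurable_restrict, rule borel_measurable_diff; rule measurable_X; simp)

lemma indep_incr:
  assumes "0 \<le> s" "0 \<le> h"
  shows "indep_vars (\<lambda>_. borel) (\<lambda>j \<omega>. X (s + real (Suc j) * h) \<omega> - X (s + real j * h) \<omega>) {..<n}"
  by (rule indep_increments[of "\<lambda>j. s + real j * h"]) (use assms in \<open>auto simp: algebra_simps\<close>)

lemma distr_incr:
  assumes "0 \<le> s" "0 \<le> h"
  shows "distr M (PiM {..<n} (\<lambda>_. borel)) (incr s h n) = grid_law h n"
proof (cases "n = 0")
  case True
  have "prob_space (distr M (PiM {..<n} (\<lambda>_. borel)) (incr s h n))" using assms by (intro prob_space_distr) auto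
  then have "emeasure (distr M (PiM {..<n} (\<lambda>_. borel)) (incr s h n)) {\<lambda>x. undefined} = 1"
    using prob_space.emeasure_space_1[of "distr M (PiM {..<n} (\<lambda>_. borel)) (incr s h n)"] True
    by (simp add: space_PiM_empty)
  then show ?thesis unfolding grid_law_def using True by (intro measure_eqI) (auto simp: sets_PiM_empty)
next
  case False
  have "distr M (PiM {..<n} (\<lambda>_. borel)) (incr s h n)
      = PiM {..<n} (\<lambda>j. distr M borel (\<lambda>\<omega>. X (s + real (Suc j) * h) \<omega> - X (s + real j * h) \<omega>))"
    unfolding incr_def using False assms indep_incr[OF assms, of n]
    by (subst indep_vars_iff_distr_eq_PiM'[symmetric]) (auto intro!: borel_measurable_diff measurable_X)
  also have "\<dots> = grid_law h n" unfolding grid_law_def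
  proof (intro PiM_cong refl)
    fix j
    have eq: "s + real (Suc j) * h = (s + real j * h) + h" by (simp add: algebra_simps)
    show "distr M borel (\<lambda>\<omega>. X (s + real (Suc j) * h) \<omega> - X (s + real j * h) \<omega>) = distr M borel (X h)"
      unfolding eq by (rule stationary_increments) (use assms in auto)
  qed
  finally show ?thesis .
qed

lemma sum_incr:
  assumes "i \<le> j" "j \<le> n"
  shows "(\<Sum>l\<in>{i..<j}. incr s h n \<omega> l) = X (s + real j * h) \<omega> - X (s + real i * h) \<omega>"
proof -
  have "(\<Sum>l\<in>{i..<j}. incr s h n \<omega> l)
      = (\<Sum>l\<in>{i..<j}. X (s + real (Suc l) * h) \<omega> - X (s + real l * h) \<omega>)"
    using assms by (intro sum.cong) (auto simp: incr_def)
  also have "\<dots> = X (s + real j * h) \<omega> - X (s + real i * h) \<omega>"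
    using sum_Suc_diff'[OF assms(1), of "\<lambda>l. X (s + real l * h) \<omega>"] by simp
  finally show ?thesis .
qed

text \<open>Reversing the order of the increments turns the depth of the minimum below the end point
  into the height of the maximum above the starting point.\<close>

lemma distr_incr_reverse:
  assumes "0 \<le> h"
  shows "distr M (PiM {..<n} (\<lambda>_. borel)) (\<lambda>\<omega>. \<lambda>j\<in>{..<n}. incr 0 h n \<omega> (n - Suc j)) = grid_law h n"
proof -
  interpret L: prob_space "distr M borel (X h)" by (rule prob_space_distr[OF measurable_X[OF assms]])
  have "distr M (PiM {..<n} (\<lambda>_. borel)) (\<lambda>\<omega>. \<lambda>j\<in>{..<n}. incr 0 h n \<omega> (n - Suc j))
     = distr (distr M (PiM {..<n} (\<lambda>_. borel)) (incr 0 h n)) (PiM {..<n} (\<lambda>_. borel))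
         (\<lambda>y. \<lambda>j\<in>{..<n}. y (n - Suc j))" using assms
    by (subst distr_distr) (auto simp: comp_def intro!: measurable_restrict measurable_component_singleton)
  also have "\<dots> = distr (grid_law h n) (PiM {..<n} (\<lambda>_. distr M borel (X h))) (\<lambda>y. \<lambda>j\<in>{..<n}. y (n - Suc j))"
    using assms by (intro distr_cong) (auto simp: distr_incr intro!: sets_PiM_cong)
  also have "\<dots> = grid_law h n" unfolding grid_law_def
    by (rule distr_PiM_reindex) (auto simp: inj_on_def L.prob_space_axioms)
  finally show ?thesis .
qed

end

section \<open>Laws on the plane determined by lower-left quadrants\<close>

lemma Int_stable_range_atMost_pair: "Int_stable (range (\<lambda>a::real \<times> real. {..a}))"
proof (rule Int_stableI_image)
  fix i j :: "real \<times> real"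
  have "{..i} \<inter> {..j} = {..inf i j}" by auto
  then show "\<exists>k\<in>UNIV. {..i} \<inter> {..j} = {..k}" by blast
qed

lemma atMost_pair: "{..(a::real, b::real)} = {z. fst z \<le> a \<and> snd z \<le> b}"
  by (auto simp: less_eq_prod_def)

lemma sets_borel_pair_atMost: "sets (borel :: (real \<times> real) measure) = sigma_sets UNIV (range (\<lambda>a. {..a}))"
  by (subst borel_eq_atMost) (simp add: sets_measure_of)

lemma UN_atMost_pair: "(\<Union>i::nat. {..(real i, real i)}) = (UNIV :: (real \<times> real) set)"
proof -
  have "\<exists>i::nat. x \<le> real i \<and> y \<le> real i" for x y :: real using real_arch_simple[of "max x y"] by auto
  then show ?thesis by (auto simp: atMost_pair)
qed

lemma pair_cdf_eqI:
  fixes M N :: "(real \<times> real) measure"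
  assumes "finite_measure M" "sets M = sets borel" "sets N = sets borel"
    and eq: "\<And>a b. emeasure M {z. fst z \<le> a \<and> snd z \<le> b} = emeasure N {z. fst z \<le> a \<and> snd z \<le> b}"
  shows "M = N"
proof (rule measure_eqI_generator_eq)
  show "Int_stable (range (\<lambda>a::real \<times> real. {..a}))" by (rule Int_stable_range_atMost_pair)
  show "emeasure M X = emeasure N X" if "X \<in> range (\<lambda>a. {..a})" for X using that eq by (auto simp: atMost_pair)
  show "sets M = sigma_sets UNIV (range (\<lambda>a. {..a}))" "sets N = sigma_sets UNIV (range (\<lambda>a. {..a}))"
    using assms(2,3) sets_borel_pair_atMost by auto
  show "range (\<lambda>i::nat. {..(real i, real i)}) \<subseteq> range (\<lambda>a. {..a})" by auto
  show "(\<Union>i::nat. {..(real i, real i)}) = UNIV" by (rule UN_atMost_pair)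
  show "emeasure M {..(real i, real i)} \<noteq> \<infinity>" for i :: nat
    using finite_measure.emeasure_finite[OF assms(1)] by auto
qed auto

section \<open>Joint law, independence and time reversal of \<open>dip\<close> and
  \<open>rise\<close>\<close>

context cadlag_Levy
begin

text \<open>The level \<open>k\<close> grid version of the event \<open>dip \<le> a\<close> and
  \<open>rise \<le> b\<close>. These events decrease to the true one as \<open>k\<close>
  grows.\<close>

definition box :: "nat \<Rightarrow> real \<Rightarrow> real \<Rightarrow> real \<Rightarrow> real \<Rightarrow> 'a set" where
  "box k s g a b = {\<omega> \<in> space M. \<forall>j\<le>2^k. X s \<omega> - X (s + g * (real j / 2^k)) \<omega> \<le> a
     \<and> X (s + g) \<omega> - X (s + g * (real j / 2^k)) \<omega> \<le> b}"

text \<open>The event of \<open>box\<close> read off from increments: negated initial sums are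
  depths below the start, tail sums are heights of the end point.\<close>

definition grid_box :: "nat \<Rightarrow> real \<Rightarrow> real \<Rightarrow> (nat \<Rightarrow> real) set" where
  "grid_box n a b = {y \<in> space (PiM {..<n} (\<lambda>_. borel)).
     \<forall>j\<le>n. - (\<Sum>l\<in>{0..<j}. y l) \<le> a \<and> (\<Sum>l\<in>{j..<n}. y l) \<le> b}"

lemma partial_sum_measurable [measurable]:
  fixes i j n :: nat
  shows "j \<le> n \<Longrightarrow> (\<lambda>y. \<Sum>l\<in>{i..<j}. y l) \<in> borel_measurable (PiM {..<n} (\<lambda>_. borel :: real measure))"
  by (intro borel_measurable_sum measurable_component_singleton) auto

lemma sets_grid_box [measurable]: "grid_box n a b \<in> sets (PiM {..<n} (\<lambda>_. borel))"
proof -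
  have "{y \<in> space (PiM {..<n} (\<lambda>_. borel :: real measure)).
      \<forall>j\<in>{..n}. - (\<Sum>l\<in>{0..<j}. y l) \<le> a \<and> (\<Sum>l\<in>{j..<n}. y l) \<le> b} \<in> sets (PiM {..<n} (\<lambda>_. borel))"
    by (intro sets.sets_Collect_finite_All) auto
  then show ?thesis unfolding grid_box_def by (simp add: Ball_def)
qed

lemma space_incr: "0 \<le> s \<Longrightarrow> 0 \<le> h \<Longrightarrow> \<omega> \<in> space M \<Longrightarrow> incr s h n \<omega> \<in> space (PiM {..<n} (\<lambda>_. borel))"
  using measurable_space[OF measurable_incr] by blast

lemma incr_in_grid_box_iff:
  assumes "\<omega> \<in> space M" "0 \<le> s" "0 \<le> h"
  shows "incr s h n \<omega> \<in> grid_box n a b \<longleftrightarrow>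
     (\<forall>j\<le>n. X s \<omega> - X (s + real j * h) \<omega> \<le> a \<and> X (s + real n * h) \<omega> - X (s + real j * h) \<omega> \<le> b)"
  unfolding grid_box_def using space_incr[OF assms(2,3,1)] by (auto simp: sum_incr)

lemma box_eq_incr:
  assumes "0 \<le> s" "0 \<le> g"
  shows "box k s g a b = incr s (g / 2^k) (2^k) -` grid_box (2^k) a b \<inter> space M"
proof -
  have eq: "real j * (g / 2^k) = g * (real j / 2^k)" "real (2^k) * (g / 2^k) = g"
      "g * (real (2^k) / 2^k) = g" for j by simp_all
  show ?thesis unfolding box_def using assms
    by (auto simp: incr_in_grid_box_iff eq simp del: of_nat_power times_divide_eq_right times_divide_eq_left)
qed

lemma sets_box [measurable]: "0 \<le> s \<Longrightarrow> 0 \<le> g \<Longrightarrow> box k s g a b \<in> events"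
  by (simp add: box_eq_incr)

lemma prob_box_shift:
  assumes "0 \<le> s" "0 \<le> g"
  shows "prob (box k s g a b) = prob (box k 0 g a b)"
proof -
  have *: "prob (box k u g a b) = measure (grid_law (g / 2^k) (2^k)) (grid_box (2^k) a b)" if "0 \<le> u" for u
    using distr_incr[of u "g / 2^k" "2^k"] that assms measure_distr[OF measurable_incr sets_grid_box, of u "g / 2^k" "2^k" a b]
    by (simp add: box_eq_incr)
  show ?thesis using *[of s] *[of 0] assms by simp
qed

lemma decseq_box: "decseq (\<lambda>k. box k s g a b)"
proof (rule decseq_SucI)
  fix k
  show "box (Suc k) s g a b \<subseteq> box k s g a b"
  proof
    fix \<omega> assume \<omega>: "\<omega> \<in> box (Suc k) s g a b"
    have *: "X s \<omega> - X (s + g * (real j / 2^k)) \<omega> \<le> a \<and> X (s + g) \<omega> - X (s + g * (real j / 2^k)) \<omega> \<le> b"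
      if "j \<le> 2^k" for j
    proof -
      have "2 * j \<le> 2 ^ Suc k" "real (2 * j) / 2 ^ Suc k = real j / 2^k" using that by auto
      then show ?thesis using \<omega> unfolding box_def by (metis (mono_tags, lifting) mem_Collect_eq)
    qed
    then show "\<omega> \<in> box k s g a b" using \<omega> unfolding box_def by blast
  qed
qed

lemma INT_box:
  assumes "0 \<le> s" "0 \<le> g"
  shows "(\<Inter>k. box k s g a b) = {\<omega> \<in> space M. dip X s g \<omega> \<le> a \<and> rise X s g \<omega> \<le> b}"
  unfolding box_def using dip_le_iff[OF _ assms] rise_le_iff[OF _ assms] by auto

lemma prob_dip_rise_le_shift:
  assumes "0 \<le> s" "0 \<le> g"
  shows "prob {\<omega> \<in> space M. dip X s g \<omega> \<le> a \<and> rise X s g \<omega> \<le> b}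
    = prob {\<omega> \<in> space M. dip X 0 g \<omega> \<le> a \<and> rise X 0 g \<omega> \<le> b}"
proof -
  have "(\<lambda>k. prob (box k u g a b)) \<longlonglongrightarrow> prob {\<omega> \<in> space M. dip X u g \<omega> \<le> a \<and> rise X u g \<omega> \<le> b}" if "0 \<le> u" for u
    unfolding INT_box[OF that assms(2), symmetric]
    using that assms by (intro finite_Lim_measure_decseq decseq_box) auto
  from this[of s] this[of 0] show ?thesis using assms prob_box_shift[of s g] by (auto intro: LIMSEQ_unique)
qed

lemma measurable_dip_rise [measurable]:
  "0 \<le> s \<Longrightarrow> 0 \<le> g \<Longrightarrow> (\<lambda>\<omega>. (dip X s g \<omega>, rise X s g \<omega>)) \<in> borel_measurable M" by (intro borel_measurable_Pair) auto

lemma distr_dip_rise_shift: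
  assumes "0 \<le> s" "0 \<le> g"
  shows "distr M borel (\<lambda>\<omega>. (dip X s g \<omega>, rise X s g \<omega>)) = distr M borel (\<lambda>\<omega>. (dip X 0 g \<omega>, rise X 0 g \<omega>))"
proof (rule pair_cdf_eqI)
  show "finite_measure (distr M borel (\<lambda>\<omega>. (dip X s g \<omega>, rise X s g \<omega>)))"
    using assms by (intro finite_measure_distr) auto
  fix a b :: real
  have sets: "{z. fst z \<le> a \<and> snd z \<le> b} \<in> sets (borel :: (real \<times> real) measure)"
    unfolding atMost_pair[symmetric] by auto
  have *: "(\<lambda>\<omega>. (dip X u g \<omega>, rise X u g \<omega>)) -` {z. fst z \<le> a \<and> snd z \<le> b} \<inter> space M
      = {\<omega> \<in> space M. dip X u g \<omega> \<le> a \<and> rise X u g \<omega> \<le> b}" for u by auto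
  have "emeasure (distr M borel (\<lambda>\<omega>. (dip X u g \<omega>, rise X u g \<omega>))) {z. fst z \<le> a \<and> snd z \<le> b}
      = prob {\<omega> \<in> space M. dip X u g \<omega> \<le> a \<and> rise X u g \<omega> \<le> b}" if "0 \<le> u" for u
    using emeasure_distr[OF measurable_dip_rise[OF that assms(2)] sets] unfolding * emeasure_eq_measure .
  from this[of s] this[of 0]
  show "emeasure (distr M borel (\<lambda>\<omega>. (dip X s g \<omega>, rise X s g \<omega>))) {z. fst z \<le> a \<and> snd z \<le> b}
      = emeasure (distr M borel (\<lambda>\<omega>. (dip X 0 g \<omega>, rise X 0 g \<omega>))) {z. fst z \<le> a \<and> snd z \<le> b}"
    using assms prob_dip_rise_le_shift[OF assms] by simp
qed auto

text \<open>The dyadic grids of all blocks, of different mesh, are concatenated into one increasing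
  sequence of times. The increments of \<open>X\<close> along it are independent, and each box
  depends only on its own group of \<open>2^k\<close> consecutive increments.\<close>

lemma prob_boxes:
  fixes t :: "nat \<Rightarrow> real"
  assumes t0: "0 \<le> t 0" and mono: "\<And>i. t i \<le> t (Suc i)" and J: "J \<subseteq> {..<n}" "J \<noteq> {}"
  shows "prob (\<Inter>i\<in>J. box k (t i) (t (Suc i) - t i) (a i) (b i))
     = (\<Prod>i\<in>J. prob (box k (t i) (t (Suc i) - t i) (a i) (b i)))"
proof -
  define K :: nat where "K = 2^k"
  have K: "K > 0" by (simp add: K_def)
  define g where "g i = t (Suc i) - t i" for i
  have g: "0 \<le> g i" for i using mono by (simp add: g_def)
  have tpos: "0 \<le> t i" for i by (induction i) (use t0 mono in \<open>auto intro: order_trans\<close>)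
  \<comment> \<open>Index \<open>i * K + l\<close> stands for the \<open>l\<close>-th grid point of
    block \<open>i\<close>.\<close>
  define \<tau> where "\<tau> m = t (m div K) + g (m div K) * (real (m mod K) / real K)" for m
  have \<tau>1: "\<tau> (i * K + l) = t i + real l * (g i / real K)" if "l < K" for i l using that K by (simp add: \<tau>_def)
  \<comment> \<open>The last point of block \<open>i\<close> is the first point of block
    \<open>i + 1\<close>; this is the case \<open>Suc l = K\<close>, where the quotient by
    \<open>K\<close> changes.\<close>
  have \<tau>2: "\<tau> (Suc (i * K + l)) = t i + real (Suc l) * (g i / real K)" if "l < K" for i l
  proof (cases "Suc l < K")
    case True
    then show ?thesis using \<tau>1[of "Suc l" i] by simp
  next
    case False
    then have l: "Suc l = K" using that by simp
    then have "Suc (i * K + l) = Suc i * K + 0" by simp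
    then have "\<tau> (Suc (i * K + l)) = \<tau> (Suc i * K + 0)" by (simp only:)
    also have "\<dots> = t (Suc i)" using \<tau>1[of 0 "Suc i"] K by simp
    also have "\<dots> = t i + real (Suc l) * (g i / real K)" using K unfolding l by (simp add: g_def)
    finally show ?thesis .
  qed
  have \<tau>mono: "\<tau> m \<le> \<tau> (Suc m)" for m
  proof -
    have "real (m mod K) * (g (m div K) / real K) \<le> real (Suc (m mod K)) * (g (m div K) / real K)"
      using K g[of "m div K"] by (intro mult_right_mono) auto
    then show ?thesis using \<tau>1[of "m mod K" "m div K"] \<tau>2[of "m mod K" "m div K"] K by simp
  qed
  have \<tau>0: "0 \<le> \<tau> 0" using \<tau>1[of 0 0] K t0 by simp
  define \<xi> where "\<xi> m \<omega> = X (\<tau> (Suc m)) \<omega> - X (\<tau> m) \<omega>" for m \<omega>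
  have ind: "indep_vars (\<lambda>_. borel) \<xi> {..<n * K}"
    unfolding \<xi>_def by (rule indep_increments) (use \<tau>0 \<tau>mono in auto)
  define G where "G i = {i * K..<i * K + K}" for i
  have Gsub: "G i \<subseteq> {..<n * K}" if "i \<in> {..<n}" for i
  proof -
    have "Suc i * K \<le> n * K" using that by (intro mult_le_mono1) auto
    then show ?thesis by (auto simp: G_def)
  qed
  have Gdiv: "m \<in> G i \<Longrightarrow> m div K = i" for m i using K by (auto simp: G_def div_nat_eqI algebra_simps)
  have "disjoint_family_on G {..<n}" unfolding disjoint_family_on_def using Gdiv by blast
  then have ind': "indep_vars (\<lambda>i. PiM (G i) (\<lambda>_. borel)) (\<lambda>i \<omega>. restrict (\<lambda>m. \<xi> m \<omega>) (G i)) {..<n}"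
    using Gsub by (intro indep_vars_restrict[OF ind]) auto
  define S where "S i y = (\<lambda>l\<in>{..<K}. y (i * K + l) :: real)" for i and y :: "nat \<Rightarrow> real"
  have S[measurable]: "S i \<in> measurable (PiM (G i) (\<lambda>_. borel)) (PiM {..<K} (\<lambda>_. borel))" for i
    unfolding S_def by (intro measurable_restrict measurable_component_singleton) (auto simp: G_def)
  define A where "A i = S i -` grid_box K (a i) (b i) \<inter> space (PiM (G i) (\<lambda>_. borel))" for i
  have A: "A i \<in> sets (PiM (G i) (\<lambda>_. borel))" for i
    unfolding A_def by (intro measurable_sets[OF S] sets_grid_box)
  have S_incr: "S i (restrict (\<lambda>m. \<xi> m \<omega>) (G i)) = incr (t i) (g i / real K) K \<omega>" for i \<omega>
    unfolding S_def incr_def by (rule restrict_ext) (auto simp: G_def \<xi>_def \<tau>1 \<tau>2)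
  have box_eq: "(\<lambda>\<omega>. restrict (\<lambda>m. \<xi> m \<omega>) (G i)) -` A i \<inter> space M = box k (t i) (g i) (a i) (b i)" for i
  proof -
    have "restrict (\<lambda>m. \<xi> m \<omega>) (G i) \<in> space (PiM (G i) (\<lambda>_. borel))" for \<omega> by (auto simp: space_PiM)
    then show ?thesis unfolding A_def box_eq_incr[OF tpos g] by (auto simp: S_incr K_def)
  qed
  have "prob (\<Inter>i\<in>J. (\<lambda>\<omega>. restrict (\<lambda>m. \<xi> m \<omega>) (G i)) -` A i \<inter> space M)
      = (\<Prod>i\<in>J. prob ((\<lambda>\<omega>. restrict (\<lambda>m. \<xi> m \<omega>) (G i)) -` A i \<inter> space M))"
    using J A finite_subset[OF J(1)] by (intro indep_varsD[OF ind']) auto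
  then show ?thesis unfolding box_eq by (simp add: g_def)
qed

text \<open>Quadrant events of a block are decreasing limits of boxes, so the product formula of
  \<open>prob_boxes\<close> survives in the limit. Quadrants are stable under intersection and
  generate the Borel sets, which upgrades the product formula to independence.\<close>

lemma indep_blocks:
  fixes t :: "nat \<Rightarrow> real"
  assumes t0: "0 \<le> t 0" and mono: "\<And>i. t i \<le> t (Suc i)"
  shows "indep_vars (\<lambda>_. borel)
    (\<lambda>i \<omega>. (dip X (t i) (t (Suc i) - t i) \<omega>, rise X (t i) (t (Suc i) - t i) \<omega>)) {..<n}"
proof -
  define g where "g i = t (Suc i) - t i" for i
  have g: "0 \<le> g i" for i using mono by (simp add: g_def)
  have tpos: "0 \<le> t i" for i by (induction i) (use t0 mono in \<open>auto intro: order_trans\<close>)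
  define U where "U i \<omega> = (dip X (t i) (g i) \<omega>, rise X (t i) (g i) \<omega>)" for i \<omega>
  have U[measurable]: "U i \<in> borel_measurable M" for i unfolding U_def using tpos g by auto
  define E where "E i = {U i -` A \<inter> space M | A. A \<in> range (\<lambda>a. {..a})}" for i
  have E_eq: "U i -` {..z} \<inter> space M = (\<Inter>k. box k (t i) (g i) (fst z) (snd z))" for i z
    unfolding INT_box[OF tpos g] by (cases z) (auto simp: U_def)
  have "indep_sets E {..<n}"
  proof (rule indep_setsI)
    show "E i \<subseteq> events" for i unfolding E_def using measurable_sets[OF U] by auto
    fix A J assume J: "J \<noteq> {}" "J \<subseteq> {..<n}" "finite J" and A: "\<forall>j\<in>J. A j \<in> E j"
    have "\<forall>j\<in>J. \<exists>z. A j = U j -` {..z} \<inter> space M"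
    proof
      fix j assume "j \<in> J"
      with A have "A j \<in> E j" by blast
      then obtain B where B: "A j = U j -` B \<inter> space M" "B \<in> range (\<lambda>a. {..a})" unfolding E_def by blast
      from B(2) obtain z where "B = {..z}" by (rule rangeE)
      then show "\<exists>z. A j = U j -` {..z} \<inter> space M" using B(1) by (intro exI[of _ z]) simp
    qed
    then obtain z where z: "\<And>j. j \<in> J \<Longrightarrow> A j = U j -` {..z j} \<inter> space M" by metis
    define B where "B k = (\<Inter>i\<in>J. box k (t i) (g i) (fst (z i)) (snd (z i)))" for k
    have Bd: "decseq B"
      unfolding B_def by (intro decseq_SucI INT_anti_mono subset_refl decseqD[OF decseq_box]) simp
    have Bs: "B k \<in> events" for k unfolding B_def using J tpos g by (intro sets.finite_INT sets_box) auto
    have "(\<Inter>k. B k) = (\<Inter>i\<in>J. A i)" using z E_eq unfolding B_def by auto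
    then have "(\<lambda>k. prob (B k)) \<longlonglongrightarrow> prob (\<Inter>i\<in>J. A i)" using finite_Lim_measure_decseq[of B] Bs Bd by auto
    moreover have "prob (B k) = (\<Prod>i\<in>J. prob (box k (t i) (g i) (fst (z i)) (snd (z i))))" for k
      unfolding B_def g_def by (rule prob_boxes) (use assms J in auto)
    moreover have "(\<lambda>k. \<Prod>i\<in>J. prob (box k (t i) (g i) (fst (z i)) (snd (z i)))) \<longlonglongrightarrow> (\<Prod>i\<in>J. prob (A i))"
    proof (intro tendsto_prod)
      fix i assume "i \<in> J"
      then have "A i = (\<Inter>k. box k (t i) (g i) (fst (z i)) (snd (z i)))" by (simp only: z E_eq)
      then show "(\<lambda>k. prob (box k (t i) (g i) (fst (z i)) (snd (z i)))) \<longlonglongrightarrow> prob (A i)"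
        using finite_Lim_measure_decseq[of "\<lambda>k. box k (t i) (g i) (fst (z i)) (snd (z i))"] decseq_box
          sets_box[OF tpos g] by (simp add: image_subset_iff)
    qed
    ultimately show "prob (\<Inter>j\<in>J. A j) = (\<Prod>j\<in>J. prob (A j))" using LIMSEQ_unique by auto
  qed
  moreover have "Int_stable (E i)" for i
  proof (rule Int_stableI)
    fix a b assume "a \<in> E i" "b \<in> E i"
    then obtain x y where "a = U i -` {..x} \<inter> space M" "b = U i -` {..y} \<inter> space M" unfolding E_def by auto
    then have "a \<inter> b = U i -` {..inf x y} \<inter> space M" by auto
    then show "a \<inter> b \<in> E i" unfolding E_def by blast
  qed
  ultimately have "indep_sets (\<lambda>i. sigma_sets (space M) (E i)) {..<n}" by (intro indep_sets_sigma)
  moreover have "sigma_sets (space M) (E i) = {U i -` A \<inter> space M | A. A \<in> sets borel}" for i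
    unfolding E_def sets_borel_pair_atMost by (rule sigma_sets_vimage_commute[symmetric]) auto
  moreover have "sigma_sets (space M) {U i -` A \<inter> space M | A. A \<in> sets borel}
      = {U i -` A \<inter> space M | A. A \<in> sets borel}" for i
    using calculation(2)[of i] sigma_sets_sigma_sets_eq[of "E i" "space M"] unfolding E_def by auto
  ultimately show ?thesis using U unfolding indep_vars_def U_def g_def by simp
qed

lemma indep_var_incr:
  assumes "0 \<le> h"
  shows "indep_var (PiM {..<k} (\<lambda>_. borel)) (incr 0 h k) (PiM {..<m} (\<lambda>_. borel)) (incr (real k * h) h m)"
proof -
  define \<xi> where "\<xi> j \<omega> = X (0 + real (Suc j) * h) \<omega> - X (0 + real j * h) \<omega>" for j \<omega>
  have "indep_vars (\<lambda>_. borel) \<xi> {..<k + m}" unfolding \<xi>_def by (rule indep_incr) (use assms in auto)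
  then have "indep_var (PiM {..<k} (\<lambda>_. borel)) (\<lambda>\<omega>. restrict (\<lambda>i. \<xi> i \<omega>) {..<k})
      (PiM {k..<k+m} (\<lambda>_. borel)) (\<lambda>\<omega>. restrict (\<lambda>i. \<xi> i \<omega>) {k..<k+m})" by (rule indep_var_restrict) auto
  then have "indep_var (PiM {..<k} (\<lambda>_. borel)) ((\<lambda>y. y) \<circ> (\<lambda>\<omega>. restrict (\<lambda>i. \<xi> i \<omega>) {..<k}))
      (PiM {..<m} (\<lambda>_. borel)) ((\<lambda>y. \<lambda>l\<in>{..<m}. y (k + l)) \<circ> (\<lambda>\<omega>. restrict (\<lambda>i. \<xi> i \<omega>) {k..<k+m}))"
    by (rule indep_var_compose) (auto intro!: measurable_restrict measurable_component_singleton)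
  moreover have "(\<lambda>y. y) \<circ> (\<lambda>\<omega>. restrict (\<lambda>i. \<xi> i \<omega>) {..<k}) = incr 0 h k"
    by (auto simp: incr_def \<xi>_def fun_eq_iff)
  moreover have "(\<lambda>y. \<lambda>l\<in>{..<m}. y (k + l)) \<circ> (\<lambda>\<omega>. restrict (\<lambda>i. \<xi> i \<omega>) {k..<k+m}) = incr (real k * h) h m"
    by (auto simp: incr_def \<xi>_def fun_eq_iff algebra_simps)
  ultimately show ?thesis by simp
qed

text \<open>The Markov property of the grid walk at a fixed index: the increments after
  \<open>k\<close> are independent of those before it, and stationarity replaces them in law by the
  first \<open>m\<close> increments.\<close>

lemma expectation_incr_mult:
  fixes f g :: "(nat \<Rightarrow> real) \<Rightarrow> real"
  assumes h: "0 \<le> h"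
    and f [measurable]: "f \<in> borel_measurable (PiM {..<k} (\<lambda>_. borel))" and fb: "\<And>y. \<bar>f y\<bar> \<le> B"
    and g [measurable]: "g \<in> borel_measurable (PiM {..<m} (\<lambda>_. borel))" and gb: "\<And>y. \<bar>g y\<bar> \<le> C"
  shows "expectation (\<lambda>\<omega>. f (incr 0 h k \<omega>) * g (incr (real k * h) h m \<omega>))
    = expectation (\<lambda>\<omega>. f (incr 0 h k \<omega>)) * expectation (\<lambda>\<omega>. g (incr 0 h m \<omega>))"
proof -
  have m1: "incr 0 h k \<in> measurable M (PiM {..<k} (\<lambda>_. borel))"
    and m2: "incr (real k * h) h m \<in> measurable M (PiM {..<m} (\<lambda>_. borel))"
    and m3: "incr 0 h m \<in> measurable M (PiM {..<m} (\<lambda>_. borel))" using h by (intro measurable_incr; simp)+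
  have "indep_var borel (f \<circ> incr 0 h k) borel (g \<circ> incr (real k * h) h m)"
    by (rule indep_var_compose[OF indep_var_incr[OF h] f g])
  then have "expectation (\<lambda>\<omega>. (f \<circ> incr 0 h k) \<omega> * (g \<circ> incr (real k * h) h m) \<omega>)
      = expectation (f \<circ> incr 0 h k) * expectation (g \<circ> incr (real k * h) h m)"
  proof (rule indep_var_lebesgue_integral)
    show "integrable M (f \<circ> incr 0 h k)"
      using fb m1 by (intro integrable_const_bound[of _ B]) (auto simp: comp_def intro: measurable_compose[OF _ f])
    show "integrable M (g \<circ> incr (real k * h) h m)"
      using gb m2 by (intro integrable_const_bound[of _ C]) (auto simp: comp_def intro: measurable_compose[OF _ g])
  qed
  moreover have "expectation (\<lambda>\<omega>. g (incr (real k * h) h m \<omega>)) = integral\<^sup>L (grid_law h m) g"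
    using distr_incr[of "real k * h" h m] h integral_distr[OF m2 g] by simp
  moreover have "expectation (\<lambda>\<omega>. g (incr 0 h m \<omega>)) = integral\<^sup>L (grid_law h m) g"
    using distr_incr[of 0 h m] h integral_distr[OF m3 g] by simp
  ultimately show ?thesis by (simp add: comp_def)
qed

text \<open>The duality of increments read backwards, carried from the grids to the limit. As
  \<open>dip (neg X)\<close> is the height of the supremum of \<open>X\<close> above its start, the
  rise from the minimum at time \<open>t\<close> is distributed like that supremum.\<close>

lemma prob_rise_le_eq_dip_uminus_le:
  assumes t: "0 \<le> t"
  shows "prob {\<omega> \<in> space M. rise X 0 t \<omega> \<le> a} = prob {\<omega> \<in> space M. dip (neg X) 0 t \<omega> \<le> a}"
proof -
  interpret N: cadlag_Levy M "neg X" by (rule uminus)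
  define K :: "nat \<Rightarrow> nat" where "K k = 2^k" for k
  define A where "A k = {\<omega> \<in> space M. \<forall>j\<le>2^k. X (0+t) \<omega> - X (0 + t * (real j / 2^k)) \<omega> \<le> a}" for k :: nat
  define B where "B k = {\<omega> \<in> space M. \<forall>j\<le>2^k. - X 0 \<omega> - - X (0 + t * (real j / 2^k)) \<omega> \<le> a}" for k :: nat
  define C where "C n = {y \<in> space (PiM {..<n} (\<lambda>_. borel)). \<forall>j\<le>n. (\<Sum>l\<in>{j..<n}. y l) \<le> a}" for n :: nat
  have C: "C n \<in> sets (PiM {..<n} (\<lambda>_. borel))" for n
  proof -
    have "{y \<in> space (PiM {..<n} (\<lambda>_. borel :: real measure)). \<forall>j\<in>{..n}. (\<Sum>l\<in>{j..<n}. y l) \<le> a} \<in> sets (PiM {..<n} (\<lambda>_. borel))"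
      by (intro sets.sets_Collect_finite_All) auto
    then show ?thesis unfolding C_def by (simp add: Ball_def)
  qed
  have h: "0 \<le> t / 2^k" for k :: nat using t by simp
  have arith: "real j * (t / 2^k) = t * (real j / 2^k)" "real (2^k) * (t / 2^k) = t"
      "t * (real (2^k) / 2^k) = t" for j k :: nat by simp_all
  define R where "R k \<omega> = (\<lambda>j\<in>{..<2^k}. incr 0 (t/2^k) (2^k) \<omega> (2^k - Suc j))" for k \<omega>
  have mR: "R k \<in> measurable M (PiM {..<2^k} (\<lambda>_. borel))" for k
  proof -
    have "(\<lambda>\<omega>. incr 0 (t/2^k) (2^k) \<omega> (2^k - Suc j)) \<in> borel_measurable M" if "j \<in> {..<2^k}" for j
      using measurable_compose[OF measurable_incr[of 0 "t/2^k" "2^k"] measurable_component_singleton[of "2^k - Suc j"]] t that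
      by auto
    then show ?thesis unfolding R_def by (intro measurable_restrict)
  qed
  have A_eq: "A k = incr 0 (t/2^k) (2^k) -` C (2^k) \<inter> space M" for k
    unfolding A_def C_def using space_incr[of 0 "t/2^k" _ "2^k"] h[of k]
    by (auto simp: sum_incr arith simp del: of_nat_power times_divide_eq_right times_divide_eq_left)
  have B_eq: "B k = R k -` C (2^k) \<inter> space M" for k
  proof -
    have "(\<Sum>l\<in>{j..<2^k}. R k \<omega> l) = X (0 + t * (real (2^k - j) / 2^k)) \<omega> - X 0 \<omega>" if "j \<le> 2^k" for j \<omega>
    proof -
      have "(\<Sum>l\<in>{j..<2^k}. R k \<omega> l) = (\<Sum>l\<in>{j..<2^k}. incr 0 (t/2^k) (2^k) \<omega> (2^k - Suc l))"
        by (intro sum.cong) (auto simp: R_def)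
      also have "\<dots> = (\<Sum>l\<in>{0..<2^k - j}. incr 0 (t/2^k) (2^k) \<omega> l)"
        by (rule sum.reindex_bij_witness[of _ "\<lambda>l. 2^k - Suc l" "\<lambda>l. 2^k - Suc l"]) (use that in auto)
      also have "\<dots> = X (0 + t * (real (2^k - j) / 2^k)) \<omega> - X 0 \<omega>"
        using that by (subst sum_incr) (auto simp: arith mult.commute)
      finally show ?thesis .
    qed
    moreover have "R k \<omega> \<in> space (PiM {..<2^k} (\<lambda>_. borel))" for \<omega> by (auto simp: R_def space_PiM)
    ultimately have "R k -` C (2^k) \<inter> space M
       = {\<omega>\<in>space M. \<forall>j\<le>2^k. X (0 + t * (real (2^k - j) / 2^k)) \<omega> - X 0 \<omega> \<le> a}" unfolding C_def by auto
    also have "\<dots> = B k"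
    proof -
      \<comment> \<open>Reversal replaces \<open>j\<close> by \<open>2^k - j\<close>, and a
        quantifier over all grid indices absorbs this.\<close>
      have "(\<forall>j\<le>2^k. P (2^k - j)) \<longleftrightarrow> (\<forall>j\<le>2^k. P j)" for P :: "nat \<Rightarrow> bool"
        by (metis diff_diff_cancel diff_le_self)
      from this[of "\<lambda>i. X (0 + t * (real i / 2^k)) _ - X 0 _ \<le> a"] show ?thesis
        unfolding B_def by (auto simp: uminus_add_conv_diff)
    qed
    finally show ?thesis by simp
  qed
  have AB: "prob (A k) = prob (B k)" for k
  proof -
    have "prob (A k) = measure (grid_law (t/2^k) (2^k)) (C (2^k))"
      using measure_distr[OF measurable_incr C, of 0 "t/2^k" "2^k"] distr_incr[of 0 "t/2^k" "2^k"] h[of k]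
      by (simp add: A_eq)
    moreover have "prob (B k) = measure (grid_law (t/2^k) (2^k)) (C (2^k))"
      using measure_distr[OF mR C, of k] distr_incr_reverse[OF h[of k], of "2^k"]
      by (simp add: B_eq R_def[abs_def])
    ultimately show ?thesis by simp
  qed
  have refine: "\<forall>j\<le>2^k. P (real j / 2^k)" if "\<forall>j\<le>2^Suc k. P (real j / 2^Suc k)" for k and P :: "real \<Rightarrow> bool"
  proof (intro allI impI)
    fix j :: nat assume "j \<le> 2^k"
    then have "P (real (2 * j) / 2^Suc k)" using that by (simp only: power_Suc)
    then show "P (real j / 2^k)" by simp
  qed
  have "decseq A"
  proof (rule decseq_SucI, rule subsetI)
    fix k \<omega> assume "\<omega> \<in> A (Suc k)"
    then show "\<omega> \<in> A k" unfolding A_def using refine[of k "\<lambda>r. X (0+t) \<omega> - X (0 + t * r) \<omega> \<le> a"] by blast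
  qed
  moreover have "decseq B"
  proof (rule decseq_SucI, rule subsetI)
    fix k \<omega> assume "\<omega> \<in> B (Suc k)"
    then show "\<omega> \<in> B k" unfolding B_def using refine[of k "\<lambda>r. - X 0 \<omega> - - X (0 + t * r) \<omega> \<le> a"] by blast
  qed
  moreover have "A k \<in> events" "B k \<in> events" for k
    unfolding A_eq B_eq using measurable_sets[OF measurable_incr[of 0 "t/2^k" "2^k"] C] measurable_sets[OF mR C] t by auto
  ultimately have "(\<lambda>k. prob (A k)) \<longlonglongrightarrow> prob (\<Inter>k. A k)" "(\<lambda>k. prob (B k)) \<longlonglongrightarrow> prob (\<Inter>k. B k)"
    by (auto intro!: finite_Lim_measure_decseq)
  then have "prob (\<Inter>k. A k) = prob (\<Inter>k. B k)" using AB LIMSEQ_unique by auto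
  moreover have "(\<Inter>k. A k) = {\<omega> \<in> space M. rise X 0 t \<omega> \<le> a}"
    unfolding A_def using rise_le_iff[OF _ order_refl t] by auto
  moreover have "(\<Inter>k. B k) = {\<omega> \<in> space M. dip (neg X) 0 t \<omega> \<le> a}"
    unfolding B_def using N.dip_le_iff[OF _ order_refl t] by auto
  ultimately show ?thesis by simp
qed

lemma distr_rise_eq_dip_uminus:
  assumes t: "0 \<le> t"
  shows "distr M borel (rise X 0 t) = distr M borel (dip (neg X) 0 t)"
proof -
  interpret N: cadlag_Levy M "neg X" by (rule uminus)
  have m: "rise X 0 t \<in> borel_measurable M" "dip (neg X) 0 t \<in> borel_measurable M" using t by auto
  show ?thesis
  proof (rule cdf_unique)
    show "real_distribution (distr M borel (rise X 0 t))" "real_distribution (distr M borel (dip (neg X) 0 t))"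
      using m by (auto intro: real_distribution_distr)
    show "cdf (distr M borel (rise X 0 t)) = cdf (distr M borel (dip (neg X) 0 t))"
    proof
      fix a
      have "f -` {..a} \<inter> space M = {\<omega> \<in> space M. f \<omega> \<le> a}" for f :: "'a \<Rightarrow> real" by auto
      then show "cdf (distr M borel (rise X 0 t)) a = cdf (distr M borel (dip (neg X) 0 t)) a"
        using m prob_rise_le_eq_dip_uminus_le[OF t] by (simp add: cdf_def measure_distr)
    qed
  qed
qed

end

section \<open>Observation at Poisson arrivals\<close>

context cadlag_Levy
begin

text \<open>A random time is approached from the right by dyadic times with countably many values.
  The measure \<open>N\<close> and the map \<open>\<pi>\<close> are left free because the result is
  needed for \<open>M\<close>, for the events generated by the paths alone, and on product
  spaces.\<close>

lemma measurable_path_random_time: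
  assumes N: "space N = space M" "\<And>t. 0 \<le> t \<Longrightarrow> X t \<in> borel_measurable N"
    and \<pi>: "\<pi> \<in> measurable Q N" and s: "s \<in> borel_measurable Q" "\<And>z. z \<in> space Q \<Longrightarrow> 0 \<le> s z"
  shows "(\<lambda>z. X (s z) (\<pi> z)) \<in> borel_measurable Q"
proof (rule borel_measurable_LIMSEQ_metric)
  define u where "u k z = real (nat \<lceil>s z * 2^k\<rceil>) / 2^k" for k z
  have "(\<lambda>z. X (real (nat \<lceil>s z * 2^k\<rceil>) / 2^k) (\<pi> z)) \<in> borel_measurable Q" for k :: nat
  proof (rule measurable_compose_countable[where f="\<lambda>i z. X (real i / 2^k) (\<pi> z)" and g="\<lambda>z. nat \<lceil>s z * 2^k\<rceil>"])
    show "(\<lambda>z. nat \<lceil>s z * 2 ^ k\<rceil>) \<in> measurable Q (count_space UNIV)" using s(1) by measurable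
    show "(\<lambda>z. X (real i / 2 ^ k) (\<pi> z)) \<in> borel_measurable Q" for i
      using N(2)[of "real i / 2^k"] \<pi> by (intro measurable_compose[OF \<pi>]) auto
  qed
  then show "(\<lambda>z. X (u k z) (\<pi> z)) \<in> borel_measurable Q" for k by (simp add: u_def)
  fix z assume z: "z \<in> space Q"
  have lo: "s z \<le> u k z" and hi: "u k z \<le> s z + (1/2)^k" for k
  proof -
    have "0 \<le> s z * 2^k" using s(2)[OF z] by simp
    then have "real (nat \<lceil>s z * 2^k\<rceil>) = of_int \<lceil>s z * 2^k\<rceil>"
      by (metis ceiling_mono ceiling_zero of_nat_nat of_int_of_nat_eq)
    then have "s z * 2^k \<le> real (nat \<lceil>s z * 2^k\<rceil>)" "real (nat \<lceil>s z * 2^k\<rceil>) \<le> s z * 2^k + 1"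
      using ceiling_correct[of "s z * 2^k"] by linarith+
    then show "s z \<le> u k z" "u k z \<le> s z + (1/2)^k" unfolding u_def by (simp_all add: field_simps power_divide)
  qed
  have "(\<lambda>k. u k z) \<longlonglongrightarrow> s z"
  proof (rule tendsto_sandwich[where f="\<lambda>_. s z"])
    show "(\<lambda>k. s z + (1/2)^k) \<longlonglongrightarrow> s z"
      using tendsto_add[OF tendsto_const[of "s z"] LIMSEQ_power_zero[of "1/2::real"]] by simp
  qed (use lo hi in auto)
  then show "(\<lambda>k. X (u k z) (\<pi> z)) \<longlonglongrightarrow> X (s z) (\<pi> z)"
    using measurable_space[OF \<pi> z] N(1) s(2)[OF z] lo by (intro path_seq) auto
qed

lemma measurable_dip_random_time:
  assumes N: "space N = space M" "\<And>t. 0 \<le> t \<Longrightarrow> X t \<in> borel_measurable N"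
    and \<pi>: "\<pi> \<in> measurable Q N" and s: "s \<in> borel_measurable Q" "\<And>z. z \<in> space Q \<Longrightarrow> 0 \<le> s z"
    and g: "g \<in> borel_measurable Q" "\<And>z. z \<in> space Q \<Longrightarrow> 0 \<le> g z"
  shows "(\<lambda>z. dip X (s z) (g z) (\<pi> z)) \<in> borel_measurable Q"
    and "(\<lambda>z. rise X (s z) (g z) (\<pi> z)) \<in> borel_measurable Q"
proof -
  have \<pi>M: "\<pi> z \<in> space M" if "z \<in> space Q" for z using measurable_space[OF \<pi> that] N by simp
  have [measurable]: "(\<lambda>z. X (s z + g z * (real j / 2^k)) (\<pi> z)) \<in> borel_measurable Q" for j k :: nat
    using s g by (intro measurable_path_random_time[OF N \<pi>]) auto
  have [measurable]: "(\<lambda>z. X (s z) (\<pi> z)) \<in> borel_measurable Q" "(\<lambda>z. X (s z + g z) (\<pi> z)) \<in> borel_measurable Q"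
    using s g by (intro measurable_path_random_time[OF N \<pi>]; auto)+
  have eq: "{z \<in> space Q. dip X (s z) (g z) (\<pi> z) \<le> a}
      = {z \<in> space Q. \<forall>k. \<forall>j\<le>2^k. X (s z) (\<pi> z) - X (s z + g z * (real j / 2^k)) (\<pi> z) \<le> a}" for a
    using dip_le_iff[OF \<pi>M s(2) g(2)] by auto
  have "{z \<in> space Q. \<forall>k. \<forall>j\<le>2^k. X (s z) (\<pi> z) - X (s z + g z * (real j / 2^k)) (\<pi> z) \<le> a} \<in> sets Q" for a
    by measurable
  then show "(\<lambda>z. dip X (s z) (g z) (\<pi> z)) \<in> borel_measurable Q" unfolding borel_measurable_iff_le eq by blast
  have eq: "{z \<in> space Q. rise X (s z) (g z) (\<pi> z) \<le> a}
      = {z \<in> space Q. \<forall>k. \<forall>j\<le>2^k. X (s z + g z) (\<pi> z) - X (s z + g z * (real j / 2^k)) (\<pi> z) \<le> a}" for a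
    using rise_le_iff[OF \<pi>M s(2) g(2)] by auto
  have "{z \<in> space Q. \<forall>k. \<forall>j\<le>2^k. X (s z + g z) (\<pi> z) - X (s z + g z * (real j / 2^k)) (\<pi> z) \<le> a} \<in> sets Q" for a
    by measurable
  then show "(\<lambda>z. rise X (s z) (g z) (\<pi> z)) \<in> borel_measurable Q" unfolding borel_measurable_iff_le eq by blast
qed

text \<open>The truncation \<open>max 0\<close> makes the triple meaningful for every real length;
  for an exponential length it changes nothing almost surely.\<close>

definition block :: "real \<times> 'a \<Rightarrow> real \<times> real \<times> real" where
  "block z = (fst z, dip X 0 (max 0 (fst z)) (snd z), rise X 0 (max 0 (fst z)) (snd z))"

lemma measurable_block [measurable]: "block \<in> borel_measurable (borel \<Otimes>\<^sub>M M)"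
  unfolding block_def
  by (intro borel_measurable_Pair measurable_dip_random_time[where N=M and \<pi>=snd] measurable_X) auto

end

locale observed_Levy = cadlag_Levy M X + Poisson_arrivals M l T
  for M :: "'a measure" and X :: "real \<Rightarrow> 'a \<Rightarrow> real" and l :: real and T :: "nat \<Rightarrow> 'a \<Rightarrow> real" +
  assumes indep_arrivals: "indep_of_arrivals M X T"
begin

definition gap :: "nat \<Rightarrow> 'a \<Rightarrow> real" where "gap i \<omega> = T (Suc i) \<omega> - T i \<omega>"

definition block_law :: "(real \<times> real \<times> real) measure" where
  "block_law = distr (density lborel (exponential_density l) \<Otimes>\<^sub>M M) borel block"

definition V :: "nat \<Rightarrow> 'a \<Rightarrow> real \<times> real \<times> real" where
  "V i \<omega> = (gap i \<omega>, dip X (T i \<omega>) (gap i \<omega>) \<omega>, rise X (T i \<omega>) (gap i \<omega>) \<omega>)"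

lemma gap_pos: "\<omega> \<in> space M \<Longrightarrow> 0 < gap i \<omega>"
  using T_less[of \<omega> i] by (simp add: gap_def)

lemma T_nonneg: "\<omega> \<in> space M \<Longrightarrow> 0 \<le> T i \<omega>"
proof (induction i)
  case (Suc i)
  then show ?case using T_less[of \<omega> i] by simp
qed (simp add: T_0)

lemma measurable_gap [measurable]: "gap i \<in> borel_measurable M"
  using exponential_gaps[of i] unfolding distributed_def gap_def[abs_def] by simp

lemma T_eq_sum: "\<omega> \<in> space M \<Longrightarrow> T i \<omega> = (\<Sum>j<i. gap j \<omega>)"
  by (induction i) (auto simp: gap_def T_0)

lemma measurable_T [measurable]: "T i \<in> borel_measurable M"
proof -
  have "(\<lambda>\<omega>. \<Sum>j<i. gap j \<omega>) \<in> borel_measurable M" by measurable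
  then show ?thesis by (rule measurable_cong[THEN iffD1, rotated]) (simp add: T_eq_sum)
qed

text \<open>Independence is available only between the events generated by the path and those
  generated by the arrivals. Naming both as measurable structures on the same space lets the
  arrivals be frozen: path and arrivals become the two coordinates of a product.\<close>

definition FX :: "'a measure" where
  "FX = sigma (space M) {X t -` B \<inter> space M | t B. 0 \<le> t \<and> B \<in> sets borel}"

definition FT :: "'a measure" where
  "FT = sigma (space M) {T i -` B \<inter> space M | i B. B \<in> sets borel}"

lemma space_FX [simp]: "space FX = space M" and space_FT [simp]: "space FT = space M"
  unfolding FX_def FT_def by (auto simp: space_measure_of_conv)

lemma sets_FX: "sets FX = sigma_sets (space M) {X t -` B \<inter> space M | t B. 0 \<le> t \<and> B \<in> sets borel}"
  unfolding FX_def by (rule sets_measure_of) auto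

lemma sets_FT: "sets FT = sigma_sets (space M) {T i -` B \<inter> space M | i B. B \<in> sets borel}"
  unfolding FT_def by (rule sets_measure_of) auto

lemma measurable_X_FX: "0 \<le> t \<Longrightarrow> X t \<in> borel_measurable FX"
  by (rule measurableI) (auto simp: sets_FX intro: sigma_sets.Basic)

lemma measurable_T_FT [measurable]: "T i \<in> borel_measurable FT"
  by (rule measurableI) (auto simp: sets_FT intro: sigma_sets.Basic)

lemma measurable_ident_FX: "(\<lambda>\<omega>. \<omega>) \<in> measurable M FX"
  unfolding FX_def by (rule measurable_measure_of) (auto intro: measurable_sets[OF measurable_X])

lemma measurable_ident_FT: "(\<lambda>\<omega>. \<omega>) \<in> measurable M FT"
  unfolding FT_def by (rule measurable_measure_of) (auto intro: measurable_sets[OF measurable_T])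

text \<open>The identity maps into \<open>FX\<close> and \<open>FT\<close> are independent random
  variables, and independence says that their joint law, the image of \<open>M\<close> on the
  diagonal, is the product of the two laws.\<close>

lemma distr_path_arrivals:
  "distr M FX (\<lambda>\<omega>. \<omega>) \<Otimes>\<^sub>M distr M FT (\<lambda>\<omega>. \<omega>) = distr M (FX \<Otimes>\<^sub>M FT) (\<lambda>\<omega>. (\<omega>, \<omega>))"
proof -
  have "{(\<lambda>\<omega>. \<omega>) -` A \<inter> space M | A. A \<in> sets F} = sets F" if "space F = space M" for F :: "'a measure"
  proof -
    have *: "(\<lambda>\<omega>. \<omega>) -` A \<inter> space M = A" if "A \<in> sets F" for A
      using sets.sets_into_space[OF that] \<open>space F = space M\<close> by auto
    show ?thesis
    proof (intro equalityI subsetI)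
      fix x assume "x \<in> {(\<lambda>\<omega>. \<omega>) -` A \<inter> space M | A. A \<in> sets F}"
      then obtain A where "A \<in> sets F" "x = (\<lambda>\<omega>. \<omega>) -` A \<inter> space M" by blast
      then show "x \<in> sets F" by (simp only: *)
    next
      fix x assume "x \<in> sets F"
      then show "x \<in> {(\<lambda>\<omega>. \<omega>) -` A \<inter> space M | A. A \<in> sets F}" by (intro CollectI exI[of _ x]) (simp only: *)
    qed
  qed
  moreover have "sigma_sets (space M) (sets F) = sets F" if "space F = space M" for F :: "'a measure"
    using sets.sigma_sets_eq[of F] that by simp
  ultimately have eq: "sigma_sets (space M) {(\<lambda>\<omega>. \<omega>) -` A \<inter> space M | A. A \<in> sets F} = sets F"
    if "space F = space M" for F :: "'a measure" using that by (simp only:)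
  have "indep_var FX (\<lambda>\<omega>. \<omega>) FT (\<lambda>\<omega>. \<omega>)" unfolding indep_var_eq eq[OF space_FX] eq[OF space_FT]
    using measurable_ident_FX measurable_ident_FT indep_arrivals
    by (simp add: indep_of_arrivals_def sets_FX sets_FT)
  then show ?thesis unfolding indep_var_distribution_eq by simp
qed

lemma measurable_V [measurable]: "V i \<in> borel_measurable M"
  unfolding V_def
  by (intro borel_measurable_Pair measurable_dip_random_time[where N=M and \<pi>="\<lambda>\<omega>. \<omega>"] measurable_X measurable_gap measurable_T)
    (auto intro: T_nonneg less_imp_le[OF gap_pos])

text \<open>With the arrivals frozen at those of \<omega>2, the blocks extend over deterministic
  intervals, so \<open>indep_blocks\<close> applies; stationarity then moves each block to time
  \<open>0\<close>, where only its length matters.\<close>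

lemma emeasure_block_section:
  assumes \<omega>2: "\<omega>2 \<in> space M" and B: "\<And>i. i < n \<Longrightarrow> B i \<in> sets borel"
  shows "emeasure M {\<omega> \<in> space M. \<forall>i<n. (gap i \<omega>2, dip X (T i \<omega>2) (gap i \<omega>2) \<omega>, rise X (T i \<omega>2) (gap i \<omega>2) \<omega>) \<in> B i}
    = (\<Prod>i<n. emeasure M {\<omega> \<in> space M. block (gap i \<omega>2, \<omega>) \<in> B i})"
proof (cases "n = 0")
  case True
  then show ?thesis by (simp add: emeasure_space_1)
next
  case False
  define t where "t i = T i \<omega>2" for i
  have t0: "0 \<le> t 0" and tm: "t i \<le> t (Suc i)" and tp: "0 \<le> t i" for i
    unfolding t_def using \<omega>2 T_nonneg T_less[OF \<omega>2, of i] by auto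
  have g: "gap i \<omega>2 = t (Suc i) - t i" for i by (simp add: gap_def t_def)
  have gp: "0 \<le> gap i \<omega>2" for i using tm g by simp
  define U where "U i \<omega> = (dip X (t i) (gap i \<omega>2) \<omega>, rise X (t i) (gap i \<omega>2) \<omega>)" for i \<omega>
  have U[measurable]: "U i \<in> borel_measurable M" for i unfolding U_def using tp gp by auto
  have ind: "indep_vars (\<lambda>_. borel) U {..<n}" unfolding U_def g by (rule indep_blocks[OF t0 tm])
  define A where "A i = Pair (gap i \<omega>2) -` B i" for i
  have A: "A i \<in> sets borel" if "i < n" for i
  proof -
    have "(\<lambda>z :: real \<times> real. (gap i \<omega>2, z)) \<in> borel_measurable borel" by (intro borel_measurable_Pair) auto
    from measurable_sets[OF this B[OF that]] show ?thesis by (simp add: A_def)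
  qed
  have "prob (\<Inter>i\<in>{..<n}. U i -` A i \<inter> space M) = (\<Prod>i\<in>{..<n}. prob (U i -` A i \<inter> space M))"
    by (rule indep_varsD[OF ind]) (use False A in auto)
  moreover have "(\<Inter>i\<in>{..<n}. U i -` A i \<inter> space M)
     = {\<omega> \<in> space M. \<forall>i<n. (gap i \<omega>2, dip X (T i \<omega>2) (gap i \<omega>2) \<omega>, rise X (T i \<omega>2) (gap i \<omega>2) \<omega>) \<in> B i}"
    using False by (auto simp: A_def U_def t_def)
  moreover have "prob (U i -` A i \<inter> space M) = prob {\<omega> \<in> space M. block (gap i \<omega>2, \<omega>) \<in> B i}" if "i < n" for i
  proof -
    have "prob (U i -` A i \<inter> space M) = measure (distr M borel (U i)) (A i)"
      using A[OF that] by (simp add: measure_distr)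
    also have "distr M borel (U i) = distr M borel (\<lambda>\<omega>. (dip X 0 (gap i \<omega>2) \<omega>, rise X 0 (gap i \<omega>2) \<omega>))"
      unfolding U_def by (rule distr_dip_rise_shift[OF tp gp])
    also have "measure \<dots> (A i) = prob ((\<lambda>\<omega>. (dip X 0 (gap i \<omega>2) \<omega>, rise X 0 (gap i \<omega>2) \<omega>)) -` A i \<inter> space M)"
      using A[OF that] gp by (intro measure_distr) auto
    also have "(\<lambda>\<omega>. (dip X 0 (gap i \<omega>2) \<omega>, rise X 0 (gap i \<omega>2) \<omega>)) -` A i \<inter> space M
        = {\<omega> \<in> space M. block (gap i \<omega>2, \<omega>) \<in> B i}" using gp[of i] by (auto simp: A_def block_def max_absorb2)
    finally show ?thesis .
  qed
  ultimately show ?thesis by (simp add: emeasure_eq_measure prod_ennreal)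
qed

lemma measurable_emeasure_block:
  assumes "B \<in> sets borel"
  shows "(\<lambda>g. emeasure M {\<omega> \<in> space M. block (g, \<omega>) \<in> B}) \<in> borel_measurable borel"
proof -
  have "block -` B \<inter> space (borel \<Otimes>\<^sub>M M) \<in> sets (borel \<Otimes>\<^sub>M M)" by (rule measurable_sets[OF measurable_block assms])
  then have "(\<lambda>g. emeasure M (Pair g -` (block -` B \<inter> space (borel \<Otimes>\<^sub>M M)))) \<in> borel_measurable borel"
    by (rule measurable_emeasure_Pair)
  then show ?thesis
    by (rule measurable_cong[THEN iffD1, rotated]) (auto simp: space_pair_measure intro!: arg_cong[where f="emeasure M"])
qed

text \<open>Fubini on the product of paths and arrivals: given the arrivals, the probability is a
  product of functions of the single gaps, and the gaps are independent with a common exponential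
  law.\<close>

lemma emeasure_V:
  assumes B: "\<And>i. i < n \<Longrightarrow> B i \<in> sets borel"
  shows "emeasure M {\<omega> \<in> space M. \<forall>i<n. V i \<omega> \<in> B i} = (\<Prod>i<n. emeasure block_law (B i))"
proof -
  let ?e = "\<lambda>i g. emeasure M {\<omega> \<in> space M. block (g, \<omega>) \<in> B i}"
  define MX where "MX = distr M FX (\<lambda>\<omega>. \<omega>)"
  define MT where "MT = distr M FT (\<lambda>\<omega>. \<omega>)"
  interpret MX: prob_space MX unfolding MX_def by (rule prob_space_distr[OF measurable_ident_FX])
  interpret MT: prob_space MT unfolding MT_def by (rule prob_space_distr[OF measurable_ident_FT])
  interpret P: pair_prob_space MX MT ..
  have prodeq: "MX \<Otimes>\<^sub>M MT = distr M (FX \<Otimes>\<^sub>M FT) (\<lambda>\<omega>. (\<omega>, \<omega>))"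
    unfolding MX_def MT_def by (rule distr_path_arrivals)
  have sp: "space MX = space M" "space MT = space M" and st: "sets MX = sets FX" "sets MT = sets FT"
    by (simp_all add: MX_def MT_def)
  define VV where "VV i z = (gap i (snd z), dip X (T i (snd z)) (gap i (snd z)) (fst z), rise X (T i (snd z)) (gap i (snd z)) (fst z))"
    for i and z :: "'a \<times> 'a"
  have gapFT: "gap i \<in> borel_measurable FT" for i
    unfolding gap_def[abs_def] by (intro borel_measurable_diff measurable_T_FT)
  have gF: "(\<lambda>z. gap i (snd z)) \<in> borel_measurable (FX \<Otimes>\<^sub>M FT)"
    and TF: "(\<lambda>z. T i (snd z)) \<in> borel_measurable (FX \<Otimes>\<^sub>M FT)" for i
    by (rule measurable_compose[OF measurable_snd gapFT], rule measurable_compose[OF measurable_snd measurable_T_FT])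
  have VV: "VV i \<in> borel_measurable (FX \<Otimes>\<^sub>M FT)" for i
  proof -
    have "0 \<le> T i (snd z)" "0 \<le> gap i (snd z)" if "z \<in> space (FX \<Otimes>\<^sub>M FT)" for z
      using that by (auto simp: space_pair_measure intro: T_nonneg less_imp_le[OF gap_pos])
    then show ?thesis unfolding VV_def
      by (intro borel_measurable_Pair measurable_dip_random_time[where N=FX and \<pi>=fst]
          measurable_X_FX gF TF measurable_fst space_FX)
  qed
  have diag: "(\<lambda>\<omega>. (\<omega>, \<omega>)) \<in> measurable M (FX \<Otimes>\<^sub>M FT)"
    by (intro measurable_Pair measurable_ident_FX measurable_ident_FT)
  define S where "S = {z \<in> space (FX \<Otimes>\<^sub>M FT). \<forall>i\<in>{..<n}. VV i z \<in> B i}"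
  have S: "S \<in> sets (FX \<Otimes>\<^sub>M FT)" unfolding S_def
  proof (intro sets.sets_Collect_finite_All)
    fix i assume "i \<in> {..<n}"
    then show "{z \<in> space (FX \<Otimes>\<^sub>M FT). VV i z \<in> B i} \<in> sets (FX \<Otimes>\<^sub>M FT)"
      using measurable_sets[OF VV B] by (simp add: vimage_def Int_def conj_commute)
  qed simp
  have "{\<omega> \<in> space M. \<forall>i<n. V i \<omega> \<in> B i} = (\<lambda>\<omega>. (\<omega>, \<omega>)) -` S \<inter> space M"
    unfolding S_def by (auto simp: space_pair_measure VV_def V_def)
  then have "emeasure M {\<omega> \<in> space M. \<forall>i<n. V i \<omega> \<in> B i} = emeasure (MX \<Otimes>\<^sub>M MT) S"
    unfolding prodeq using diag S by (simp add: emeasure_distr)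
  also have "\<dots> = (\<integral>\<^sup>+ y. emeasure MX ((\<lambda>x. (x, y)) -` S) \<partial>MT)"
    using S st by (intro P.emeasure_pair_measure_alt2) (simp cong: sets_pair_measure_cong)
  also have "\<dots> = (\<integral>\<^sup>+ y. (\<Prod>i<n. ?e i (gap i y)) \<partial>MT)"
  proof (rule nn_integral_cong)
    fix y assume "y \<in> space MT"
    then have y: "y \<in> space M" by (simp add: sp)
    have eq: "(\<lambda>x. (x, y)) -` S = {\<omega> \<in> space M. \<forall>i<n. (gap i y, dip X (T i y) (gap i y) \<omega>, rise X (T i y) (gap i y) \<omega>) \<in> B i}"
      unfolding S_def using y by (auto simp: space_pair_measure VV_def)
    have "(\<lambda>x. (x, y)) -` S \<in> sets FX" using S by (rule sets_Pair2)
    then have "emeasure MX ((\<lambda>x. (x, y)) -` S) = emeasure M ((\<lambda>\<omega>. \<omega>) -` ((\<lambda>x. (x, y)) -` S) \<inter> space M)"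
      unfolding MX_def by (rule emeasure_distr[OF measurable_ident_FX])
    also have "(\<lambda>\<omega>. \<omega>) -` ((\<lambda>x. (x, y)) -` S) \<inter> space M
        = {\<omega> \<in> space M. \<forall>i<n. (gap i y, dip X (T i y) (gap i y) \<omega>, rise X (T i y) (gap i y) \<omega>) \<in> B i}"
    proof -
      have "(\<lambda>\<omega>. \<omega>) -` {\<omega> \<in> space M. Q \<omega>} \<inter> space M = {\<omega> \<in> space M. Q \<omega>}" for Q by blast
      then show ?thesis unfolding eq .
    qed
    finally show "emeasure MX ((\<lambda>x. (x, y)) -` S) = (\<Prod>i<n. ?e i (gap i y))"
      using emeasure_block_section[OF y B] by simp
  qed
  also have "\<dots> = (\<integral>\<^sup>+ y. (\<Prod>i<n. ?e i (gap i y)) \<partial>M)"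
  proof -
    have "(\<lambda>y. ?e i (gap i y)) \<in> borel_measurable FT" if "i < n" for i
      by (rule measurable_compose[OF gapFT measurable_emeasure_block[OF B[OF that]]])
    then have "(\<lambda>y. \<Prod>i<n. ?e i (gap i y)) \<in> borel_measurable FT" by (intro borel_measurable_prod_ennreal) auto
    then have "(\<lambda>y. \<Prod>i<n. ?e i (gap i y))
        \<in> borel_measurable (distr M FT (\<lambda>\<omega>. \<omega>))" by (simp only: measurable_distr_eq1)
    from nn_integral_distr[OF measurable_ident_FT this] show ?thesis unfolding MT_def .
  qed
  \<comment> \<open>The factor \<open>i\<close> depends on the gap \<open>i\<close> alone, so the
    independence of the gaps splits the mean.\<close>
  also have "\<dots> = (\<Prod>i<n. \<integral>\<^sup>+ y. ?e i (gap i y) \<partial>M)"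
  proof -
    have "indep_vars (\<lambda>_. borel) (\<lambda>i y. ?e i (gap i y)) {..<n}"
      using measurable_emeasure_block[OF B] by (intro indep_vars_compose2[where Y="?e"
            and M'="\<lambda>_. borel" and X=gap] indep_vars_subset[OF indep_gaps[folded gap_def]]) auto
    then show ?thesis by (intro indep_vars_nn_integral) auto
  qed
  also have "\<dots> = (\<Prod>i<n. emeasure block_law (B i))"
  proof (rule prod.cong[OF refl])
    fix i assume i: "i \<in> {..<n}"
    define S where "S = block -` B i \<inter> space (borel \<Otimes>\<^sub>M M)"
    have S: "S \<in> sets (borel \<Otimes>\<^sub>M M)" unfolding S_def
      using i by (intro measurable_sets[OF measurable_block B]) auto
    have Sg: "Pair g -` S = {\<omega> \<in> space M. block (g, \<omega>) \<in> B i}" for g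
      unfolding S_def by (auto simp: space_pair_measure)
    let ?D = "density lborel (exponential_density l)"
    interpret D: prob_space ?D using rate_pos by (rule prob_space_exponential_density)
    have setsD: "sets (?D \<Otimes>\<^sub>M M) = sets (borel \<Otimes>\<^sub>M M)" by (intro sets_pair_measure_cong) auto
    have "emeasure block_law (B i) = emeasure (?D \<Otimes>\<^sub>M M) (block -` B i \<inter> space (?D \<Otimes>\<^sub>M M))"
      unfolding block_law_def using i B setsD by (intro emeasure_distr) (auto cong: measurable_cong_sets)
    also have "\<dots> = emeasure (?D \<Otimes>\<^sub>M M) S" unfolding S_def by (simp add: space_pair_measure)
    also have "\<dots> = (\<integral>\<^sup>+ g. emeasure M (Pair g -` S) \<partial>?D)"
      using S setsD by (intro emeasure_pair_measure_alt) auto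
    also have "\<dots> = (\<integral>\<^sup>+ g. emeasure M (Pair g -` S) \<partial>(distr M borel (gap i)))"
    proof -
      have "distr M lborel (gap i) = ?D"
        using exponential_gaps[of i] unfolding distributed_def gap_def[abs_def] by simp
      moreover have "distr M lborel (gap i) = distr M borel (gap i)" by (intro distr_cong) auto
      ultimately show ?thesis by simp
    qed
    also have "\<dots> = (\<integral>\<^sup>+ y. emeasure M (Pair (gap i y) -` S) \<partial>M)"
      by (rule nn_integral_distr[OF measurable_gap]) (simp only: measurable_distr_eq1 measurable_emeasure_Pair[OF S])
    also have "\<dots> = (\<integral>\<^sup>+ y. ?e i (gap i y) \<partial>M)" by (simp only: Sg)
    finally show "(\<integral>\<^sup>+ y. ?e i (gap i y) \<partial>M) = emeasure block_law (B i)" by simp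
  qed
  finally show ?thesis .
qed

lemma prob_space_block_law: "prob_space block_law"
proof -
  interpret D: prob_space "density lborel (exponential_density l)" using rate_pos by (rule prob_space_exponential_density)
  interpret P: pair_prob_space "density lborel (exponential_density l)" M ..
  have "sets (density lborel (exponential_density l) \<Otimes>\<^sub>M M) = sets (borel \<Otimes>\<^sub>M M)" by (intro sets_pair_measure_cong) auto
  then show ?thesis unfolding block_law_def by (intro P.prob_space_distr) (simp cong: measurable_cong_sets)
qed

lemma sets_block_law [simp, measurable_cong]: "sets block_law = sets borel"
  unfolding block_law_def by simp

lemma space_block_law [simp]: "space block_law = UNIV"
  unfolding block_law_def by simp

lemma indep_V: "indep_vars (\<lambda>_. borel) V UNIV"
  unfolding indep_vars_def2
proof (rule conjI; (rule ballI)?)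
  show "V i \<in> borel_measurable M" for i by measurable
  show "indep_sets (\<lambda>i. {V i -` A \<inter> space M | A. A \<in> sets borel}) UNIV"
  proof (rule indep_setsI)
  interpret B: prob_space block_law by (rule prob_space_block_law)
  show "{V i -` A \<inter> space M | A. A \<in> sets borel} \<subseteq> events" for i using measurable_sets[OF measurable_V] by auto
  fix A :: "nat \<Rightarrow> 'a set" and J :: "nat set" assume J: "J \<noteq> {}" "finite J" and A: "\<forall>j\<in>J. A j \<in> {V j -` A \<inter> space M | A. A \<in> sets borel}"
  then obtain B where B: "\<And>j. j \<in> J \<Longrightarrow> A j = V j -` B j \<inter> space M" "\<And>j. j \<in> J \<Longrightarrow> B j \<in> sets borel" by simp metis
  \<comment> \<open>Used for \<open>K = J\<close> and for singletons; the latter identify each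
    factor as the probability of \<open>A j\<close>.\<close>
  have P: "emeasure M (\<Inter>j\<in>K. A j) = (\<Prod>j\<in>K. emeasure block_law (B j))" if K: "K \<subseteq> J" "K \<noteq> {}" for K
  proof -
    define n where "n = Suc (Max J)"
    have Jn: "J \<subseteq> {..<n}" using J by (auto simp: n_def less_Suc_eq_le)
    \<comment> \<open>Padding with \<open>UNIV\<close> reduces an arbitrary finite index set to the
      initial segment of \<open>emeasure_V\<close>.\<close>
    define C where "C j = (if j \<in> K then B j else UNIV)" for j
    have "(\<Inter>j\<in>K. A j) = (\<Inter>j\<in>K. V j -` B j \<inter> space M)" using K by (intro INF_cong refl B(1)) auto
    also have "\<dots> = {\<omega> \<in> space M. \<forall>i<n. V i \<omega> \<in> C i}"
    proof -
      have "\<And>j. j \<in> K \<Longrightarrow> j < n" using K Jn by auto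
      then show ?thesis using K(2) by (auto simp: C_def)
    qed
    finally have "emeasure M (\<Inter>j\<in>K. A j) = emeasure M {\<omega> \<in> space M. \<forall>i<n. V i \<omega> \<in> C i}" by simp
    also have "\<dots> = (\<Prod>j<n. emeasure block_law (C j))" by (rule emeasure_V) (use B K in \<open>auto simp: C_def\<close>)
    also have "\<dots> = (\<Prod>j\<in>K. emeasure block_law (C j))"
      using K Jn B.emeasure_space_1 by (intro prod.mono_neutral_right) (auto simp: C_def)
    also have "\<dots> = (\<Prod>j\<in>K. emeasure block_law (B j))" by (simp add: C_def)
    finally show ?thesis .
  qed
  have "emeasure M (A j) = emeasure block_law (B j)" if "j \<in> J" for j using P[of "{j}"] that by simp
  then have "emeasure M (\<Inter>j\<in>J. A j) = (\<Prod>j\<in>J. emeasure M (A j))" using P[of J] J by simp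
  then show "prob (\<Inter>j\<in>J. A j) = (\<Prod>j\<in>J. prob (A j))" by (simp add: emeasure_eq_measure prod_ennreal prod_nonneg)
  qed
qed

lemma distr_V: "distr M borel (V n) = block_law"
proof (rule measure_eqI)
  interpret B: prob_space block_law by (rule prob_space_block_law)
  fix A assume "A \<in> sets (distr M borel (V n))"
  then have A: "A \<in> sets borel" by simp
  define C where "C j = (if j = n then A else UNIV)" for j
  have "V n -` A \<inter> space M = {\<omega> \<in> space M. \<forall>i<Suc n. V i \<omega> \<in> C i}" by (auto simp: C_def)
  then have "emeasure (distr M borel (V n)) A = (\<Prod>j<Suc n. emeasure block_law (C j))"
    using A emeasure_V[of "Suc n" C] by (simp add: emeasure_distr C_def)
  also have "\<dots> = (\<Prod>j\<in>{n}. emeasure block_law (C j))"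
    using B.emeasure_space_1 by (intro prod.mono_neutral_right) (auto simp: C_def)
  finally show "emeasure (distr M borel (V n)) A = emeasure block_law A" by (simp add: C_def)
qed simp

end

section \<open>Wiener--Hopf factorisation\<close>

abbreviation exp_law :: "real \<Rightarrow> real measure" where
  "exp_law p \<equiv> density lborel (exponential_density p)"

lemma AE_exp_law_pos: "AE t in exp_law p. 0 < t"
proof -
  have "AE t in lborel. (t :: real) \<noteq> 0" by (rule AE_lborel_singleton)
  then show ?thesis by (subst AE_density) (auto simp: exponential_density_def elim!: eventually_mono)
qed

lemma prob_exp_law_interval:
  assumes p: "0 < p" and ab: "0 \<le> a" "a \<le> b"
  shows "measure (exp_law p) {a<..b} = exp (- p * a) - exp (- p * b)"
proof -
  interpret prob_space "exp_law p" by (rule prob_space_exponential_density[OF p])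
  have "distr (exp_law p) lborel (\<lambda>x. x) = exp_law p" by (rule distr_id2) simp
  then have "distributed (exp_law p) lborel (\<lambda>x. x) (exponential_density p)"
    unfolding distributed_def by (auto simp: exponential_density_nonneg[OF p])
  then have le: "prob {..c} = 1 - exp (- p * c)" if "0 \<le> c" for c
    using exponential_distributedD_le[OF _ that p, of "\<lambda>x. x"] by (simp add: atMost_def mult.commute)
  have "{a<..b} = {..b} - {..a}" by auto
  then have "prob {a<..b} = prob {..b} - prob {..a}" using finite_measure_Diff[of "{..b}" "{..a}"] ab by simp
  then show ?thesis using le ab by simp
qed

text \<open>The number of cells of length \<open>h\<close> begun by an exponential time is
  geometric: the ceiling of \<open>t / h\<close> equals \<open>Suc n\<close> with probability
  \<open>(1 - exp (- p * h)) * exp (- p * h) ^ n\<close>.\<close>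

lemma exp_law_geometric_sums:
  fixes u :: "nat \<Rightarrow> real"
  assumes p: "0 < p" and h: "0 < h" and u: "\<And>n. \<bar>u n\<bar> \<le> C"
  shows "(\<lambda>n. (1 - exp (- p * h)) * exp (- p * h) ^ n * u (Suc n)) sums (\<integral>t. u (nat \<lceil>t / h\<rceil>) \<partial>exp_law p)"
proof -
  interpret prob_space "exp_law p" by (rule prob_space_exponential_density[OF p])
  define I where "I n = {real n * h<..real (Suc n) * h}" for n
  have prI: "prob (I n) = (1 - exp (- p * h)) * exp (- p * h) ^ n" for n
  proof -
    have "prob (I n) = exp (- p * (real n * h)) - exp (- p * (real (Suc n) * h))"
      unfolding I_def using h by (intro prob_exp_law_interval p) (auto intro: mult_right_mono)
    moreover have "exp (- p * (real n * h)) = exp (- p * h) ^ n"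
      by (subst exp_of_nat_mult[symmetric]) (simp add: mult_ac)
    moreover have "exp (- p * (real (Suc n) * h)) = exp (- p * h) ^ Suc n"
      by (subst exp_of_nat_mult[symmetric]) (simp add: mult_ac)
    ultimately show ?thesis by (simp add: algebra_simps)
  qed
  have inI: "t \<in> I n \<longleftrightarrow> nat \<lceil>t / h\<rceil> = Suc n" if "0 < t" for t n
  proof -
    have "t \<in> I n \<longleftrightarrow> real n < t / h \<and> t / h \<le> real n + 1" unfolding I_def using h by (auto simp: field_simps)
    also have "\<dots> \<longleftrightarrow> \<lceil>t / h\<rceil> = int n + 1" by (auto simp: ceiling_eq_iff)
    also have "\<dots> \<longleftrightarrow> nat \<lceil>t / h\<rceil> = Suc n" by auto
    finally show ?thesis .
  qed
  have "(\<lambda>m. \<integral>t. (\<Sum>n<m. indicator (I n) t * u (Suc n)) \<partial>exp_law p) \<longlonglongrightarrow> (\<integral>t. u (nat \<lceil>t / h\<rceil>) \<partial>exp_law p)"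
  proof (rule integral_dominated_convergence[where w="\<lambda>_. C"])
    show "(\<lambda>t. u (nat \<lceil>t / h\<rceil>)) \<in> borel_measurable (exp_law p)" by measurable
    show "(\<lambda>t. \<Sum>n<m. indicator (I n) t * u (Suc n)) \<in> borel_measurable (exp_law p)" for m
      unfolding I_def by measurable
    have sumI: "(\<Sum>n<m. indicator (I n) t * u (Suc n)) = (if nat \<lceil>t / h\<rceil> \<le> m then u (nat \<lceil>t / h\<rceil>) else 0)"
      if t: "0 < t" for t m
    proof -
      have "0 < \<lceil>t / h\<rceil>" using t h by simp
      then obtain k where k: "nat \<lceil>t / h\<rceil> = Suc k" by (cases "nat \<lceil>t / h\<rceil>") auto
      have "(\<Sum>n<m. indicator (I n) t * u (Suc n)) = (\<Sum>n<m. if n = k then u (Suc k) else 0)"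
        using inI[OF t] k by (intro sum.cong) (auto simp: indicator_def)
      also have "\<dots> = (if k < m then u (Suc k) else 0)" by simp
      finally show ?thesis using k by simp
    qed
    show "AE t in exp_law p. (\<lambda>m. \<Sum>n<m. indicator (I n) t * u (Suc n)) \<longlonglongrightarrow> u (nat \<lceil>t / h\<rceil>)" using AE_exp_law_pos
    proof eventually_elim
      case (elim t)
      have "\<forall>\<^sub>F m in sequentially. (\<Sum>n<m. indicator (I n) t * u (Suc n)) = u (nat \<lceil>t / h\<rceil>)"
        using eventually_ge_at_top[of "nat \<lceil>t / h\<rceil>"] by eventually_elim (simp add: sumI[OF elim])
      then show ?case by (rule tendsto_eventually)
    qed
    show "AE t in exp_law p. norm (\<Sum>n<m. indicator (I n) t * u (Suc n)) \<le> C" for m using AE_exp_law_pos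
    proof eventually_elim
      case (elim t)
      have "0 \<le> C" using u[of 0] by simp
      then show ?case using u[of "nat \<lceil>t / h\<rceil>"] by (simp add: sumI[OF elim])
    qed
  qed simp
  moreover have "(\<integral>t. (\<Sum>n<m. indicator (I n) t * u (Suc n)) \<partial>exp_law p)
      = (\<Sum>n<m. (1 - exp (- p * h)) * exp (- p * h) ^ n * u (Suc n))" for m
  proof -
    have "integrable (exp_law p) (\<lambda>t. indicator (I n) t * u (Suc n))" for n
      by (intro integrable_mult_left integrable_const_bound[of _ 1]) (auto simp: I_def indicator_def)
    then have "(\<integral>t. (\<Sum>n<m. indicator (I n) t * u (Suc n)) \<partial>exp_law p) = (\<Sum>n<m. prob (I n) * u (Suc n))"
      by (subst Bochner_Integration.integral_sum) (auto simp: I_def)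
    then show ?thesis by (simp add: prI)
  qed
  ultimately show ?thesis by (simp add: sums_def)
qed

text \<open>A geometric number of steps of length \<open>1 / 2^k\<close> with ratio
  \<open>exp (- p / 2^k)\<close> approximates an exponential time, so bounded quantities that
  converge at each fixed time also converge after this randomisation, by dominated
  convergence.\<close>

lemma geometric_to_exp_law:
  fixes u :: "nat \<Rightarrow> nat \<Rightarrow> real"
  assumes p: "0 < p" and u: "\<And>k n. \<bar>u k n\<bar> \<le> C" and v: "v \<in> borel_measurable borel"
    and lim: "\<And>t. 0 < t \<Longrightarrow> (\<lambda>k. u k (nat \<lceil>t * 2^k\<rceil>)) \<longlonglongrightarrow> v t"
  shows "(\<lambda>k. (1 - exp (- p / 2^k)) * (\<Sum>n. exp (- p / 2^k) ^ n * u k n)) \<longlonglongrightarrow> (\<integral>t. v t \<partial>exp_law p)"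
proof -
  interpret prob_space "exp_law p" by (rule prob_space_exponential_density[OF p])
  define r where "r k = exp (- p / 2^k)" for k :: nat
  have r01: "0 < r k" "r k < 1" for k using p by (auto simp: r_def)
  have "(\<lambda>k. - p * (1/2)^k) \<longlonglongrightarrow> - p * 0" by (intro tendsto_mult tendsto_const LIMSEQ_power_zero) simp
  then have "(\<lambda>k. - p / 2^k) \<longlonglongrightarrow> 0" by (simp add: power_divide)
  then have rlim: "r \<longlonglongrightarrow> 1" unfolding r_def[abs_def] using tendsto_exp by fastforce
  \<comment> \<open>The series starts at \<open>0\<close> but the ceiling of a positive time starts
    at \<open>1\<close>. The shift costs the summand \<open>(1 - r k) * u k 0\<close> and the factor
    \<open>r k\<close>, which tend to \<open>0\<close> and \<open>1\<close>.\<close>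
  have eq: "(1 - r k) * (\<Sum>n. r k ^ n * u k n) = (1 - r k) * u k 0 + r k * (\<integral>t. u k (nat \<lceil>t * 2^k\<rceil>) \<partial>exp_law p)" for k
  proof -
    have sm: "summable (\<lambda>n. r k ^ n * u k n)"
    proof (rule summable_comparison_test)
      show "summable (\<lambda>n. C * r k ^ n)" using r01[of k] by (intro summable_mult summable_geometric) auto
      show "\<exists>N. \<forall>n\<ge>N. norm (r k ^ n * u k n) \<le> C * r k ^ n"
        using r01[of k] u by (auto simp: abs_mult mult.commute mult_left_mono power_abs)
    qed
    have "(\<lambda>n. (1 - r k) * r k ^ n * u k (Suc n)) sums (\<integral>t. u k (nat \<lceil>t * 2^k\<rceil>) \<partial>exp_law p)"
      using exp_law_geometric_sums[OF p, of "1 / 2^k" "u k" C] u by (simp add: r_def)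
    then have "(\<integral>t. u k (nat \<lceil>t * 2^k\<rceil>) \<partial>exp_law p) = (\<Sum>n. (1 - r k) * (r k ^ n * u k (Suc n)))"
      by (simp add: sums_iff mult.assoc)
    then have "r k * (\<integral>t. u k (nat \<lceil>t * 2^k\<rceil>) \<partial>exp_law p) = r k * (\<Sum>n. (1 - r k) * (r k ^ n * u k (Suc n)))"
      by simp
    moreover have "summable (\<lambda>n. r k ^ n * u k (Suc n))"
    proof -
      have "summable (\<lambda>n. (r k ^ Suc n * u k (Suc n)) / r k)"
        by (intro summable_divide) (rule summable_Suc_iff[THEN iffD2, OF sm])
      moreover have "(r k ^ Suc n * u k (Suc n)) / r k = r k ^ n * u k (Suc n)" for n using r01[of k] by simp
      ultimately show ?thesis by simp
    qed
    ultimately have "r k * (\<integral>t. u k (nat \<lceil>t * 2^k\<rceil>) \<partial>exp_law p) = (1 - r k) * (\<Sum>n. r k ^ Suc n * u k (Suc n))"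
      by (subst (asm) suminf_mult) (auto simp: suminf_mult[symmetric] mult_ac)
    moreover have "(\<Sum>n. r k ^ n * u k n) = u k 0 + (\<Sum>n. r k ^ Suc n * u k (Suc n))"
      using suminf_split_head[OF sm] by simp
    ultimately show ?thesis by (simp add: algebra_simps)
  qed
  have "(\<lambda>k. \<integral>t. u k (nat \<lceil>t * 2^k\<rceil>) \<partial>exp_law p) \<longlonglongrightarrow> (\<integral>t. v t \<partial>exp_law p)"
  proof (rule integral_dominated_convergence[where w="\<lambda>_. C"])
    show "AE t in exp_law p. (\<lambda>k. u k (nat \<lceil>t * 2^k\<rceil>)) \<longlonglongrightarrow> v t" using AE_exp_law_pos by eventually_elim (rule lim)
  qed (use u v in auto)
  moreover have "(\<lambda>k. (1 - r k) * u k 0) \<longlonglongrightarrow> 0"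
  proof (rule Lim_null_comparison)
    show "\<forall>\<^sub>F k in sequentially. norm ((1 - r k) * u k 0) \<le> (1 - r k) * C"
      using r01 u by (intro always_eventually) (auto simp: abs_mult less_imp_le intro!: mult_left_mono)
    show "(\<lambda>k. (1 - r k) * C) \<longlonglongrightarrow> 0"
      using tendsto_mult[OF tendsto_diff[OF tendsto_const[of 1] rlim] tendsto_const[of C]] by simp
  qed
  ultimately have "(\<lambda>k. (1 - r k) * u k 0 + r k * (\<integral>t. u k (nat \<lceil>t * 2^k\<rceil>) \<partial>exp_law p)) \<longlonglongrightarrow> 0 + 1 * (\<integral>t. v t \<partial>exp_law p)"
    by (intro tendsto_add tendsto_mult rlim)
  then show ?thesis by (simp add: eq[symmetric]) (simp add: r_def)
qed

text \<open>Exactly one index is the first minimiser.\<close>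

lemma sum_first_argmin:
  fixes s :: "nat \<Rightarrow> real" and F :: "real \<Rightarrow> real"
  shows "(\<Sum>j\<le>n. F (s j) * (of_bool (\<forall>i<j. s j < s i) * of_bool (\<forall>i\<le>n - j. s j \<le> s (j + i)))) = F (Min (s ` {..n}))"
proof -
  have "\<exists>j\<le>n. s j = Min (s ` {..n})"
  proof -
    have "Min (s ` {..n}) \<in> s ` {..n}" by (rule Min_in) auto
    then show ?thesis by (metis atMost_iff imageE)
  qed
  then obtain j where j: "j \<le> n" "s j = Min (s ` {..n})" and first: "\<And>i. i < j \<Longrightarrow> \<not> (i \<le> n \<and> s i = Min (s ` {..n}))"
    using exists_least_iff[of "\<lambda>j. j \<le> n \<and> s j = Min (s ` {..n})"] by blast
  have le: "s j \<le> s i" if "i \<le> n" for i using that j by auto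
  have lt: "s j < s i" if "i < j" for i
    using first[OF that] le[of i] that j(1) unfolding j(2)[symmetric] by (auto simp: less_le)
  have "(\<Sum>k\<le>n. F (s k) * (of_bool (\<forall>i<k. s k < s i) * of_bool (\<forall>i\<le>n - k. s k \<le> s (k + i))))
      = (\<Sum>k\<le>n. if k = j then F (s j) else 0)"
  proof (intro sum.cong refl)
    fix k assume k: "k \<in> {..n}"
    show "F (s k) * (of_bool (\<forall>i<k. s k < s i) * of_bool (\<forall>i\<le>n - k. s k \<le> s (k + i))) = (if k = j then F (s j) else 0)"
    proof (cases k j rule: linorder_cases)
      case less
      have "\<not> (\<forall>i\<le>n - k. s k \<le> s (k + i))" using lt[OF less] less j(1) by (auto intro!: exI[of _ "j - k"])
      then show ?thesis using less by simp
    next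
      case equal
      then show ?thesis using lt le j(1) by auto
    next
      case greater
      then have "\<not> (\<forall>i<k. s k < s i)" using le[of k] k by (auto intro!: exI[of _ j])
      then show ?thesis using greater by simp
    qed
  qed
  also have "\<dots> = F (Min (s ` {..n}))" using j by simp
  finally show ?thesis .
qed

context cadlag_Levy
begin

lemma abs_expectation_le:
  fixes f :: "'a \<Rightarrow> real"
  assumes "f \<in> borel_measurable M" "\<And>\<omega>. \<bar>f \<omega>\<bar> \<le> B"
  shows "\<bar>expectation f\<bar> \<le> B"
proof -
  have "0 \<le> B" using assms(2)[of undefined] by linarith
  have "\<bar>expectation f\<bar> \<le> expectation (\<lambda>\<omega>. \<bar>f \<omega>\<bar>)" by (rule integral_abs_bound)
  also have "\<dots> \<le> expectation (\<lambda>\<omega>. B)"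
    using assms \<open>0 \<le> B\<close> by (intro integral_mono integrable_const_bound[of _ B]) auto
  finally show ?thesis by (simp add: prob_space)
qed

definition walk_dip :: "real \<Rightarrow> nat \<Rightarrow> 'a \<Rightarrow> real" where
  "walk_dip h n \<omega> = X 0 \<omega> - Min ((\<lambda>j. X (real j * h) \<omega>) ` {..n})"

definition walk_rise :: "real \<Rightarrow> nat \<Rightarrow> 'a \<Rightarrow> real" where
  "walk_rise h n \<omega> = X (real n * h) \<omega> - Min ((\<lambda>j. X (real j * h) \<omega>) ` {..n})"

text \<open>The strict inequality before the minimiser here and the weak one after it in
  \<open>post_min\<close> single out the first minimiser. \<open>pre_min\<close> sees only the first
  \<open>j\<close> increments and \<open>post_min\<close> only the remaining ones.\<close>

definition pre_min :: "(real \<Rightarrow> real) \<Rightarrow> nat \<Rightarrow> (nat \<Rightarrow> real) \<Rightarrow> real" where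
  "pre_min \<phi> j y = \<phi> (- (\<Sum>l\<in>{0..<j}. y l)) * of_bool (\<forall>i\<in>{..<j}. (\<Sum>l\<in>{0..<j}. y l) < (\<Sum>l\<in>{0..<i}. y l))"

definition post_min :: "(real \<Rightarrow> real) \<Rightarrow> nat \<Rightarrow> (nat \<Rightarrow> real) \<Rightarrow> real" where
  "post_min \<psi> m y = \<psi> (\<Sum>l\<in>{0..<m}. y l) * of_bool (\<forall>i\<in>{..m}. 0 \<le> (\<Sum>l\<in>{0..<i}. y l))"

lemma measurable_pre_min:
  assumes [measurable]: "\<phi> \<in> borel_measurable borel"
  shows "pre_min \<phi> j \<in> borel_measurable (PiM {..<j} (\<lambda>_. borel))"
proof -
  have "{y \<in> space (PiM {..<j} (\<lambda>_. borel)). \<forall>i\<in>{..<j}. (\<Sum>l\<in>{0..<j}. y l) < (\<Sum>l\<in>{0..<i}. y l :: real)} \<in> sets (PiM {..<j} (\<lambda>_. borel))"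
    by (intro sets.sets_Collect_finite_All) auto
  then have [measurable]: "Measurable.pred (PiM {..<j} (\<lambda>_. borel)) (\<lambda>y. \<forall>i\<in>{..<j}. (\<Sum>l\<in>{0..<j}. y l) < (\<Sum>l\<in>{0..<i}. y l :: real))"
    by (simp add: pred_def)
  have [measurable]: "(\<lambda>y. \<Sum>l\<in>{0..<j}. y l :: real) \<in> borel_measurable (PiM {..<j} (\<lambda>_. borel))"
    by (rule partial_sum_measurable) simp
  show ?thesis unfolding pre_min_def[abs_def] of_bool_def by measurable
qed

lemma measurable_post_min:
  assumes [measurable]: "\<psi> \<in> borel_measurable borel"
  shows "post_min \<psi> m \<in> borel_measurable (PiM {..<m} (\<lambda>_. borel))"
proof -
  have "{y \<in> space (PiM {..<m} (\<lambda>_. borel)). \<forall>i\<in>{..m}. 0 \<le> (\<Sum>l\<in>{0..<i}. y l :: real)} \<in> sets (PiM {..<m} (\<lambda>_. borel))"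
    by (intro sets.sets_Collect_finite_All) auto
  then have [measurable]: "Measurable.pred (PiM {..<m} (\<lambda>_. borel)) (\<lambda>y. \<forall>i\<in>{..m}. 0 \<le> (\<Sum>l\<in>{0..<i}. y l :: real))"
    by (simp add: pred_def)
  have [measurable]: "(\<lambda>y. \<Sum>l\<in>{0..<m}. y l :: real) \<in> borel_measurable (PiM {..<m} (\<lambda>_. borel))"
    by (rule partial_sum_measurable) simp
  show ?thesis unfolding post_min_def[abs_def] of_bool_def by measurable
qed

text \<open>\<open>sum_first_argmin\<close> written in increments: the first minimiser cuts the path
  into two pieces that share no increment.\<close>

lemma walk_dip_rise_eq:
  "\<phi> (walk_dip h n \<omega>) * \<psi> (walk_rise h n \<omega>)
    = (\<Sum>j\<le>n. pre_min \<phi> j (incr 0 h j \<omega>) * post_min \<psi> (n - j) (incr (real j * h) h (n - j) \<omega>))"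
proof -
  define s where "s j = X (real j * h) \<omega>" for j
  have main: "(\<Sum>j\<le>n. (\<lambda>z. \<phi> (s 0 - z) * \<psi> (s n - z)) (s j) * (of_bool (\<forall>i<j. s j < s i) * of_bool (\<forall>i\<le>n - j. s j \<le> s (j + i))))
     = \<phi> (s 0 - Min (s ` {..n})) * \<psi> (s n - Min (s ` {..n}))" by (rule sum_first_argmin)
  have pre: "pre_min \<phi> j (incr 0 h j \<omega>) = \<phi> (s 0 - s j) * of_bool (\<forall>i<j. s j < s i)" for j
    unfolding pre_min_def by (auto simp: sum_incr s_def)
  have post: "post_min \<psi> (n - j) (incr (real j * h) h (n - j) \<omega>) = \<psi> (s n - s j) * of_bool (\<forall>i\<le>n - j. s j \<le> s (j + i))"
    if "j \<le> n" for j
  proof -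
    have S: "(\<Sum>l\<in>{0..<i}. incr (real j * h) h (n - j) \<omega> l) = s (j + i) - s j" if "i \<le> n - j" for i
      using sum_incr[of 0 i "n - j" "real j * h" h \<omega>] that by (simp add: s_def algebra_simps)
    then show ?thesis unfolding post_min_def using that S[of "n - j"] by auto
  qed
  have img: "(\<lambda>j. X (real j * h) \<omega>) = s" by (auto simp: s_def)
  have "\<phi> (walk_dip h n \<omega>) * \<psi> (walk_rise h n \<omega>) = \<phi> (s 0 - Min (s ` {..n})) * \<psi> (s n - Min (s ` {..n}))"
    unfolding walk_dip_def walk_rise_def img by (simp add: s_def)
  also have "\<dots> = (\<Sum>j\<le>n. pre_min \<phi> j (incr 0 h j \<omega>) * post_min \<psi> (n - j) (incr (real j * h) h (n - j) \<omega>))"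
    unfolding main[symmetric] by (intro sum.cong refl) (simp add: pre post mult.assoc mult.left_commute)
  finally show ?thesis .
qed

text \<open>By independence of the two pieces the mean over \<open>n\<close> steps is a discrete
  convolution of a pre-minimum and a post-minimum sequence, so its generating function is a
  product.\<close>

lemma walk_Wiener_Hopf:
  fixes \<phi> \<psi> :: "real \<Rightarrow> real"
  assumes h: "0 \<le> h" and r: "0 \<le> r" "r < 1"
    and \<phi>: "\<phi> \<in> borel_measurable borel" "\<And>x. \<bar>\<phi> x\<bar> \<le> 1"
    and \<psi>: "\<psi> \<in> borel_measurable borel" "\<And>x. \<bar>\<psi> x\<bar> \<le> 1"
  shows "(\<Sum>n. r ^ n * expectation (\<lambda>\<omega>. \<phi> (walk_dip h n \<omega>) * \<psi> (walk_rise h n \<omega>)))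
    = (\<Sum>n. r ^ n * expectation (\<lambda>\<omega>. pre_min \<phi> n (incr 0 h n \<omega>))) * (\<Sum>n. r ^ n * expectation (\<lambda>\<omega>. post_min \<psi> n (incr 0 h n \<omega>)))"
proof -
  define a where "a n = expectation (\<lambda>\<omega>. pre_min \<phi> n (incr 0 h n \<omega>))" for n
  define b where "b n = expectation (\<lambda>\<omega>. post_min \<psi> n (incr 0 h n \<omega>))" for n
  have pre1: "\<bar>pre_min \<phi> n y\<bar> \<le> 1" and post1: "\<bar>post_min \<psi> n y\<bar> \<le> 1" for n y
    unfolding pre_min_def post_min_def using \<phi>(2) \<psi>(2) by (auto simp: abs_mult)
  have mpre: "(\<lambda>\<omega>. pre_min \<phi> j (incr 0 h j \<omega>)) \<in> borel_measurable M"
    and mpost: "(\<lambda>\<omega>. post_min \<psi> m (incr (real j * h) h m \<omega>)) \<in> borel_measurable M" for j m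
    using h by (auto intro!: measurable_compose[OF measurable_incr measurable_pre_min[OF \<phi>(1)]]
        measurable_compose[OF measurable_incr measurable_post_min[OF \<psi>(1)]])
  have abound: "\<bar>a n\<bar> \<le> 1" and bbound: "\<bar>b n\<bar> \<le> 1" for n unfolding a_def b_def
    using mpre[of n] mpost[of n 0] pre1 post1 by (auto intro!: abs_expectation_le)
  have summ: "summable (\<lambda>n. norm (r ^ n * c n))" if "\<And>n. \<bar>c n\<bar> \<le> 1" for c :: "nat \<Rightarrow> real"
  proof (rule summable_comparison_test)
    show "summable (\<lambda>n. r ^ n)" using r by (intro summable_geometric) auto
    show "\<exists>N. \<forall>n\<ge>N. norm (norm (r ^ n * c n)) \<le> r ^ n" using r that by (auto simp: abs_mult mult_left_le)
  qed
  have "expectation (\<lambda>\<omega>. \<phi> (walk_dip h n \<omega>) * \<psi> (walk_rise h n \<omega>)) = (\<Sum>j\<le>n. a j * b (n - j))" for n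
  proof -
    have "expectation (\<lambda>\<omega>. \<phi> (walk_dip h n \<omega>) * \<psi> (walk_rise h n \<omega>))
       = (\<Sum>j\<le>n. expectation (\<lambda>\<omega>. pre_min \<phi> j (incr 0 h j \<omega>) * post_min \<psi> (n - j) (incr (real j * h) h (n - j) \<omega>)))"
      unfolding walk_dip_rise_eq
    proof (rule Bochner_Integration.integral_sum)
      fix j assume "j \<in> {..n}"
      have "\<bar>pre_min \<phi> j (incr 0 h j \<omega>) * post_min \<psi> (n - j) (incr (real j * h) h (n - j) \<omega>)\<bar> \<le> 1 * 1" for \<omega>
        unfolding abs_mult by (intro mult_mono pre1 post1) auto
      then show "integrable M (\<lambda>\<omega>. pre_min \<phi> j (incr 0 h j \<omega>) * post_min \<psi> (n - j) (incr (real j * h) h (n - j) \<omega>))"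
        using mpre mpost by (intro integrable_const_bound[of _ 1]) auto
    qed
    also have "\<dots> = (\<Sum>j\<le>n. a j * b (n - j))" unfolding a_def b_def
      by (intro sum.cong refl expectation_incr_mult[OF h measurable_pre_min[OF \<phi>(1)] pre1 measurable_post_min[OF \<psi>(1)] post1])
    finally show ?thesis .
  qed
  then have "(\<Sum>n. r ^ n * expectation (\<lambda>\<omega>. \<phi> (walk_dip h n \<omega>) * \<psi> (walk_rise h n \<omega>)))
      = (\<Sum>n. \<Sum>j\<le>n. (r ^ j * a j) * (r ^ (n - j) * b (n - j)))"
    by (intro suminf_cong) (auto simp: sum_distrib_left mult_ac power_add[symmetric] intro!: sum.cong)
  also have "\<dots> = (\<Sum>n. r ^ n * a n) * (\<Sum>n. r ^ n * b n)"
    by (rule Cauchy_product[symmetric]) (intro summ abound bbound)+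
  finally show ?thesis unfolding a_def b_def .
qed

text \<open>The walk stops at the first grid time that is not before \<open>t\<close>, so its final
  value converges by right-continuity and its minimum by
  \<open>tendsto_Min_grid_INF\<close>.\<close>

lemma walk_limits:
  assumes \<omega>: "\<omega> \<in> space M" and t: "0 < t"
  shows "(\<lambda>k. walk_dip (1/2^k) (nat \<lceil>t * 2^k\<rceil>) \<omega>) \<longlonglongrightarrow> dip X 0 t \<omega>"
    and "(\<lambda>k. walk_rise (1/2^k) (nat \<lceil>t * 2^k\<rceil>) \<omega>) \<longlonglongrightarrow> rise X 0 t \<omega>"
proof -
  define N where "N k = nat \<lceil>t * 2^k\<rceil>" for k :: nat
  have N: "t * 2^k \<le> real (N k)" "real (N k) \<le> t * 2^k + 1" for k
  proof -
    have "0 \<le> t * 2^k" using t by simp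
    then have "0 \<le> \<lceil>t * 2^k\<rceil>" by simp
    then have "real (N k) = of_int \<lceil>t * 2^k\<rceil>" unfolding N_def by (intro of_nat_nat)
    then show "t * 2^k \<le> real (N k)" "real (N k) \<le> t * 2^k + 1" using ceiling_correct[of "t * 2^k"] by linarith+
  qed
  define D where "D k = (\<lambda>j. real j * (1/2^k)) ` {..N k}" for k
  have D_eq: "(\<lambda>j. X (real j * (1/2^k)) \<omega>) ` {..N k} = (\<lambda>s. X s \<omega>) ` D k" for k
    unfolding D_def by (simp add: image_image)
  have e: "(\<lambda>k. (1/2)^k) \<longlonglongrightarrow> (0::real)" by (rule LIMSEQ_power_zero) simp
  have Dhi: "real (N k) * (1/2^k) \<le> t + (1/2)^k" and Dlo: "t \<le> real (N k) * (1/2^k)" for k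
    using N[of k] by (simp_all add: field_simps power_divide)
  have Min_lim: "(\<lambda>k. Min ((\<lambda>s. X s \<omega>) ` D k)) \<longlonglongrightarrow> (INF s\<in>{0..t}. X s \<omega>)"
  proof (rule tendsto_Min_grid_INF[OF _ _ _ _ _ _ e])
    show "continuous (at_right s) (\<lambda>s. X s \<omega>)" if "0 \<le> s" for s by (rule right_cont[OF \<omega> that])
    show "bdd_below ((\<lambda>s. X s \<omega>) ` {0..t})" by (rule path_bdd_below[OF \<omega>]) simp
    show "D k \<subseteq> {0..t + (1/2)^k}" for k
    proof
      fix x assume "x \<in> D k"
      then obtain j where j: "j \<le> N k" "x = real j * (1/2^k)" by (auto simp: D_def)
      then have "x \<le> real (N k) * (1/2^k)" unfolding j(2) by (intro mult_right_mono) auto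
      then show "x \<in> {0..t + (1/2)^k}" using Dhi[of k] j(2) by auto
    qed
    show "\<exists>u\<in>D k. s \<le> u \<and> u \<le> s + (1/2)^k" if s: "s \<in> {0..t}" for s k
    proof -
      define j where "j = nat \<lceil>s * 2^k\<rceil>"
      have "0 \<le> s * 2^k" using s by simp
      then have "0 \<le> \<lceil>s * 2^k\<rceil>" by simp
      then have "real j = of_int \<lceil>s * 2^k\<rceil>" unfolding j_def by (intro of_nat_nat)
      then have "s * 2^k \<le> real j" "real j \<le> s * 2^k + 1" using ceiling_correct[of "s * 2^k"] by linarith+
      then have "s \<le> real j * (1/2^k)" "real j * (1/2^k) \<le> s + (1/2)^k"
        by (simp_all add: field_simps power_divide)
      moreover have "j \<le> N k"
        unfolding j_def N_def using s by (intro nat_mono ceiling_mono mult_right_mono) auto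
      ultimately show ?thesis unfolding D_def by blast
    qed
  qed (use t in \<open>auto simp: D_def\<close>)
  have "(\<lambda>k. real (N k) * (1/2^k)) \<longlonglongrightarrow> t"
  proof (rule tendsto_sandwich[where f="\<lambda>_. t"])
    show "(\<lambda>k. t + (1/2)^k) \<longlonglongrightarrow> t" using tendsto_add[OF tendsto_const[of t] e] by simp
  qed (use Dlo Dhi in auto)
  then have X_lim: "(\<lambda>k. X (real (N k) * (1/2^k)) \<omega>) \<longlonglongrightarrow> X t \<omega>" using t Dlo by (intro path_seq[OF \<omega>]) auto
  show "(\<lambda>k. walk_dip (1/2^k) (nat \<lceil>t * 2^k\<rceil>) \<omega>) \<longlonglongrightarrow> dip X 0 t \<omega>"
    unfolding walk_dip_def dip_def N_def[symmetric] D_eq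
    by (simp only: add_0) (intro tendsto_diff tendsto_const Min_lim)
  show "(\<lambda>k. walk_rise (1/2^k) (nat \<lceil>t * 2^k\<rceil>) \<omega>) \<longlonglongrightarrow> rise X 0 t \<omega>"
    unfolding walk_rise_def rise_def N_def[symmetric] D_eq
    by (simp only: add_0) (intro tendsto_diff X_lim Min_lim)
qed

end

text \<open>The process is an argument, and the definition stands outside the locale, so that the
  laws for \<open>X\<close> and \<open>neg X\<close> can occur in one statement.\<close>

definition dip_law :: "'a measure \<Rightarrow> (real \<Rightarrow> 'a \<Rightarrow> real) \<Rightarrow> real \<Rightarrow> real measure" where
  "dip_law M X p = distr (exp_law p \<Otimes>\<^sub>M M) borel (\<lambda>z. dip X 0 (max 0 (fst z)) (snd z))"

lemma measurable_fst_borel: "fst \<in> borel_measurable (borel :: (real \<times> real) measure)"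
  and measurable_snd_borel: "snd \<in> borel_measurable (borel :: (real \<times> real) measure)"
  by (auto simp: borel_prod[symmetric])

text \<open>A ramp of slope \<open>- j\<close> that equals \<open>1\<close> up to \<open>a\<close>
  and falls to \<open>0\<close> behind it, a continuous substitute for the indicator of
  \<open>{..a}\<close>. Grid limits are available only for continuous test functions; the same ramps
  later cut off tails of Laplace integrals.\<close>

definition step_approx :: "real \<Rightarrow> nat \<Rightarrow> real \<Rightarrow> real" where
  "step_approx a j x = max 0 (min 1 (1 - real j * (x - a)))"

lemma step_approx_cont: "continuous_on UNIV (step_approx a j)"
  unfolding step_approx_def by (intro continuous_intros)

lemma step_approx_le1: "\<bar>step_approx a j x\<bar> \<le> 1"
  unfolding step_approx_def by auto

lemma step_approx_lim: "(\<lambda>j. step_approx a j x) \<longlonglongrightarrow> (if x \<le> a then 1 else 0)"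
proof (cases "x \<le> a")
  case True
  then have "real j * (x - a) \<le> 0" for j by (simp add: mult_nonneg_nonpos)
  then have "step_approx a j x = 1" for j unfolding step_approx_def by (simp add: min_absorb1)
  then show ?thesis using True by simp
next
  case False
  obtain N :: nat where N: "1 < real N * (x - a)" using False reals_Archimedean3[of "x - a"] by auto
  have "step_approx a j x = 0" if "j \<ge> N" for j
  proof -
    have "real N * (x - a) \<le> real j * (x - a)" using that False by (intro mult_right_mono) auto
    then show ?thesis using N unfolding step_approx_def by simp
  qed
  then have "\<forall>\<^sub>F j in sequentially. step_approx a j x = 0" by (auto simp: eventually_sequentially)
  then show ?thesis using False by (simp add: tendsto_eventually)
qed

context cadlag_Levy
begin

definition dr_law :: "real \<Rightarrow> (real \<times> real) measure" where
  "dr_law p = distr (exp_law p \<Otimes>\<^sub>M M) borel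
     (\<lambda>z. (dip X 0 (max 0 (fst z)) (snd z), rise X 0 (max 0 (fst z)) (snd z)))"

lemma sets_exp_pair [measurable_cong]: "sets (exp_law p \<Otimes>\<^sub>M M) = sets (borel \<Otimes>\<^sub>M M)"
  by (intro sets_pair_measure_cong) auto

lemma measurable_dip_joint: "(\<lambda>z. dip X 0 (max 0 (fst z)) (snd z)) \<in> borel_measurable (borel \<Otimes>\<^sub>M M)"
  and measurable_rise_joint: "(\<lambda>z. rise X 0 (max 0 (fst z)) (snd z)) \<in> borel_measurable (borel \<Otimes>\<^sub>M M)"
  by (intro measurable_dip_random_time[where N=M and \<pi>=snd] measurable_X; auto)+

lemma measurable_exp_pair: "f \<in> borel_measurable (borel \<Otimes>\<^sub>M M) \<Longrightarrow> f \<in> borel_measurable (exp_law p \<Otimes>\<^sub>M M)"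
  using measurable_cong_sets[OF sets_exp_pair refl] by blast

lemma measurable_dr_joint:
  "(\<lambda>z. (dip X 0 (max 0 (fst z)) (snd z), rise X 0 (max 0 (fst z)) (snd z))) \<in> borel_measurable (borel \<Otimes>\<^sub>M M)"
  by (intro borel_measurable_Pair measurable_dip_joint measurable_rise_joint)

lemma prob_space_exp_pair: "0 < p \<Longrightarrow> prob_space (exp_law p \<Otimes>\<^sub>M M)"
  by (intro prob_space_pair prob_space_exponential_density prob_space_axioms)

lemma prob_space_dr_law: "0 < p \<Longrightarrow> prob_space (dr_law p)"
  unfolding dr_law_def
  by (intro prob_space.prob_space_distr prob_space_exp_pair measurable_exp_pair measurable_dr_joint)

lemma sets_dr_law [simp, measurable_cong]: "sets (dr_law p) = sets borel"
  unfolding dr_law_def by simp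

lemma prob_space_dip_law: "0 < p \<Longrightarrow> prob_space (dip_law M X p)"
  unfolding dip_law_def
  by (intro prob_space.prob_space_distr prob_space_exp_pair measurable_exp_pair measurable_dip_joint)

lemma integral_dr_law:
  fixes F :: "real \<times> real \<Rightarrow> real"
  assumes p: "0 < p" and F: "F \<in> borel_measurable borel" "\<And>z. \<bar>F z\<bar> \<le> B"
  shows "(\<integral>z. F z \<partial>dr_law p) = (\<integral>t. expectation (\<lambda>\<omega>. F (dip X 0 (max 0 t) \<omega>, rise X 0 (max 0 t) \<omega>)) \<partial>exp_law p)"
    and "(\<lambda>t. expectation (\<lambda>\<omega>. F (dip X 0 (max 0 t) \<omega>, rise X 0 (max 0 t) \<omega>))) \<in> borel_measurable borel"
proof -
  interpret E: prob_space "exp_law p" by (rule prob_space_exponential_density[OF p])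
  interpret P: pair_prob_space "exp_law p" M ..
  let ?G = "\<lambda>z. F (dip X 0 (max 0 (fst z)) (snd z), rise X 0 (max 0 (fst z)) (snd z))"
  have m: "?G \<in> borel_measurable (borel \<Otimes>\<^sub>M M)" by (rule measurable_compose[OF measurable_dr_joint F(1)])
  have "(\<integral>z. F z \<partial>dr_law p) = (\<integral>z. ?G z \<partial>(exp_law p \<Otimes>\<^sub>M M))"
    unfolding dr_law_def by (rule integral_distr[OF measurable_exp_pair[OF measurable_dr_joint] F(1)])
  also have "\<dots> = (\<integral>t. \<integral>\<omega>. ?G (t, \<omega>) \<partial>M \<partial>exp_law p)"
    using F(2) by (intro P.integral_fst'[symmetric] P.P.integrable_const_bound[of _ B] measurable_exp_pair m) auto
  finally show "(\<integral>z. F z \<partial>dr_law p) = (\<integral>t. expectation (\<lambda>\<omega>. F (dip X 0 (max 0 t) \<omega>, rise X 0 (max 0 t) \<omega>)) \<partial>exp_law p)"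
    by simp
  show "(\<lambda>t. expectation (\<lambda>\<omega>. F (dip X 0 (max 0 t) \<omega>, rise X 0 (max 0 t) \<omega>))) \<in> borel_measurable borel"
    using borel_measurable_lebesgue_integral[of "\<lambda>t \<omega>. ?G (t, \<omega>)" borel] m by (simp add: case_prod_unfold)
qed

lemma walk_measurable:
  assumes "0 \<le> h"
  shows "walk_dip h n \<in> borel_measurable M" "walk_rise h n \<in> borel_measurable M"
proof -
  have "(\<lambda>\<omega>. Min ((\<lambda>j. X (real j * h) \<omega>) ` {..n})) \<in> borel_measurable M"
    using assms by (intro borel_measurable_Min measurable_X) auto
  then show "walk_dip h n \<in> borel_measurable M" "walk_rise h n \<in> borel_measurable M"
    unfolding walk_dip_def[abs_def] walk_rise_def[abs_def]
    using assms by (auto intro!: borel_measurable_diff measurable_X)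
qed

lemma geometric_walk_limit:
  fixes f g :: "real \<Rightarrow> real"
  assumes p: "0 < p"
    and f: "continuous_on UNIV f" "\<And>x. \<bar>f x\<bar> \<le> 1" and g: "continuous_on UNIV g" "\<And>x. \<bar>g x\<bar> \<le> 1"
  shows "(\<lambda>k. (1 - exp (- p / 2^k)) * (\<Sum>n. exp (- p / 2^k) ^ n *
       expectation (\<lambda>\<omega>. f (walk_dip (1/2^k) n \<omega>) * g (walk_rise (1/2^k) n \<omega>))))
    \<longlonglongrightarrow> (\<integral>z. f (fst z) * g (snd z) \<partial>dr_law p)"
proof -
  let ?U = "\<lambda>k n. expectation (\<lambda>\<omega>. f (walk_dip (1/2^k) n \<omega>) * g (walk_rise (1/2^k) n \<omega>))"
  have fm [measurable]: "f \<in> borel_measurable borel" "g \<in> borel_measurable borel"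
    using f g by (auto intro: borel_measurable_continuous_onI)
  have fg1: "\<bar>f x * g y\<bar> \<le> 1" for x y using mult_mono[OF f(2)[of x] g(2)[of y]] by (simp add: abs_mult)
  have wm: "(\<lambda>\<omega>. f (walk_dip (1/2^k) n \<omega>) * g (walk_rise (1/2^k) n \<omega>)) \<in> borel_measurable M" for k n :: nat
    using walk_measurable[of "1/2^k" n] by measurable
  define F where "F z = f (fst z) * g (snd z)" for z :: "real \<times> real"
  have F: "F \<in> borel_measurable borel" "\<And>z. \<bar>F z\<bar> \<le> 1"
    unfolding F_def[abs_def] using fg1 by (auto simp: borel_prod[symmetric])
  have U1: "\<bar>?U k n\<bar> \<le> 1" for k n by (rule abs_expectation_le[OF wm fg1])
  have "(\<lambda>k. (1 - exp (- p / 2^k)) * (\<Sum>n. exp (- p / 2^k) ^ n * ?U k n)) \<longlonglongrightarrow>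
     (\<integral>t. expectation (\<lambda>\<omega>. F (dip X 0 (max 0 t) \<omega>, rise X 0 (max 0 t) \<omega>)) \<partial>exp_law p)"
  proof (rule geometric_to_exp_law[OF p U1 integral_dr_law(2)[OF p F]])
    fix t :: real assume t: "0 < t"
    show "(\<lambda>k. ?U k (nat \<lceil>t * 2 ^ k\<rceil>)) \<longlonglongrightarrow>
       expectation (\<lambda>\<omega>. F (dip X 0 (max 0 t) \<omega>, rise X 0 (max 0 t) \<omega>))" unfolding F_def fst_conv snd_conv
    proof (rule integral_dominated_convergence[where w="\<lambda>_. 1"])
      show "(\<lambda>\<omega>. f (dip X 0 (max 0 t) \<omega>) * g (rise X 0 (max 0 t) \<omega>)) \<in> borel_measurable M"
        using borel_measurable_dip[of 0 "max 0 t"] borel_measurable_rise[of 0 "max 0 t"] by measurable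
      show "AE \<omega> in M. (\<lambda>k. f (walk_dip (1/2^k) (nat \<lceil>t * 2 ^ k\<rceil>) \<omega>) * g (walk_rise (1/2^k) (nat \<lceil>t * 2 ^ k\<rceil>) \<omega>))
          \<longlonglongrightarrow> f (dip X 0 (max 0 t) \<omega>) * g (rise X 0 (max 0 t) \<omega>)"
      proof (rule AE_I2)
        fix \<omega> assume \<omega>: "\<omega> \<in> space M"
        have cont: "isCont f x" "isCont g x" for x using f g by (auto simp: continuous_on_eq_continuous_at)
        show "(\<lambda>k. f (walk_dip (1/2^k) (nat \<lceil>t * 2 ^ k\<rceil>) \<omega>) * g (walk_rise (1/2^k) (nat \<lceil>t * 2 ^ k\<rceil>) \<omega>))
          \<longlonglongrightarrow> f (dip X 0 (max 0 t) \<omega>) * g (rise X 0 (max 0 t) \<omega>)" using walk_limits[OF \<omega> t] t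
          by (intro tendsto_mult isCont_tendsto_compose[OF cont(1)] isCont_tendsto_compose[OF cont(2)]) (auto simp: max_absorb2)
      qed
    qed (use wm fg1 in auto)
  qed
  also have "(\<integral>t. expectation (\<lambda>\<omega>. F (dip X 0 (max 0 t) \<omega>, rise X 0 (max 0 t) \<omega>)) \<partial>exp_law p) = (\<integral>z. f (fst z) * g (snd z) \<partial>dr_law p)"
    unfolding integral_dr_law(1)[OF p F, symmetric] by (simp add: F_def[abs_def])
  finally show ?thesis .
qed

text \<open>On a grid the mean \<open>L f g\<close> is \<open>(1 - r) * (A f * B g)\<close>. No
  limit of the single factors is known, but the cross relation
  \<open>L \<phi> \<psi> * L 1 1 = L \<phi> 1 * L 1 \<psi>\<close>, in which they match on both
  sides, involves only convergent quantities, and \<open>L 1 1\<close> tends to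
  \<open>1\<close>.\<close>

lemma Wiener_Hopf_continuous:
  fixes \<phi> \<psi> :: "real \<Rightarrow> real"
  assumes p: "0 < p"
    and \<phi>: "continuous_on UNIV \<phi>" "\<And>x. \<bar>\<phi> x\<bar> \<le> 1" and \<psi>: "continuous_on UNIV \<psi>" "\<And>x. \<bar>\<psi> x\<bar> \<le> 1"
  shows "(\<integral>z. \<phi> (fst z) * \<psi> (snd z) \<partial>dr_law p) = (\<integral>z. \<phi> (fst z) \<partial>dr_law p) * (\<integral>z. \<psi> (snd z) \<partial>dr_law p)"
proof -
  define r where "r k = exp (- p / 2^k)" for k :: nat
  have r: "0 \<le> r k" "r k < 1" for k using p by (auto simp: r_def)
  define U where "U f g k n = expectation (\<lambda>\<omega>. f (walk_dip (1/2^k) n \<omega>) * g (walk_rise (1/2^k) n \<omega>))"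
    for f g :: "real \<Rightarrow> real" and k n :: nat
  define L where "L f g k = (1 - r k) * (\<Sum>n. r k ^ n * U f g k n)" for f g k
  define J where "J f g = (\<integral>z. f (fst z) * g (snd z) \<partial>dr_law p)" for f g :: "real \<Rightarrow> real"
  have lim: "L f g \<longlonglongrightarrow> J f g"
    if f: "continuous_on UNIV f" "\<And>x. \<bar>f x\<bar> \<le> 1" and g: "continuous_on UNIV g" "\<And>x. \<bar>g x\<bar> \<le> 1"
    for f g :: "real \<Rightarrow> real"
    unfolding L_def[abs_def] U_def J_def r_def by (rule geometric_walk_limit[OF p that])
  let ?one = "\<lambda>_. 1 :: real"
  have one: "continuous_on UNIV ?one" "\<And>x. \<bar>?one x\<bar> \<le> 1" by auto
  have mb: "\<phi> \<in> borel_measurable borel" "\<psi> \<in> borel_measurable borel" "?one \<in> borel_measurable borel"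
    using \<phi> \<psi> by (auto intro: borel_measurable_continuous_onI)
  define A where "A f k = (\<Sum>n. r k ^ n * expectation (\<lambda>\<omega>. pre_min f n (incr 0 (1/2^k) n \<omega>)))" for f k
  define B where "B g k = (\<Sum>n. r k ^ n * expectation (\<lambda>\<omega>. post_min g n (incr 0 (1/2^k) n \<omega>)))" for g k
  have W: "L f g k = (1 - r k) * (A f k * B g k)"
    if "f \<in> borel_measurable borel" "\<And>x. \<bar>f x\<bar> \<le> 1" "g \<in> borel_measurable borel" "\<And>x. \<bar>g x\<bar> \<le> 1" for f g k
    using walk_Wiener_Hopf[OF _ r that, of "1/2^k" k] by (simp add: L_def U_def A_def B_def)
  have "L \<phi> \<psi> k * L ?one ?one k = L \<phi> ?one k * L ?one \<psi> k" for k
    using W[OF mb(1) \<phi>(2) mb(2) \<psi>(2), of k] W[OF mb(3) one(2) mb(3) one(2), of k]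
      W[OF mb(1) \<phi>(2) mb(3) one(2), of k] W[OF mb(3) one(2) mb(2) \<psi>(2), of k] by (simp only: mult_ac)
  moreover have "(\<lambda>k. L \<phi> \<psi> k * L ?one ?one k) \<longlonglongrightarrow> J \<phi> \<psi> * J ?one ?one" by (intro tendsto_mult lim \<phi> \<psi> one)
  moreover have "(\<lambda>k. L \<phi> ?one k * L ?one \<psi> k) \<longlonglongrightarrow> J \<phi> ?one * J ?one \<psi>" by (intro tendsto_mult lim \<phi> \<psi> one)
  ultimately have "J \<phi> \<psi> * J ?one ?one = J \<phi> ?one * J ?one \<psi>" using LIMSEQ_unique by auto
  moreover have "J ?one ?one = 1"
    unfolding J_def using prob_space.prob_space[OF prob_space_dr_law[OF p]] by simp
  ultimately show ?thesis by (simp add: J_def)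
qed

lemma measure_dr_law_box:
  assumes p: "0 < p"
  shows "measure (dr_law p) {z. fst z \<le> a \<and> snd z \<le> b} = measure (dr_law p) {z. fst z \<le> a} * measure (dr_law p) {z. snd z \<le> b}"
proof -
  interpret D: prob_space "dr_law p" by (rule prob_space_dr_law[OF p])
  have sp: "space (dr_law p) = UNIV" using sets_eq_imp_space_eq[OF sets_dr_law] by simp
  have [measurable]: "step_approx c j \<in> borel_measurable borel" for c j
    by (intro borel_measurable_continuous_onI step_approx_cont)
  have fst_m [measurable]: "fst \<in> borel_measurable (borel :: (real \<times> real) measure)" "snd \<in> borel_measurable (borel :: (real \<times> real) measure)"
    by (auto simp: borel_prod[symmetric])
  have lim1: "(\<lambda>j. \<integral>z. step_approx a j (fst z) * step_approx b j (snd z) \<partial>dr_law p) \<longlonglongrightarrow>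
      (\<integral>z. indicator {z. fst z \<le> a \<and> snd z \<le> b} z \<partial>dr_law p)"
  proof (rule integral_dominated_convergence[where w="\<lambda>_. 1"])
    show "AE z in dr_law p. (\<lambda>j. step_approx a j (fst z) * step_approx b j (snd z)) \<longlonglongrightarrow> indicator {z. fst z \<le> a \<and> snd z \<le> b} z"
    proof (rule AE_I2)
      fix z :: "real \<times> real"
      show "(\<lambda>j. step_approx a j (fst z) * step_approx b j (snd z)) \<longlonglongrightarrow> indicator {z. fst z \<le> a \<and> snd z \<le> b} z"
        using tendsto_mult[OF step_approx_lim[of a "fst z"] step_approx_lim[of b "snd z"]]
        by (auto simp: indicator_def split: if_splits)
    qed
    show "AE z in dr_law p. norm (step_approx a j (fst z) * step_approx b j (snd z)) \<le> 1" for j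
      using mult_mono[OF step_approx_le1 step_approx_le1] by (auto simp: abs_mult intro!: AE_I2)
  qed auto
  have lim2: "(\<lambda>j. \<integral>z. step_approx a j (fst z) \<partial>dr_law p) \<longlonglongrightarrow> (\<integral>z. indicator {z. fst z \<le> a} z \<partial>dr_law p)"
  proof (rule integral_dominated_convergence[where w="\<lambda>_. 1"])
    show "AE z in dr_law p. (\<lambda>j. step_approx a j (fst z)) \<longlonglongrightarrow> indicator {z. fst z \<le> a} z"
    proof (rule AE_I2)
      fix z :: "real \<times> real"
      show "(\<lambda>j. step_approx a j (fst z)) \<longlonglongrightarrow> indicator {z. fst z \<le> a} z"
        using step_approx_lim[of a "fst z"] by (cases "fst z \<le> a") (simp_all add: indicator_def)
    qed
  qed (use step_approx_le1 in auto)
  have lim3: "(\<lambda>j. \<integral>z. step_approx b j (snd z) \<partial>dr_law p) \<longlonglongrightarrow> (\<integral>z. indicator {z. snd z \<le> b} z \<partial>dr_law p)"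
  proof (rule integral_dominated_convergence[where w="\<lambda>_. 1"])
    show "AE z in dr_law p. (\<lambda>j. step_approx b j (snd z)) \<longlonglongrightarrow> indicator {z. snd z \<le> b} z"
    proof (rule AE_I2)
      fix z :: "real \<times> real"
      show "(\<lambda>j. step_approx b j (snd z)) \<longlonglongrightarrow> indicator {z. snd z \<le> b} z"
        using step_approx_lim[of b "snd z"] by (cases "snd z \<le> b") (simp_all add: indicator_def)
    qed
  qed (use step_approx_le1 in auto)
  have "(\<integral>z. indicator {z. fst z \<le> a \<and> snd z \<le> b} z \<partial>dr_law p)
      = (\<integral>z. indicator {z. fst z \<le> a} z \<partial>dr_law p) * (\<integral>z. indicator {z. snd z \<le> b} z \<partial>dr_law p :: real)"
    using lim1 tendsto_mult[OF lim2 lim3]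
    unfolding Wiener_Hopf_continuous[OF p step_approx_cont step_approx_le1 step_approx_cont step_approx_le1]
    by (rule LIMSEQ_unique)
  then show ?thesis by (simp add: sp)
qed

lemma distr_fst_dr_law: "distr (dr_law p) borel fst = dip_law M X p"
  unfolding dr_law_def dip_law_def
  by (subst distr_distr[OF measurable_fst_borel measurable_exp_pair[OF measurable_dr_joint]]) (simp add: comp_def)

text \<open>The time reversal of \<open>distr_rise_eq_dip_uminus\<close> holds at every fixed time,
  and integrating over the exponential law transfers it to the exponential time.\<close>

lemma distr_snd_dr_law:
  assumes p: "0 < p"
  shows "distr (dr_law p) borel snd = dip_law M (neg X) p"
proof -
  interpret N: cadlag_Levy M "neg X" by (rule uminus)
  have m: "(\<lambda>z. rise X 0 (max 0 (fst z)) (snd z)) \<in> borel_measurable (exp_law p \<Otimes>\<^sub>M M)"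
      "(\<lambda>z. dip (neg X) 0 (max 0 (fst z)) (snd z)) \<in> borel_measurable (exp_law p \<Otimes>\<^sub>M M)"
    by (intro measurable_exp_pair measurable_rise_joint N.measurable_dip_joint)+
  have "distr (dr_law p) borel snd = distr (exp_law p \<Otimes>\<^sub>M M) borel (\<lambda>z. rise X 0 (max 0 (fst z)) (snd z))"
    unfolding dr_law_def
    by (subst distr_distr[OF measurable_snd_borel measurable_exp_pair[OF measurable_dr_joint]]) (simp add: comp_def)
  also have "\<dots> = dip_law M (neg X) p" unfolding dip_law_def
  proof (rule measure_eqI)
    fix A assume "A \<in> sets (distr (exp_law p \<Otimes>\<^sub>M M) borel (\<lambda>z. rise X 0 (max 0 (fst z)) (snd z)))"
    then have A: "A \<in> sets borel" by simp
    have e: "emeasure (distr (exp_law p \<Otimes>\<^sub>M M) borel (\<lambda>z. f (fst z) (snd z))) A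
        = (\<integral>\<^sup>+t. emeasure (distr M borel (f t)) A \<partial>exp_law p)"
      if f: "(\<lambda>z. f (fst z) (snd z)) \<in> borel_measurable (exp_law p \<Otimes>\<^sub>M M)" for f :: "real \<Rightarrow> 'a \<Rightarrow> real"
    proof -
      have "emeasure (distr (exp_law p \<Otimes>\<^sub>M M) borel (\<lambda>z. f (fst z) (snd z))) A
        = emeasure (exp_law p \<Otimes>\<^sub>M M) ((\<lambda>z. f (fst z) (snd z)) -` A \<inter> space (exp_law p \<Otimes>\<^sub>M M))"
        by (rule emeasure_distr[OF f A])
      also have "\<dots> = (\<integral>\<^sup>+t. emeasure M (Pair t -` ((\<lambda>z. f (fst z) (snd z)) -` A \<inter> space (exp_law p \<Otimes>\<^sub>M M))) \<partial>exp_law p)"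
        by (rule emeasure_pair_measure_alt[OF measurable_sets[OF f A]])
      also have "\<dots> = (\<integral>\<^sup>+t. emeasure (distr M borel (f t)) A \<partial>exp_law p)"
      proof (rule nn_integral_cong)
        fix t assume t: "t \<in> space (exp_law p)"
        have "f t \<in> borel_measurable M" using measurable_compose[OF measurable_Pair1'[OF t] f] by simp
        then show "emeasure M (Pair t -` ((\<lambda>z. f (fst z) (snd z)) -` A \<inter> space (exp_law p \<Otimes>\<^sub>M M))) = emeasure (distr M borel (f t)) A"
          using A by (subst emeasure_distr) (auto simp: space_pair_measure intro!: arg_cong[where f="emeasure M"])
      qed
      finally show ?thesis .
    qed
    show "emeasure (distr (exp_law p \<Otimes>\<^sub>M M) borel (\<lambda>z. rise X 0 (max 0 (fst z)) (snd z))) A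
        = emeasure (distr (exp_law p \<Otimes>\<^sub>M M) borel (\<lambda>z. dip (neg X) 0 (max 0 (fst z)) (snd z))) A"
      unfolding e[of "\<lambda>t. rise X 0 (max 0 t)", OF m(1)] e[of "\<lambda>t. dip (neg X) 0 (max 0 t)", OF m(2)]
      by (intro nn_integral_cong) (simp add: distr_rise_eq_dip_uminus)
  qed simp
  finally show ?thesis .
qed

theorem Wiener_Hopf:
  assumes p: "0 < p"
  shows "dr_law p = dip_law M X p \<Otimes>\<^sub>M dip_law M (neg X) p"
proof -
  interpret N: cadlag_Levy M "neg X" by (rule uminus)
  interpret D: prob_space "dr_law p" by (rule prob_space_dr_law[OF p])
  interpret D1: prob_space "dip_law M X p" by (rule prob_space_dip_law[OF p])
  interpret D2: prob_space "dip_law M (neg X) p" by (rule N.prob_space_dip_law[OF p])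
  interpret P: pair_prob_space "dip_law M X p" "dip_law M (neg X) p" ..
  have fst_m: "fst \<in> measurable (dr_law p) borel" "snd \<in> measurable (dr_law p) borel"
    by (auto simp: borel_prod[symmetric] cong: measurable_cong_sets)
  have sp: "space (dr_law p) = UNIV" using sets_eq_imp_space_eq[OF sets_dr_law] by simp
  have s1: "sets (dip_law M Y p) = sets borel" for Y unfolding dip_law_def by simp
  show ?thesis
  proof (rule pair_cdf_eqI)
    show "finite_measure (dr_law p)" by (rule D.finite_measure_axioms)
    show "sets (dip_law M X p \<Otimes>\<^sub>M dip_law M (neg X) p) = sets borel"
      unfolding borel_prod[symmetric] by (intro sets_pair_measure_cong s1)
    fix a b :: real
    have "{z :: real \<times> real. fst z \<le> a \<and> snd z \<le> b} = {..a} \<times> {..b}" by auto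
    then have "emeasure (dip_law M X p \<Otimes>\<^sub>M dip_law M (neg X) p) {z. fst z \<le> a \<and> snd z \<le> b}
        = emeasure (dip_law M X p) {..a} * emeasure (dip_law M (neg X) p) {..b}"
      by (simp add: D2.emeasure_pair_measure_Times s1)
    also have "\<dots> = emeasure (dr_law p) {z. fst z \<le> a} * emeasure (dr_law p) {z. snd z \<le> b}"
      unfolding distr_fst_dr_law[symmetric] distr_snd_dr_law[OF p, symmetric]
      using fst_m by (simp add: emeasure_distr sp vimage_def)
    also have "\<dots> = emeasure (dr_law p) {z. fst z \<le> a \<and> snd z \<le> b}"
      using measure_dr_law_box[OF p, of a b] by (simp add: D.emeasure_eq_measure ennreal_mult)
    finally show "emeasure (dr_law p) {z. fst z \<le> a \<and> snd z \<le> b}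
       = emeasure (dip_law M X p \<Otimes>\<^sub>M dip_law M (neg X) p) {z. fst z \<le> a \<and> snd z \<le> b}" by simp
  qed simp
qed

end

section \<open>First passage of the grid walk and lack of memory\<close>

lemma sum_first_passage:
  fixes s :: "nat \<Rightarrow> real" and B :: "nat \<Rightarrow> real"
  shows "(\<Sum>j\<le>n. of_bool ((\<forall>i<j. s i \<le> x) \<and> x < s j) * B j)
    = (if \<exists>i\<le>n. x < s i then B (LEAST i. x < s i) else 0)"
proof (cases "\<exists>i\<le>n. x < s i")
  case True
  define m where "m = (LEAST i. x < s i)"
  from True obtain i where i: "i \<le> n" "x < s i" by blast
  have m: "x < s m" "m \<le> i" unfolding m_def using i by (auto intro: LeastI Least_le)
  have less: "s k \<le> x" if "k < m" for k using not_less_Least[of k "\<lambda>i. x < s i"] that by (simp add: m_def)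
  have "(\<forall>i<j. s i \<le> x) \<and> x < s j \<longleftrightarrow> j = m" for j
  proof
    assume j: "(\<forall>i<j. s i \<le> x) \<and> x < s j"
    then have "\<not> m < j" "\<not> j < m" using m less[of j] by (auto simp: not_less[symmetric])
    then show "j = m" by simp
  qed (use m less in auto)
  then have "(\<Sum>j\<le>n. of_bool ((\<forall>i<j. s i \<le> x) \<and> x < s j) * B j) = (\<Sum>j\<le>n. if j = m then B j else 0)"
    by (intro sum.cong) auto
  also have "\<dots> = B m" using m i by simp
  finally show ?thesis using True by (simp add: m_def)
next
  case False
  then show ?thesis by (auto intro!: sum.neutral)
qed

text \<open>The logarithm of \<open>G\<close> is additive and monotone, so
  \<open>additive_bounded_linear\<close> makes it linear. The work is to exclude the degenerate
  cases \<open>G 1 = 0\<close> and \<open>G 1 = 1\<close>, by right-continuity at \<open>0\<close>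
  and by decay at infinity.\<close>

lemma multiplicative_survival_exponential:
  fixes G :: "real \<Rightarrow> real"
  assumes mult: "\<And>x y. 0 \<le> x \<Longrightarrow> 0 \<le> y \<Longrightarrow> G (x + y) = G x * G y"
    and mono: "\<And>x y. x \<le> y \<Longrightarrow> G y \<le> G x" and range: "\<And>x. 0 \<le> G x" "\<And>x. G x \<le> 1"
    and right: "\<And>x d. d \<longlonglongrightarrow> 0 \<Longrightarrow> (\<And>n. 0 < d n) \<Longrightarrow> (\<lambda>n. G (x + d n)) \<longlonglongrightarrow> G x"
    and top: "(\<lambda>n. G (real n)) \<longlonglongrightarrow> 0" and pos: "G 0 \<noteq> 0"
  obtains c where "0 < c" "\<And>x. 0 \<le> x \<Longrightarrow> G x = exp (- c * x)"
proof -
  have G0: "G 0 = 1" using mult[of 0 0] pos by simp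
  \<comment> \<open>A zero at \<open>1\<close> would propagate by halving to all
    \<open>(1/2)^n\<close> and then, by right-continuity, to \<open>0\<close>.\<close>
  have G1: "G 1 \<noteq> 0"
  proof
    assume "G 1 = 0"
    have "G ((1/2)^n) = 0" for n
    proof (induction n)
      case (Suc n)
      have "G ((1/2)^n) = G ((1/2)^Suc n) * G ((1/2)^Suc n)" by (subst mult[symmetric]) auto
      then show ?case using Suc by simp
    qed (simp add: \<open>G 1 = 0\<close>)
    moreover have "(\<lambda>n. G (0 + (1/2)^n)) \<longlonglongrightarrow> G 0" by (rule right) (auto intro: LIMSEQ_power_zero)
    ultimately have "G 0 = 0" by (simp add: LIMSEQ_const_iff)
    then show False using pos by simp
  qed
  have Gn: "G (real n) = G 1 ^ n" for n
  proof (induction n)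
    case (Suc n)
    then show ?case using mult[of 1 "real n"] by simp
  qed (simp add: G0)
  have Gpos: "0 < G x" if "0 \<le> x" for x
  proof -
    have "G (real (nat \<lceil>x\<rceil>)) \<le> G x" by (rule mono) (use that in linarith)
    moreover have "0 < G (real (nat \<lceil>x\<rceil>))" using G1 range(1)[of 1] by (simp add: Gn)
    ultimately show ?thesis by simp
  qed
  have G1less: "G 1 < 1"
  proof (rule ccontr)
    assume "\<not> G 1 < 1"
    then have "G 1 = 1" using range(2)[of 1] by simp
    then show False using top by (simp add: Gn LIMSEQ_const_iff)
  qed
  have lin: "ln (G x) = x * ln (G 1)" if "0 < x" for x
  proof (rule additive_bounded_linear[where B="- ln (G 1)"])
    show "ln (G (x + y)) = ln (G x) + ln (G y)" if "0 < x" "0 < y" for x y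
      using that Gpos[of x] Gpos[of y] by (simp add: mult ln_mult)
    show "\<bar>ln (G x)\<bar> \<le> - ln (G 1)" if "0 < x" "x \<le> 1" for x
    proof -
      have "ln (G 1) \<le> ln (G x)" using that mono[of x 1] Gpos[of 1] Gpos[of x] by simp
      moreover have "ln (G x) \<le> 0" using that range(2)[of x] Gpos[of x] by simp
      ultimately show ?thesis by simp
    qed
  qed (rule that)
  show thesis
  proof (rule that)
    show "0 < - ln (G 1)" using G1less Gpos[of 1] by simp
    show "G x = exp (- (- ln (G 1)) * x)" if "0 \<le> x" for x
    proof (cases "x = 0")
      case False
      then have "exp (ln (G x)) = exp (x * ln (G 1))" using lin[of x] that by simp
      then show ?thesis using Gpos[OF that] by (simp add: mult.commute)
    qed (simp add: G0)
  qed
qed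

context cadlag_Levy
begin

definition first_passage :: "real \<Rightarrow> nat \<Rightarrow> (nat \<Rightarrow> real) \<Rightarrow> real" where
  "first_passage x j y = of_bool ((\<forall>i\<in>{..<j}. (\<Sum>l\<in>{0..<i}. y l) \<le> x) \<and> x < (\<Sum>l\<in>{0..<j}. y l))"

definition hits :: "real \<Rightarrow> nat \<Rightarrow> (nat \<Rightarrow> real) \<Rightarrow> real" where
  "hits x m y = of_bool (\<exists>i\<in>{..m}. x < (\<Sum>l\<in>{0..<i}. y l))"

lemma measurable_first_passage: "first_passage x j \<in> borel_measurable (PiM {..<j} (\<lambda>_. borel))"
proof -
  have "{y \<in> space (PiM {..<j} (\<lambda>_. borel)). \<forall>i\<in>{..<j}. (\<Sum>l\<in>{0..<i}. y l :: real) \<le> x} \<in> sets (PiM {..<j} (\<lambda>_. borel))"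
    by (intro sets.sets_Collect_finite_All) auto
  then have [measurable]: "Measurable.pred (PiM {..<j} (\<lambda>_. borel)) (\<lambda>y. \<forall>i\<in>{..<j}. (\<Sum>l\<in>{0..<i}. y l :: real) \<le> x)"
    by (simp add: pred_def)
  have [measurable]: "(\<lambda>y. \<Sum>l\<in>{0..<j}. y l :: real) \<in> borel_measurable (PiM {..<j} (\<lambda>_. borel))"
    by (rule partial_sum_measurable) simp
  show ?thesis unfolding first_passage_def[abs_def] of_bool_def by measurable
qed

lemma measurable_hits: "hits x m \<in> borel_measurable (PiM {..<m} (\<lambda>_. borel))"
proof -
  have "{y \<in> space (PiM {..<m} (\<lambda>_. borel)). \<exists>i\<in>{..m}. x < (\<Sum>l\<in>{0..<i}. y l :: real)} \<in> sets (PiM {..<m} (\<lambda>_. borel))"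
    by (intro sets.sets_Collect_finite_Ex) auto
  then have [measurable]: "Measurable.pred (PiM {..<m} (\<lambda>_. borel)) (\<lambda>y. \<exists>i\<in>{..m}. x < (\<Sum>l\<in>{0..<i}. y l :: real))"
    by (simp add: pred_def)
  show ?thesis unfolding hits_def[abs_def] of_bool_def by measurable
qed

definition hit_prob :: "real \<Rightarrow> real \<Rightarrow> nat \<Rightarrow> real" where
  "hit_prob h x n = expectation (\<lambda>\<omega>. hits x n (incr 0 h n \<omega>))"

text \<open>A grid walk can leap over a level even if the process cannot. This probability that the
  first passage over \<open>x\<close> lands beyond \<open>x + e\<close> is the error in the
  lack-of-memory relation.\<close>

definition overshoot_prob :: "real \<Rightarrow> real \<Rightarrow> real \<Rightarrow> nat \<Rightarrow> real" where
  "overshoot_prob h x e n = expectation (\<lambda>\<omega>. of_bool (\<exists>j\<le>n. x + e < X (real j * h) \<omega> - X 0 \<omega>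
      \<and> (\<forall>i<j. X (real i * h) \<omega> - X 0 \<omega> \<le> x)))"

lemma hits_incr: "hits x n (incr 0 h n \<omega>) = of_bool (\<exists>i\<le>n. x < X (real i * h) \<omega> - X 0 \<omega>)"
  unfolding hits_def by (auto simp: sum_incr Bex_def)

lemma first_passage_incr:
  "first_passage x j (incr 0 h j \<omega>) = of_bool ((\<forall>i<j. X (real i * h) \<omega> - X 0 \<omega> \<le> x) \<and> x < X (real j * h) \<omega> - X 0 \<omega>)"
  unfolding first_passage_def by (auto simp: sum_incr)

text \<open>Split at the first passage over \<open>x\<close>. From there a further climb above
  \<open>y\<close> suffices to exceed \<open>x + y\<close>; and unless the passage overshot by more
  than \<open>e\<close>, such a climb is also necessary to exceed \<open>x + y + e\<close>.\<close>

lemma first_passage_product: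
  fixes h :: real
  assumes h: "0 \<le> h"
  defines "a \<equiv> \<lambda>x j. expectation (\<lambda>\<omega>. first_passage x j (incr 0 h j \<omega>))"
  shows "hit_prob h x n = (\<Sum>j\<le>n. a x j)"
    and "(\<Sum>j\<le>n. a x j * hit_prob h y (n - j)) \<le> hit_prob h (x + y) n"
    and "0 \<le> y \<Longrightarrow> 0 \<le> e \<Longrightarrow> hit_prob h (x + y + e) n \<le> (\<Sum>j\<le>n. a x j * hit_prob h y (n - j)) + overshoot_prob h x e n"
proof -
  have f1: "\<bar>first_passage x j y\<bar> \<le> 1" "\<bar>hits x m y\<bar> \<le> 1" for x j m y by (auto simp: first_passage_def hits_def)
  have mf: "(\<lambda>\<omega>. first_passage x j (incr 0 h j \<omega>)) \<in> borel_measurable M"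
    and mh: "(\<lambda>\<omega>. hits x m (incr (real j * h) h m \<omega>)) \<in> borel_measurable M" for x j m
    using h by (auto intro!: measurable_compose[OF measurable_incr measurable_first_passage]
        measurable_compose[OF measurable_incr measurable_hits])
  have mh0: "(\<lambda>\<omega>. hits x m (incr 0 h m \<omega>)) \<in> borel_measurable M" for x m using mh[of x m 0] by simp
  have intf: "integrable M (\<lambda>\<omega>. first_passage x j (incr 0 h j \<omega>))"
    and inth: "integrable M (\<lambda>\<omega>. hits x m (incr 0 h m \<omega>))"
    and intfh: "integrable M (\<lambda>\<omega>. first_passage x j (incr 0 h j \<omega>) * hits y m (incr (real j * h) h m \<omega>))" for x y j m
    using f1 mult_mono[OF f1(1) f1(2)]
    by (auto intro!: integrable_const_bound[of _ 1] mf mh mh0 borel_measurable_times simp: abs_mult)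
  define s where "s \<omega> j = X (real j * h) \<omega> - X 0 \<omega>" for \<omega> j
  have fp: "first_passage x j (incr 0 h j \<omega>) = of_bool ((\<forall>i<j. s \<omega> i \<le> x) \<and> x < s \<omega> j)" for x j \<omega>
    unfolding first_passage_incr s_def by simp
  have hp: "hits x n (incr 0 h n \<omega>) = of_bool (\<exists>i\<le>n. x < s \<omega> i)" for x n \<omega> unfolding hits_incr s_def by simp
  have hq: "hits y m (incr (real j * h) h m \<omega>) = of_bool (\<exists>i\<le>m. y < s \<omega> (j + i) - s \<omega> j)" for y m j \<omega>
  proof -
    have "(\<Sum>l\<in>{0..<i}. incr (real j * h) h m \<omega> l) = s \<omega> (j + i) - s \<omega> j" if "i \<le> m" for i
      using sum_incr[of 0 i m "real j * h" h \<omega>] that by (simp add: s_def algebra_simps)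
    then show ?thesis unfolding hits_def by auto
  qed
  show "hit_prob h x n = (\<Sum>j\<le>n. a x j)"
  proof -
    have "hits x n (incr 0 h n \<omega>) = (\<Sum>j\<le>n. first_passage x j (incr 0 h j \<omega>))" for \<omega>
      using sum_first_passage[where s="s \<omega>" and B="\<lambda>_. 1" and n=n and x=x] by (simp add: fp hp)
    then show ?thesis unfolding hit_prob_def a_def using intf by (simp add: Bochner_Integration.integral_sum)
  qed
  define D where "D \<omega> = (\<Sum>j\<le>n. first_passage x j (incr 0 h j \<omega>) * hits y (n - j) (incr (real j * h) h (n - j) \<omega>))" for \<omega>
  have D: "expectation D = (\<Sum>j\<le>n. a x j * hit_prob h y (n - j))" "integrable M D"
  proof -
    have "expectation D = (\<Sum>j\<le>n. expectation (\<lambda>\<omega>. first_passage x j (incr 0 h j \<omega>) * hits y (n - j) (incr (real j * h) h (n - j) \<omega>)))"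
      unfolding D_def by (rule Bochner_Integration.integral_sum) (rule intfh)
    also have "\<dots> = (\<Sum>j\<le>n. a x j * hit_prob h y (n - j))" unfolding a_def hit_prob_def
      by (intro sum.cong refl expectation_incr_mult[OF h measurable_first_passage f1(1) measurable_hits f1(2)])
    finally show "expectation D = (\<Sum>j\<le>n. a x j * hit_prob h y (n - j))" .
    show "integrable M D" unfolding D_def using intfh by auto
  qed
  have D_eq: "D \<omega> = (if \<exists>i\<le>n. x < s \<omega> i then of_bool (\<exists>i\<le>n - (LEAST i. x < s \<omega> i). y < s \<omega> ((LEAST i. x < s \<omega> i) + i) - s \<omega> (LEAST i. x < s \<omega> i)) else 0)" for \<omega>
    unfolding D_def fp hq by (rule sum_first_passage)
  have least: "(LEAST i. x < s \<omega> i) \<le> n" "x < s \<omega> (LEAST i. x < s \<omega> i)" if "\<exists>i\<le>n. x < s \<omega> i" for \<omega>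
  proof -
    from that obtain i where "i \<le> n" "x < s \<omega> i" by blast
    then show "(LEAST i. x < s \<omega> i) \<le> n" "x < s \<omega> (LEAST i. x < s \<omega> i)"
      using Least_le[of "\<lambda>i. x < s \<omega> i" i] LeastI[of "\<lambda>i. x < s \<omega> i" i] by auto
  qed
  show "(\<Sum>j\<le>n. a x j * hit_prob h y (n - j)) \<le> hit_prob h (x + y) n"
    unfolding D(1)[symmetric] unfolding hit_prob_def
  proof (rule integral_mono[OF D(2) inth])
    fix \<omega>
    show "D \<omega> \<le> hits (x + y) n (incr 0 h n \<omega>)"
    proof (cases "D \<omega> = 0")
      case False
      then obtain i where ex: "\<exists>i\<le>n. x < s \<omega> i" and i: "i \<le> n - (LEAST i. x < s \<omega> i)" "y < s \<omega> ((LEAST i. x < s \<omega> i) + i) - s \<omega> (LEAST i. x < s \<omega> i)"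
        unfolding D_eq by (auto split: if_splits)
      then have "x + y < s \<omega> ((LEAST i. x < s \<omega> i) + i)" "(LEAST i. x < s \<omega> i) + i \<le> n" using least[OF ex] by auto
      then have "hits (x + y) n (incr 0 h n \<omega>) = 1" unfolding hp by auto
      moreover have "D \<omega> \<le> 1" unfolding D_eq by auto
      ultimately show ?thesis by simp
    qed (simp add: hp)
  qed
  show "hit_prob h (x + y + e) n \<le> (\<Sum>j\<le>n. a x j * hit_prob h y (n - j)) + overshoot_prob h x e n"
    if y: "0 \<le> y" and e: "0 \<le> e"
  proof -
    have mO: "(\<lambda>\<omega>. of_bool (\<exists>j\<le>n. x + e < s \<omega> j \<and> (\<forall>i<j. s \<omega> i \<le> x)) :: real) \<in> borel_measurable M"
    proof -
      have [measurable]: "X (real j * h) \<in> borel_measurable M" "X 0 \<in> borel_measurable M" for j :: nat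
        using h by (auto intro: measurable_X)
      show ?thesis unfolding s_def of_bool_def by measurable
    qed
    have intO: "integrable M (\<lambda>\<omega>. of_bool (\<exists>j\<le>n. x + e < s \<omega> j \<and> (\<forall>i<j. s \<omega> i \<le> x)) :: real)"
      by (rule integrable_const_bound[where B=1, OF AE_I2 mO]) simp
    have "hit_prob h (x + y + e) n \<le> expectation (\<lambda>\<omega>. D \<omega> + of_bool (\<exists>j\<le>n. x + e < s \<omega> j \<and> (\<forall>i<j. s \<omega> i \<le> x)))"
      unfolding hit_prob_def
    proof (rule integral_mono[OF inth Bochner_Integration.integrable_add[OF D(2) intO]])
      fix \<omega>
      have D0: "0 \<le> D \<omega>" unfolding D_eq by auto
      show "hits (x + y + e) n (incr 0 h n \<omega>) \<le> D \<omega> + of_bool (\<exists>j\<le>n. x + e < s \<omega> j \<and> (\<forall>i<j. s \<omega> i \<le> x))"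
      proof (cases "\<exists>i\<le>n. x + y + e < s \<omega> i")
        case True
        then obtain i where i: "i \<le> n" "x + y + e < s \<omega> i" by blast
        then have xi: "x < s \<omega> i" using y e by simp
        then have ex: "\<exists>i\<le>n. x < s \<omega> i" using i by blast
        define m where "m = (LEAST i. x < s \<omega> i)"
        have m: "m \<le> n" "x < s \<omega> m" "m \<le> i" using least[OF ex] Least_le[of "\<lambda>i. x < s \<omega> i", OF xi] by (auto simp: m_def)
        have mlt: "\<forall>k<m. s \<omega> k \<le> x" using not_less_Least[of _ "\<lambda>i. x < s \<omega> i"] by (auto simp: m_def not_less)
        show ?thesis
        proof (cases "x + e < s \<omega> m")
          case True
          then have "\<exists>j\<le>n. x + e < s \<omega> j \<and> (\<forall>i<j. s \<omega> i \<le> x)" using m mlt by blast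
          then show ?thesis using D0 unfolding hp by simp
        next
          case False
          then have "y < s \<omega> (m + (i - m)) - s \<omega> m" using i m by simp
          moreover have "i - m \<le> n - m" using i m by simp
          ultimately have "D \<omega> = 1" unfolding D_eq m_def[symmetric] using ex by auto
          then show ?thesis unfolding hp by simp
        qed
      next
        case False
        then have "hits (x + y + e) n (incr 0 h n \<omega>) = 0" unfolding hp by simp
        then show ?thesis using D0 by simp
      qed
    qed
    also have "\<dots> = expectation D + overshoot_prob h x e n"
      unfolding overshoot_prob_def s_def[symmetric] by (rule Bochner_Integration.integral_add[OF D(2) intO])
    finally show ?thesis unfolding D(1) .
  qed
qed

text \<open>\<open>Q x\<close> is the chance that the walk, killed at a geometric time, has exceeded
  \<open>x\<close>. The killing has no memory, so the convolutions of
  \<open>first_passage_product\<close> turn into products \<open>Q x * Q y\<close>.\<close>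

lemma geometric_hit_prob:
  fixes h r :: real
  assumes h: "0 \<le> h" and r: "0 \<le> r" "r < 1"
  defines "Q \<equiv> \<lambda>x. (1 - r) * (\<Sum>n. r ^ n * hit_prob h x n)"
  shows "Q x * Q y \<le> Q (x + y)"
    and "0 \<le> y \<Longrightarrow> 0 \<le> e \<Longrightarrow> Q (x + y + e) \<le> Q x * Q y + (1 - r) * (\<Sum>n. r ^ n * overshoot_prob h x e n)"
proof -
  define a where "a x j = expectation (\<lambda>\<omega>. first_passage x j (incr 0 h j \<omega>))" for x j
  note fp = first_passage_product[OF h, folded a_def]
  have a01: "0 \<le> a x j" "a x j \<le> 1" for x j
  proof -
    have m: "(\<lambda>\<omega>. first_passage x j (incr 0 h j \<omega>)) \<in> borel_measurable M"
      using h by (auto intro!: measurable_compose[OF measurable_incr measurable_first_passage])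
    show "0 \<le> a x j" unfolding a_def by (rule Bochner_Integration.integral_nonneg) (simp add: first_passage_def)
    have "\<bar>a x j\<bar> \<le> 1" unfolding a_def by (rule abs_expectation_le[OF m]) (simp add: first_passage_def)
    then show "a x j \<le> 1" by simp
  qed
  have h01: "0 \<le> hit_prob h x n" "hit_prob h x n \<le> 1" for x n
  proof -
    have m: "(\<lambda>\<omega>. hits x n (incr 0 h n \<omega>)) \<in> borel_measurable M"
      using h by (auto intro!: measurable_compose[OF measurable_incr measurable_hits])
    show "0 \<le> hit_prob h x n" unfolding hit_prob_def by (rule Bochner_Integration.integral_nonneg) (simp add: hits_def)
    have "\<bar>hit_prob h x n\<bar> \<le> 1" unfolding hit_prob_def by (rule abs_expectation_le[OF m]) (simp add: hits_def)
    then show "hit_prob h x n \<le> 1" by simp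
  qed
  have o01: "0 \<le> overshoot_prob h x e n" "overshoot_prob h x e n \<le> 1" for x e n
  proof -
    have [measurable]: "X (real j * h) \<in> borel_measurable M" "X 0 \<in> borel_measurable M" for j :: nat
      using h by (auto intro: measurable_X)
    have m: "(\<lambda>\<omega>. of_bool (\<exists>j\<le>n. x + e < X (real j * h) \<omega> - X 0 \<omega> \<and> (\<forall>i<j. X (real i * h) \<omega> - X 0 \<omega> \<le> x)) :: real) \<in> borel_measurable M"
      unfolding of_bool_def by measurable
    show "0 \<le> overshoot_prob h x e n" unfolding overshoot_prob_def by (rule Bochner_Integration.integral_nonneg) simp
    have "\<bar>overshoot_prob h x e n\<bar> \<le> 1" unfolding overshoot_prob_def by (rule abs_expectation_le[OF m]) simp
    then show "overshoot_prob h x e n \<le> 1" by simp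
  qed
  have summ: "summable (\<lambda>n. norm (r ^ n * c n))" "summable (\<lambda>n. r ^ n * c n)"
    if "\<And>n. 0 \<le> c n" "\<And>n. c n \<le> 1" for c :: "nat \<Rightarrow> real"
  proof -
    show "summable (\<lambda>n. norm (r ^ n * c n))"
    proof (rule summable_comparison_test)
      show "summable (\<lambda>n. r ^ n)" using r by (intro summable_geometric) auto
      show "\<exists>N. \<forall>n\<ge>N. norm (norm (r ^ n * c n)) \<le> r ^ n" using r that by (auto simp: abs_mult mult_left_le)
    qed
    then show "summable (\<lambda>n. r ^ n * c n)" by (rule summable_norm_cancel)
  qed
  define A where "A x = (\<Sum>n. r ^ n * a x n)" for x
  \<comment> \<open>\<open>hit_prob\<close> is the partial sum of the first passage probabilities,
    so its series is theirs times the geometric series. Consequently \<open>Q x\<close> is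
    \<open>A x\<close>, the generating function of the passage index.\<close>
  have QA: "(\<Sum>n. r ^ n * hit_prob h x n) = A x * (1 / (1 - r))" for x
  proof -
    have "(\<Sum>n. r ^ n * hit_prob h x n) = (\<Sum>n. \<Sum>j\<le>n. (r ^ j * a x j) * (r ^ (n - j) * 1))"
      unfolding fp(1) by (intro suminf_cong) (auto simp: sum_distrib_left mult_ac power_add[symmetric] intro!: sum.cong)
    also have "\<dots> = A x * (\<Sum>n. r ^ n * 1)"
      unfolding A_def by (rule Cauchy_product[symmetric]) (intro summ(1) a01; simp)+
    also have "(\<Sum>n. r ^ n * 1) = 1 / (1 - r)" using r suminf_geometric[of r] by simp
    finally show ?thesis .
  qed
  have QQ: "Q x * Q y = (1 - r) * (\<Sum>n. r ^ n * (\<Sum>j\<le>n. a x j * hit_prob h y (n - j)))" for x y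
  proof -
    have "(\<Sum>n. r ^ n * (\<Sum>j\<le>n. a x j * hit_prob h y (n - j))) = (\<Sum>n. \<Sum>j\<le>n. (r ^ j * a x j) * (r ^ (n - j) * hit_prob h y (n - j)))"
      by (intro suminf_cong) (auto simp: sum_distrib_left mult_ac power_add[symmetric] intro!: sum.cong)
    also have "\<dots> = A x * (\<Sum>n. r ^ n * hit_prob h y n)"
      unfolding A_def by (rule Cauchy_product[symmetric]) (intro summ(1) a01 h01; simp)+
    finally show ?thesis unfolding Q_def QA[of x] using r by simp
  qed
  define S where "S x y n = (\<Sum>j\<le>n. a x j * hit_prob h y (n - j))" for x y n
  have S0: "0 \<le> S x y n" and S1: "S x y n \<le> 1" for x y n
    unfolding S_def using fp(2)[of x y n] h01(2)[of "x + y" n] by (auto intro!: sum_nonneg mult_nonneg_nonneg a01 h01)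
  show "Q x * Q y \<le> Q (x + y)" unfolding QQ unfolding Q_def S_def[symmetric] using r fp(2)[of x y, folded S_def]
    by (intro mult_left_mono suminf_le summ(2) S0 S1 h01) auto
  show "Q (x + y + e) \<le> Q x * Q y + (1 - r) * (\<Sum>n. r ^ n * overshoot_prob h x e n)" if y: "0 \<le> y" and e: "0 \<le> e"
  proof -
    have "(\<Sum>n. r ^ n * hit_prob h (x + y + e) n) \<le> (\<Sum>n. r ^ n * S x y n + r ^ n * overshoot_prob h x e n)"
    proof (rule suminf_le)
      show "summable (\<lambda>n. r ^ n * hit_prob h (x + y + e) n)" by (intro summ h01)
      show "summable (\<lambda>n. r ^ n * S x y n + r ^ n * overshoot_prob h x e n)" by (intro summable_add summ S0 S1 o01)
      show "r ^ n * hit_prob h (x + y + e) n \<le> r ^ n * S x y n + r ^ n * overshoot_prob h x e n" for n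
        using fp(3)[OF y e, of x n] r unfolding S_def[symmetric] distrib_left[symmetric] by (intro mult_left_mono) auto
    qed
    also have "\<dots> = (\<Sum>n. r ^ n * S x y n) + (\<Sum>n. r ^ n * overshoot_prob h x e n)"
      by (intro suminf_add[symmetric] summ S0 S1 o01)
    finally have "(1 - r) * (\<Sum>n. r ^ n * hit_prob h (x + y + e) n)
        \<le> (1 - r) * ((\<Sum>n. r ^ n * S x y n) + (\<Sum>n. r ^ n * overshoot_prob h x e n))"
      using r by (intro mult_left_mono) auto
    then show ?thesis unfolding QQ unfolding Q_def S_def[symmetric] by (simp add: distrib_left)
  qed
qed

end

section \<open>The supremum at an exponential time\<close>

lemma measure_exp_law_greaterThan:
  assumes c: "0 < c" and x: "0 \<le> x"
  shows "measure (exp_law c) {..x} = 1 - exp (- c * x)"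
proof -
  interpret prob_space "exp_law c" by (rule prob_space_exponential_density[OF c])
  have "prob {..x} = prob {0<..x}"
    using AE_exp_law_pos[of c] by (intro finite_measure_eq_AE) (auto elim!: eventually_mono)
  then show ?thesis using prob_exp_law_interval[OF c, of 0 x] x by simp
qed

lemma measure_exp_law_negative: "0 < c \<Longrightarrow> x < 0 \<Longrightarrow> measure (exp_law c) {..x} = 0"
proof -
  assume c: "0 < c" and x: "x < 0"
  interpret prob_space "exp_law c" by (rule prob_space_exponential_density[OF c])
  have "prob {..x} = prob {}"
    using AE_exp_law_pos[of c] x by (intro finite_measure_eq_AE) (auto elim!: eventually_mono)
  then show "prob {..x} = 0" by simp
qed

text \<open>The exponential law charges every interval from \<open>T\<close> to
  \<open>T + 1\<close>. This transfers facts about an exponential time to arbitrarily late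
  deterministic times.\<close>

lemma AE_exp_law_unbounded:
  assumes p: "0 < p" and T: "0 \<le> T" and ae: "AE t in exp_law p. P t"
  obtains t where "T < t" "P t"
proof -
  interpret E: prob_space "exp_law p" by (rule prob_space_exponential_density[OF p])
  have "\<exists>t>T. P t"
  proof (rule ccontr)
    assume "\<not> ?thesis"
    then have "AE t in exp_law p. t \<notin> {T<..T + 1}" using ae by (auto elim!: eventually_mono)
    then have "E.prob {T<..T + 1} = E.prob {}" by (intro E.finite_measure_eq_AE) auto
    then show False using prob_exp_law_interval[OF p T, of "T + 1"] p by simp
  qed
  then show thesis using that by blast
qed

sublocale spectrally_negative_Levy \<subseteq> cadlag_Levy by (rule cadlag_Levy)

context spectrally_negative_Levy
begin

text \<open>Let \<tau> be the infimum of the times above level \<open>x\<close>. Without an upward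
  jump the path is at most \<open>x\<close> at \<tau>, and right-continuity keeps it within
  \<open>e\<close> of its value there for some time \<open>d\<close>. A sufficiently fine grid
  already has a point above \<open>x\<close> before \<open>\<tau> + d\<close>, so its first passage
  happens where the path is still below \<open>x + e\<close>.\<close>

lemma no_overshoot:
  "AE \<omega> in M. \<forall>x\<ge>0. \<forall>e>0. \<forall>\<^sub>F k in sequentially.
     \<not> (\<exists>j. x + e < X (real j * (1/2^k)) \<omega> - X 0 \<omega> \<and> (\<forall>i<j. X (real i * (1/2^k)) \<omega> - X 0 \<omega> \<le> x))"
  using no_positive_jumps AE_space
proof eventually_elim
  case (elim \<omega>)
  note jump = elim(1) and \<omega> = elim(2)
  define w where "w u = X u \<omega> - X 0 \<omega>" for u
  have rc: "\<exists>d>0. \<forall>v. u \<le> v \<and> v < u + d \<longrightarrow> \<bar>w v - w u\<bar> < e" if "0 \<le> u" "0 < e" for u e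
  proof -
    have "((\<lambda>s. X s \<omega>) \<longlongrightarrow> X u \<omega>) (at_right u)" using right_cont[OF \<omega> that(1)] by (simp add: continuous_within)
    then have "\<forall>\<^sub>F v in at_right u. dist (X v \<omega>) (X u \<omega>) < e" using that by (intro tendstoD) auto
    then obtain b where "b > u" "\<And>v. u < v \<Longrightarrow> v < b \<Longrightarrow> dist (X v \<omega>) (X u \<omega>) < e"
      by (auto simp: eventually_at_right_field)
    then show ?thesis using that by (intro exI[of _ "b - u"]) (auto simp: dist_real_def w_def le_less)
  qed
  have "\<forall>\<^sub>F k in sequentially. \<not> (\<exists>j. x + e < w (real j * (1/2^k)) \<and> (\<forall>i<j. w (real i * (1/2^k)) \<le> x))"
    if x: "0 \<le> x" and e: "0 < e" for x e
  proof (cases "\<exists>u\<ge>0. x < w u")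
    case False
    then have "\<not> x + e < w (real j * (1/2^k))" for j k :: nat
      using e by (metis add_strict_increasing2 less_eq_real_def less_trans mult_nonneg_nonneg of_nat_0_le_iff less_add_same_cancel1 zero_le_divide_1_iff zero_le_numeral zero_le_power)
    then show ?thesis by simp
  next
    case True
    define A where "A = {u. 0 \<le> u \<and> x < w u}"
    have A: "A \<noteq> {}" "bdd_below A" using True by (auto simp: A_def intro: bdd_belowI[of _ 0])
    define \<tau> where "\<tau> = Inf A"
    have \<tau>0: "0 \<le> \<tau>" unfolding \<tau>_def by (rule cInf_greatest[OF A(1)]) (auto simp: A_def)
    have below: "w u \<le> x" if "0 \<le> u" "u < \<tau>" for u
    proof (rule ccontr)
      assume "\<not> w u \<le> x"
      then have "u \<in> A" using that by (simp add: A_def)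
      then have "\<tau> \<le> u" unfolding \<tau>_def by (rule cInf_lower[OF _ A(2)])
      then show False using that by simp
    qed
    \<comment> \<open>At \<tau> = 0 this is \<open>0 \<le> x\<close>; otherwise the left limit is at
      most \<open>x\<close> and the jump is not positive.\<close>
    have w\<tau>: "w \<tau> \<le> x"
    proof (cases "\<tau> = 0")
      case True
      then show ?thesis using x by (simp add: w_def)
    next
      case False
      then have pos: "0 < \<tau>" using \<tau>0 by simp
      obtain L where L: "((\<lambda>s. X s \<omega>) \<longlongrightarrow> L) (at_left \<tau>)" using left_limits[OF \<omega> pos] by blast
      then have "Lim (at_left \<tau>) (\<lambda>s. X s \<omega>) = L" by (intro tendsto_Lim) auto
      then have "X \<tau> \<omega> \<le> L" using jump pos by auto
      moreover have "L \<le> x + X 0 \<omega>"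
      proof (rule tendsto_upperbound[OF L])
        show "\<forall>\<^sub>F s in at_left \<tau>. X s \<omega> \<le> x + X 0 \<omega>" unfolding eventually_at_left_field using pos below
          by (intro exI[of _ 0]) (auto simp: w_def algebra_simps)
      qed simp
      ultimately show ?thesis by (simp add: w_def)
    qed
    obtain d where d: "d > 0" "\<And>v. \<tau> \<le> v \<Longrightarrow> v < \<tau> + d \<Longrightarrow> \<bar>w v - w \<tau>\<bar> < e" using rc[OF \<tau>0 e] by blast
    obtain u where u: "u \<in> A" "u < \<tau> + d" using cInf_lessD[OF A(1), of "\<tau> + d"] d(1) unfolding \<tau>_def by auto
    have u0: "0 \<le> u" "x < w u" using u(1) by (auto simp: A_def)
    obtain d' where d': "d' > 0" "\<And>v. u \<le> v \<Longrightarrow> v < u + d' \<Longrightarrow> \<bar>w v - w u\<bar> < w u - x"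
      using rc[of u "w u - x"] u0 by auto
    \<comment> \<open>A grid point within \<open>D\<close> after \<open>u\<close> is both above
      \<open>x\<close> and before \<open>\<tau> + d\<close>.\<close>
    define D where "D = min d' (\<tau> + d - u)"
    have D: "0 < D" using d'(1) u(2) by (simp add: D_def)
    have "(\<lambda>k. (1/2)^k) \<longlonglongrightarrow> (0::real)" by (rule LIMSEQ_power_zero) simp
    then have "\<forall>\<^sub>F k in sequentially. (1/2)^k < D" using D by (rule order_tendstoD)
    then show ?thesis
    proof eventually_elim
      case (elim k)
      have "\<exists>j::nat. u \<le> real j * (1/2^k) \<and> real j * (1/2^k) \<le> u + (1/2)^k"
      proof -
        define j where "j = nat \<lceil>u * 2^k\<rceil>"
        have "0 \<le> u * 2^k" using u0 by simp
        then have "0 \<le> \<lceil>u * 2^k\<rceil>" by simp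
        then have "real j = of_int \<lceil>u * 2^k\<rceil>" unfolding j_def by (intro of_nat_nat)
        then have "u * 2^k \<le> real j" "real j \<le> u * 2^k + 1" using ceiling_correct[of "u * 2^k"] by linarith+
        then have "u \<le> real j * (1/2^k)" "real j * (1/2^k) \<le> u + (1/2)^k"
          by (simp_all add: field_simps power_divide)
        then show ?thesis by blast
      qed
      then obtain m :: nat where m: "u \<le> real m * (1/2^k)" "real m * (1/2^k) \<le> u + (1/2)^k" by blast
      have "real m * (1/2^k) < u + D" using m(2) elim by simp
      then have m': "real m * (1/2^k) < u + d'" "real m * (1/2^k) < \<tau> + d" by (auto simp: D_def)
      have hit: "x < w (real m * (1/2^k))" using d'(2)[OF m(1) m'(1)] by linarith
      show ?case
      proof
        assume "\<exists>j. x + e < w (real j * (1/2^k)) \<and> (\<forall>i<j. w (real i * (1/2^k)) \<le> x)"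
        then obtain j :: nat where j: "x + e < w (real j * (1/2^k))" "\<forall>i<j. w (real i * (1/2^k)) \<le> x" by blast
        have "j \<le> m" using hit j(2) by (meson not_less)
        then have "real j * (1/2^k) \<le> real m * (1/2^k)" by (intro mult_right_mono) auto
        then have lt: "real j * (1/2^k) < \<tau> + d" using m' by simp
        have "real j * (1/2^k) \<in> A" using j(1) e by (auto simp: A_def)
        then have "\<tau> \<le> real j * (1/2^k)" unfolding \<tau>_def by (rule cInf_lower[OF _ A(2)])
        then have "w (real j * (1/2^k)) < w \<tau> + e" using d(2)[OF _ lt] by force
        then show False using j(1) w\<tau> by simp
      qed
    qed
  qed
  then show ?case unfolding w_def by blast
qed

lemma geometric_overshoot_limit:
  assumes p: "0 < p" and x: "0 \<le> x" and e: "0 < e"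
  shows "(\<lambda>k. (1 - exp (- p / 2^k)) * (\<Sum>n. exp (- p / 2^k) ^ n * overshoot_prob (1/2^k) x e n)) \<longlonglongrightarrow> 0"
proof -
  define Ov where "Ov k n \<omega> = (of_bool (\<exists>j\<le>n. x + e < X (real j * (1/2^k)) \<omega> - X 0 \<omega>
      \<and> (\<forall>i<j. X (real i * (1/2^k)) \<omega> - X 0 \<omega> \<le> x)) :: real)" for k n :: nat and \<omega>
  have mOv: "Ov k n \<in> borel_measurable M" for k n
  proof -
    have [measurable]: "X (real j * (1/2^k)) \<in> borel_measurable M" "X 0 \<in> borel_measurable M" for j :: nat
      by (auto intro: measurable_X)
    show ?thesis unfolding Ov_def of_bool_def by measurable
  qed
  have Ov_eq: "overshoot_prob (1/2^k) x e n = expectation (Ov k n)" for k n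
    unfolding overshoot_prob_def Ov_def by simp
  have "(\<lambda>k. (1 - exp (- p / 2^k)) * (\<Sum>n. exp (- p / 2^k) ^ n * overshoot_prob (1/2^k) x e n)) \<longlonglongrightarrow> (\<integral>t. 0 \<partial>exp_law p)"
  proof (rule geometric_to_exp_law[OF p])
    show "\<bar>overshoot_prob (1/2^k) x e n\<bar> \<le> 1" for k n
      unfolding Ov_eq by (rule abs_expectation_le[OF mOv]) (simp add: Ov_def)
    fix t :: real
    have "(\<lambda>k. expectation (Ov k (nat \<lceil>t * 2^k\<rceil>))) \<longlonglongrightarrow> expectation (\<lambda>\<omega>. 0)"
    proof (rule integral_dominated_convergence[where w="\<lambda>_. 1"])
      show "AE \<omega> in M. (\<lambda>k. Ov k (nat \<lceil>t * 2^k\<rceil>) \<omega>) \<longlonglongrightarrow> 0" using no_overshoot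
      proof eventually_elim
        case (elim \<omega>)
        then have "\<forall>\<^sub>F k in sequentially. \<not> (\<exists>j. x + e < X (real j * (1/2^k)) \<omega> - X 0 \<omega> \<and> (\<forall>i<j. X (real i * (1/2^k)) \<omega> - X 0 \<omega> \<le> x))"
          using x e by blast
        then have "\<forall>\<^sub>F k in sequentially. Ov k (nat \<lceil>t * 2^k\<rceil>) \<omega> = 0"
          by (rule eventually_mono) (auto simp: Ov_def)
        then show ?case by (rule tendsto_eventually)
      qed
    qed (use mOv in \<open>auto simp: Ov_def\<close>)
    then show "(\<lambda>k. overshoot_prob (1/2^k) x e (nat \<lceil>t * 2^k\<rceil>)) \<longlonglongrightarrow> 0" unfolding Ov_eq by simp
  qed simp
  then show ?thesis by simp
qed

text \<open>This is where \<open>not_nonincreasing\<close> enters. If the supremum at an exponential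
  time never exceeded the start, the same would hold up to arbitrarily late fixed times, by
  stationarity from every rational starting time, and by right-continuity from every time: the paths
  would be non-increasing.\<close>

lemma sup_law_not_zero:
  assumes p: "0 < p"
  shows "measure (dip_law M (neg X) p) {0<..} \<noteq> 0"
proof
  interpret N: cadlag_Levy M "neg X" by (rule uminus)
  interpret E: prob_space "exp_law p" by (rule prob_space_exponential_density[OF p])
  interpret P: pair_prob_space "exp_law p" M ..
  let ?Y = "neg X"
  assume "measure (dip_law M ?Y p) {0<..} = 0"
  then have "measure (exp_law p \<Otimes>\<^sub>M M) ((\<lambda>z. dip ?Y 0 (max 0 (fst z)) (snd z)) -` {0<..} \<inter> space (exp_law p \<Otimes>\<^sub>M M)) = 0"
    unfolding dip_law_def by (subst (asm) measure_distr[OF measurable_exp_pair[OF N.measurable_dip_joint]]) auto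
  then have "AE z in exp_law p \<Otimes>\<^sub>M M. dip ?Y 0 (max 0 (fst z)) (snd z) \<le> 0"
    using measurable_sets[OF measurable_exp_pair[OF N.measurable_dip_joint], of "{0<..}" p]
    by (intro AE_I[where N="(\<lambda>z. dip ?Y 0 (max 0 (fst z)) (snd z)) -` {0<..} \<inter> space (exp_law p \<Otimes>\<^sub>M M)"])
      (auto simp: P.P.emeasure_eq_measure)
  then have AE1: "AE t in exp_law p. AE \<omega> in M. dip ?Y 0 (max 0 t) \<omega> \<le> 0" using P.AE_pair by fastforce
  have "\<exists>t>real n. AE \<omega> in M. dip ?Y 0 (max 0 t) \<omega> \<le> 0" for n :: nat
    using AE_exp_law_unbounded[OF p of_nat_0_le_iff AE1] by blast
  then obtain \<tau> where \<tau>: "\<And>n::nat. \<tau> n > real n" "\<And>n. AE \<omega> in M. dip ?Y 0 (max 0 (\<tau> n)) \<omega> \<le> 0" by metis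
  have \<tau>0: "0 \<le> \<tau> n" for n using \<tau>(1)[of n] by (meson less_imp_le of_nat_0_le_iff order_trans)
  have shift: "AE \<omega> in M. dip ?Y s (\<tau> n) \<omega> \<le> 0" if s: "0 \<le> s" for s n
  proof -
    have m: "(\<lambda>\<omega>. (dip ?Y u (\<tau> n) \<omega>, rise ?Y u (\<tau> n) \<omega>)) \<in> borel_measurable M" if "0 \<le> u" for u
      using that \<tau>0 by (intro N.measurable_dip_rise)
    have "AE z in distr M borel (\<lambda>\<omega>. (dip ?Y 0 (\<tau> n) \<omega>, rise ?Y 0 (\<tau> n) \<omega>)). fst z \<le> 0"
      using \<tau>(2)[of n] \<tau>0[of n] measurable_fst_borel by (subst AE_distr_iff[OF m]) (auto simp: max_absorb2)
    then have "AE z in distr M borel (\<lambda>\<omega>. (dip ?Y s (\<tau> n) \<omega>, rise ?Y s (\<tau> n) \<omega>)). fst z \<le> 0"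
      using N.distr_dip_rise_shift[OF s \<tau>0[of n]] by (simp only:)
    then show ?thesis using measurable_fst_borel by (subst (asm) AE_distr_iff[OF m[OF s]]) auto
  qed
  \<comment> \<open>Only countably many starts and horizons can share one null set; hence rational
    starts and the sequence \<open>\<tau>\<close>.\<close>
  have "AE \<omega> in M. \<forall>r\<in>{r\<in>\<rat>. 0 \<le> r}. \<forall>n. dip ?Y r (\<tau> n) \<omega> \<le> 0"
    by (subst AE_ball_countable) (auto intro: countable_rat countable_subset[OF _ countable_rat] simp: AE_all_countable intro!: shift)
  then have "AE \<omega> in M. \<forall>s t. 0 \<le> s \<longrightarrow> s \<le> t \<longrightarrow> X t \<omega> \<le> X s \<omega>" using AE_space
  proof eventually_elim
    case (elim \<omega>)
    have rat: "X t \<omega> \<le> X r \<omega>" if r: "r \<in> \<rat>" "0 \<le> r" "r \<le> t" for r t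
    proof -
      obtain n :: nat where "t - r < real n" using reals_Archimedean2 by blast
      then have "t \<in> {r..r + \<tau> n}" using r \<tau>(1)[of n] by auto
      then have "(INF u\<in>{r..r + \<tau> n}. - X u \<omega>) \<le> - X t \<omega>" by (intro cINF_lower N.path_bdd_below elim r)
      moreover have "dip ?Y r (\<tau> n) \<omega> \<le> 0" using elim r by blast
      ultimately show ?thesis unfolding dip_def by linarith
    qed
    show ?case
    proof (intro allI impI)
      fix s t :: real assume s: "0 \<le> s" "s \<le> t"
      show "X t \<omega> \<le> X s \<omega>"
      proof (cases "s = t")
        case False
        then have st: "s < t" using s by simp
        have "\<exists>r\<in>\<rat>. s < r \<and> r < min t (s + 1 / real (Suc n))" for n
          by (rule Rats_dense_in_real) (use st in auto)
        then obtain r where r: "\<And>n. r n \<in> \<rat>" "\<And>n. s < r n" "\<And>n. r n < min t (s + 1 / real (Suc n))" by metis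
        have "r \<longlonglongrightarrow> s"
        proof (rule tendsto_sandwich[where f="\<lambda>_. s" and h="\<lambda>n. s + 1 / real (Suc n)"])
          show "(\<lambda>n. s + 1 / real (Suc n)) \<longlonglongrightarrow> s"
            using tendsto_add[OF tendsto_const[of s] LIMSEQ_inverse_real_of_nat] by (simp add: inverse_eq_divide)
        qed (use r in \<open>auto intro!: always_eventually less_imp_le\<close>)
        then have "(\<lambda>n. X (r n) \<omega>) \<longlonglongrightarrow> X s \<omega>" using r s by (intro path_seq elim) (auto intro: less_imp_le)
        moreover have "X t \<omega> \<le> X (r n) \<omega>" for n using r(1,2,3)[of n] s by (intro rat) auto
        ultimately show ?thesis by (intro LIMSEQ_le_const) auto
      qed simp
    qed
  qed
  then show False using not_nonincreasing by simp
qed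

text \<open>The survival function \<open>G\<close> of the supremum lies between \<open>F j x\<close>
  and \<open>F j (x - 1 / j)\<close>, means of continuous test functions, for which grid limits
  exist. The discrete lack of memory makes \<open>G\<close> multiplicative up to shifts of order
  \<open>1 / j\<close>, and right-continuity of \<open>G\<close> removes the shifts.\<close>

theorem sup_law_exponential:
  assumes p: "0 < p"
  obtains c where "0 < c" "dip_law M (neg X) p = distr (exp_law c) borel (\<lambda>x. x)"
proof -
  interpret N: cadlag_Levy M "neg X" by (rule uminus)
  let ?S = "dip_law M (neg X) p"
  interpret S: prob_space ?S by (rule N.prob_space_dip_law[OF p])
  have setsS [simp]: "sets ?S = sets borel" by (simp add: dip_law_def)
  have spS [simp]: "space ?S = UNIV" using sets_eq_imp_space_eq[OF setsS] by simp
  define G where "G x = measure ?S {x<..}" for x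
  \<comment> \<open>A ramp that approximates the indicator of \<open>{x<..}\<close> from below and,
    shifted by \<open>1 / j\<close>, dominates it.\<close>
  define f where "f j x m = 1 - step_approx x j m" for j :: nat and x m :: real
  have f01: "0 \<le> f j x m" "f j x m \<le> 1" for j x m unfolding f_def step_approx_def by auto
  have fabs: "\<bar>f j x m\<bar> \<le> 1" for j x m using f01[of j x m] by simp
  have fcont: "continuous_on UNIV (f j x)" for j x
    unfolding f_def[abs_def] by (intro continuous_intros step_approx_cont)
  have fm [measurable]: "f j x \<in> borel_measurable borel" for j x
    by (rule borel_measurable_continuous_onI[OF fcont])
  have flow: "f j x m \<le> of_bool (x < m)" for j x m
  proof (cases "x < m")
    case False
    then have "real j * (m - x) \<le> 0" by (simp add: mult_nonneg_nonpos)
    then show ?thesis using False unfolding f_def step_approx_def by (simp add: min_absorb1)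
  qed (use f01 in auto)
  have fup: "of_bool (x < m) \<le> f j (x - 1 / real j) m" if "0 < j" for j x m
  proof (cases "x < m")
    case True
    then have "1 \<le> real j * (m - (x - 1 / real j))" using that by (simp add: field_simps)
    then show ?thesis using True unfolding f_def step_approx_def by simp
  qed (use f01 in auto)
  define F where "F j x = (\<integral>m. f j x m \<partial>?S)" for j x
  have intf: "integrable ?S (f j x)" for j x
    using fabs by (intro S.integrable_const_bound[of _ 1]) (auto simp: measurable_cong_sets[OF setsS refl])
  have G_eq: "G x = (\<integral>m. of_bool (x < m) \<partial>?S)" for x
  proof -
    have "(\<integral>m. (of_bool (x < m) :: real) \<partial>?S) = (\<integral>m. indicator {x<..} m \<partial>?S)"
      by (intro Bochner_Integration.integral_cong) (auto simp: indicator_def)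
    then show ?thesis by (simp add: G_def)
  qed
  have intG: "integrable ?S (\<lambda>m. of_bool (x < m) :: real)" for x
    by (intro S.integrable_const_bound[of _ 1]) (auto simp: measurable_cong_sets[OF setsS refl] of_bool_def)
  have FG: "F j x \<le> G x" for j x unfolding F_def G_eq by (intro integral_mono intf intG flow)
  have GF: "G x \<le> F j (x - 1 / real j)" if "0 < j" for j x
    unfolding F_def G_eq by (intro integral_mono intf intG fup that)
  define r where "r k = exp (- p / 2^k)" for k :: nat
  have r: "0 \<le> r k" "r k < 1" for k using p by (auto simp: r_def)
  define Q where "Q k x = (1 - r k) * (\<Sum>n. r k ^ n * hit_prob (1/2^k) x n)" for k x
  define L where "L j x k = (1 - r k) * (\<Sum>n. r k ^ n * expectation (\<lambda>\<omega>. f j x (N.walk_dip (1/2^k) n \<omega>)))" for j x k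
  define Ov where "Ov x e k = (1 - r k) * (\<Sum>n. r k ^ n * overshoot_prob (1/2^k) x e n)" for x e k
  have L_lim: "L j x \<longlonglongrightarrow> F j x" for j x
  proof -
    have "(\<lambda>k. (1 - exp (- p / 2^k)) * (\<Sum>n. exp (- p / 2^k) ^ n *
        expectation (\<lambda>\<omega>. f j x (N.walk_dip (1/2^k) n \<omega>) * (\<lambda>_. 1) (N.walk_rise (1/2^k) n \<omega>))))
      \<longlonglongrightarrow> (\<integral>z. f j x (fst z) * (\<lambda>_. 1) (snd z) \<partial>N.dr_law p)"
      by (rule N.geometric_walk_limit[OF p fcont fabs]) auto
    also have "(\<integral>z. f j x (fst z) * (\<lambda>_. 1) (snd z) \<partial>N.dr_law p) = F j x"
      unfolding F_def N.distr_fst_dr_law[symmetric]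
      by (subst integral_distr) (auto simp: measurable_cong_sets[OF N.sets_dr_law refl] measurable_fst_borel)
    finally show ?thesis by (simp add: L_def[abs_def] r_def[abs_def])
  qed
  have hit_eq: "hits x n (incr 0 h n \<omega>) = of_bool (x < N.walk_dip h n \<omega>)" for x h n \<omega>
  proof -
    have "x < N.walk_dip h n \<omega> \<longleftrightarrow> Min ((\<lambda>j. - X (real j * h) \<omega>) ` {..n}) < - X 0 \<omega> - x"
      unfolding N.walk_dip_def by auto
    also have "\<dots> \<longleftrightarrow> (\<exists>i\<le>n. x < X (real i * h) \<omega> - X 0 \<omega>)"
    proof -
      have "- u < - v - x \<longleftrightarrow> x < u - v" for u v :: real by linarith
      then show ?thesis by (subst Min_less_iff) auto
    qed
    finally show ?thesis unfolding hits_incr by simp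
  qed
  have summ: "summable (\<lambda>n. r k ^ n * c n)" if "\<And>n. 0 \<le> c n" "\<And>n. c n \<le> 1" for c :: "nat \<Rightarrow> real" and k
  proof (rule summable_comparison_test)
    show "summable (\<lambda>n. r k ^ n)" using r[of k] by (intro summable_geometric) auto
    show "\<exists>N. \<forall>n\<ge>N. norm (r k ^ n * c n) \<le> r k ^ n" using r[of k] that by (auto simp: abs_mult mult_left_le)
  qed
  have mh: "(\<lambda>\<omega>. hits x n (incr 0 (1/2^k) n \<omega>)) \<in> borel_measurable M" for x n and k :: nat
    by (auto intro!: measurable_compose[OF measurable_incr measurable_hits])
  have mw: "(\<lambda>\<omega>. f j x (N.walk_dip (1/2^k) n \<omega>)) \<in> borel_measurable M" for j x n and k :: nat
    using N.walk_measurable(1)[of "1/2^k" n] by measurable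
  have inth: "integrable M (\<lambda>\<omega>. hits x n (incr 0 (1/2^k) n \<omega>))"
    and intw: "integrable M (\<lambda>\<omega>. f j x (N.walk_dip (1/2^k) n \<omega>))" for j x n and k :: nat
    using mh mw fabs by (auto intro!: integrable_const_bound[of _ 1] simp: hits_def)
  have e01: "0 \<le> hit_prob (1/2^k) x n" "hit_prob (1/2^k) x n \<le> 1"
    "0 \<le> expectation (\<lambda>\<omega>. f j x (N.walk_dip (1/2^k) n \<omega>))" "expectation (\<lambda>\<omega>. f j x (N.walk_dip (1/2^k) n \<omega>)) \<le> 1" for j x n and k :: nat
  proof -
    show "0 \<le> hit_prob (1/2^k) x n" unfolding hit_prob_def by (rule Bochner_Integration.integral_nonneg) (simp add: hits_def)
    have "\<bar>hit_prob (1/2^k) x n\<bar> \<le> 1" unfolding hit_prob_def by (rule abs_expectation_le[OF mh]) (simp add: hits_def)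
    then show "hit_prob (1/2^k) x n \<le> 1" by simp
    show "0 \<le> expectation (\<lambda>\<omega>. f j x (N.walk_dip (1/2^k) n \<omega>))" by (rule Bochner_Integration.integral_nonneg) (rule f01)
    have "\<bar>expectation (\<lambda>\<omega>. f j x (N.walk_dip (1/2^k) n \<omega>))\<bar> \<le> 1" by (rule abs_expectation_le[OF mw fabs])
    then show "expectation (\<lambda>\<omega>. f j x (N.walk_dip (1/2^k) n \<omega>)) \<le> 1" by simp
  qed
  have LQ: "L j x k \<le> Q k x" for j x k unfolding L_def Q_def using r[of k] flow
    by (intro mult_left_mono suminf_le summ e01) (auto simp: hit_prob_def hit_eq intro!: mult_left_mono integral_mono intw inth[unfolded hit_eq])
  have QL: "Q k x \<le> L j (x - 1 / real j) k" if "0 < j" for j x k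
    unfolding L_def Q_def using r[of k] fup[OF that]
    by (intro mult_left_mono suminf_le summ e01) (auto simp: hit_prob_def hit_eq intro!: mult_left_mono integral_mono intw inth[unfolded hit_eq])
  have L0: "0 \<le> L j x k" for j x k
    unfolding L_def using r[of k] by (intro mult_nonneg_nonneg suminf_nonneg summ e01) auto
  have Q0: "0 \<le> Q k x" for k x using LQ[of 1 x k] L0[of 1 x k] by simp
  have F0: "0 \<le> F j x" for j x unfolding F_def by (intro Bochner_Integration.integral_nonneg f01)
  have G01: "0 \<le> G x" "G x \<le> 1" for x unfolding G_def by auto
  have Gmono: "G y \<le> G x" if "x \<le> y" for x y unfolding G_def using that by (intro S.finite_measure_mono) auto
  \<comment> \<open>The supermultiplicative half: on the walk, exceeding \<open>x\<close> and then
    climbing above \<open>y\<close> exceeds \<open>x + y\<close>. Returning from \<open>Q\<close> to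
    a test function costs \<open>1 / j\<close>.\<close>
  have lower: "F j x * F j y \<le> F j (x + y - 1 / real j)" if j: "0 < j" for j x y
  proof (rule LIMSEQ_le)
    show "(\<lambda>k. L j x k * L j y k) \<longlonglongrightarrow> F j x * F j y" by (intro tendsto_mult L_lim)
    show "L j (x + y - 1 / real j) \<longlonglongrightarrow> F j (x + y - 1 / real j)" by (rule L_lim)
    have "L j x k * L j y k \<le> L j (x + y - 1 / real j) k" for k
    proof -
      have "L j x k * L j y k \<le> Q k x * Q k y" by (intro mult_mono LQ L0 Q0)
      also have "\<dots> \<le> Q k (x + y)" unfolding Q_def by (rule geometric_hit_prob(1)) (use r in auto)
      also have "\<dots> \<le> L j (x + y - 1 / real j) k" by (rule QL[OF j])
      finally show ?thesis .
    qed
    then show "\<exists>N. \<forall>k\<ge>N. L j x k * L j y k \<le> L j (x + y - 1 / real j) k" by blast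
  qed
  \<comment> \<open>The submultiplicative half: here the overshoot term appears and vanishes along
    the grids; each factor is shifted by \<open>1 / j\<close>.\<close>
  have upper: "F j (x + y + e) \<le> F j (x - 1 / real j) * F j (y - 1 / real j)"
    if j: "0 < j" and x: "0 \<le> x" and y: "0 \<le> y" and e: "0 < e" for j x y e
  proof (rule LIMSEQ_le)
    show "L j (x + y + e) \<longlonglongrightarrow> F j (x + y + e)" by (rule L_lim)
    have "Ov x e \<longlonglongrightarrow> 0" unfolding Ov_def[abs_def] r_def by (rule geometric_overshoot_limit[OF p x e])
    then have "(\<lambda>k. L j (x - 1 / real j) k * L j (y - 1 / real j) k + Ov x e k) \<longlonglongrightarrow> F j (x - 1 / real j) * F j (y - 1 / real j) + 0"
      by (intro tendsto_add tendsto_mult L_lim)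
    then show "(\<lambda>k. L j (x - 1 / real j) k * L j (y - 1 / real j) k + Ov x e k) \<longlonglongrightarrow> F j (x - 1 / real j) * F j (y - 1 / real j)" by simp
    have "L j (x + y + e) k \<le> L j (x - 1 / real j) k * L j (y - 1 / real j) k + Ov x e k" for k
    proof -
      have "L j (x + y + e) k \<le> Q k (x + y + e)" by (rule LQ)
      also have "\<dots> \<le> Q k x * Q k y + Ov x e k"
        unfolding Q_def Ov_def by (rule geometric_hit_prob(2)) (use r y e in auto)
      also have "\<dots> \<le> L j (x - 1 / real j) k * L j (y - 1 / real j) k + Ov x e k"
        by (intro add_right_mono mult_mono QL j Q0 L0)
      finally show ?thesis .
    qed
    then show "\<exists>N. \<forall>k\<ge>N. L j (x + y + e) k \<le> L j (x - 1 / real j) k * L j (y - 1 / real j) k + Ov x e k" by blast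
  qed
  have right: "(\<lambda>n. G (x + d n)) \<longlonglongrightarrow> G x" if "d \<longlonglongrightarrow> 0" "\<And>n. 0 < d n" for x d
  proof -
    have G_cdf: "G y = 1 - cdf ?S y" for y
    proof -
      have "{y<..} = space ?S - {..y}" by auto
      then show ?thesis unfolding G_def cdf_def using S.prob_compl[of "{..y}"] by simp
    qed
    interpret R: real_distribution ?S by unfold_locales auto
    have "(\<lambda>n. cdf ?S (x + d n)) \<longlonglongrightarrow> cdf ?S x"
    proof (rule right_cont_seq[where w="cdf ?S"])
      show "continuous (at_right x) (cdf ?S)" by (rule R.cdf_is_right_cont)
      show "(\<lambda>n. x + d n) \<longlonglongrightarrow> x" using tendsto_add[OF tendsto_const[of x] that(1)] by simp
    qed (use that in \<open>auto intro: less_imp_le\<close>)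
    then show ?thesis unfolding G_cdf by (intro tendsto_intros)
  qed
  define d where "d n = 1 / real (Suc n)" for n
  have d: "0 < d n" "(\<lambda>n. a * d n) \<longlonglongrightarrow> 0" for n a
  proof -
    show "0 < d n" by (simp add: d_def)
    have "d \<longlonglongrightarrow> 0" using LIMSEQ_inverse_real_of_nat by (simp add: d_def[abs_def] inverse_eq_divide)
    then show "(\<lambda>n. a * d n) \<longlonglongrightarrow> 0" using tendsto_mult[OF tendsto_const[of a]] by fastforce
  qed
  have mult: "G (x + y) = G x * G y" if x: "0 \<le> x" and y: "0 \<le> y" for x y
  proof (rule antisym)
    \<comment> \<open>Of the five shifts one is lost in passing from \<open>G\<close> to
      \<open>F\<close>, two compensate the shifts of the factors in \<open>upper\<close>, and two
      serve as the overshoot allowance.\<close>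
    have "G (x + y + 5 * d n) \<le> G x * G y" for n
    proof -
      have "G (x + y + 5 * d n) \<le> F (Suc n) (x + y + 5 * d n - 1 / real (Suc n))" by (rule GF) simp
      also have "\<dots> = F (Suc n) ((x + d n) + (y + d n) + 2 * d n)" by (simp add: d_def algebra_simps)
      also have "\<dots> \<le> F (Suc n) (x + d n - 1 / real (Suc n)) * F (Suc n) (y + d n - 1 / real (Suc n))"
        using x y d(1)[of n] by (intro upper) auto
      also have "\<dots> = F (Suc n) x * F (Suc n) y" by (simp add: d_def)
      also have "\<dots> \<le> G x * G y" by (intro mult_mono FG F0 G01)
      finally show ?thesis .
    qed
    moreover have "(\<lambda>n. G (x + y + 5 * d n)) \<longlonglongrightarrow> G (x + y)" using d by (intro right) auto
    ultimately show "G (x + y) \<le> G x * G y" by (intro LIMSEQ_le_const2) auto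
    \<comment> \<open>Of the four shifts, two are lost in passing from \<open>G\<close> to
      \<open>F\<close> and one in \<open>lower\<close>; the last is discarded by
      monotonicity.\<close>
    have "G (x + 2 * d n) * G (y + 2 * d n) \<le> G (x + y)" for n
    proof -
      have "G (x + 2 * d n) * G (y + 2 * d n) \<le> F (Suc n) (x + 2 * d n - 1 / real (Suc n)) * F (Suc n) (y + 2 * d n - 1 / real (Suc n))"
        by (intro mult_mono GF G01 F0) auto
      also have "\<dots> \<le> F (Suc n) ((x + 2 * d n - 1 / real (Suc n)) + (y + 2 * d n - 1 / real (Suc n)) - 1 / real (Suc n))"
        by (rule lower) simp
      also have "\<dots> \<le> G ((x + 2 * d n - 1 / real (Suc n)) + (y + 2 * d n - 1 / real (Suc n)) - 1 / real (Suc n))" by (rule FG)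
      also have "\<dots> \<le> G (x + y)" by (rule Gmono) (simp add: d_def)
      finally show ?thesis .
    qed
    moreover have "(\<lambda>n. G (x + 2 * d n) * G (y + 2 * d n)) \<longlonglongrightarrow> G x * G y"
      using d by (intro tendsto_mult right) auto
    ultimately show "G x * G y \<le> G (x + y)" by (intro LIMSEQ_le_const2) auto
  qed
  have top: "(\<lambda>n. G (real n)) \<longlonglongrightarrow> 0"
  proof -
    have "(\<lambda>n. S.prob {real n<..}) \<longlonglongrightarrow> S.prob (\<Inter>n. {real n<..})"
      by (rule S.finite_Lim_measure_decseq) (auto simp: decseq_def)
    moreover have "(\<Inter>n::nat. {real n<..}) = {}"
    proof -
      have "\<exists>n::nat. \<not> real n < x" for x :: real
        using reals_Archimedean2[of x] by (auto simp: not_less intro: less_imp_le)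
      then show ?thesis by blast
    qed
    ultimately show ?thesis by (simp add: G_def)
  qed
  have pos: "G 0 \<noteq> 0" unfolding G_def by (rule sup_law_not_zero[OF p])
  obtain c where c: "0 < c" and Gc: "\<And>x. 0 \<le> x \<Longrightarrow> G x = exp (- c * x)"
    using multiplicative_survival_exponential[of G, OF mult Gmono G01 right top pos] by blast
  show thesis
  proof (rule that[OF c])
    interpret Ec: prob_space "exp_law c" by (rule prob_space_exponential_density[OF c])
    show "?S = distr (exp_law c) borel (\<lambda>x. x)"
    proof (rule cdf_unique)
      show "real_distribution ?S" by unfold_locales auto
      show "real_distribution (distr (exp_law c) borel (\<lambda>x. x))" by (intro Ec.real_distribution_distr) simp
      show "cdf ?S = cdf (distr (exp_law c) borel (\<lambda>x. x))"
      proof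
        fix x
        have R: "cdf (distr (exp_law c) borel (\<lambda>x. x)) x = measure (exp_law c) {..x}"
          unfolding cdf_def by (subst measure_distr) auto
        show "cdf ?S x = cdf (distr (exp_law c) borel (\<lambda>x. x)) x"
        proof (cases "0 \<le> x")
          case True
          have "{..x} = space ?S - {x<..}" by auto
          then have "cdf ?S x = 1 - G x" unfolding G_def cdf_def using S.prob_compl[of "{x<..}"] by simp
          then show ?thesis unfolding R using Gc[OF True] measure_exp_law_greaterThan[OF c True] by simp
        next
          case False
          have "(\<lambda>z. dip (neg X) 0 (max 0 (fst z)) (snd z)) -` {..x} \<inter> space (exp_law p \<Otimes>\<^sub>M M) = {}"
            using False N.dip_nonneg[of _ 0] by (auto simp: space_pair_measure not_le) (meson less_le_trans max.cobounded1 not_le order_refl)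
          then have "cdf ?S x = 0"
            unfolding cdf_def dip_law_def by (subst measure_distr[OF measurable_exp_pair[OF N.measurable_dip_joint]]) auto
          then show ?thesis unfolding R using measure_exp_law_negative[OF c] False by simp
        qed
      qed
    qed
  qed
qed

end

section \<open>Laplace transforms\<close>

text \<open>Value and integrability are recorded together, so that linear combinations of transforms
  need no side conditions. No bound on \<open>f\<close> is assumed, only the transform at the one
  argument \<open>s\<close>.\<close>

definition has_Laplace :: "(real \<Rightarrow> real) \<Rightarrow> real \<Rightarrow> real \<Rightarrow> bool" where
  "has_Laplace f s v \<longleftrightarrow> has_bochner_integral lborel (\<lambda>x. indicator {0..} x * (exp (- s * x) * f x)) v"

lemma has_Laplace_add: "has_Laplace f s v \<Longrightarrow> has_Laplace g s u \<Longrightarrow> has_Laplace (\<lambda>x. f x + g x) s (v + u)"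
  unfolding has_Laplace_def by (drule (1) has_bochner_integral_add) (simp add: algebra_simps)

lemma has_Laplace_diff: "has_Laplace f s v \<Longrightarrow> has_Laplace g s u \<Longrightarrow> has_Laplace (\<lambda>x. f x - g x) s (v - u)"
  unfolding has_Laplace_def by (drule (1) has_bochner_integral_diff) (simp add: algebra_simps)

lemma has_Laplace_cmult: "has_Laplace f s v \<Longrightarrow> has_Laplace (\<lambda>x. a * f x) s (a * v)"
proof -
  assume "has_Laplace f s v"
  then have "has_bochner_integral lborel (\<lambda>x. a * (indicator {0..} x * (exp (- s * x) * f x))) (a * v)"
    unfolding has_Laplace_def by (rule has_bochner_integral_mult_right)
  then show ?thesis unfolding has_Laplace_def by (simp add: mult.left_commute)
qed

lemma has_Laplace_unique: "has_Laplace f s v \<Longrightarrow> has_Laplace f s u \<Longrightarrow> v = u"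
  unfolding has_Laplace_def by (rule has_bochner_integral_eq)

lemma has_Laplace_nonneg_iff:
  assumes "f \<in> borel_measurable borel" "\<And>x. 0 \<le> x \<Longrightarrow> 0 \<le> f x" "0 \<le> v"
  shows "has_Laplace f s v \<longleftrightarrow> (\<integral>\<^sup>+x. ennreal (indicator {0..} x * (exp (- s * x) * f x)) \<partial>lborel) = ennreal v"
proof
  assume "has_Laplace f s v"
  then have "integrable lborel (\<lambda>x. indicator {0..} x * (exp (- s * x) * f x))"
     "integral\<^sup>L lborel (\<lambda>x. indicator {0..} x * (exp (- s * x) * f x)) = v"
    unfolding has_Laplace_def by (auto simp: has_bochner_integral_iff)
  then show "(\<integral>\<^sup>+x. ennreal (indicator {0..} x * (exp (- s * x) * f x)) \<partial>lborel) = ennreal v"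
    using assms by (subst nn_integral_eq_integral) (auto simp: indicator_def)
next
  assume "(\<integral>\<^sup>+x. ennreal (indicator {0..} x * (exp (- s * x) * f x)) \<partial>lborel) = ennreal v"
  then show "has_Laplace f s v" unfolding has_Laplace_def using assms
    by (intro has_bochner_integral_nn_integral) (auto simp: indicator_def)
qed

lemma has_Laplace_exp:
  assumes "\<theta> < s" shows "has_Laplace (\<lambda>x. exp (\<theta> * x)) s (1 / (s - \<theta>))"
proof -
  have p: "0 < s - \<theta>" using assms by simp
  interpret E: prob_space "exp_law (s - \<theta>)" by (rule prob_space_exponential_density[OF p])
  have "(\<integral>\<^sup>+x. ennreal (exponential_density (s - \<theta>) x) \<partial>lborel) = 1"
    using E.emeasure_space_1 by (simp add: emeasure_density)
  moreover have "ennreal (exponential_density (s - \<theta>) x)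
      = ennreal (s - \<theta>) * ennreal (indicator {0..} x * (exp (- s * x) * exp (\<theta> * x)))" for x
    using p by (auto simp: exponential_density_def indicator_def ennreal_mult[symmetric] exp_add[symmetric] algebra_simps)
  ultimately have "ennreal (s - \<theta>) * (\<integral>\<^sup>+x. ennreal (indicator {0..} x * (exp (- s * x) * exp (\<theta> * x))) \<partial>lborel) = 1"
    by (simp add: nn_integral_cmult)
  then have "ennreal (1 / (s - \<theta>)) * (ennreal (s - \<theta>) * (\<integral>\<^sup>+x. ennreal (indicator {0..} x * (exp (- s * x) * exp (\<theta> * x))) \<partial>lborel)) = ennreal (1 / (s - \<theta>))"
    by simp
  then have "(\<integral>\<^sup>+x. ennreal (indicator {0..} x * (exp (- s * x) * exp (\<theta> * x))) \<partial>lborel) = ennreal (1 / (s - \<theta>))"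
    using p by (simp add: mult.assoc[symmetric] ennreal_mult[symmetric])
  then show ?thesis using p by (subst has_Laplace_nonneg_iff) auto
qed

text \<open>The closed interval matters: the law of the depth may have an atom at \<open>0\<close>,
  and it has to be counted.\<close>

definition conv :: "(real \<Rightarrow> real) \<Rightarrow> real measure \<Rightarrow> real \<Rightarrow> real" where
  "conv f \<nu> x = (\<integral>r. indicator {0..x} r * f (x - r) \<partial>\<nu>)"

lemma measurable_conv:
  assumes "sigma_finite_measure \<nu>" and [measurable_cong]: "sets \<nu> = sets borel" and [measurable]: "f \<in> borel_measurable borel"
  shows "conv f \<nu> \<in> borel_measurable borel"
proof -
  interpret sigma_finite_measure \<nu> by fact
  show ?thesis unfolding conv_def[abs_def] indicator_def atLeastAtMost_iff by measurable
qed

lemma has_Laplace_conv: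
  assumes \<nu>: "sigma_finite_measure \<nu>" and sets_\<nu> [measurable_cong]: "sets \<nu> = sets borel"
    and f [measurable]: "f \<in> borel_measurable borel" and f0: "\<And>x. 0 \<le> x \<Longrightarrow> 0 \<le> f x"
    and int: "\<And>x. 0 \<le> x \<Longrightarrow> integrable \<nu> (\<lambda>r. indicator {0..x} r * f (x - r))"
    and Lf: "has_Laplace f s v" and v: "0 \<le> v"
    and L\<nu>: "(\<integral>\<^sup>+r. ennreal (indicator {0..} r * exp (- s * r)) \<partial>\<nu>) = ennreal k" and k: "0 \<le> k"
  shows "has_Laplace (conv f \<nu>) s (v * k)"
proof -
  interpret N: sigma_finite_measure \<nu> by fact
  interpret P: pair_sigma_finite lborel \<nu> ..
  have cm: "conv f \<nu> \<in> borel_measurable borel" by (rule measurable_conv[OF \<nu> sets_\<nu> f])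
  have c0: "0 \<le> conv f \<nu> x" for x
    unfolding conv_def using f0 by (intro Bochner_Integration.integral_nonneg) (auto simp: indicator_def)
  define H where "H x r = (if 0 \<le> r \<and> r \<le> x then exp (- s * x) * f (x - r) else 0)" for x r :: real
  have Hm [measurable]: "(\<lambda>z. H (fst z) (snd z)) \<in> borel_measurable (lborel \<Otimes>\<^sub>M \<nu>)" unfolding H_def by measurable
  have "(\<integral>\<^sup>+x. ennreal (indicator {0..} x * (exp (- s * x) * conv f \<nu> x)) \<partial>lborel)
      = (\<integral>\<^sup>+x. \<integral>\<^sup>+r. ennreal (H x r) \<partial>\<nu> \<partial>lborel)"
  proof (rule nn_integral_cong)
    fix x :: real
    show "ennreal (indicator {0..} x * (exp (- s * x) * conv f \<nu> x)) = (\<integral>\<^sup>+r. ennreal (H x r) \<partial>\<nu>)"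
    proof (cases "0 \<le> x")
      case True
      have "ennreal (exp (- s * x) * conv f \<nu> x) = (\<integral>\<^sup>+r. ennreal (exp (- s * x) * (indicator {0..x} r * f (x - r))) \<partial>\<nu>)"
        unfolding conv_def using int[OF True] f0 by (subst nn_integral_eq_integral) (auto simp: indicator_def)
      also have "\<dots> = (\<integral>\<^sup>+r. ennreal (H x r) \<partial>\<nu>)" by (intro nn_integral_cong) (auto simp: H_def indicator_def)
      finally show ?thesis using True by simp
    next
      case False
      then have "H x r = 0" for r by (simp add: H_def)
      then show ?thesis using False by simp
    qed
  qed
  also have "\<dots> = (\<integral>\<^sup>+r. \<integral>\<^sup>+x. ennreal (H x r) \<partial>lborel \<partial>\<nu>)"
    using P.Fubini[of "\<lambda>z. ennreal (H (fst z) (snd z))"] by simp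
  also have "\<dots> = (\<integral>\<^sup>+r. ennreal v * ennreal (indicator {0..} r * exp (- s * r)) \<partial>\<nu>)"
  proof (rule nn_integral_cong)
    fix r :: real
    have "(\<lambda>x. ennreal (H x r)) \<in> borel_measurable borel" unfolding H_def by measurable
    then have "(\<integral>\<^sup>+x. ennreal (H x r) \<partial>lborel) = (\<integral>\<^sup>+y. ennreal (H (r + 1 * y) r) \<partial>lborel)"
      by (subst nn_integral_real_affine[where t=r and c=1]) auto
    also have "\<dots> = (\<integral>\<^sup>+y. ennreal (indicator {0..} r * exp (- s * r)) * ennreal (indicator {0..} y * (exp (- s * y) * f y)) \<partial>lborel)"
      using f0 by (intro nn_integral_cong)
        (auto simp: H_def indicator_def ennreal_mult[symmetric] exp_add[symmetric] algebra_simps)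
    also have "\<dots> = ennreal (indicator {0..} r * exp (- s * r)) * ennreal v"
      using Lf has_Laplace_nonneg_iff[of f v s] f f0 v by (subst nn_integral_cmult) auto
    finally show "(\<integral>\<^sup>+x. ennreal (H x r) \<partial>lborel) = ennreal v * ennreal (indicator {0..} r * exp (- s * r))"
      by (simp add: mult.commute)
  qed
  also have "\<dots> = ennreal v * ennreal k" using L\<nu> by (subst nn_integral_cmult) auto
  also have "\<dots> = ennreal (v * k)" using v k by (simp add: ennreal_mult)
  finally show ?thesis using c0 v k cm by (subst has_Laplace_nonneg_iff) auto
qed

text \<open>Under the substitution \<open>u = exp (- t)\<close> the transforms at the natural
  numbers are moments on the unit interval. By the Stone-Weierstrass theorem vanishing moments
  annihilate every continuous function of \<open>u\<close>.\<close>

lemma Laplace_zero_continuous: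
  fixes g \<phi> :: "real \<Rightarrow> real"
  assumes g: "integrable lborel (\<lambda>t. indicator {0..} t * g t)"
    and zero: "\<And>n::nat. (\<integral>t. indicator {0..} t * g t * exp (- real n * t) \<partial>lborel) = 0"
    and \<phi>: "continuous_on {0..1} \<phi>"
  shows "(\<integral>t. indicator {0..} t * g t * \<phi> (exp (- t)) \<partial>lborel) = 0"
proof (rule ccontr)
  let ?G = "\<lambda>t. indicator {0..} t * g t"
  define I where "I = (\<integral>t. \<bar>?G t\<bar> \<partial>lborel)"
  have I0: "0 \<le> I" unfolding I_def by simp
  assume ne: "(\<integral>t. ?G t * \<phi> (exp (- t)) \<partial>lborel) \<noteq> 0"
  \<comment> \<open>Chosen so that the approximation error \<open>e * I\<close> stays strictly below
    the supposedly non-zero integral, which is \<open>e * (I + 1)\<close> in absolute value.\<close>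
  define e where "e = \<bar>\<integral>t. ?G t * \<phi> (exp (- t)) \<partial>lborel\<bar> / (I + 1)"
  have e: "0 < e" using ne I0 by (simp add: e_def)
  obtain P where P: "real_polynomial_function P" "\<And>x. x \<in> {0..1} \<Longrightarrow> \<bar>\<phi> x - P x\<bar> < e"
    using Stone_Weierstrass_real_polynomial_function[of "{0..1}" \<phi> e] \<phi> e by auto
  obtain a m where Pa: "P = (\<lambda>x. \<Sum>i\<le>m. a i * x ^ i)"
    using P(1) unfolding real_polynomial_function_iff_sum by blast
  have Gm: "?G \<in> borel_measurable borel" using borel_measurable_integrable[OF g] by simp
  have intn: "integrable lborel (\<lambda>t. ?G t * exp (- real n * t))" for n :: nat
    by (rule Bochner_Integration.integrable_bound[OF g]) (use Gm in \<open>auto simp: abs_mult indicator_def mult_left_le\<close>)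
  have Pexp: "?G t * P (exp (- t)) = (\<Sum>i\<le>m. a i * (?G t * exp (- real i * t)))" for t
    unfolding Pa by (simp add: sum_distrib_left exp_of_nat_mult[symmetric] mult_ac)
  have intP: "integrable lborel (\<lambda>t. ?G t * P (exp (- t)))" unfolding Pexp using intn by auto
  have P0: "(\<integral>t. ?G t * P (exp (- t)) \<partial>lborel) = 0"
    unfolding Pexp using intn zero by (simp add: Bochner_Integration.integral_sum)
  have dm: "(\<lambda>t. ?G t * (\<phi> (exp (- t)) - P (exp (- t)))) \<in> borel_measurable borel"
  proof -
    have "(\<lambda>t. \<phi> (exp (- (max 0 t)))) \<in> borel_measurable borel"
      by (intro borel_measurable_continuous_onI continuous_on_compose2[OF \<phi>]) (auto intro!: continuous_intros)
    moreover have "(\<lambda>t. P (exp (- t))) \<in> borel_measurable borel" unfolding Pa by measurable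
    ultimately have "(\<lambda>t. ?G t * (\<phi> (exp (- (max 0 t))) - P (exp (- t)))) \<in> borel_measurable borel"
      by (intro borel_measurable_times[OF Gm] borel_measurable_diff)
    then show ?thesis by (rule measurable_cong[THEN iffD1, rotated]) (auto simp: indicator_def)
  qed
  have db: "\<bar>?G t * (\<phi> (exp (- t)) - P (exp (- t)))\<bar> \<le> e * \<bar>?G t\<bar>" for t
  proof (cases "0 \<le> t")
    case True
    then have "\<bar>\<phi> (exp (- t)) - P (exp (- t))\<bar> \<le> e" by (intro less_imp_le P(2)) auto
    then have "\<bar>g t\<bar> * \<bar>\<phi> (exp (- t)) - P (exp (- t))\<bar> \<le> \<bar>g t\<bar> * e" by (intro mult_left_mono) auto
    then show ?thesis using True by (simp add: abs_mult mult.commute)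
  qed simp
  have intd: "integrable lborel (\<lambda>t. ?G t * (\<phi> (exp (- t)) - P (exp (- t))))"
    by (rule Bochner_Integration.integrable_bound[OF integrable_mult_right[OF integrable_abs[OF g], of e]])
      (use dm db e in \<open>auto simp: abs_mult\<close>)
  have "(\<integral>t. ?G t * \<phi> (exp (- t)) \<partial>lborel) = (\<integral>t. ?G t * (\<phi> (exp (- t)) - P (exp (- t))) + ?G t * P (exp (- t)) \<partial>lborel)"
    by (intro Bochner_Integration.integral_cong) (auto simp: algebra_simps)
  also have "\<dots> = (\<integral>t. ?G t * (\<phi> (exp (- t)) - P (exp (- t))) \<partial>lborel)"
    by (subst Bochner_Integration.integral_add[OF intd intP]) (simp add: P0)
  finally have "\<bar>\<integral>t. ?G t * \<phi> (exp (- t)) \<partial>lborel\<bar> \<le> (\<integral>t. \<bar>?G t * (\<phi> (exp (- t)) - P (exp (- t)))\<bar> \<partial>lborel)"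
    by (simp add: integral_abs_bound)
  also have "\<dots> \<le> (\<integral>t. e * \<bar>?G t\<bar> \<partial>lborel)"
    by (intro integral_mono integrable_abs intd integrable_mult_right g db)
  also have "\<dots> = e * I" unfolding I_def by simp
  also have "\<dots> < e * (I + 1)" using e by simp
  also have "\<dots> = \<bar>\<integral>t. ?G t * \<phi> (exp (- t)) \<partial>lborel\<bar>" using I0 by (simp add: e_def)
  finally show False by simp
qed

lemma Laplace_zero_moments:
  assumes zero: "\<And>n::nat. has_Laplace f (P + real n) 0"
  shows "integrable lborel (\<lambda>t. indicator {0..} t * (exp (- P * t) * f t))"
    and "(\<integral>t. indicator {0..} t * (exp (- P * t) * f t) * exp (- real n * t) \<partial>lborel) = 0"
proof -
  show "integrable lborel (\<lambda>t. indicator {0..} t * (exp (- P * t) * f t))"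
    using zero[of 0] by (simp add: has_Laplace_def has_bochner_integral_iff)
  have "indicator {0..} t * (exp (- P * t) * f t) * exp (- real n * t) = indicator {0..} t * (exp (- (P + real n) * t) * f t)" for t
    by (simp add: exp_add[symmetric] algebra_simps)
  then show "(\<integral>t. indicator {0..} t * (exp (- P * t) * f t) * exp (- real n * t) \<partial>lborel) = 0"
    using zero[of n] by (simp only: has_Laplace_def has_bochner_integral_iff)
qed

text \<open>The transform at a smaller argument integrates the same function against a larger
  weight, which is a monotone limit of continuous functions of \<open>exp (- t)\<close>. Each
  approximation gives zero, and the existence of the transform at \<open>s\<close> supplies the
  dominating function.\<close>

lemma Laplace_zero_extend:
  assumes zero: "\<And>n::nat. has_Laplace f (P + real n) 0" and s: "s \<le> P" and v: "has_Laplace f s v"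
  shows "v = 0"
proof -
  define g where "g t = exp (- P * t) * f t" for t
  let ?G = "\<lambda>t. indicator {0..} t * g t" and ?F = "\<lambda>t. indicator {0..} t * (exp (- s * t) * f t)"
  note gz = Laplace_zero_moments[OF zero, folded g_def]
  \<comment> \<open>In terms of \<open>u = exp (- t)\<close> the missing weight
    \<open>exp ((P - s) * t)\<close> is \<open>inverse u powr (P - s)\<close>, in general unbounded
    near \<open>0\<close>. Cutting \<open>u\<close> off at \<open>1 / Suc n\<close> makes it
    continuous on the unit interval.\<close>
  define \<phi> where "\<phi> n u = inverse (max u (1 / real (Suc n))) powr (P - s)" for n :: nat and u :: real
  let ?A = "\<lambda>n t. ?G t * \<phi> n (exp (- t))"
  have maxpos: "0 < max u (1 / real (Suc n))" for u n by (simp add: less_max_iff_disj)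
  have cont: "continuous_on {0..1} (\<phi> n)" for n
    unfolding \<phi>_def using maxpos by (intro continuous_intros) (auto simp: less_imp_neq[symmetric] max_def split: if_splits)
  have "(\<lambda>n. \<integral>t. ?A n t \<partial>lborel) \<longlonglongrightarrow> (\<integral>t. ?F t \<partial>lborel)"
  proof (rule integral_dominated_convergence[where w="\<lambda>t. \<bar>?F t\<bar>"])
    show "integrable lborel (\<lambda>t. \<bar>?F t\<bar>)"
      using v by (intro integrable_abs) (simp add: has_Laplace_def has_bochner_integral_iff)
    then show "(\<lambda>t. ?F t) \<in> borel_measurable lborel"
      using v by (auto simp: has_Laplace_def has_bochner_integral_iff)
    show "(\<lambda>t. ?A n t) \<in> borel_measurable lborel" for n
    proof (rule borel_measurable_times)
      show "(\<lambda>t. ?G t) \<in> borel_measurable lborel" using gz(1) by auto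
      show "(\<lambda>t. \<phi> n (exp (- t))) \<in> borel_measurable lborel" unfolding \<phi>_def by measurable
    qed
    have phi_exp: "inverse (exp (- t)) powr (P - s) = exp ((P - s) * t)" for t
      by (simp add: exp_minus[symmetric] powr_def)
    have geq: "g t * exp ((P - s) * t) = exp (- s * t) * f t" for t
      by (simp add: g_def exp_add[symmetric] algebra_simps)
    show "AE t in lborel. (\<lambda>n. ?A n t) \<longlonglongrightarrow> ?F t"
    proof (rule AE_I2)
      fix t :: real
      obtain N where N: "1 / real (Suc N) < exp (- t)" using nat_approx_posE[of "exp (- t)"] by auto
      have "\<phi> n (exp (- t)) = exp ((P - s) * t)" if "n \<ge> N" for n
      proof -
        have "1 / real (Suc n) \<le> 1 / real (Suc N)" using that by (intro divide_left_mono) auto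
        then have "max (exp (- t)) (1 / real (Suc n)) = exp (- t)" using N by simp
        then show ?thesis unfolding \<phi>_def by (simp only: phi_exp)
      qed
      then have "\<forall>\<^sub>F n in sequentially. ?A n t = ?F t"
        unfolding eventually_sequentially by (intro exI[of _ N] allI impI) (simp only: mult.assoc geq)
      then show "(\<lambda>n. ?A n t) \<longlonglongrightarrow> ?F t" by (rule tendsto_eventually)
    qed
    show "AE t in lborel. norm (?A n t) \<le> \<bar>?F t\<bar>" for n
    proof (rule AE_I2)
      fix t :: real
      have "\<phi> n (exp (- t)) \<le> inverse (exp (- t)) powr (P - s)"
        unfolding \<phi>_def using s maxpos[of "exp (- t)" n] by (intro powr_mono2 le_imp_inverse_le) auto
      then have le: "\<phi> n (exp (- t)) \<le> exp ((P - s) * t)" by (simp only: phi_exp)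
      have nn: "0 \<le> \<phi> n (exp (- t))" by (simp add: \<phi>_def)
      have "\<bar>g t * \<phi> n (exp (- t))\<bar> \<le> \<bar>g t * exp ((P - s) * t)\<bar>"
        unfolding abs_mult using le nn by (intro mult_left_mono) auto
      then show "norm (?A n t) \<le> \<bar>?F t\<bar>" unfolding geq by (simp add: indicator_def)
    qed
  qed
  then have "(\<integral>t. ?F t \<partial>lborel) = 0"
    unfolding Laplace_zero_continuous[OF gz cont] by (simp add: LIMSEQ_const_iff)
  then show ?thesis using v by (simp add: has_Laplace_def has_bochner_integral_iff)
qed

text \<open>Vanishing transforms make the weighted integral over every half-line zero, hence also
  over every interval from \<open>x\<close> to \<open>b\<close>. If \<open>f x\<close> were
  positive, right-continuity would make such an integral positive; the negative case is
  symmetric.\<close>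

lemma Laplace_zero_unique:
  assumes zero: "\<And>n::nat. has_Laplace f (P + real n) 0"
    and right: "\<And>x. 0 \<le> x \<Longrightarrow> continuous (at_right x) f" and x: "0 \<le> x"
  shows "f x = 0"
proof -
  have nonpos: "f x \<le> 0"
    if zero: "\<And>n::nat. has_Laplace f (P + real n) 0" and right: "continuous (at_right x) f" for f :: "real \<Rightarrow> real"
  proof (rule ccontr)
    assume "\<not> f x \<le> 0"
    then have fx: "0 < f x" by simp
    define g where "g t = exp (- P * t) * f t" for t
    note gz = Laplace_zero_moments[OF zero, folded g_def]
    \<comment> \<open>The ramps are placed at \<open>exp (- a)\<close> because
      \<open>exp (- t) \<le> exp (- a)\<close> means \<open>a \<le> t\<close>.\<close>
    let ?T = "\<lambda>a t. indicator {a..} t * g t" and ?S = "\<lambda>a j t. indicator {0..} t * g t * step_approx (exp (- a)) j (exp (- t))"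
    have tail: "integrable lborel (\<lambda>t. ?T a t)" "(\<integral>t. ?T a t \<partial>lborel) = 0" if a: "0 \<le> a" for a
    proof -
      have eq: "?T a t = indicator {a..} t * (?T 0 t)" for t using a by (simp add: indicator_def)
      show "integrable lborel (\<lambda>t. ?T a t)"
        unfolding eq using integrable_mult_indicator[OF _ gz(1), of "{a..}"] by simp
      have "(\<lambda>j. \<integral>t. ?S a j t \<partial>lborel) \<longlonglongrightarrow> (\<integral>t. ?T a t \<partial>lborel)"
      proof (rule integral_dominated_convergence[where w="\<lambda>t. \<bar>?T 0 t\<bar>"])
        have [measurable]: "step_approx c j \<in> borel_measurable borel" for c j
          by (intro borel_measurable_continuous_onI step_approx_cont)
        have [measurable]: "(\<lambda>t. ?T 0 t) \<in> borel_measurable borel" using borel_measurable_integrable[OF gz(1)] by simp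
        show "(\<lambda>t. ?S a j t) \<in> borel_measurable lborel" for j by measurable
        show "(\<lambda>t. ?T a t) \<in> borel_measurable lborel" unfolding eq by measurable
        show "integrable lborel (\<lambda>t. \<bar>?T 0 t\<bar>)" by (intro integrable_abs gz(1))
        show "AE t in lborel. norm (?S a j t) \<le> \<bar>?T 0 t\<bar>" for j
          using step_approx_le1 by (auto simp: abs_mult intro!: mult_left_le AE_I2)
        show "AE t in lborel. (\<lambda>j. ?S a j t) \<longlonglongrightarrow> ?T a t"
        proof (rule AE_I2)
          fix t :: real
          have "(\<lambda>j. ?S a j t) \<longlonglongrightarrow> ?T 0 t * (if exp (- t) \<le> exp (- a) then 1 else 0)"
            by (intro tendsto_mult tendsto_const step_approx_lim)
          then show "(\<lambda>j. ?S a j t) \<longlonglongrightarrow> ?T a t" using a by (auto simp: indicator_def split: if_splits)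
        qed
      qed
      moreover have "(\<integral>t. ?S a j t \<partial>lborel) = 0" for j
        by (rule Laplace_zero_continuous[OF gz continuous_on_subset[OF step_approx_cont]]) simp
      ultimately show "(\<integral>t. ?T a t \<partial>lborel) = 0" by (simp add: LIMSEQ_const_iff)
    qed
    have "(f \<longlongrightarrow> f x) (at_right x)" using right by (simp add: continuous_within)
    then have "\<forall>\<^sub>F t in at_right x. f x / 2 < f t" using fx by (intro order_tendstoD) auto
    then obtain b where b: "x < b" "\<And>t. x < t \<Longrightarrow> t < b \<Longrightarrow> f x / 2 < f t" by (auto simp: eventually_at_right_field)
    \<comment> \<open>A lower bound of the weighted function between \<open>x\<close> and
      \<open>b\<close>. The minimum over both end points is taken because the sign of
      \<open>P\<close> is unknown.\<close>
    define m where "m = min (exp (- P * x)) (exp (- P * b)) * (f x / 2)"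
    have m: "0 < m" using fx by (simp add: m_def)
    have gm: "m \<le> g t" if "x < t" "t < b" for t
    proof -
      have "min (exp (- P * x)) (exp (- P * b)) \<le> exp (- P * t)"
      proof (cases "0 \<le> P")
        case True
        then have "P * t \<le> P * b" using that by (intro mult_left_mono) auto
        then show ?thesis by (simp add: min_le_iff_disj)
      next
        case False
        then have "P * t \<le> P * x" using that by (intro mult_left_mono_neg) auto
        then show ?thesis by (simp add: min_le_iff_disj)
      qed
      then show ?thesis unfolding m_def g_def using b(2)[OF that] fx by (intro mult_mono) auto
    qed
    have gx: "m \<le> g x" unfolding m_def g_def using fx by (intro mult_mono) auto
    have "(\<integral>t. ?T x t - ?T b t \<partial>lborel) = 0"
      using tail[of x] tail[of b] x b(1) by (subst Bochner_Integration.integral_diff) auto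
    moreover have "(\<integral>t. indicator {x..<b} t * m \<partial>lborel) \<le> (\<integral>t. ?T x t - ?T b t \<partial>lborel)"
    proof (rule integral_mono)
      show "integrable lborel (\<lambda>t. indicator {x..<b} t * m)"
        using b(1) by (intro integrable_mult_left integrable_real_indicator) auto
      show "integrable lborel (\<lambda>t. ?T x t - ?T b t)"
        using tail[of x] tail[of b] x b(1) by (intro Bochner_Integration.integrable_diff) auto
      show "indicator {x..<b} t * m \<le> ?T x t - ?T b t" for t
        using gm[of t] gx b(1) by (cases "t = x") (auto simp: indicator_def)
    qed
    moreover have "(\<integral>t. indicator {x..<b} t * m \<partial>lborel) = (b - x) * m" using b(1) by simp
    moreover have "0 < (b - x) * m" using b(1) m by simp
    ultimately show False by linarith
  qed
  have "f x \<le> 0" by (rule nonpos[OF zero right[OF x]])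
  moreover have "- f x \<le> 0"
  proof (rule nonpos[where f="\<lambda>t. - f t"])
    show "has_Laplace (\<lambda>t. - f t) (P + real n) 0" for n :: nat
      using has_Laplace_cmult[OF zero[of n], of "-1"] by simp
    show "continuous (at_right x) (\<lambda>t. - f t)" using right[OF x] by (rule continuous_minus)
  qed
  ultimately show ?thesis by simp
qed

section \<open>Laplace exponent and infimum\<close>

lemma nn_integral_exp_law:
  assumes p: "0 < p" and f: "f \<in> borel_measurable borel" "\<And>x. 0 \<le> x \<Longrightarrow> 0 \<le> f x"
  shows "(\<integral>\<^sup>+x. ennreal (f x) \<partial>exp_law p) = ennreal p * (\<integral>\<^sup>+x. ennreal (indicator {0..} x * (exp (- p * x) * f x)) \<partial>lborel)"
proof -
  have "(\<integral>\<^sup>+x. ennreal (f x) \<partial>exp_law p) = (\<integral>\<^sup>+x. ennreal (exponential_density p x) * ennreal (f x) \<partial>lborel)"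
    using f by (subst nn_integral_density) auto
  also have "\<dots> = (\<integral>\<^sup>+x. ennreal p * ennreal (indicator {0..} x * (exp (- p * x) * f x)) \<partial>lborel)"
    using p f(2) by (intro nn_integral_cong) (auto simp: exponential_density_def indicator_def ennreal_mult[symmetric] mult_ac)
  also have "\<dots> = ennreal p * (\<integral>\<^sup>+x. ennreal (indicator {0..} x * (exp (- p * x) * f x)) \<partial>lborel)"
    using f(1) by (intro nn_integral_cmult) measurable
  finally show ?thesis .
qed

text \<open>A mean at an \<open>Exp p\<close> time is \<open>p\<close> times a Laplace transform at
  \<open>p\<close>. Statements about laws at exponential times thus become relations between
  transforms in \<open>p\<close>, to which uniqueness applies.\<close>

lemma has_Laplace_exp_law_iff:
  assumes p: "0 < p" and f: "f \<in> borel_measurable borel" "\<And>x. 0 \<le> x \<Longrightarrow> 0 \<le> f x" and v: "0 \<le> v"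
  shows "has_Laplace f p (v / p) \<longleftrightarrow> (\<integral>\<^sup>+x. ennreal (f x) \<partial>exp_law p) = ennreal v"
proof -
  let ?I = "\<integral>\<^sup>+x. ennreal (indicator {0..} x * (exp (- p * x) * f x)) \<partial>lborel"
  have "has_Laplace f p (v / p) \<longleftrightarrow> ?I = ennreal (v / p)"
    using has_Laplace_nonneg_iff[of f "v / p" p] f v p by simp
  also have "\<dots> \<longleftrightarrow> ennreal p * ?I = ennreal p * ennreal (v / p)" using p by (subst ennreal_mult_cancel_left) auto
  also have "ennreal p * ennreal (v / p) = ennreal v" using p v by (simp add: ennreal_mult[symmetric])
  finally show ?thesis by (simp add: nn_integral_exp_law[OF p f])
qed

lemma nn_integral_exp_exp_law:
  assumes "\<theta> < c" "0 < c"
  shows "(\<integral>\<^sup>+x. ennreal (exp (\<theta> * x)) \<partial>exp_law c) = ennreal (c / (c - \<theta>))"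
  using has_Laplace_exp_law_iff[of c "\<lambda>x. exp (\<theta> * x)" "c / (c - \<theta>)"] has_Laplace_exp[OF assms(1)] assms by simp

lemma nn_integral_exp_exp_law_infinite:
  assumes "c \<le> \<theta>" "0 < c"
  shows "(\<integral>\<^sup>+x. ennreal (exp (\<theta> * x)) \<partial>exp_law c) = \<infinity>"
proof -
  have "\<infinity> = (\<integral>\<^sup>+x. ennreal c * indicator {0::real..} x \<partial>lborel)"
  proof -
    have "emeasure lborel {0::real..} = \<infinity>"
    proof (rule ccontr)
      assume "emeasure lborel {0::real..} \<noteq> \<infinity>"
      then obtain n where "emeasure lborel {0::real..} < of_nat n"
        using ennreal_Ex_less_of_nat[of "emeasure lborel {0::real..}"] by (auto simp: less_top)
      moreover have "emeasure lborel {0..real n} \<le> emeasure lborel {0::real..}" by (intro emeasure_mono) auto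
      moreover have "emeasure lborel {0..real n} = of_nat n" by (simp add: ennreal_of_nat_eq_real_of_nat)
      ultimately show False by simp
    qed
    then show ?thesis using assms(2) by (subst nn_integral_cmult_indicator) (auto simp: ennreal_mult_top)
  qed
  also have "\<dots> \<le> (\<integral>\<^sup>+x. ennreal c * ennreal (indicator {0..} x * (exp (- c * x) * exp (\<theta> * x))) \<partial>lborel)"
  proof (intro nn_integral_mono mult_left_mono)
    fix x :: real
    show "indicator {0..} x \<le> ennreal (indicator {0..} x * (exp (- c * x) * exp (\<theta> * x)))"
    proof (cases "0 \<le> x")
      case True
      then have "c * x \<le> \<theta> * x" using assms by (intro mult_right_mono)
      then have "1 \<le> exp (- c * x) * exp (\<theta> * x)" by (simp add: exp_add[symmetric])
      then show ?thesis using True by simp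
    qed simp
  qed simp
  also have "\<dots> = (\<integral>\<^sup>+x. ennreal (exp (\<theta> * x)) \<partial>exp_law c)"
    using assms nn_integral_exp_law[of c "\<lambda>x. exp (\<theta> * x)"] by (simp add: nn_integral_cmult)
  finally show ?thesis by (simp add: top_unique)
qed

context cadlag_Levy
begin

lemma dip_mono: "\<omega> \<in> space M \<Longrightarrow> 0 \<le> t \<Longrightarrow> t \<le> t' \<Longrightarrow> dip X 0 t \<omega> \<le> dip X 0 t' \<omega>"
  unfolding dip_def by (intro diff_left_mono cINF_superset_mono path_bdd_below) auto

lemma nn_integral_dr_law:
  assumes F: "F \<in> borel_measurable borel"
  shows "(\<integral>\<^sup>+z. F z \<partial>dr_law p) = (\<integral>\<^sup>+t. \<integral>\<^sup>+\<omega>. F (dip X 0 (max 0 t) \<omega>, rise X 0 (max 0 t) \<omega>) \<partial>M \<partial>exp_law p)"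
proof -
  let ?G = "\<lambda>z. F (dip X 0 (max 0 (fst z)) (snd z), rise X 0 (max 0 (fst z)) (snd z))"
  have m: "?G \<in> borel_measurable (exp_law p \<Otimes>\<^sub>M M)"
    by (rule measurable_compose[OF measurable_exp_pair[OF measurable_dr_joint] F])
  have "(\<integral>\<^sup>+z. F z \<partial>dr_law p) = (\<integral>\<^sup>+z. ?G z \<partial>(exp_law p \<Otimes>\<^sub>M M))"
    unfolding dr_law_def using F by (subst nn_integral_distr[OF measurable_exp_pair[OF measurable_dr_joint]]) auto
  also have "\<dots> = (\<integral>\<^sup>+t. \<integral>\<^sup>+\<omega>. ?G (t, \<omega>) \<partial>M \<partial>exp_law p)" by (rule nn_integral_fst[OF m, symmetric])
  finally show ?thesis by simp
qed

lemma nn_integral_dip_law: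
  assumes F: "F \<in> borel_measurable borel"
  shows "(\<integral>\<^sup>+x. F x \<partial>dip_law M X p) = (\<integral>\<^sup>+t. \<integral>\<^sup>+\<omega>. F (dip X 0 (max 0 t) \<omega>) \<partial>M \<partial>exp_law p)"
  unfolding distr_fst_dr_law[symmetric] using measurable_compose[OF measurable_fst_borel F] F
  by (subst nn_integral_distr) (auto simp: nn_integral_dr_law measurable_cong_sets[OF sets_dr_law refl] measurable_fst_borel)

lemma measurable_nn_dr:
  assumes F: "F \<in> borel_measurable borel"
  shows "(\<lambda>t. \<integral>\<^sup>+\<omega>. F (dip X 0 (max 0 t) \<omega>, rise X 0 (max 0 t) \<omega>) \<partial>M) \<in> borel_measurable borel"
  using borel_measurable_nn_integral[of "\<lambda>t \<omega>. F (dip X 0 (max 0 t) \<omega>, rise X 0 (max 0 t) \<omega>)" borel]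
    measurable_compose[OF measurable_dr_joint F] by (simp add: case_prod_unfold)

lemma sets_dip_law [simp, measurable_cong]: "sets (dip_law M Y p) = sets borel"
  unfolding dip_law_def by simp

lemma space_dip_law [simp]: "space (dip_law M Y p) = UNIV"
  unfolding dip_law_def by simp

lemma AE_dip_law_nonneg: "AE x in dip_law M X p. 0 \<le> x"
  unfolding dip_law_def using dip_nonneg[of _ 0]
  by (subst AE_distr_iff[OF measurable_exp_pair[OF measurable_dip_joint]])
    (auto intro!: AE_I2 simp: space_pair_measure)

end

context spectrally_negative_Levy
begin

interpretation N: cadlag_Levy M "neg X" by (rule uminus)

text \<open>Chosen before it is known that \<open>psi (rate p) = p\<close>; only
  \<open>Phi_eq_rate\<close> identifies it with \<open>Phi psi p\<close>.\<close>

definition rate :: "real \<Rightarrow> real" where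
  "rate p = (SOME c. 0 < c \<and> dip_law M (neg X) p = distr (exp_law c) borel (\<lambda>x. x))"

lemma rate:
  assumes "0 < p"
  shows rate_pos: "0 < rate p" and sup_law: "dip_law M (neg X) p = distr (exp_law (rate p)) borel (\<lambda>x. x)"
proof -
  obtain c where "0 < c \<and> dip_law M (neg X) p = distr (exp_law c) borel (\<lambda>x. x)"
    using sup_law_exponential[OF assms] by metis
  then have "0 < rate p \<and> dip_law M (neg X) p = distr (exp_law (rate p)) borel (\<lambda>x. x)"
    unfolding rate_def by (rule someI)
  then show "0 < rate p" "dip_law M (neg X) p = distr (exp_law (rate p)) borel (\<lambda>x. x)" by auto
qed

lemma nn_integral_sup_law:
  assumes "0 < p" "F \<in> borel_measurable borel"
  shows "(\<integral>\<^sup>+x. F x \<partial>dip_law M (neg X) p) = (\<integral>\<^sup>+x. F x \<partial>exp_law (rate p))"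
  unfolding sup_law[OF assms(1)] using assms(2) by (subst nn_integral_distr) auto

definition kappa :: "real \<Rightarrow> real \<Rightarrow> real" where
  "kappa p \<theta> = (\<integral>r. exp (- \<theta> * r) \<partial>dip_law M X p)"

lemma kappa:
  assumes p: "0 < p" and \<theta>: "0 \<le> \<theta>"
  shows integrable_kappa: "integrable (dip_law M X p) (\<lambda>r. exp (- \<theta> * r))"
    and kappa_pos: "0 < kappa p \<theta>" and kappa_le: "kappa p \<theta> \<le> 1"
    and nn_kappa: "(\<integral>\<^sup>+r. ennreal (exp (- \<theta> * r)) \<partial>dip_law M X p) = ennreal (kappa p \<theta>)"
proof -
  interpret D: prob_space "dip_law M X p" by (rule prob_space_dip_law[OF p])
  have le1: "AE r in dip_law M X p. norm (exp (- \<theta> * r)) \<le> 1"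
    using AE_dip_law_nonneg by eventually_elim (use \<theta> in simp)
  have m: "(\<lambda>r. exp (- \<theta> * r)) \<in> borel_measurable (dip_law M X p)" by simp
  show int: "integrable (dip_law M X p) (\<lambda>r. exp (- \<theta> * r))" by (rule D.integrable_const_bound[OF le1 m])
  show nn: "(\<integral>\<^sup>+r. ennreal (exp (- \<theta> * r)) \<partial>dip_law M X p) = ennreal (kappa p \<theta>)"
    unfolding kappa_def using int by (intro nn_integral_eq_integral) auto
  have "kappa p \<theta> \<le> (\<integral>r. 1 \<partial>dip_law M X p)"
    unfolding kappa_def using le1 by (intro integral_mono_AE int) (auto elim: eventually_mono)
  then show "kappa p \<theta> \<le> 1" using D.prob_space by simp
  have "kappa p \<theta> \<noteq> 0"
  proof
    assume "kappa p \<theta> = 0"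
    then have "AE r in dip_law M X p. exp (- \<theta> * r) = 0"
      using integral_nonneg_eq_0_iff_AE[OF int] by (simp add: kappa_def)
    then have "AE r in dip_law M X p. False" by simp
    then show False by (simp only: D.AE_False)
  qed
  moreover have "0 \<le> kappa p \<theta>" unfolding kappa_def by (rule Bochner_Integration.integral_nonneg) simp
  ultimately show "0 < kappa p \<theta>" by simp
qed

text \<open>The factorisation for \<open>neg X\<close>: there \<open>dip\<close> is the height of
  the supremum of \<open>X\<close>, and \<open>rise\<close> is the distance from the supremum down
  to the final value, which has the law of the depth.\<close>

lemma sup_dr_law:
  assumes "0 < p"
  shows "N.dr_law p = dip_law M (neg X) p \<Otimes>\<^sub>M dip_law M X p" using N.Wiener_Hopf[OF assms] by simp

text \<open>The moment is finite at an \<open>Exp p\<close> time because the supremum is then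
  exponential with parameter \<open>rate p\<close>. Hence it is finite at some fixed time after
  \<open>t\<close>, and at \<open>t\<close> because the supremum increases with time.\<close>

lemma sup_exp_moment:
  assumes p: "0 < p" and \<theta>: "0 \<le> \<theta>" "\<theta> < rate p" and t: "0 \<le> t"
  shows "(\<integral>\<^sup>+\<omega>. ennreal (exp (\<theta> * dip (neg X) 0 t \<omega>)) \<partial>M) < \<infinity>"
proof -
  have "(\<integral>\<^sup>+t. \<integral>\<^sup>+\<omega>. ennreal (exp (\<theta> * dip (neg X) 0 (max 0 t) \<omega>)) \<partial>M \<partial>exp_law p)
      = (\<integral>\<^sup>+x. ennreal (exp (\<theta> * x)) \<partial>exp_law (rate p))"
    using N.nn_integral_dip_law[of "\<lambda>x. ennreal (exp (\<theta> * x))" p] nn_integral_sup_law[OF p, of "\<lambda>x. ennreal (exp (\<theta> * x))"] by simp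
  also have "\<dots> < \<infinity>" using nn_integral_exp_exp_law[OF \<theta>(2) rate_pos[OF p]] by simp
  finally have "AE t in exp_law p. (\<integral>\<^sup>+\<omega>. ennreal (exp (\<theta> * dip (neg X) 0 (max 0 t) \<omega>)) \<partial>M) \<noteq> \<infinity>"
    using N.measurable_nn_dr[of "\<lambda>z. ennreal (exp (\<theta> * fst z))"] measurable_fst_borel
    by (intro nn_integral_PInf_AE) auto
  then obtain t' where t': "t < t'" "(\<integral>\<^sup>+\<omega>. ennreal (exp (\<theta> * dip (neg X) 0 (max 0 t') \<omega>)) \<partial>M) \<noteq> \<infinity>"
    using AE_exp_law_unbounded[OF p t] by blast
  have "(\<integral>\<^sup>+\<omega>. ennreal (exp (\<theta> * dip (neg X) 0 t \<omega>)) \<partial>M)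
      \<le> (\<integral>\<^sup>+\<omega>. ennreal (exp (\<theta> * dip (neg X) 0 (max 0 t') \<omega>)) \<partial>M)"
    using t t'(1) \<theta> by (intro nn_integral_mono) (auto intro!: mult_left_mono N.dip_mono)
  then show ?thesis using t'(2) by (simp add: less_top order_le_less_trans top.not_eq_extremum)
qed

text \<open>By right-continuity the supremum rarely exceeds \<open>1\<close> before a small time
  \<open>t0\<close>, and for large \<open>p\<close> an \<open>Exp p\<close> time rarely exceeds
  \<open>t0\<close>. So \<open>exp (- rate p)\<close>, the probability that the supremum exceeds
  \<open>1\<close>, is small.\<close>

lemma rate_unbounded:
  obtains P where "0 < P" "\<And>p. P \<le> p \<Longrightarrow> \<theta> < rate p"
proof -
  let ?Y = "neg X"
  \<comment> \<open>One half of \<open>exp (- \<theta>)\<close> is spent on a high supremum before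
    \<open>t0\<close>, the other on a long exponential time.\<close>
  define e where "e = exp (- \<theta>) / 2"
  have e: "0 < e" by (simp add: e_def)
  define A where "A n = {\<omega> \<in> space M. 1 < dip ?Y 0 (1 / real (Suc n)) \<omega>}" for n
  have A: "A n \<in> events" for n
    unfolding A_def using N.borel_measurable_dip[of 0 "1 / real (Suc n)"] by measurable
  have "decseq A"
  proof (rule decseq_SucI)
    fix n
    have "1 / real (Suc (Suc n)) \<le> 1 / real (Suc n)" by (intro divide_left_mono) auto
    then show "A (Suc n) \<subseteq> A n"
      unfolding A_def using N.dip_mono[of _ "1 / real (Suc (Suc n))" "1 / real (Suc n)"] by (auto intro: less_le_trans)
  qed
  then have "(\<lambda>n. prob (A n)) \<longlonglongrightarrow> prob (\<Inter>n. A n)" using A by (intro finite_Lim_measure_decseq) auto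
  moreover have "(\<Inter>n. A n) = {}"
  proof -
    have "\<exists>n. \<omega> \<notin> A n" for \<omega>
    proof (cases "\<omega> \<in> space M")
      case True
      have "((\<lambda>s. X s \<omega>) \<longlongrightarrow> X 0 \<omega>) (at_right 0)" using right_cont[OF True, of 0] by (simp add: continuous_within)
      then have "\<forall>\<^sub>F s in at_right 0. X s \<omega> < X 0 \<omega> + 1" by (rule order_tendstoD) simp
      then obtain b where b: "0 < b" "\<And>s. 0 < s \<Longrightarrow> s < b \<Longrightarrow> X s \<omega> < X 0 \<omega> + 1"
        by (auto simp: eventually_at_right_field)
      obtain n where n: "1 / real (Suc n) < b" using nat_approx_posE[OF b(1)] by blast
      have "- X 0 \<omega> - 1 \<le> (INF s\<in>{0..0 + 1 / real (Suc n)}. - X s \<omega>)"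
      proof (rule cINF_greatest)
        fix s assume "s \<in> {0..0 + 1 / real (Suc n)}"
        then show "- X 0 \<omega> - 1 \<le> - X s \<omega>" using b(2)[of s] n by (cases "s = 0") auto
      qed auto
      then have "\<omega> \<notin> A n" unfolding A_def dip_def by auto
      then show ?thesis by blast
    qed (auto simp: A_def)
    then show ?thesis by blast
  qed
  ultimately have "(\<lambda>n. prob (A n)) \<longlonglongrightarrow> 0" by simp
  then have "\<forall>\<^sub>F n in sequentially. prob (A n) < e" using e by (rule order_tendstoD)
  then obtain n where n: "prob (A n) < e" by (auto simp: eventually_sequentially)
  define t0 where "t0 = 1 / real (Suc n)"
  have t0: "0 < t0" by (simp add: t0_def)
  have A_eq: "A n = {\<omega> \<in> space M. 1 < dip ?Y 0 t0 \<omega>}" by (simp only: A_def t0_def)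
  \<comment> \<open>From here on \<open>exp (- p * t0)\<close> is at most
    \<open>exp (- \<theta>) / 2\<close>; the \<open>1\<close> only ensures positivity.\<close>
  define P where "P = max 1 ((\<theta> + ln 2) / t0)"
  show thesis
  proof (rule that)
    show "0 < P" by (simp add: P_def)
    fix p assume pP: "P \<le> p"
    then have p: "0 < p" by (simp add: P_def)
    interpret E: prob_space "exp_law p" by (rule prob_space_exponential_density[OF p])
    have "(\<theta> + ln 2) / t0 \<le> p" using pP by (simp add: P_def)
    then have "\<theta> + ln 2 \<le> p * t0" using t0 by (simp add: field_simps)
    then have "exp (- (p * t0)) \<le> exp (- (\<theta> + ln 2))" by simp
    also have "\<dots> = e" by (simp add: e_def exp_minus exp_add exp_diff field_simps)
    finally have pe: "exp (- (p * t0)) \<le> e" .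
    have "ennreal (exp (- rate p)) = emeasure (exp_law (rate p)) {1<..}"
    proof -
      interpret R: prob_space "exp_law (rate p)" by (rule prob_space_exponential_density[OF rate_pos[OF p]])
      have "{1<..} = space (exp_law (rate p)) - {..1}" by auto
      then have "R.prob {1<..} = exp (- rate p)"
        using measure_exp_law_greaterThan[OF rate_pos[OF p], of 1] R.prob_compl[of "{..1}"] by simp
      then show ?thesis by (simp add: R.emeasure_eq_measure)
    qed
    also have "\<dots> = (\<integral>\<^sup>+x. indicator {1<..} x \<partial>exp_law (rate p))" by simp
    also have "\<dots> = (\<integral>\<^sup>+t. \<integral>\<^sup>+\<omega>. indicator {1<..} (dip ?Y 0 (max 0 t) \<omega>) \<partial>M \<partial>exp_law p)"
      using N.nn_integral_dip_law[of "indicator {1<..}" p] nn_integral_sup_law[OF p, of "indicator {1<..}"] by simp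
    also have "\<dots> \<le> (\<integral>\<^sup>+t. ennreal (prob (A n)) + indicator {t0<..} t \<partial>exp_law p)"
    proof (rule nn_integral_mono)
      fix t :: real
      show "(\<integral>\<^sup>+\<omega>. indicator {1<..} (dip ?Y 0 (max 0 t) \<omega>) \<partial>M) \<le> ennreal (prob (A n)) + indicator {t0<..} t"
      proof (cases "t0 < t")
        case True
        have "(\<integral>\<^sup>+\<omega>. indicator {1<..} (dip ?Y 0 (max 0 t) \<omega>) \<partial>M) \<le> (\<integral>\<^sup>+\<omega>. 1 \<partial>M)"
          by (intro nn_integral_mono) (auto simp: indicator_def)
        also have "\<dots> = 1" by (simp add: emeasure_space_1)
        finally show ?thesis using True by (simp add: add_increasing)
      next
        case False
        have "(\<integral>\<^sup>+\<omega>. indicator {1<..} (dip ?Y 0 (max 0 t) \<omega>) \<partial>M) \<le> (\<integral>\<^sup>+\<omega>. indicator (A n) \<omega> \<partial>M)"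
          using False t0 N.dip_mono[of _ "max 0 t" t0] unfolding A_eq
          by (intro nn_integral_mono) (auto simp: indicator_def intro: less_le_trans)
        also have "\<dots> = ennreal (prob (A n))" using A by (simp add: emeasure_eq_measure)
        finally show ?thesis using False by simp
      qed
    qed
    also have "\<dots> = ennreal (prob (A n)) + emeasure (exp_law p) {t0<..}"
      by (subst nn_integral_add) (auto simp: E.emeasure_space_1[simplified])
    also have "emeasure (exp_law p) {t0<..} = ennreal (exp (- (p * t0)))"
    proof -
      have "{t0<..} = space (exp_law p) - {..t0}" by auto
      then have "E.prob {t0<..} = exp (- p * t0)"
        using measure_exp_law_greaterThan[OF p, of t0] t0 E.prob_compl[of "{..t0}"] by simp
      then show ?thesis by (simp add: E.emeasure_eq_measure)
    qed
    also have "ennreal (prob (A n)) + ennreal (exp (- (p * t0))) = ennreal (prob (A n) + exp (- (p * t0)))"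
      by (simp add: ennreal_plus)
    finally have "exp (- rate p) \<le> prob (A n) + exp (- (p * t0))"
      by (simp add: ennreal_plus[symmetric] ennreal_le_iff del: ennreal_plus)
    also have "\<dots> < 2 * e" using n pe by simp
    also have "\<dots> = exp (- \<theta>)" by (simp add: e_def)
    finally show "\<theta> < rate p" by simp
  qed
qed

lemma sup_exp_moment': "0 \<le> \<theta> \<Longrightarrow> 0 \<le> t \<Longrightarrow>
    integrable M (\<lambda>\<omega>. exp (\<theta> * dip (neg X) 0 t \<omega>))"
proof -
  assume a: "0 \<le> \<theta>" "0 \<le> t"
  obtain P where "0 < P" "\<And>p. P \<le> p \<Longrightarrow> \<theta> < rate p" using rate_unbounded[of \<theta>] by blast
  then have "(\<integral>\<^sup>+\<omega>. ennreal (exp (\<theta> * dip (neg X) 0 t \<omega>)) \<partial>M) < \<infinity>" by (intro sup_exp_moment[of P] a) auto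
  moreover have "(\<lambda>\<omega>. exp (\<theta> * dip (neg X) 0 t \<omega>)) \<in> borel_measurable M"
    using N.borel_measurable_dip[of 0 t] a by measurable
  ultimately show ?thesis by (intro integrableI_nonneg) auto
qed

lemma X_diff_eq: "dip (neg X) 0 t \<omega> - rise (neg X) 0 t \<omega> = X t \<omega> - X 0 \<omega>"
  by (simp add: dip_def rise_def)

lemma integrable_exp_X:
  assumes "0 \<le> \<theta>" "0 \<le> t"
  shows "integrable M (\<lambda>\<omega>. exp (\<theta> * X t \<omega>))"
    and "expectation (\<lambda>\<omega>. exp (\<theta> * X t \<omega>)) \<le> expectation (\<lambda>\<omega>. exp (\<theta> * dip (neg X) 0 t \<omega>))"
proof -
  have [measurable]: "X t \<in> borel_measurable M" using assms by (intro measurable_X)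
  have le: "AE \<omega> in M. exp (\<theta> * X t \<omega>) \<le> exp (\<theta> * dip (neg X) 0 t \<omega>)" using X_0 AE_space
  proof eventually_elim
    case (elim \<omega>)
    have "X t \<omega> \<le> dip (neg X) 0 t \<omega>" using X_diff_eq[of t \<omega>] N.rise_nonneg[of \<omega> 0 t] elim assms by simp
    then show ?case using assms by (simp add: mult_left_mono)
  qed
  show int: "integrable M (\<lambda>\<omega>. exp (\<theta> * X t \<omega>))"
    by (rule Bochner_Integration.integrable_bound[OF sup_exp_moment'[OF assms]]) (use le in auto)
  show "expectation (\<lambda>\<omega>. exp (\<theta> * X t \<omega>)) \<le> expectation (\<lambda>\<omega>. exp (\<theta> * dip (neg X) 0 t \<omega>))"
    by (rule integral_mono_AE[OF int sup_exp_moment'[OF assms] le])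
qed

lemma expectation_exp_X_add:
  assumes \<theta>: "0 \<le> \<theta>" and s: "0 \<le> s" and t: "0 \<le> t"
  shows "expectation (\<lambda>\<omega>. exp (\<theta> * X (s + t) \<omega>)) = expectation (\<lambda>\<omega>. exp (\<theta> * X s \<omega>)) * expectation (\<lambda>\<omega>. exp (\<theta> * X t \<omega>))"
proof -
  have [measurable]: "X t \<in> borel_measurable M" "X s \<in> borel_measurable M" "X (s + t) \<in> borel_measurable M" "X 0 \<in> borel_measurable M"
    using s t by (auto intro: measurable_X)
  define \<tau> where "\<tau> i = (if i = 0 then 0 else if i = 1 then s else s + t)" for i :: nat
  have "indep_vars (\<lambda>_. borel) (\<lambda>i \<omega>. X (\<tau> (Suc i)) \<omega> - X (\<tau> i) \<omega>) {..<2}"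
    by (rule indep_increments) (use s t in \<open>auto simp: \<tau>_def\<close>)
  then have ind: "indep_vars (\<lambda>_. borel) (\<lambda>i \<omega>. exp (\<theta> * (X (\<tau> (Suc i)) \<omega> - X (\<tau> i) \<omega>))) {..<2}"
    by (rule indep_vars_compose2[where Y="\<lambda>_ x. exp (\<theta> * x)"]) auto
  have incr: "integrable M (\<lambda>\<omega>. exp (\<theta> * (X (u + h) \<omega> - X u \<omega>)))"
     "expectation (\<lambda>\<omega>. exp (\<theta> * (X (u + h) \<omega> - X u \<omega>))) = expectation (\<lambda>\<omega>. exp (\<theta> * X h \<omega>))"
    if u: "0 \<le> u" and h: "0 \<le> h" for u h
  proof -
    have [measurable]: "X u \<in> borel_measurable M" "X h \<in> borel_measurable M" "X (u + h) \<in> borel_measurable M"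
      using u h by (auto intro: measurable_X)
    have "integrable (distr M borel (X h)) (\<lambda>x. exp (\<theta> * x))"
      using integrable_exp_X(1)[OF \<theta> h] by (subst integrable_distr_eq) auto
    then have "integrable (distr M borel (\<lambda>\<omega>. X (u + h) \<omega> - X u \<omega>)) (\<lambda>x. exp (\<theta> * x))"
      by (simp only: stationary_increments[OF u h])
    then show "integrable M (\<lambda>\<omega>. exp (\<theta> * (X (u + h) \<omega> - X u \<omega>)))" by (subst (asm) integrable_distr_eq) auto
    have "expectation (\<lambda>\<omega>. exp (\<theta> * (X (u + h) \<omega> - X u \<omega>))) = (\<integral>x. exp (\<theta> * x) \<partial>distr M borel (\<lambda>\<omega>. X (u + h) \<omega> - X u \<omega>))"
      by (subst integral_distr) auto
    also have "\<dots> = (\<integral>x. exp (\<theta> * x) \<partial>distr M borel (X h))" by (simp only: stationary_increments[OF u h])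
    also have "\<dots> = expectation (\<lambda>\<omega>. exp (\<theta> * X h \<omega>))" by (subst integral_distr) auto
    finally show "expectation (\<lambda>\<omega>. exp (\<theta> * (X (u + h) \<omega> - X u \<omega>))) = expectation (\<lambda>\<omega>. exp (\<theta> * X h \<omega>))" .
  qed
  have "expectation (\<lambda>\<omega>. \<Prod>i<2. exp (\<theta> * (X (\<tau> (Suc i)) \<omega> - X (\<tau> i) \<omega>))) = (\<Prod>i<2. expectation (\<lambda>\<omega>. exp (\<theta> * (X (\<tau> (Suc i)) \<omega> - X (\<tau> i) \<omega>))))"
  proof (rule indep_vars_lebesgue_integral[OF _ ind])
    fix i :: nat assume "i \<in> {..<2}"
    then have "i = 0 \<or> i = 1" by auto
    then show "integrable M (\<lambda>\<omega>. exp (\<theta> * (X (\<tau> (Suc i)) \<omega> - X (\<tau> i) \<omega>)))"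
      using incr(1)[of 0 s] incr(1)[of s t] s t by (auto simp: \<tau>_def)
  qed simp
  moreover have "(\<Prod>i<2. exp (\<theta> * (X (\<tau> (Suc i)) \<omega> - X (\<tau> i) \<omega>))) = exp (\<theta> * (X (s + t) \<omega> - X 0 \<omega>))" for \<omega>
    by (simp add: \<tau>_def numeral_2_eq_2 exp_add[symmetric] algebra_simps)
  moreover have "(\<Prod>i<2. expectation (\<lambda>\<omega>. exp (\<theta> * (X (\<tau> (Suc i)) \<omega> - X (\<tau> i) \<omega>)))) = expectation (\<lambda>\<omega>. exp (\<theta> * X s \<omega>)) * expectation (\<lambda>\<omega>. exp (\<theta> * X t \<omega>))"
    using incr(2)[of 0 s] incr(2)[of s t] s t by (simp add: \<tau>_def numeral_2_eq_2)
  moreover have "expectation (\<lambda>\<omega>. exp (\<theta> * (X (s + t) \<omega> - X 0 \<omega>))) = expectation (\<lambda>\<omega>. exp (\<theta> * X (s + t) \<omega>))"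
    using X_0 by (intro integral_cong_AE) (auto elim: eventually_mono)
  ultimately show ?thesis by simp
qed

abbreviation psi :: "real \<Rightarrow> real" where "psi \<equiv> Laplace_exponent M X"

text \<open>\<open>psi\<close> is defined by \<open>X 1\<close> alone. Independent stationary
  increments make the logarithm of the moment additive in \<open>t\<close>; for
  \<open>additive_bounded_linear\<close> the running supremum bounds it above on the unit interval,
  and \<open>m 1 = m x * m (1 - x)\<close> then bounds it below.\<close>

lemma expectation_exp_X:
  assumes \<theta>: "0 \<le> \<theta>" and t: "0 < t"
  shows "expectation (\<lambda>\<omega>. exp (\<theta> * X t \<omega>)) = exp (t * psi \<theta>)"
proof -
  define m where "m t = expectation (\<lambda>\<omega>. exp (\<theta> * X t \<omega>))" for t
  have pos: "0 < m t" if "0 \<le> t" for t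
  proof -
    have "m t \<noteq> 0"
    proof
      assume "m t = 0"
      then have "AE \<omega> in M. exp (\<theta> * X t \<omega>) = 0"
        using integral_nonneg_eq_0_iff_AE[OF integrable_exp_X(1)[OF \<theta> that]] by (simp add: m_def)
      then have "AE \<omega> in M. False" by simp
      then show False by (simp only: AE_False)
    qed
    moreover have "0 \<le> m t" unfolding m_def by (rule Bochner_Integration.integral_nonneg) simp
    ultimately show ?thesis by simp
  qed
  define K where "K = expectation (\<lambda>\<omega>. exp (\<theta> * dip (neg X) 0 1 \<omega>))"
  have K: "m t \<le> K" if "0 \<le> t" "t \<le> 1" for t
  proof -
    have "m t \<le> expectation (\<lambda>\<omega>. exp (\<theta> * dip (neg X) 0 t \<omega>))"
      unfolding m_def by (rule integrable_exp_X(2)[OF \<theta> that(1)])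
    also have "\<dots> \<le> K"
      unfolding K_def using that \<theta> by (intro integral_mono sup_exp_moment') (auto intro!: mult_left_mono N.dip_mono)
    finally show ?thesis .
  qed
  have Kpos: "0 < K" using K[of 1] pos[of 1] by simp
  have "ln (m t) = t * ln (m 1)"
  proof (rule additive_bounded_linear[where B="\<bar>ln K\<bar> + \<bar>ln (m 1)\<bar>"])
    show "ln (m (x + y)) = ln (m x) + ln (m y)" if "0 < x" "0 < y" for x y
      using that pos[of x] pos[of y] unfolding m_def by (simp add: expectation_exp_X_add[OF \<theta>] ln_mult)
    show "\<bar>ln (m x)\<bar> \<le> \<bar>ln K\<bar> + \<bar>ln (m 1)\<bar>" if "0 < x" "x \<le> 1" for x
    proof -
      have up: "ln (m x) \<le> ln K" using K[of x] pos[of x] that Kpos by simp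
      have "m 1 = m x * m (1 - x)" unfolding m_def using expectation_exp_X_add[OF \<theta>, of x "1 - x"] that by simp
      then have "ln (m 1) = ln (m x) + ln (m (1 - x))" using pos[of x] pos[of "1 - x"] that by (simp add: ln_mult)
      moreover have "ln (m (1 - x)) \<le> ln K" using K[of "1 - x"] pos[of "1 - x"] that Kpos by simp
      ultimately show ?thesis using up by linarith
    qed
  qed (rule t)
  moreover have "m t = exp (ln (m t))" using pos[of t] t by simp
  ultimately have "m t = exp (t * ln (m 1))" by (simp only:)
  then show ?thesis by (simp only: m_def Laplace_exponent_def)
qed

end

section \<open>The transform of the depth, and \<open>rate\<close> as inverse of
  \<open>psi\<close>\<close>

context spectrally_negative_Levy
begin

interpretation N: cadlag_Levy M "neg X" by (rule uminus)

text \<open>The mean of \<open>exp (\<theta> * (X - X 0))\<close> at an \<open>Exp p\<close> time is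
  computed twice: by integrating \<open>exp (psi \<theta> * t)\<close>, and as a product, since the
  increment is the supremum minus an independent variable with the law of the depth. The product is
  finite for \<theta> < \<open>rate p\<close>, which forces \<open>psi \<theta> < p\<close>.\<close>

lemma kappa_identity_small:
  assumes p: "0 < p" and \<theta>: "0 \<le> \<theta>" "\<theta> < rate p"
  shows "psi \<theta> < p" "(p - psi \<theta>) * kappa p \<theta> = p * (1 - \<theta> / rate p)"
proof -
  let ?Y = "neg X"
  define c where "c = rate p"
  have c: "0 < c" "\<theta> < c" using rate_pos[OF p] \<theta> by (auto simp: c_def)
  interpret D1: prob_space "dip_law M ?Y p" by (rule N.prob_space_dip_law[OF p])
  interpret D2: prob_space "dip_law M X p" by (rule prob_space_dip_law[OF p])
  have Fm: "(\<lambda>z. ennreal (exp (\<theta> * (fst z - snd z)))) \<in> borel_measurable (borel :: (real \<times> real) measure)"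
    by (simp add: borel_prod[symmetric])
  have "(\<integral>\<^sup>+t. ennreal (exp (psi \<theta> * t)) \<partial>exp_law p) = (\<integral>\<^sup>+z. ennreal (exp (\<theta> * (fst z - snd z))) \<partial>N.dr_law p)"
    unfolding N.nn_integral_dr_law[OF Fm] fst_conv snd_conv X_diff_eq
  proof (rule nn_integral_cong_AE)
    show "AE t in exp_law p. ennreal (exp (psi \<theta> * t)) = (\<integral>\<^sup>+\<omega>. ennreal (exp (\<theta> * (X (max 0 t) \<omega> - X 0 \<omega>))) \<partial>M)"
      using AE_exp_law_pos
    proof eventually_elim
      case (elim t)
      have "(\<integral>\<^sup>+\<omega>. ennreal (exp (\<theta> * (X (max 0 t) \<omega> - X 0 \<omega>))) \<partial>M) = (\<integral>\<^sup>+\<omega>. ennreal (exp (\<theta> * X t \<omega>)) \<partial>M)"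
        using X_0 elim by (intro nn_integral_cong_AE) (auto elim: eventually_mono simp: max_absorb2)
      also have "\<dots> = ennreal (exp (t * psi \<theta>))"
        using integrable_exp_X(1)[OF \<theta>(1), of t] elim expectation_exp_X[OF \<theta>(1) elim]
        by (subst nn_integral_eq_integral) auto
      finally show ?case by (simp add: mult.commute)
    qed
  qed
  also have "\<dots> = (\<integral>\<^sup>+x. \<integral>\<^sup>+y. ennreal (exp (\<theta> * (x - y))) \<partial>dip_law M X p \<partial>dip_law M ?Y p)"
  proof -
    have "(\<lambda>z. ennreal (exp (\<theta> * (fst z - snd z)))) \<in> borel_measurable (dip_law M ?Y p \<Otimes>\<^sub>M dip_law M X p)"
      by measurable
    from D2.nn_integral_fst[OF this] show ?thesis unfolding sup_dr_law[OF p] by simp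
  qed
  also have "\<dots> = (\<integral>\<^sup>+x. ennreal (exp (\<theta> * x)) * ennreal (kappa p \<theta>) \<partial>dip_law M ?Y p)"
  proof (rule nn_integral_cong)
    fix x
    have "(\<integral>\<^sup>+y. ennreal (exp (\<theta> * (x - y))) \<partial>dip_law M X p) = (\<integral>\<^sup>+y. ennreal (exp (\<theta> * x)) * ennreal (exp (- \<theta> * y)) \<partial>dip_law M X p)"
      by (intro nn_integral_cong) (simp add: ennreal_mult[symmetric] exp_add[symmetric] algebra_simps)
    also have "\<dots> = ennreal (exp (\<theta> * x)) * ennreal (kappa p \<theta>)"
      using nn_kappa[OF p \<theta>(1)] by (subst nn_integral_cmult) auto
    finally show "(\<integral>\<^sup>+y. ennreal (exp (\<theta> * (x - y))) \<partial>dip_law M X p) = ennreal (exp (\<theta> * x)) * ennreal (kappa p \<theta>)" .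
  qed
  also have "\<dots> = ennreal (c / (c - \<theta>)) * ennreal (kappa p \<theta>)"
    using nn_integral_sup_law[OF p, of "\<lambda>x. ennreal (exp (\<theta> * x))"] nn_integral_exp_exp_law[OF c(2,1)]
    by (subst nn_integral_multc) (auto simp: c_def)
  finally have eq: "(\<integral>\<^sup>+t. ennreal (exp (psi \<theta> * t)) \<partial>exp_law p) = ennreal (c / (c - \<theta>) * kappa p \<theta>)"
    using c kappa_pos[OF p \<theta>(1)] by (subst ennreal_mult) auto
  show lt: "psi \<theta> < p"
  proof (rule ccontr)
    assume "\<not> psi \<theta> < p"
    then show False using nn_integral_exp_exp_law_infinite[of p "psi \<theta>"] p eq by simp
  qed
  have "p / (p - psi \<theta>) = c / (c - \<theta>) * kappa p \<theta>"
    using eq nn_integral_exp_exp_law[OF lt p] lt p c kappa_pos[OF p \<theta>(1)] by simp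
  then have "p * (c - \<theta>) = c * kappa p \<theta> * (p - psi \<theta>)" using lt c by (simp add: field_simps)
  then show "(p - psi \<theta>) * kappa p \<theta> = p * (1 - \<theta> / rate p)"
    using c unfolding c_def[symmetric] by (simp add: field_simps)
qed

text \<open>For large \<open>p\<close> the identity says that a certain function of \<open>t\<close>, not depending on \<open>p\<close>, has a
  vanishing Laplace transform at \<open>p\<close>; by uniqueness the function is \<open>0\<close>, whence the identity for all \<open>p\<close>.\<close>

theorem kappa_identity:
  assumes p: "0 < p" and \<theta>: "0 \<le> \<theta>"
  shows "(p - psi \<theta>) * kappa p \<theta> = p * (1 - \<theta> / rate p)"
proof -
  let ?Y = "neg X"
  \<comment> \<open>\<open>i t\<close> involves the distance from the supremum, which at an
    \<open>Exp p\<close> time has the law of the depth, and \<open>s t\<close> is the mean supremum;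
    their transforms at \<open>p\<close> are \<open>kappa p \<theta> / p\<close> and
    \<open>1 / (rate p * p)\<close>.\<close>
  define i where "i t = expectation (\<lambda>\<omega>. exp (- \<theta> * rise ?Y 0 (max 0 t) \<omega>))" for t
  define s where "s t = expectation (\<lambda>\<omega>. dip ?Y 0 (max 0 t) \<omega>)" for t
  have mr [measurable]: "rise ?Y 0 (max 0 t) \<in> borel_measurable M" "dip ?Y 0 (max 0 t) \<in> borel_measurable M" for t
    by auto
  have inti: "integrable M (\<lambda>\<omega>. exp (- \<theta> * rise ?Y 0 (max 0 t) \<omega>))" for t
    using N.rise_nonneg[of _ 0 "max 0 t"] \<theta> by (intro integrable_const_bound[of _ 1]) auto
  have ints: "integrable M (dip ?Y 0 (max 0 t))" for t
  proof (rule Bochner_Integration.integrable_bound[OF sup_exp_moment'[of 1 "max 0 t"]])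
    show "AE \<omega> in M. norm (dip ?Y 0 (max 0 t) \<omega>) \<le> norm (exp (1 * dip ?Y 0 (max 0 t) \<omega>))"
    proof (rule AE_I2)
      fix \<omega> assume "\<omega> \<in> space M"
      then have "0 \<le> dip ?Y 0 (max 0 t) \<omega>" by (intro N.dip_nonneg) auto
      moreover have "dip ?Y 0 (max 0 t) \<omega> \<le> exp (dip ?Y 0 (max 0 t) \<omega>)"
        using exp_ge_add_one_self[of "dip ?Y 0 (max 0 t) \<omega>"] by linarith
      ultimately show "norm (dip ?Y 0 (max 0 t) \<omega>) \<le> norm (exp (1 * dip ?Y 0 (max 0 t) \<omega>))" by simp
    qed
  qed auto
  have inn: "ennreal (i t) = (\<integral>\<^sup>+\<omega>. ennreal (exp (- \<theta> * rise ?Y 0 (max 0 t) \<omega>)) \<partial>M)" for t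
    unfolding i_def using inti by (intro nn_integral_eq_integral[symmetric]) auto
  have snn: "ennreal (s t) = (\<integral>\<^sup>+\<omega>. ennreal (dip ?Y 0 (max 0 t) \<omega>) \<partial>M)" for t
    unfolding s_def using ints N.dip_nonneg[of _ 0 "max 0 t"] by (intro nn_integral_eq_integral[symmetric]) auto
  have i01: "0 \<le> i t" "i t \<le> 1" for t
  proof -
    show "0 \<le> i t" unfolding i_def by (rule Bochner_Integration.integral_nonneg) simp
    have "i t \<le> expectation (\<lambda>\<omega>. 1)"
      unfolding i_def using N.rise_nonneg[of _ 0 "max 0 t"] \<theta> by (intro integral_mono inti) auto
    then show "i t \<le> 1" by (simp add: prob_space)
  qed
  have s0: "0 \<le> s t" for t
    unfolding s_def using N.dip_nonneg[of _ 0 "max 0 t"] by (intro integral_nonneg_AE) auto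
  have Fi: "(\<lambda>z. ennreal (exp (- \<theta> * snd z))) \<in> borel_measurable (borel :: (real \<times> real) measure)"
    and Fs: "(\<lambda>z. ennreal (fst z)) \<in> borel_measurable (borel :: (real \<times> real) measure)"
    by (auto simp: borel_prod[symmetric])
  have im [measurable]: "i \<in> borel_measurable borel"
  proof -
    have "(\<lambda>t. enn2real (ennreal (i t))) \<in> borel_measurable borel"
      unfolding inn using N.measurable_nn_dr[OF Fi] by simp
    then show ?thesis using i01 by simp
  qed
  have sm [measurable]: "s \<in> borel_measurable borel"
  proof -
    have "(\<lambda>t. enn2real (ennreal (s t))) \<in> borel_measurable borel"
      unfolding snn using N.measurable_nn_dr[OF Fs] by simp
    then show ?thesis using s0 by simp
  qed
  have Li: "has_Laplace i p (kappa p \<theta> / p)" if p: "0 < p" for p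
  proof -
    have "(\<integral>\<^sup>+t. ennreal (i t) \<partial>exp_law p) = (\<integral>\<^sup>+z. ennreal (exp (- \<theta> * snd z)) \<partial>N.dr_law p)"
      unfolding N.nn_integral_dr_law[OF Fi] inn by simp
    also have "\<dots> = (\<integral>\<^sup>+r. ennreal (exp (- \<theta> * r)) \<partial>distr (N.dr_law p) borel snd)"
      by (subst nn_integral_distr) (auto simp: measurable_snd_borel measurable_cong_sets[OF N.sets_dr_law refl])
    also have "\<dots> = ennreal (kappa p \<theta>)" unfolding N.distr_snd_dr_law[OF p] using nn_kappa[OF p \<theta>] by simp
    finally show ?thesis using has_Laplace_exp_law_iff[OF p im i01(1), of "kappa p \<theta>"] kappa_pos[OF p \<theta>] by simp
  qed
  have Ls: "has_Laplace s p ((1 / rate p) / p)" if p: "0 < p" for p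
  proof -
    have "(\<integral>\<^sup>+t. ennreal (s t) \<partial>exp_law p) = (\<integral>\<^sup>+x. ennreal x \<partial>exp_law (rate p))"
      unfolding snn using N.nn_integral_dip_law[of ennreal p] nn_integral_sup_law[OF p, of ennreal] by simp
    also have "\<dots> = (\<integral>\<^sup>+x. ennreal (erlang_density 0 (rate p) x * x ^ 1) \<partial>lborel)"
      using rate_pos[OF p] by (subst nn_integral_density) (auto simp: ennreal_mult' exponential_density_nonneg intro!: nn_integral_cong)
    also have "\<dots> = ennreal (1 / rate p)" using nn_integral_erlang_ith_moment[OF rate_pos[OF p], of 0 1] by simp
    finally show ?thesis using has_Laplace_exp_law_iff[OF p sm s0, of "1 / rate p"] rate_pos[OF p] by simp
  qed
  define \<nu> where "\<nu> = density lborel (\<lambda>r. ennreal (i r))"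
  have sets\<nu>: "sets \<nu> = sets borel" by (simp add: \<nu>_def)
  have fin: "sigma_finite_measure \<nu>"
    unfolding \<nu>_def by (subst sigma_finite_measure.sigma_finite_iff_density_finite[OF lborel.sigma_finite_measure_axioms]) auto
  have L1: "has_Laplace (\<lambda>_. 1) p (1 / p)" if "0 < p" for p using has_Laplace_exp[of 0 p] that by simp
  have Lc: "has_Laplace (conv (\<lambda>_. 1) \<nu>) p (1 / p * (kappa p \<theta> / p))" if p: "0 < p" for p
  proof (rule has_Laplace_conv[OF fin sets\<nu> _ _ _ L1[OF p]])
    show "(\<integral>\<^sup>+r. ennreal (indicator {0..} r * exp (- p * r)) \<partial>\<nu>) = ennreal (kappa p \<theta> / p)"
    proof -
      have "(\<integral>\<^sup>+r. ennreal (indicator {0..} r * exp (- p * r)) \<partial>\<nu>)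
          = (\<integral>\<^sup>+r. ennreal (i r) * ennreal (indicator {0..} r * exp (- p * r)) \<partial>lborel)"
        unfolding \<nu>_def by (rule nn_integral_density) auto
      also have "\<dots> = (\<integral>\<^sup>+r. ennreal (indicator {0..} r * (exp (- p * r) * i r)) \<partial>lborel)"
        using i01 by (intro nn_integral_cong) (auto simp: ennreal_mult[symmetric] mult_ac)
      also have "\<dots> = ennreal (kappa p \<theta> / p)"
        using Li[OF p] has_Laplace_nonneg_iff[of i "kappa p \<theta> / p" p] i01 im kappa_pos[OF p \<theta>] p by simp
      finally show ?thesis .
    qed
    show "integrable \<nu> (\<lambda>r. indicator {0..x} r * (1::real))" if "0 \<le> x" for x
    proof -
      have "emeasure \<nu> {0..x} = (\<integral>\<^sup>+r. ennreal (i r) * indicator {0..x} r \<partial>lborel)"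
        unfolding \<nu>_def by (rule emeasure_density) auto
      also have "\<dots> \<le> (\<integral>\<^sup>+r. 1 * indicator {0..x} r \<partial>lborel)"
        using i01 by (intro nn_integral_mono mult_right_mono) auto
      also have "\<dots> < \<infinity>" using that by simp
      finally have "integrable \<nu> (indicator {0..x} :: real \<Rightarrow> real)"
        by (intro integrable_real_indicator) (simp_all add: sets\<nu>)
      then show ?thesis by simp
    qed
  qed (use p kappa_pos[OF p \<theta>] in auto)
  \<comment> \<open>Divided by \<open>p^2\<close>, the identity has only terms that are transforms
    at \<open>p\<close> of functions free of \<open>p\<close>: of \<open>i\<close>, of its integral
    \<open>conv (\<lambda>_. 1) \<nu>\<close>, of the constant \<open>1\<close>, and of
    \<open>s\<close>.\<close>
  define G where "G t = i t - psi \<theta> * conv (\<lambda>_. 1) \<nu> t - 1 + \<theta> * s t" for t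
  have LG: "has_Laplace G p (kappa p \<theta> / p - psi \<theta> * (1 / p * (kappa p \<theta> / p)) - 1 / p + \<theta> * ((1 / rate p) / p))"
    if p: "0 < p" for p unfolding G_def
    by (intro has_Laplace_add has_Laplace_diff has_Laplace_cmult Li Lc L1 Ls p)
  have iff: "kappa p \<theta> / p - psi \<theta> * (1 / p * (kappa p \<theta> / p)) - 1 / p + \<theta> * ((1 / rate p) / p)
      = ((p - psi \<theta>) * kappa p \<theta> - p * (1 - \<theta> / rate p)) / p^2" if "0 < p" for p
    using that rate_pos[OF that] by (simp add: field_simps power2_eq_square)
  obtain P where P: "0 < P" "\<And>p. P \<le> p \<Longrightarrow> \<theta> < rate p" using rate_unbounded[of \<theta>] by blast
  have zero: "has_Laplace G p 0" if "P \<le> p" for p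
    using LG[of p] iff[of p] kappa_identity_small(2)[of p \<theta>] P that \<theta> by simp
  have "has_Laplace G p 0 \<Longrightarrow> ?thesis" using has_Laplace_unique[OF LG[OF p]] iff[OF p] p by fastforce
  moreover have "has_Laplace G p 0"
  proof (cases "P \<le> p")
    case True
    then show ?thesis by (rule zero)
  next
    case False
    \<comment> \<open>Below \<open>P\<close> the transform of \<open>G\<close> exists by
      \<open>LG\<close>, and it must vanish since those at \<open>P\<close>, \<open>P + 1\<close>
      and so on do.\<close>
    have "kappa p \<theta> / p - psi \<theta> * (1 / p * (kappa p \<theta> / p)) - 1 / p + \<theta> * ((1 / rate p) / p) = 0"
      by (rule Laplace_zero_extend[OF zero _ LG[OF p], of P]) (use False in auto)
    then show ?thesis using LG[OF p] by simp
  qed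
  ultimately show ?thesis by blast
qed

text \<open>At \<theta> = \<open>rate p\<close> the right-hand side of \<open>kappa_identity\<close>
  vanishes while \<open>kappa\<close> is positive.\<close>

lemma psi_rate: "0 < p \<Longrightarrow> psi (rate p) = p"
  using kappa_identity[of p "rate p"] rate_pos[of p] kappa_pos[of p "rate p"] by simp

lemma psi_less: "0 < p \<Longrightarrow> 0 \<le> \<theta> \<Longrightarrow> \<theta> < rate p \<Longrightarrow> psi \<theta> < p"
  by (rule kappa_identity_small)

lemma psi_greater:
  assumes p: "0 < p" and \<theta>: "rate p < \<theta>" shows "p < psi \<theta>"
proof -
  have t0: "0 \<le> \<theta>" using rate_pos[OF p] \<theta> by simp
  have "(p - psi \<theta>) * kappa p \<theta> < 0"
    unfolding kappa_identity[OF p t0] using p \<theta> rate_pos[OF p] by (simp add: mult_less_0_iff field_simps)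
  then show ?thesis using kappa_pos[OF p t0] by (simp add: mult_less_0_iff)
qed

lemma Phi_eq_rate:
  assumes p: "0 < p" shows "Phi psi p = rate p" unfolding Phi_def psi_q_def
proof (rule Greatest_equality)
  show "0 \<le> rate p \<and> psi (rate p) - p = 0" using psi_rate[OF p] rate_pos[OF p] by simp
  show "\<theta> \<le> rate p" if "0 \<le> \<theta> \<and> psi \<theta> - p = 0" for \<theta>
    using psi_greater[OF p, of \<theta>] that by (cases "rate p < \<theta>") auto
qed

lemma psi_eq_iff: "0 < p \<Longrightarrow> 0 \<le> \<theta> \<Longrightarrow> psi \<theta> = p \<longleftrightarrow> \<theta> = rate p"
  using psi_rate psi_less psi_greater by (metis less_irrefl linorder_neqE)

end

section \<open>Scale functions\<close>

text \<open>Continuity from the right is what can be expected: an atom of \<nu> at \<open>x\<close>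
  is counted at \<open>x\<close> and to the right of it, but not to the left.\<close>

lemma conv_right_continuous:
  assumes "prob_space \<nu>" and sets [measurable_cong]: "sets \<nu> = sets borel"
    and fm [measurable]: "f \<in> borel_measurable borel" and f: "continuous_on {0..} f" and x: "0 \<le> x"
    and supp: "AE r in \<nu>. 0 \<le> r"
  shows "continuous (at_right x) (conv f \<nu>)" unfolding continuous_within
proof (rule tendsto_at_right_sequentially[of x "x + 1"])
  interpret prob_space \<nu> by fact
  fix S assume S: "\<And>n. x < S n" "\<And>n. S n < x + 1" "S \<longlonglongrightarrow> x"
  have "compact (f ` {0..x + 1})" by (intro compact_continuous_image continuous_on_subset[OF f]) auto
  then obtain B where B: "\<And>y. y \<in> {0..x + 1} \<Longrightarrow> \<bar>f y\<bar> \<le> B"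
    using compact_imp_bounded bounded_iff by (metis imageI real_norm_def)
  show "(\<lambda>n. conv f \<nu> (S n)) \<longlonglongrightarrow> conv f \<nu> x" unfolding conv_def
  proof (rule integral_dominated_convergence[where w="\<lambda>_. B"])
    show "AE r in \<nu>. (\<lambda>n. indicator {0..S n} r * f (S n - r)) \<longlonglongrightarrow> indicator {0..x} r * f (x - r)" using supp
    proof eventually_elim
      case (elim r)
      show ?case
      proof (cases "r \<le> x")
        case True
        have "(\<lambda>n. S n - r) \<longlonglongrightarrow> x - r" by (intro tendsto_intros S)
        then have "(\<lambda>n. f (S n - r)) \<longlonglongrightarrow> f (x - r)"
        proof (rule continuous_on_tendsto_compose[OF f])
          have "r \<le> S n" for n using S(1)[of n] True by simp
          then show "\<forall>\<^sub>F n in sequentially. S n - r \<in> {0..}" by simp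
        qed (use True in auto)
        moreover have "indicator {0..S n} r = (1::real)" for n using S(1)[of n] True elim by simp
        ultimately show ?thesis using True elim by simp
      next
        case False
        then have "\<forall>\<^sub>F n in sequentially. S n < r" using S(3) by (intro order_tendstoD) auto
        then have "\<forall>\<^sub>F n in sequentially. indicator {0..S n} r * f (S n - r) = 0" by eventually_elim simp
        then show ?thesis using False by (simp add: tendsto_eventually)
      qed
    qed
    show "AE r in \<nu>. norm (indicator {0..S n} r * f (S n - r)) \<le> B" for n
    proof (rule AE_I2)
      fix r
      have "0 \<le> B" using B[of 0] x by simp
      then show "norm (indicator {0..S n} r * f (S n - r)) \<le> B"
        using B[of "S n - r"] S(2)[of n] by (auto simp: indicator_def)
    qed
    show "(\<lambda>r. indicator {0..S n} r * f (S n - r)) \<in> borel_measurable \<nu>" for n by measurable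
    show "(\<lambda>r. indicator {0..x} r * f (x - r)) \<in> borel_measurable \<nu>" by measurable
  qed simp
qed simp

lemma integrable_conv_integrand:
  fixes f :: "real \<Rightarrow> real" and x :: real
  assumes "prob_space \<nu>" and sets [measurable_cong]: "sets \<nu> = sets borel"
    and fm [measurable]: "f \<in> borel_measurable borel" and f: "continuous_on {0..} f"
  shows "integrable \<nu> (\<lambda>r. indicator {0..x} r * f (x - r))"
proof -
  interpret prob_space \<nu> by fact
  have "compact (f ` {0..\<bar>x\<bar>})" by (intro compact_continuous_image continuous_on_subset[OF f]) auto
  then obtain B where B: "\<And>y. y \<in> {0..\<bar>x\<bar>} \<Longrightarrow> \<bar>f y\<bar> \<le> B"
    using compact_imp_bounded bounded_iff by (metis imageI real_norm_def)
  have "0 \<le> B" using B[of 0] by simp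
  then have "AE r in \<nu>. norm (indicator {0..x} r * f (x - r)) \<le> B"
    using B by (intro AE_I2) (auto simp: indicator_def)
  then show ?thesis by (rule integrable_const_bound) measurable
qed

locale scale_setup = spectrally_negative_Levy M X for M :: "'a measure" and X +
  fixes W :: "real \<Rightarrow> real" and q l :: real
  assumes q: "0 \<le> q" and l: "0 < l" and W: "is_scale_function (Laplace_exponent M X) q W"
begin

definition \<Phi> :: real where "\<Phi> = rate (l + q)"

abbreviation Z :: "real \<Rightarrow> real \<Rightarrow> real" where "Z \<equiv> scale_Z psi q W"
abbreviation \<psi>q :: "real \<Rightarrow> real" where "\<psi>q \<equiv> psi_q psi q"
abbreviation \<mu> :: "real measure" where "\<mu> \<equiv> dip_law M X (l + q)"
abbreviation \<kappa> :: "real \<Rightarrow> real" where "\<kappa> \<equiv> kappa (l + q)"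

lemma lq: "0 < l + q" using q l by simp

lemma Phi_pos: "0 < \<Phi>" unfolding \<Phi>_def by (rule rate_pos[OF lq])

lemma Phi_eq: "Phi psi (l + q) = \<Phi>" unfolding \<Phi>_def by (rule Phi_eq_rate[OF lq])

lemma psi_q_Phi: "\<psi>q \<Phi> = l" using psi_rate[OF lq] by (simp add: psi_q_def \<Phi>_def)

lemma psi_q_eq_iff: "0 \<le> \<theta> \<Longrightarrow> \<psi>q \<theta> = l \<longleftrightarrow> \<theta> = \<Phi>"
  using psi_eq_iff[OF lq, of \<theta>] by (auto simp: psi_q_def \<Phi>_def)

lemma kappa_Phi: "0 \<le> \<theta> \<Longrightarrow> (\<psi>q \<theta> - l) * \<kappa> \<theta> = (l + q) / \<Phi> * (\<theta> - \<Phi>)"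
  using kappa_identity[OF lq, of \<theta>] Phi_pos unfolding \<Phi>_def[symmetric] by (simp add: psi_q_def field_simps)

lemma W_neg: "x < 0 \<Longrightarrow> W x = 0" and W_cont: "continuous_on {0..} W" and W_nonneg: "0 \<le> W x"
  and W_integral: "Phi psi q < s \<Longrightarrow> ((\<lambda>x. exp (- s * x) * W x) has_integral (1 / \<psi>q s)) {0..}"
  using W unfolding is_scale_function_def by auto

lemma W_measurable [measurable]: "W \<in> borel_measurable borel"
proof -
  have "continuous_on UNIV (\<lambda>x. W (max 0 x))"
    by (intro continuous_on_compose2[OF W_cont] continuous_intros) auto
  then have [measurable]: "(\<lambda>x. W (max 0 x)) \<in> borel_measurable borel" by (rule borel_measurable_continuous_onI)
  have "W = (\<lambda>x. if x < 0 then 0 else W (max 0 x))" by (auto simp: W_neg max_absorb2)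
  moreover have "(\<lambda>x. if x < 0 then 0 else W (max 0 x)) \<in> borel_measurable borel" by measurable
  ultimately show ?thesis by simp
qed

lemma W_Laplace:
  assumes "Phi psi q < s" shows "has_Laplace W s (1 / \<psi>q s)"
proof -
  have nn: "0 \<le> indicator {0..} x * (exp (- s * x) * W x)" for x using W_nonneg by (simp add: indicator_def)
  have "((\<lambda>x. indicator {0..} x * (exp (- s * x) * W x)) has_integral (1 / \<psi>q s)) UNIV"
  proof -
    have "((\<lambda>x. if x \<in> {0..} then exp (- s * x) * W x else 0) has_integral (1 / \<psi>q s)) UNIV"
      using W_integral[OF assms] by (subst has_integral_restrict_UNIV)
    then show ?thesis by (rule has_integral_eq[rotated]) (auto simp: indicator_def)
  qed
  moreover from this nn have v: "0 \<le> 1 / \<psi>q s" by (rule has_integral_nonneg)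
  ultimately have "(\<integral>\<^sup>+x. ennreal (indicator {0..} x * (exp (- s * x) * W x)) \<partial>lborel) = ennreal (1 / \<psi>q s)"
    using nn by (intro nn_integral_has_integral_lborel) auto
  then show ?thesis using has_Laplace_nonneg_iff[of W "1 / \<psi>q s" s] W_nonneg v by simp
qed

definition J :: "real \<Rightarrow> real \<Rightarrow> real" where "J \<theta> x = integral {0..x} (\<lambda>y. exp (- \<theta> * y) * W y)"

lemma W_exp_cont: "continuous_on {0..x} (\<lambda>y. exp (- \<theta> * y) * W y)"
  by (intro continuous_intros continuous_on_subset[OF W_cont]) auto

lemma J_deriv_within:
  assumes "0 \<le> x" "x \<le> b"
  shows "(J \<theta> has_real_derivative exp (- \<theta> * x) * W x) (at x within {0..b})"
  unfolding J_def[abs_def] by (rule integral_has_real_derivative[OF W_exp_cont]) (use assms in auto)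

lemma J_deriv:
  assumes "0 < x" shows "(J \<theta> has_real_derivative exp (- \<theta> * x) * W x) (at x)"
proof -
  have "x \<in> interior {0..x + 1}" using assms by simp
  then have "at x within {0..x + 1} = at x" by (rule at_within_interior)
  then show ?thesis using J_deriv_within[of x "x + 1" \<theta>] assms by simp
qed

lemma J_0 [simp]: "J \<theta> 0 = 0" by (simp add: J_def)

lemma J_cont: "continuous_on {0..} (J \<theta>)"
  unfolding continuous_on_eq_continuous_within
proof
  fix x :: real assume "x \<in> {0..}"
  then have x: "0 \<le> x" by simp
  have "continuous (at x within {0..x + 1}) (J \<theta>)"
    using J_deriv_within[of x "x + 1" \<theta>] x by (intro DERIV_continuous) auto
  moreover have "at x within {0..x + 1} = at x within {0..}" by (rule at_within_nhd[of _ "{..<x + 1}"]) auto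
  ultimately show "continuous (at x within {0..}) (J \<theta>)" by simp
qed

lemma Z_eq: "Z x \<theta> = exp (\<theta> * x) * (1 - \<psi>q \<theta> * J \<theta> (max 0 x))"
  by (simp add: scale_Z_def J_def max_absorb1 max_absorb2)

lemma Z_cont: "continuous_on UNIV (\<lambda>x. Z x \<theta>)"
  unfolding Z_eq by (intro continuous_intros continuous_on_compose2[OF J_cont]) auto

lemma Z_measurable [measurable]: "(\<lambda>x. Z x \<theta>) \<in> borel_measurable borel"
  by (rule borel_measurable_continuous_onI[OF Z_cont])

lemma Z_neg: "x \<le> 0 \<Longrightarrow> Z x \<theta> = exp (\<theta> * x)"
  by (simp add: Z_eq max_absorb1)

lemma Z_0 [simp]: "Z 0 \<theta> = 1" by (simp add: Z_neg)

text \<open>This is the source of the differential equations used below. Since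
  \<open>\<psi>q \<Phi> = l\<close>, the scale function \<open>W\<close> cancels from the derivative
  of \<open>\<psi>q \<eta> * Z x \<Phi> - l * Z x \<eta>\<close>.\<close>

lemma Z_deriv:
  assumes x: "0 < x"
  shows "((\<lambda>x. Z x \<theta>) has_real_derivative \<theta> * Z x \<theta> - \<psi>q \<theta> * W x) (at x)"
proof -
  have "((\<lambda>x. exp (\<theta> * x) * (1 - \<psi>q \<theta> * J \<theta> x)) has_real_derivative
      (exp (\<theta> * x) * \<theta>) * (1 - \<psi>q \<theta> * J \<theta> x) + (- (\<psi>q \<theta> * (exp (- \<theta> * x) * W x))) * exp (\<theta> * x)) (at x)"
    by (auto intro!: derivative_eq_intros J_deriv x)
  moreover have "(exp (\<theta> * x) * \<theta>) * (1 - \<psi>q \<theta> * J \<theta> x) + (- (\<psi>q \<theta> * (exp (- \<theta> * x) * W x))) * exp (\<theta> * x) = \<theta> * Z x \<theta> - \<psi>q \<theta> * W x"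
    using x by (simp add: Z_eq max_absorb2 exp_minus field_simps)
  ultimately have "((\<lambda>x. exp (\<theta> * x) * (1 - \<psi>q \<theta> * J \<theta> x)) has_real_derivative \<theta> * Z x \<theta> - \<psi>q \<theta> * W x) (at x)" by simp
  then show ?thesis
  proof (rule has_field_derivative_transform_within_open[of _ _ _ "{0<..}"])
    show "exp (\<theta> * y) * (1 - \<psi>q \<theta> * J \<theta> y) = Z y \<theta>" if "y \<in> {0<..}" for y
      using that by (simp add: Z_eq max_absorb2)
  qed (use x in auto)
qed

text \<open>The building block of \<open>Z\<close>, which is
  \<open>exp (\<theta> * x) - \<psi>q \<theta> * b \<theta> x\<close> for \<open>x \<ge> 0\<close>.
  As a convolution with the measure of density \<open>W\<close> it has a transform that can be read
  off.\<close>

definition b :: "real \<Rightarrow> real \<Rightarrow> real" where "b \<theta> = conv (\<lambda>x. exp (\<theta> * x)) (density lborel (\<lambda>r. ennreal (W r)))"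

lemma b_eq:
  assumes "0 \<le> x"
  shows "b \<theta> x = exp (\<theta> * x) * J \<theta> x"
    and "integrable (density lborel (\<lambda>r. ennreal (W r))) (\<lambda>r. indicator {0..x} r * exp (\<theta> * (x - r)))"
proof -
  have si: "set_integrable lborel {0..x} (\<lambda>y. exp (- \<theta> * y) * W y)" unfolding set_integrable_def
    using borel_integrable_compact[of "{0..x}", OF _ W_exp_cont] by simp
  have "integrable lborel (\<lambda>r. exp (\<theta> * x) * (indicator {0..x} r *\<^sub>R (exp (- \<theta> * r) * W r)))"
    using si unfolding set_integrable_def by (rule integrable_mult_right)
  moreover have eq: "exp (\<theta> * x) * (indicator {0..x} r *\<^sub>R (exp (- \<theta> * r) * W r)) = W r *\<^sub>R (indicator {0..x} r * exp (\<theta> * (x - r)))" for r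
    by (simp add: exp_diff exp_minus field_simps right_diff_distrib)
  ultimately have "integrable lborel (\<lambda>r. W r *\<^sub>R (indicator {0..x} r * exp (\<theta> * (x - r))))" by (simp only: eq)
  then show "integrable (density lborel (\<lambda>r. ennreal (W r))) (\<lambda>r. indicator {0..x} r * exp (\<theta> * (x - r)))"
    using W_nonneg by (subst integrable_density) auto
  have "b \<theta> x = (\<integral>r. W r *\<^sub>R (indicator {0..x} r * exp (\<theta> * (x - r))) \<partial>lborel)"
    unfolding b_def conv_def using W_nonneg by (subst integral_density) auto
  also have "\<dots> = exp (\<theta> * x) * (LINT r:{0..x}|lborel. exp (- \<theta> * r) * W r)"
    unfolding eq[symmetric] set_lebesgue_integral_def by (rule integral_mult_right_zero)
  also have "(LINT r:{0..x}|lborel. exp (- \<theta> * r) * W r) = J \<theta> x"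
    unfolding J_def by (rule set_borel_integral_eq_integral(2)[OF si])
  finally show "b \<theta> x = exp (\<theta> * x) * J \<theta> x" .
qed

lemma Z_eq_b: "0 \<le> x \<Longrightarrow> Z x \<theta> = exp (\<theta> * x) - \<psi>q \<theta> * b \<theta> x"
  by (simp add: Z_eq b_eq max_absorb2 algebra_simps)

lemma sigma_finite_W: "sigma_finite_measure (density lborel (\<lambda>r. ennreal (W r)))"
  by (subst sigma_finite_measure.sigma_finite_iff_density_finite[OF lborel.sigma_finite_measure_axioms]) auto

lemma b_measurable [measurable]: "b \<theta> \<in> borel_measurable borel"
  unfolding b_def by (rule measurable_conv[OF sigma_finite_W]) auto

lemma b_cont: "continuous_on {0..} (b \<theta>)"
proof -
  have "continuous_on {0..} (\<lambda>x. exp (\<theta> * x) * J \<theta> x)" by (intro continuous_intros J_cont)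
  then show ?thesis by (rule continuous_on_cong[THEN iffD1, rotated 2]) (auto simp: b_eq)
qed

lemma b_nonneg: "0 \<le> b \<theta> x"
  unfolding b_def conv_def by (rule Bochner_Integration.integral_nonneg) simp

lemma prob_space_\<mu>: "prob_space \<mu>" by (rule prob_space_dip_law[OF lq])

lemma nn_kappa_indicator:
  "0 \<le> s \<Longrightarrow> (\<integral>\<^sup>+r. ennreal (indicator {0..} r * exp (- s * r)) \<partial>\<mu>) = ennreal (\<kappa> s)"
  unfolding nn_kappa[OF lq, symmetric]
proof (rule nn_integral_cong_AE)
  show "AE r in \<mu>. ennreal (indicator {0..} r * exp (- s * r)) = ennreal (exp (- s * r))"
    using AE_dip_law_nonneg by eventually_elim simp
qed

text \<open>In terms of measures this says \<open>\<mu> - l \<mu> * W = (l + q) / \<Phi> * (dW - \<Phi> W dx)\<close>, convolved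
  with \<open>exp (\<theta> x)\<close>.\<close>

lemma convolution_identity:
  assumes \<theta>: "0 \<le> \<theta>" and x: "0 \<le> x"
  shows "conv (\<lambda>x. exp (\<theta> * x)) \<mu> x - l * conv (b \<theta>) \<mu> x = (l + q) / \<Phi> * (W x + (\<theta> - \<Phi>) * b \<theta> x)"
proof -
  define G where "G x = conv (\<lambda>x. exp (\<theta> * x)) \<mu> x - l * conv (b \<theta>) \<mu> x - (l + q) / \<Phi> * (W x + (\<theta> - \<Phi>) * b \<theta> x)" for x
  \<comment> \<open>Beyond this argument all transforms involved exist, and \<open>\<psi>q\<close>
    exceeds \<open>l\<close>, so no denominator vanishes.\<close>
  define P where "P = max (max \<theta> \<Phi>) (Phi psi q) + 1"
  interpret mu: prob_space \<mu> by (rule prob_space_\<mu>)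
  have em: "(\<lambda>x. exp (\<theta> * x)) \<in> borel_measurable borel" by simp
  have ec: "continuous_on {0..} (\<lambda>x. exp (\<theta> * x))" by (intro continuous_intros)
  have "has_Laplace G (P + real n) 0" for n
  proof -
    define s where "s = P + real n"
    have s: "\<theta> < s" "\<Phi> < s" "Phi psi q < s" "0 \<le> s" using \<theta> by (auto simp: s_def P_def max_def)
    have \<psi>: "l < \<psi>q s" using psi_greater[OF lq, of s] s(2) by (simp add: psi_q_def \<Phi>_def)
    have LW: "has_Laplace W s (1 / \<psi>q s)" by (rule W_Laplace[OF s(3)])
    have Le: "has_Laplace (\<lambda>x. exp (\<theta> * x)) s (1 / (s - \<theta>))" by (rule has_Laplace_exp[OF s(1)])
    have LA: "has_Laplace (conv (\<lambda>x. exp (\<theta> * x)) \<mu>) s (1 / (s - \<theta>) * \<kappa> s)"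
      by (rule has_Laplace_conv[OF _ _ em _ _ Le _ nn_kappa_indicator[OF s(4)]])
        (use s kappa_pos[OF lq s(4)] integrable_conv_integrand[OF prob_space_\<mu> _ em ec] in \<open>auto intro: mu.sigma_finite_measure_axioms less_imp_le\<close>)
    have Lb: "has_Laplace (b \<theta>) s (1 / (s - \<theta>) * (1 / \<psi>q s))" unfolding b_def
    proof (rule has_Laplace_conv[OF sigma_finite_W _ em _ b_eq(2) Le])
      have "(\<integral>\<^sup>+r. ennreal (indicator {0..} r * exp (- s * r)) \<partial>density lborel (\<lambda>r. ennreal (W r)))
          = (\<integral>\<^sup>+r. ennreal (W r) * ennreal (indicator {0..} r * exp (- s * r)) \<partial>lborel)"
        by (rule nn_integral_density) auto
      also have "\<dots> = (\<integral>\<^sup>+r. ennreal (indicator {0..} r * (exp (- s * r) * W r)) \<partial>lborel)"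
        using W_nonneg by (intro nn_integral_cong) (auto simp: ennreal_mult[symmetric] mult_ac)
      also have "\<dots> = ennreal (1 / \<psi>q s)" using LW has_Laplace_nonneg_iff[of W "1 / \<psi>q s" s] W_nonneg \<psi> l by simp
      finally show "(\<integral>\<^sup>+r. ennreal (indicator {0..} r * exp (- s * r)) \<partial>density lborel (\<lambda>r. ennreal (W r))) = ennreal (1 / \<psi>q s)" .
    qed (use s \<psi> l in auto)
    have LC: "has_Laplace (conv (b \<theta>) \<mu>) s (1 / (s - \<theta>) * (1 / \<psi>q s) * \<kappa> s)"
      by (rule has_Laplace_conv[OF _ _ b_measurable b_nonneg _ Lb _ nn_kappa_indicator[OF s(4)]])
        (use s \<psi> l kappa_pos[OF lq s(4)] integrable_conv_integrand[OF prob_space_\<mu> _ b_measurable b_cont] in \<open>auto intro: mu.sigma_finite_measure_axioms less_imp_le\<close>)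
    have "has_Laplace G s (1 / (s - \<theta>) * \<kappa> s - l * (1 / (s - \<theta>) * (1 / \<psi>q s) * \<kappa> s)
        - (l + q) / \<Phi> * (1 / \<psi>q s + (\<theta> - \<Phi>) * (1 / (s - \<theta>) * (1 / \<psi>q s))))"
      unfolding G_def by (intro has_Laplace_diff has_Laplace_cmult has_Laplace_add LA LC LW Lb)
    \<comment> \<open>Over the common denominator the numerator is precisely the difference of the
      two sides of \<open>kappa_Phi\<close>.\<close>
    moreover have "1 / (s - \<theta>) * \<kappa> s - l * (1 / (s - \<theta>) * (1 / \<psi>q s) * \<kappa> s)
        - (l + q) / \<Phi> * (1 / \<psi>q s + (\<theta> - \<Phi>) * (1 / (s - \<theta>) * (1 / \<psi>q s)))
        = ((\<psi>q s - l) * \<kappa> s - (l + q) / \<Phi> * (s - \<Phi>)) / ((s - \<theta>) * \<psi>q s)"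
      using s \<psi> l Phi_pos by (simp add: divide_simps) (simp add: algebra_simps)
    ultimately show "has_Laplace G (P + real n) 0" using kappa_Phi[OF s(4)] by (simp add: s_def)
  qed
  moreover have "continuous (at_right y) G" if "0 \<le> y" for y
  proof -
    have r: "continuous (at_right y) f" if "continuous_on {0..} f" for f :: "real \<Rightarrow> real"
      using that \<open>0 \<le> y\<close> by (auto simp: continuous_on_eq_continuous_within intro: continuous_within_subset)
    show ?thesis unfolding G_def using AE_dip_law_nonneg that
      by (intro continuous_intros conv_right_continuous prob_space_\<mu> em ec b_measurable b_cont r W_cont) auto
  qed
  ultimately have "G x = 0" using x by (intro Laplace_zero_unique[where f=G and P=P]) auto
  then show ?thesis by (simp add: G_def)
qed

text \<open>For \<open>r \<le> x\<close> the integrand equals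
  \<open>(\<psi>q \<theta> - l) * exp (\<theta> * (x - r))\<close> minus \<open>\<psi>q \<theta> *
  (exp (\<theta> * (x - r)) - l * b \<theta> (x - r))\<close>. So it is an exponential on the whole
  half-line, whose mean is known by \<open>kappa_Phi\<close>, minus a convolution known by
  \<open>convolution_identity\<close>. The two branches are those that both reflections produce; the
  second one vanishes at \<theta> = \<Phi>.\<close>

theorem dip_integral_Z:
  assumes \<theta>: "0 \<le> \<theta>"
  shows "(\<integral>r. (if r \<le> x then - l * Z (x - r) \<theta> else (\<psi>q \<theta> - l) * exp (\<theta> * (x - r))) \<partial>\<mu>)
    = (l + q) / \<Phi> * ((\<theta> - \<Phi>) * Z x \<theta> - \<psi>q \<theta> * W x)"
proof -
  interpret mu: prob_space \<mu> by (rule prob_space_\<mu>)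
  define A where "A = conv (\<lambda>x. exp (\<theta> * x)) \<mu> x"
  define C where "C = conv (b \<theta>) \<mu> x"
  have em: "(\<lambda>x. exp (\<theta> * x)) \<in> borel_measurable borel" by simp
  have ec: "continuous_on {0..} (\<lambda>x. exp (\<theta> * x))" by (intro continuous_intros)
  have iA: "integrable \<mu> (\<lambda>r. indicator {0..x} r * exp (\<theta> * (x - r)))"
    by (rule integrable_conv_integrand[OF prob_space_\<mu> _ em ec]) simp
  have iC: "integrable \<mu> (\<lambda>r. indicator {0..x} r * b \<theta> (x - r))"
    by (rule integrable_conv_integrand[OF prob_space_\<mu> _ b_measurable b_cont]) simp
  have iE: "integrable \<mu> (\<lambda>r. exp (\<theta> * x) * exp (- \<theta> * r))"
    by (intro integrable_mult_right integrable_kappa[OF lq \<theta>])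
  have "(\<integral>r. (if r \<le> x then - l * Z (x - r) \<theta> else (\<psi>q \<theta> - l) * exp (\<theta> * (x - r))) \<partial>\<mu>)
     = (\<integral>r. (\<psi>q \<theta> - l) * (exp (\<theta> * x) * exp (- \<theta> * r)) - \<psi>q \<theta> * (indicator {0..x} r * exp (\<theta> * (x - r)))
         + l * \<psi>q \<theta> * (indicator {0..x} r * b \<theta> (x - r)) \<partial>\<mu>)"
  proof (rule integral_cong_AE)
    show "AE r in \<mu>. (if r \<le> x then - l * Z (x - r) \<theta> else (\<psi>q \<theta> - l) * exp (\<theta> * (x - r)))
      = (\<psi>q \<theta> - l) * (exp (\<theta> * x) * exp (- \<theta> * r)) - \<psi>q \<theta> * (indicator {0..x} r * exp (\<theta> * (x - r)))
         + l * \<psi>q \<theta> * (indicator {0..x} r * b \<theta> (x - r))" using AE_dip_law_nonneg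
    proof eventually_elim
      case (elim r)
      have "exp (\<theta> * x) * exp (- \<theta> * r) = exp (\<theta> * (x - r))" by (simp add: exp_add[symmetric] algebra_simps)
      then show ?case using elim by (auto simp: Z_eq_b indicator_def algebra_simps)
    qed
  qed measurable
  also have "\<dots> = (\<psi>q \<theta> - l) * (exp (\<theta> * x) * \<kappa> \<theta>) - \<psi>q \<theta> * A + l * \<psi>q \<theta> * C"
    unfolding A_def C_def conv_def kappa_def
    using iA iC iE by (simp add: Bochner_Integration.integral_add Bochner_Integration.integral_diff)
  also have "\<dots> = (l + q) / \<Phi> * ((\<theta> - \<Phi>) * Z x \<theta> - \<psi>q \<theta> * W x)"
  proof (cases "0 \<le> x")
    case True
    have "A - l * C = (l + q) / \<Phi> * (W x + (\<theta> - \<Phi>) * b \<theta> x)"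
      unfolding A_def C_def by (rule convolution_identity[OF \<theta> True])
    moreover have "\<psi>q \<theta> * A - l * \<psi>q \<theta> * C = \<psi>q \<theta> * (A - l * C)" by (simp add: algebra_simps)
    ultimately have "\<psi>q \<theta> * A - l * \<psi>q \<theta> * C = \<psi>q \<theta> * ((l + q) / \<Phi> * (W x + (\<theta> - \<Phi>) * b \<theta> x))" by (simp only:)
    moreover have "(\<psi>q \<theta> - l) * (exp (\<theta> * x) * \<kappa> \<theta>) = exp (\<theta> * x) * ((l + q) / \<Phi> * (\<theta> - \<Phi>))"
      unfolding kappa_Phi[OF \<theta>, symmetric] by simp
    moreover define k where "k = (l + q) / \<Phi>"
    ultimately show ?thesis unfolding Z_eq_b[OF True] k_def[symmetric] by (simp add: algebra_simps)
  next
    case False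
    \<comment> \<open>For \<open>x < 0\<close> only the exponential branch is met, and
      \<open>Z\<close> and \<open>W\<close> have their values on the negative axis.\<close>
    then have "A = 0" "C = 0" unfolding A_def C_def conv_def by simp_all
    then show ?thesis using False kappa_Phi[OF \<theta>] by (simp add: Z_neg W_neg) (simp add: mult_ac)
  qed
  finally show ?thesis .
qed

end

section \<open>The chain of observed states\<close>

lemma indep_of_arrivals_uminus:
  assumes "indep_of_arrivals M X T" shows "indep_of_arrivals M (neg X) T"
proof -
  have "{(\<lambda>\<omega>. - X t \<omega>) -` B \<inter> space M | t B. 0 \<le> t \<and> B \<in> sets borel} = {X t -` B \<inter> space M | t B. 0 \<le> t \<and> B \<in> sets borel}"
    (is "?L = ?R")
  proof (intro equalityI subsetI)
    have m: "uminus -` B \<in> sets borel" if "B \<in> sets borel" for B :: "real set"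
      using measurable_sets[of uminus borel borel B] that by simp
    fix A
    { assume "A \<in> ?L"
      then obtain t B where "0 \<le> t" "B \<in> sets borel" "A = X t -` (uminus -` B) \<inter> space M" by auto
      then show "A \<in> ?R" using m[of B] by blast }
    { assume "A \<in> ?R"
      then obtain t B where B: "0 \<le> t" "B \<in> sets borel" "A = X t -` B \<inter> space M" by auto
      then have "A = (\<lambda>\<omega>. - X t \<omega>) -` (uminus -` B) \<inter> space M" by auto
      then show "A \<in> ?L" using m[of B] B by blast }
  qed
  then show ?thesis using assms unfolding indep_of_arrivals_def by simp
qed

lemma (in observed_Levy) observed_uminus: "observed_Levy M (neg X) l T"
proof -
  interpret N: cadlag_Levy M "neg X" by (rule uminus)
  show ?thesis by unfold_locales (rule indep_of_arrivals_uminus[OF indep_arrivals])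
qed

lemma reg_above_eq: "reg_above a w t = reg_below (\<lambda>s. a - w s) t" if "bdd_above (w ` {0..t})" "0 \<le> t"
proof -
  have bd: "bdd_above (w ` {0..t})" by (rule that)
  have "(INF s\<in>{0..t}. a - w s) = a - (SUP s\<in>{0..t}. w s)"
  proof (rule antisym)
    have "(SUP s\<in>{0..t}. w s) \<le> a - (INF s\<in>{0..t}. a - w s)"
    proof (rule cSUP_least)
      fix s assume s: "s \<in> {0..t}"
      obtain C where "\<forall>y\<in>w ` {0..t}. y \<le> C" using bd unfolding bdd_above_def by blast
      then have C: "w s \<le> C" if "s \<in> {0..t}" for s using that by blast
      have "bdd_below ((\<lambda>s. a - w s) ` {0..t})" using C by (intro bdd_belowI[of _ "a - C"]) force
      from cINF_lower[OF this s] show "w s \<le> a - (INF s\<in>{0..t}. a - w s)" by simp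
    qed (use that in auto)
    then show "(INF s\<in>{0..t}. a - w s) \<le> a - (SUP s\<in>{0..t}. w s)" by simp
    show "a - (SUP s\<in>{0..t}. w s) \<le> (INF s\<in>{0..t}. a - w s)"
      using that cSUP_upper[OF _ that(1)] by (intro cINF_greatest) auto
  qed
  then show ?thesis by (simp add: reg_above_def reg_below_def)
qed

text \<open>A block \<open>v\<close> consists of length, depth and rise. From \<open>s\<close> the
  reflected path sinks by the depth, but not below \<open>0\<close>, and then rises; the part of the
  depth that exceeds \<open>s\<close> goes into the regulator, as \<open>weight\<close>
  records.\<close>

definition step :: "real \<Rightarrow> real \<times> real \<times> real \<Rightarrow> real" where
  "step s v = max 0 (s - fst (snd v)) + snd (snd v)"

definition weight :: "real \<Rightarrow> real \<Rightarrow> real \<Rightarrow> real \<times> real \<times> real \<Rightarrow> real" where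
  "weight q \<eta> s v = exp (- q * max 0 (fst v) - \<eta> * max 0 (fst (snd v) - s))"

text \<open>The first component is the accumulated discount, set to \<open>0\<close> once the chain has been above \<open>a\<close>.\<close>

primrec chain :: "real \<Rightarrow> real \<Rightarrow> real \<Rightarrow> real \<Rightarrow> (nat \<Rightarrow> real \<times> real \<times> real) \<Rightarrow> nat \<Rightarrow> real \<times> real" where
  "chain q \<eta> a s v 0 = (1, s)"
| "chain q \<eta> a s v (Suc n) =
     (fst (chain q \<eta> a s v n) * weight q \<eta> (snd (chain q \<eta> a s v n)) (v n) * of_bool (step (snd (chain q \<eta> a s v n)) (v n) \<le> a),
      step (snd (chain q \<eta> a s v n)) (v n))"

definition payoff :: "real \<Rightarrow> real \<Rightarrow> real \<Rightarrow> real" where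
  "payoff a \<theta> y = of_bool (a < y) * exp (- \<theta> * (y - a))"

text \<open>Index \<open>n\<close> belongs to arrival \<open>Suc n\<close>; the initial state is
  never tested because time \<open>0\<close> is not an arrival. At most one index has a non-zero
  reward, the one of the observed passage, so the sum over \<open>n\<close> is the discounted
  payoff.\<close>

definition reward :: "real \<Rightarrow> real \<Rightarrow> real \<Rightarrow> real \<Rightarrow> real \<Rightarrow> (nat \<Rightarrow> real \<times> real \<times> real) \<Rightarrow> nat \<Rightarrow> real" where
  "reward q \<eta> \<theta> a s v n = fst (chain q \<eta> a s v n) * weight q \<eta> (snd (chain q \<eta> a s v n)) (v n)
     * payoff a \<theta> (step (snd (chain q \<eta> a s v n)) (v n))"

lemma measurable_triple [measurable]:
  "(fst :: real \<times> real \<times> real \<Rightarrow> real) \<in> borel_measurable borel"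
  "(\<lambda>v :: real \<times> real \<times> real. fst (snd v)) \<in> borel_measurable borel"
  "(\<lambda>v :: real \<times> real \<times> real. snd (snd v)) \<in> borel_measurable borel" by (auto simp: borel_prod[symmetric])

lemma measurable_step:
  assumes [measurable]: "s \<in> borel_measurable Q" and v: "v \<in> borel_measurable Q"
  shows "(\<lambda>z. step (s z) (v z)) \<in> borel_measurable Q" "(\<lambda>z. weight q \<eta> (s z) (v z)) \<in> borel_measurable Q"
proof -
  have [measurable]: "(\<lambda>z. fst (v z)) \<in> borel_measurable Q" "(\<lambda>z. fst (snd (v z))) \<in> borel_measurable Q" "(\<lambda>z. snd (snd (v z))) \<in> borel_measurable Q"
    using measurable_compose[OF v measurable_triple(1)] measurable_compose[OF v measurable_triple(2)] measurable_compose[OF v measurable_triple(3)] by auto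
  show "(\<lambda>z. step (s z) (v z)) \<in> borel_measurable Q" unfolding step_def by measurable
  show "(\<lambda>z. weight q \<eta> (s z) (v z)) \<in> borel_measurable Q" unfolding weight_def by measurable
qed

lemma measurable_payoff [measurable]: "payoff a \<theta> \<in> borel_measurable borel"
  unfolding payoff_def[abs_def] of_bool_def by measurable

lemma measurable_chain:
  assumes s: "s \<in> borel_measurable Q" and v: "\<And>i. i < n \<Longrightarrow> v i \<in> borel_measurable Q"
  shows "(\<lambda>z. fst (chain q \<eta> a (s z) (\<lambda>i. v i z) n)) \<in> borel_measurable Q"
    and "(\<lambda>z. snd (chain q \<eta> a (s z) (\<lambda>i. v i z) n)) \<in> borel_measurable Q"
proof -
  have "(\<lambda>z. fst (chain q \<eta> a (s z) (\<lambda>i. v i z) n)) \<in> borel_measurable Q \<and>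
    (\<lambda>z. snd (chain q \<eta> a (s z) (\<lambda>i. v i z) n)) \<in> borel_measurable Q" using v
  proof (induction n)
    case (Suc n)
    have IH [measurable]: "(\<lambda>z. fst (chain q \<eta> a (s z) (\<lambda>i. v i z) n)) \<in> borel_measurable Q"
       "(\<lambda>z. snd (chain q \<eta> a (s z) (\<lambda>i. v i z) n)) \<in> borel_measurable Q" using Suc by auto
    have [measurable]: "(\<lambda>z. step (snd (chain q \<eta> a (s z) (\<lambda>i. v i z) n)) (v n z)) \<in> borel_measurable Q"
      "(\<lambda>z. weight q \<eta> (snd (chain q \<eta> a (s z) (\<lambda>i. v i z) n)) (v n z)) \<in> borel_measurable Q"
      using measurable_step[OF IH(2), of "v n"] Suc.prems by auto
    show ?case unfolding chain.simps fst_conv snd_conv of_bool_def by (intro conjI; measurable)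
  qed (use s in auto)
  then show "(\<lambda>z. fst (chain q \<eta> a (s z) (\<lambda>i. v i z) n)) \<in> borel_measurable Q"
    and "(\<lambda>z. snd (chain q \<eta> a (s z) (\<lambda>i. v i z) n)) \<in> borel_measurable Q" by auto
qed

lemma measurable_reward:
  assumes s: "s \<in> borel_measurable Q" and v: "\<And>i. i \<le> n \<Longrightarrow> v i \<in> borel_measurable Q"
  shows "(\<lambda>z. reward q \<eta> \<theta> a (s z) (\<lambda>i. v i z) n) \<in> borel_measurable Q"
proof -
  have c [measurable]: "(\<lambda>z. fst (chain q \<eta> a (s z) (\<lambda>i. v i z) n)) \<in> borel_measurable Q"
     "(\<lambda>z. snd (chain q \<eta> a (s z) (\<lambda>i. v i z) n)) \<in> borel_measurable Q"
    using v by (auto intro!: measurable_chain s)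
  have [measurable]: "(\<lambda>z. step (snd (chain q \<eta> a (s z) (\<lambda>i. v i z) n)) (v n z)) \<in> borel_measurable Q"
    "(\<lambda>z. weight q \<eta> (snd (chain q \<eta> a (s z) (\<lambda>i. v i z) n)) (v n z)) \<in> borel_measurable Q"
    using measurable_step[OF c(2), of "v n"] v[of n] by auto
  show ?thesis unfolding reward_def by measurable
qed

lemma chain_cong: "(\<And>i. i < n \<Longrightarrow> v i = v' i) \<Longrightarrow> chain q \<eta> a s v n = chain q \<eta> a s v' n"
  by (induction n) auto

lemma weight_range:
  assumes "0 \<le> q" "0 \<le> \<eta>" shows "0 < weight q \<eta> s v \<and> weight q \<eta> s v \<le> 1"
proof -
  have "0 \<le> q * max 0 (fst v)" "0 \<le> \<eta> * max 0 (fst (snd v) - s)" using assms by auto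
  then show ?thesis unfolding weight_def by simp
qed

lemma chain_range: "0 \<le> q \<Longrightarrow> 0 \<le> \<eta> \<Longrightarrow> 0 \<le> fst (chain q \<eta> a s v n) \<and> fst (chain q \<eta> a s v n) \<le> 1"
proof (induction n)
  case (Suc n)
  then show ?case using weight_range[of q \<eta> "snd (chain q \<eta> a s v n)" "v n"]
    by (auto intro!: mult_le_one mult_nonneg_nonneg)
qed simp

lemma payoff_range: "0 \<le> \<theta> \<Longrightarrow> 0 \<le> payoff a \<theta> y \<and> payoff a \<theta> y \<le> 1"
  unfolding payoff_def by (auto simp: mult_nonneg_nonneg)

lemma reward_range: "0 \<le> q \<Longrightarrow> 0 \<le> \<eta> \<Longrightarrow> 0 \<le> \<theta> \<Longrightarrow> 0 \<le> reward q \<eta> \<theta> a s v n \<and> reward q \<eta> \<theta> a s v n \<le> 1"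
  unfolding reward_def
  using chain_range[of q \<eta> a s v n] weight_range[of q \<eta> "snd (chain q \<eta> a s v n)" "v n"] payoff_range[of \<theta> a "step (snd (chain q \<eta> a s v n)) (v n)"]
  by (auto intro!: mult_le_one mult_nonneg_nonneg)

context observed_Levy
begin

text \<open>One step of the chain: payoff, scaled by \<beta>, beyond \<open>a\<close>, and
  continuation value \<open>F\<close> otherwise. The scale \<beta> keeps the inhomogeneous and the
  homogeneous equation under one roof.\<close>

definition renewal :: "real \<Rightarrow> real \<Rightarrow> real \<Rightarrow> real \<Rightarrow> real \<Rightarrow> (real \<Rightarrow> real) \<Rightarrow> real \<Rightarrow> real" where
  "renewal q \<eta> \<theta> a \<beta> F s = (\<integral>v. weight q \<eta> s v * (if a < step s v then \<beta> * payoff a \<theta> (step s v) else F (step s v)) \<partial>block_law)"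

text \<open>The state before block \<open>n\<close> is a function of the earlier blocks, hence
  independent of \<open>V n\<close>, which can be integrated out.\<close>

lemma expectation_chain:
  fixes h :: "(real \<times> real) \<times> (real \<times> real \<times> real) \<Rightarrow> real"
  assumes h: "h \<in> borel_measurable (borel \<Otimes>\<^sub>M borel)" "\<And>z. \<bar>h z\<bar> \<le> C"
  shows "expectation (\<lambda>\<omega>. h (chain q \<eta> a s (\<lambda>i. V i \<omega>) n, V n \<omega>))
    = expectation (\<lambda>\<omega>. \<integral>v. h (chain q \<eta> a s (\<lambda>i. V i \<omega>) n, v) \<partial>block_law)"
proof -
  \<comment> \<open>The dummy component gives the state the type of a block, as
    \<open>indep_var\<close> relates random variables of one type.\<close>
  define e where "e y = (0 :: real, y)" for y :: "real \<times> real"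
  define Y where "Y \<omega> = e (chain q \<eta> a s (\<lambda>i. V i \<omega>) n)" for \<omega>
  define h' where "h' z = h (snd (fst z), snd z)" for z :: "(real \<times> real \<times> real) \<times> (real \<times> real \<times> real)"
  have snd_m: "snd \<in> measurable borel (borel :: (real \<times> real) measure)"
    by (intro borel_measurable_continuous_onI continuous_intros)
  have h': "h' \<in> borel_measurable (borel \<Otimes>\<^sub>M borel)" unfolding h'_def
    by (rule measurable_compose[OF measurable_Pair[OF measurable_compose[OF measurable_fst snd_m] measurable_snd] h(1)])
  have "indep_var (PiM {..<n} (\<lambda>_. borel)) (\<lambda>\<omega>. restrict (\<lambda>i. V i \<omega>) {..<n}) (PiM {n} (\<lambda>_. borel)) (\<lambda>\<omega>. restrict (\<lambda>i. V i \<omega>) {n})"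
    by (rule indep_var_restrict[OF indep_V]) auto
  moreover have cm: "(\<lambda>y. e (chain q \<eta> a s y n)) \<in> measurable (PiM {..<n} (\<lambda>_. borel)) borel"
  proof -
    have "(\<lambda>y. (0 :: real, fst (chain q \<eta> a ((\<lambda>_. s) y) (\<lambda>i. (\<lambda>y. y i) y) n), snd (chain q \<eta> a ((\<lambda>_. s) y) (\<lambda>i. (\<lambda>y. y i) y) n)))
        \<in> borel_measurable (PiM {..<n} (\<lambda>_. borel))"
      by (intro borel_measurable_Pair measurable_chain measurable_component_singleton) auto
    then show ?thesis by (simp add: e_def)
  qed
  moreover have "(\<lambda>y. y n) \<in> measurable (PiM {n} (\<lambda>_. borel :: (real \<times> real \<times> real) measure)) borel"
    by (rule measurable_component_singleton) simp
  ultimately have "indep_var borel ((\<lambda>y. e (chain q \<eta> a s y n)) \<circ> (\<lambda>\<omega>. restrict (\<lambda>i. V i \<omega>) {..<n})) borel ((\<lambda>y. y n) \<circ> (\<lambda>\<omega>. restrict (\<lambda>i. V i \<omega>) {n}))"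
    by (rule indep_var_compose)
  moreover have "(\<lambda>y. e (chain q \<eta> a s y n)) \<circ> (\<lambda>\<omega>. restrict (\<lambda>i. V i \<omega>) {..<n}) = Y"
    by (auto simp: Y_def fun_eq_iff intro!: arg_cong[of _ _ e] chain_cong)
  moreover have "(\<lambda>y. y n) \<circ> (\<lambda>\<omega>. restrict (\<lambda>i. V i \<omega>) {n}) = V n" by (auto simp: fun_eq_iff)
  ultimately have ind: "indep_var borel Y borel (V n)" by simp
  then have Ym: "Y \<in> borel_measurable M" by (rule indep_var_rv1)
  have eq: "distr M borel Y \<Otimes>\<^sub>M block_law = distr M (borel \<Otimes>\<^sub>M borel) (\<lambda>\<omega>. (Y \<omega>, V n \<omega>))"
    using ind unfolding indep_var_distribution_eq distr_V by simp
  interpret DY: prob_space "distr M borel Y" by (rule prob_space_distr[OF Ym])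
  interpret B: prob_space block_law by (rule prob_space_block_law)
  interpret P: pair_prob_space "distr M borel Y" block_law ..
  have sp: "sets (distr M borel Y \<Otimes>\<^sub>M block_law) = sets (borel \<Otimes>\<^sub>M borel)" by (intro sets_pair_measure_cong) auto
  have hm: "h' \<in> borel_measurable (distr M borel Y \<Otimes>\<^sub>M block_law)" using h' measurable_cong_sets[OF sp refl] by blast
  have YV: "(\<lambda>\<omega>. (Y \<omega>, V n \<omega>)) \<in> measurable M (borel \<Otimes>\<^sub>M borel)" by (intro measurable_Pair Ym measurable_V)
  have "expectation (\<lambda>\<omega>. h' (Y \<omega>, V n \<omega>)) = (\<integral>z. h' z \<partial>(distr M borel Y \<Otimes>\<^sub>M block_law))"
    unfolding eq by (rule integral_distr[OF YV h', symmetric])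
  also have "\<dots> = (\<integral>y. \<integral>v. h' (y, v) \<partial>block_law \<partial>distr M borel Y)"
  proof (rule P.integral_fst'[symmetric])
    show "integrable (distr M borel Y \<Otimes>\<^sub>M block_law) h'"
      using h(2) by (intro P.P.integrable_const_bound[OF _ hm, of C] AE_I2) (simp add: h'_def)
  qed
  also have "\<dots> = expectation (\<lambda>\<omega>. \<integral>v. h' (Y \<omega>, v) \<partial>block_law)"
  proof (rule integral_distr[OF Ym])
    have "(\<lambda>y. \<integral>v. h' (y, v) \<partial>block_law) \<in> borel_measurable (distr M borel Y)"
      using hm by (intro B.borel_measurable_lebesgue_integral) (simp add: case_prod_unfold)
    then show "(\<lambda>y. \<integral>v. h' (y, v) \<partial>block_law) \<in> borel_measurable borel" by simp
  qed
  finally show ?thesis by (simp add: Y_def h'_def e_def)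
qed

text \<open>Iterating the fixed-point equation writes \<open>renewal\<close> at \<open>s\<close> as
  a partial sum of expected rewards plus a remainder, which the contraction makes geometrically
  small. The equation is assumed only on the interval from \<open>0\<close> to \<open>a\<close>,
  where the surviving chain lives after one step; so the start \<open>s\<close> is arbitrary, and
  the limit is \<open>renewal\<close> at \<open>s\<close> rather than \<open>F s\<close>.\<close>

lemma renewal_limit:
  assumes q: "0 \<le> q" and \<eta>: "0 \<le> \<eta>" and \<theta>: "0 \<le> \<theta>"
    and F [measurable]: "F \<in> borel_measurable borel" and FB: "\<And>y. \<bar>F y\<bar> \<le> B"
    and fix_eq: "\<And>s. 0 \<le> s \<Longrightarrow> s \<le> a \<Longrightarrow> renewal q \<eta> \<theta> a \<beta> F s = F s"
    and contr: "\<And>s. 0 \<le> s \<Longrightarrow> s \<le> a \<Longrightarrow> (\<integral>v. weight q \<eta> s v * of_bool (step s v \<le> a) \<partial>block_law) \<le> c" and c: "0 \<le> c" "c < 1"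
  shows "(\<lambda>N. \<Sum>n<N. \<beta> * expectation (\<lambda>\<omega>. reward q \<eta> \<theta> a s (\<lambda>i. V i \<omega>) n)) \<longlonglongrightarrow> renewal q \<eta> \<theta> a \<beta> F s"
proof -
  let ?c = "\<lambda>\<omega> n. chain q \<eta> a s (\<lambda>i. V i \<omega>) n"
  \<comment> \<open>Clipping bounds the integrands on the whole space, as
    \<open>expectation_chain\<close> demands; on the accumulated discount it acts as the
    identity.\<close>
  define cl where "cl x = max 0 (min 1 x)" for x :: real
  have cl: "0 \<le> cl x" "cl x \<le> 1" for x by (auto simp: cl_def)
  have clc: "cl (fst (?c \<omega> n)) = fst (?c \<omega> n)" for \<omega> n
    using chain_range[OF q \<eta>, of a s "\<lambda>i. V i \<omega>" n] by (simp add: cl_def)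
  have [measurable]: "cl \<in> borel_measurable borel" unfolding cl_def[abs_def] by measurable
  have B0: "0 \<le> B" using FB[of 0] by simp
  have m [measurable]: "(\<lambda>z :: (real \<times> real) \<times> (real \<times> real \<times> real). fst (fst z)) \<in> borel_measurable (borel \<Otimes>\<^sub>M borel)"
     "(\<lambda>z :: (real \<times> real) \<times> (real \<times> real \<times> real). step (snd (fst z)) (snd z)) \<in> borel_measurable (borel \<Otimes>\<^sub>M borel)"
     "(\<lambda>z :: (real \<times> real) \<times> (real \<times> real \<times> real). weight q \<eta> (snd (fst z)) (snd z)) \<in> borel_measurable (borel \<Otimes>\<^sub>M borel)"
    by (auto intro!: measurable_step measurable_compose[OF measurable_fst] simp: borel_prod[symmetric])
  define h1 where "h1 z = cl (fst (fst z)) * (weight q \<eta> (snd (fst z)) (snd z) *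
      (if a < step (snd (fst z)) (snd z) then \<beta> * payoff a \<theta> (step (snd (fst z)) (snd z)) else F (step (snd (fst z)) (snd z))))"
    for z :: "(real \<times> real) \<times> (real \<times> real \<times> real)"
  have h1m: "h1 \<in> borel_measurable (borel \<Otimes>\<^sub>M borel)" unfolding h1_def[abs_def] by measurable
  have h1b: "\<bar>h1 z\<bar> \<le> \<bar>\<beta>\<bar> + B" for z
  proof -
    have "\<bar>h1 z\<bar> \<le> 1 * (1 * (\<bar>\<beta>\<bar> + B))"
      unfolding h1_def abs_mult using cl weight_range[OF q \<eta>, of "snd (fst z)" "snd z"]
    proof (intro mult_mono)
      show "\<bar>if a < step (snd (fst z)) (snd z) then \<beta> * payoff a \<theta> (step (snd (fst z)) (snd z)) else F (step (snd (fst z)) (snd z))\<bar> \<le> \<bar>\<beta>\<bar> + B"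
        using FB[of "step (snd (fst z)) (snd z)"] payoff_range[OF \<theta>, of a "step (snd (fst z)) (snd z)"] B0
        by (auto simp: abs_mult intro: order_trans[OF mult_left_le])
    qed (auto simp: abs_of_pos)
    then show ?thesis by simp
  qed
  define h2 where "h2 z = cl (fst (fst z)) * (weight q \<eta> (snd (fst z)) (snd z) * of_bool (step (snd (fst z)) (snd z) \<le> a))"
    for z :: "(real \<times> real) \<times> (real \<times> real \<times> real)"
  have h2m: "h2 \<in> borel_measurable (borel \<Otimes>\<^sub>M borel)" unfolding h2_def[abs_def] of_bool_def by measurable
  have h2b: "\<bar>h2 z\<bar> \<le> 1" for z unfolding h2_def using cl weight_range[OF q \<eta>, of "snd (fst z)" "snd z"]
    by (auto simp: abs_mult intro!: mult_le_one)
  have cm [measurable]: "(\<lambda>\<omega>. fst (?c \<omega> n)) \<in> borel_measurable M" "(\<lambda>\<omega>. snd (?c \<omega> n)) \<in> borel_measurable M" for n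
    by (auto intro!: measurable_chain)
  have rm [measurable]: "(\<lambda>\<omega>. reward q \<eta> \<theta> a s (\<lambda>i. V i \<omega>) n) \<in> borel_measurable M" for n
    by (rule measurable_reward) auto
  have ir: "integrable M (\<lambda>\<omega>. reward q \<eta> \<theta> a s (\<lambda>i. V i \<omega>) n)" for n
    using reward_range[OF q \<eta> \<theta>] by (intro integrable_const_bound[of _ 1]) auto
  have iF: "integrable M (\<lambda>\<omega>. fst (?c \<omega> n) * F (snd (?c \<omega> n)))" for n
  proof (rule integrable_const_bound[of _ B])
    show "AE \<omega> in M. norm (fst (?c \<omega> n) * F (snd (?c \<omega> n))) \<le> B"
    proof (rule AE_I2)
      fix \<omega>
      have "\<bar>fst (?c \<omega> n) * F (snd (?c \<omega> n))\<bar> \<le> 1 * B"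
        unfolding abs_mult using chain_range[OF q \<eta>, of a s "\<lambda>i. V i \<omega>" n] FB by (intro mult_mono) auto
      then show "norm (fst (?c \<omega> n) * F (snd (?c \<omega> n))) \<le> B" by simp
    qed
  qed measurable
  have iQ: "integrable M (\<lambda>\<omega>. fst (?c \<omega> n))" for n
    using chain_range[OF q \<eta>] by (intro integrable_const_bound[of _ 1]) auto
  define R where "R n = expectation (\<lambda>\<omega>. fst (?c \<omega> n) * F (snd (?c \<omega> n)))" for n
  define Q where "Q n = expectation (\<lambda>\<omega>. fst (?c \<omega> n))" for n
  define p where "p n = \<beta> * expectation (\<lambda>\<omega>. reward q \<eta> \<theta> a s (\<lambda>i. V i \<omega>) n)" for n
  have one_step: "p n + R (Suc n) = expectation (\<lambda>\<omega>. fst (?c \<omega> n) * renewal q \<eta> \<theta> a \<beta> F (snd (?c \<omega> n)))" for n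
  proof -
    have "p n + R (Suc n) = expectation (\<lambda>\<omega>. \<beta> * reward q \<eta> \<theta> a s (\<lambda>i. V i \<omega>) n + fst (?c \<omega> (Suc n)) * F (snd (?c \<omega> (Suc n))))"
      unfolding p_def R_def using ir iF[of "Suc n"] by (subst Bochner_Integration.integral_add) auto
    also have "\<dots> = expectation (\<lambda>\<omega>. h1 (?c \<omega> n, V n \<omega>))"
      by (intro Bochner_Integration.integral_cong) (auto simp: h1_def clc reward_def payoff_def mult_ac)
    also have "\<dots> = expectation (\<lambda>\<omega>. \<integral>v. h1 (?c \<omega> n, v) \<partial>block_law)" by (rule expectation_chain[OF h1m h1b])
    also have "\<dots> = expectation (\<lambda>\<omega>. fst (?c \<omega> n) * renewal q \<eta> \<theta> a \<beta> F (snd (?c \<omega> n)))"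
      unfolding h1_def fst_conv snd_conv clc mult.assoc integral_mult_right_zero renewal_def ..
    finally show ?thesis .
  qed
  \<comment> \<open>After a step the state is non-negative because the rise is, and a state above
    \<open>a\<close> has weight zero.\<close>
  have inside: "fst (?c \<omega> (Suc n)) = 0 \<or> (0 \<le> snd (?c \<omega> (Suc n)) \<and> snd (?c \<omega> (Suc n)) \<le> a)" if "\<omega> \<in> space M" for \<omega> n
  proof -
    have "0 \<le> snd (snd (V n \<omega>))"
      unfolding V_def using rise_nonneg[OF that T_nonneg[OF that] less_imp_le[OF gap_pos[OF that]]] by simp
    then have "0 \<le> snd (?c \<omega> (Suc n))" by (simp add: step_def)
    then show ?thesis by auto
  qed
  have R_step: "p (Suc n) + R (Suc (Suc n)) = R (Suc n)" for n unfolding one_step unfolding R_def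
  proof (rule Bochner_Integration.integral_cong[OF refl])
    fix \<omega> assume "\<omega> \<in> space M"
    from inside[OF this, of n] show "fst (?c \<omega> (Suc n)) * renewal q \<eta> \<theta> a \<beta> F (snd (?c \<omega> (Suc n))) = fst (?c \<omega> (Suc n)) * F (snd (?c \<omega> (Suc n)))"
      using fix_eq[of "snd (?c \<omega> (Suc n))"] by auto
  qed
  have "p 0 + R (Suc 0) = renewal q \<eta> \<theta> a \<beta> F s" unfolding one_step by (simp add: prob_space)
  then have sum: "(\<Sum>n<Suc N. p n) + R (Suc N) = renewal q \<eta> \<theta> a \<beta> F s" for N
  proof (induction N)
    case (Suc N)
    then show ?case using R_step[of N] by simp
  qed simp
  \<comment> \<open>The contraction acts from index \<open>1\<close> on, because the initial state
    may lie outside the interval.\<close>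
  have Q_step: "Q (Suc (Suc n)) \<le> c * Q (Suc n)" for n
  proof -
    have "Q (Suc (Suc n)) = expectation (\<lambda>\<omega>. h2 (?c \<omega> (Suc n), V (Suc n) \<omega>))"
      unfolding Q_def h2_def fst_conv snd_conv clc by (subst chain.simps) (simp add: mult.assoc)
    also have "\<dots> = expectation (\<lambda>\<omega>. \<integral>v. h2 (?c \<omega> (Suc n), v) \<partial>block_law)"
      by (rule expectation_chain[OF h2m h2b])
    also have "\<dots> \<le> expectation (\<lambda>\<omega>. c * fst (?c \<omega> (Suc n)))"
    proof (rule integral_mono_AE)
      interpret B: prob_space block_law by (rule prob_space_block_law)
      have mm: "(\<lambda>\<omega>. \<integral>v. h2 (?c \<omega> (Suc n), v) \<partial>block_law) \<in> borel_measurable M"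
      proof -
        have "(\<lambda>y. \<integral>v. h2 (y, v) \<partial>block_law) \<in> borel_measurable (borel :: (real \<times> real) measure)"
          using h2m measurable_cong_sets[OF sets_pair_measure_cong[OF refl sets_block_law] refl]
          by (intro B.borel_measurable_lebesgue_integral) (simp add: case_prod_unfold)
        moreover have "(\<lambda>\<omega>. ?c \<omega> (Suc n)) \<in> borel_measurable M"
        proof -
          have "(\<lambda>\<omega>. (fst (?c \<omega> (Suc n)), snd (?c \<omega> (Suc n)))) \<in> borel_measurable M"
            by (intro borel_measurable_Pair cm)
          then show ?thesis by (simp only: prod.collapse)
        qed
        ultimately show ?thesis by (rule measurable_compose[rotated])
      qed
      have bb: "\<bar>\<integral>v. h2 (y, v) \<partial>block_law\<bar> \<le> 1" for y
      proof -
        have "(\<lambda>v. h2 (y, v)) \<in> borel_measurable block_law"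
          using measurable_compose[OF measurable_Pair1' h2m, of y] by simp
        then have "(\<integral>v. \<bar>h2 (y, v)\<bar> \<partial>block_law) \<le> 1"
          using h2b by (intro B.integral_le_const B.integrable_const_bound[of _ 1]) auto
        then show ?thesis using integral_abs_bound[of block_law "\<lambda>v. h2 (y, v)"] by linarith
      qed
      show "integrable M (\<lambda>\<omega>. \<integral>v. h2 (?c \<omega> (Suc n), v) \<partial>block_law)"
        using bb by (intro integrable_const_bound[of _ 1] mm) auto
      show "integrable M (\<lambda>\<omega>. c * fst (?c \<omega> (Suc n)))" by (intro integrable_mult_right iQ)
      show "AE \<omega> in M. (\<integral>v. h2 (?c \<omega> (Suc n), v) \<partial>block_law) \<le> c * fst (?c \<omega> (Suc n))"
      proof (rule AE_I2)
        fix \<omega> assume "\<omega> \<in> space M"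
        from inside[OF this, of n]
        have "fst (?c \<omega> (Suc n)) * (\<integral>v. weight q \<eta> (snd (?c \<omega> (Suc n))) v * of_bool (step (snd (?c \<omega> (Suc n))) v \<le> a) \<partial>block_law)
           \<le> fst (?c \<omega> (Suc n)) * c"
        proof
          assume "0 \<le> snd (?c \<omega> (Suc n)) \<and> snd (?c \<omega> (Suc n)) \<le> a"
          then show ?thesis using chain_range[OF q \<eta>, of a s "\<lambda>i. V i \<omega>" "Suc n"] by (intro mult_left_mono contr) blast+
        next
          assume "fst (?c \<omega> (Suc n)) = 0"
          then show ?thesis by (simp only: mult_zero_left order_refl)
        qed
        moreover have "(\<integral>v. h2 (?c \<omega> (Suc n), v) \<partial>block_law)
          = fst (?c \<omega> (Suc n)) * (\<integral>v. weight q \<eta> (snd (?c \<omega> (Suc n))) v * of_bool (step (snd (?c \<omega> (Suc n))) v \<le> a) \<partial>block_law)"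
          unfolding h2_def fst_conv snd_conv clc by (rule integral_mult_right_zero)
        ultimately show "(\<integral>v. h2 (?c \<omega> (Suc n), v) \<partial>block_law) \<le> c * fst (?c \<omega> (Suc n))" by (simp only: mult.commute)
      qed
    qed
    also have "\<dots> = c * Q (Suc n)" unfolding Q_def by simp
    finally show ?thesis .
  qed
  have Q_le: "Q (Suc n) \<le> c ^ n" for n
  proof (induction n)
    case 0
    have "Q (Suc 0) \<le> expectation (\<lambda>\<omega>. 1)"
      unfolding Q_def using chain_range[OF q \<eta>] by (intro integral_mono iQ) (simp_all del: chain.simps)
    then show ?case by (simp add: prob_space)
  next
    case (Suc n)
    then have "c * Q (Suc n) \<le> c * c ^ n" using c by (intro mult_left_mono)
    then show ?case using Q_step[of n] by simp
  qed
  have R_le: "\<bar>R n\<bar> \<le> B * Q n" for n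
  proof -
    have "\<bar>R n\<bar> \<le> expectation (\<lambda>\<omega>. \<bar>fst (?c \<omega> n) * F (snd (?c \<omega> n))\<bar>)" unfolding R_def by (rule integral_abs_bound)
    also have "\<dots> \<le> expectation (\<lambda>\<omega>. B * fst (?c \<omega> n))"
    proof (intro integral_mono integrable_abs iF integrable_mult_right iQ)
      fix \<omega>
      have "fst (?c \<omega> n) * \<bar>F (snd (?c \<omega> n))\<bar> \<le> fst (?c \<omega> n) * B"
        using chain_range[OF q \<eta>, of a s "\<lambda>i. V i \<omega>" n] FB by (intro mult_left_mono) auto
      then show "\<bar>fst (?c \<omega> n) * F (snd (?c \<omega> n))\<bar> \<le> B * fst (?c \<omega> n)"
        using chain_range[OF q \<eta>, of a s "\<lambda>i. V i \<omega>" n] by (simp add: abs_mult mult.commute)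
    qed
    finally show ?thesis unfolding Q_def by simp
  qed
  have "(\<lambda>n. R (Suc n)) \<longlonglongrightarrow> 0"
  proof (rule Lim_null_comparison)
    show "\<forall>\<^sub>F n in sequentially. norm (R (Suc n)) \<le> B * c ^ n"
    proof (intro always_eventually allI)
      fix n
      have "B * Q (Suc n) \<le> B * c ^ n" by (rule mult_left_mono[OF Q_le B0])
      then show "norm (R (Suc n)) \<le> B * c ^ n" using R_le[of "Suc n"] by simp
    qed
    show "(\<lambda>n. B * c ^ n) \<longlonglongrightarrow> 0" using tendsto_mult[OF tendsto_const[of B] LIMSEQ_power_zero[of c]] c by simp
  qed
  then have "(\<lambda>N. renewal q \<eta> \<theta> a \<beta> F s - R (Suc N)) \<longlonglongrightarrow> renewal q \<eta> \<theta> a \<beta> F s - 0" by (intro tendsto_intros)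
  moreover have "(\<lambda>N. renewal q \<eta> \<theta> a \<beta> F s - R (Suc N)) = (\<lambda>N. \<Sum>n<Suc N. p n)"
    using sum by (intro ext) (metis add_diff_cancel_right')
  ultimately have "(\<lambda>N. \<Sum>n<Suc N. p n) \<longlonglongrightarrow> renewal q \<eta> \<theta> a \<beta> F s" by (simp only: diff_zero)
  then show ?thesis unfolding p_def by (rule LIMSEQ_imp_Suc)
qed

end

section \<open>The reflected path at the arrivals and its chain\<close>

lemma INF_const_add:
  fixes f :: "'b \<Rightarrow> real" assumes "A \<noteq> {}" "bdd_below (f ` A)"
  shows "(INF i\<in>A. c + f i) = c + (INF i\<in>A. f i)"
proof (rule antisym)
  obtain m where "\<forall>y\<in>f ` A. m \<le> y" using assms(2) unfolding bdd_below_def by blast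
  then have bb: "bdd_below ((\<lambda>i. c + f i) ` A)" by (intro bdd_belowI[of _ "c + m"]) auto
  have "(INF i\<in>A. c + f i) - c \<le> (INF i\<in>A. f i)"
  proof (rule cINF_greatest[OF assms(1)])
    fix i assume "i \<in> A"
    from cINF_lower[OF bb this] show "(INF i\<in>A. c + f i) - c \<le> f i" by simp
  qed
  then show "(INF i\<in>A. c + f i) \<le> c + (INF i\<in>A. f i)" by simp
  show "c + (INF i\<in>A. f i) \<le> (INF i\<in>A. c + f i)"
    by (rule cINF_greatest[OF assms(1)]) (simp add: cINF_lower[OF assms(2)])
qed

text \<open>The running infimum up to \<open>t + g\<close> is the minimum of the one up to
  \<open>t\<close> and the one over the block, so the reflected value at \<open>t\<close> together
  with \<open>dip\<close> and \<open>rise\<close> of the block determines both updates.\<close>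

lemma (in cadlag_Levy) reg_below_step:
  fixes x :: real
  assumes \<omega>: "\<omega> \<in> space M" and t: "0 \<le> t" and g: "0 \<le> g"
  defines "w \<equiv> \<lambda>u. x + X u \<omega>"
  shows "reg_below w (t + g) = reg_below w t + max 0 (dip X t g \<omega> - refl_below w t)"
    and "refl_below w (t + g) = max 0 (refl_below w t - dip X t g \<omega>) + rise X t g \<omega>"
proof -
  have bd: "bdd_below (w ` {s..u})" if s: "0 \<le> s" for s u
  proof -
    obtain m where "\<forall>y\<in>(\<lambda>v. X v \<omega>) ` {s..u}. m \<le> y" using path_bdd_below[OF \<omega> s, of u] unfolding bdd_below_def by blast
    then show ?thesis unfolding w_def by (intro bdd_belowI[of _ "x + m"]) auto
  qed
  define I0 I1 where "I0 = (INF u\<in>{0..t}. w u)" and "I1 = (INF u\<in>{t..t+g}. w u)"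
  have "{0..t+g} = {0..t} \<union> {t..t+g}" using t g by auto
  then have "(INF u\<in>{0..t+g}. w u) = Inf (w ` {0..t} \<union> w ` {t..t+g})" by (simp only: image_Un)
  also have "\<dots> = min I0 I1"
    unfolding I0_def I1_def inf_min[symmetric] using t g by (intro cInf_union_distrib bd) auto
  finally have I: "(INF u\<in>{0..t+g}. w u) = min I0 I1" .
  have I1: "I1 = x + (INF u\<in>{t..t+g}. X u \<omega>)"
    unfolding I1_def w_def using g by (intro INF_const_add path_bdd_below \<omega> t) auto
  then have d: "dip X t g \<omega> = w t - I1" and r: "rise X t g \<omega> = w (t + g) - I1"
    unfolding dip_def rise_def w_def by simp_all
  have rt: "reg_below w t = max (- I0) 0" by (simp add: reg_below_def I0_def)
  have rtg: "reg_below w (t + g) = max (- min I0 I1) 0" unfolding reg_below_def I ..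
  show "reg_below w (t + g) = reg_below w t + max 0 (dip X t g \<omega> - refl_below w t)"
    unfolding refl_below_def d rt rtg by (auto simp: max_def min_def)
  show "refl_below w (t + g) = max 0 (refl_below w t - dip X t g \<omega>) + rise X t g \<omega>"
    unfolding refl_below_def d r rt rtg by (auto simp: max_def min_def)
qed

context observed_Levy
begin

lemma T_strict_mono: "\<omega> \<in> space M \<Longrightarrow> i < j \<Longrightarrow> T i \<omega> < T j \<omega>"
  by (rule lift_Suc_mono_less[of "\<lambda>i. T i \<omega>"]) (auto intro: T_less)

lemma obs_time_eq:
  assumes \<omega>: "\<omega> \<in> space M" and m: "1 \<le> m" "y (T m \<omega>) \<in> A" "\<And>i. 1 \<le> i \<Longrightarrow> i < m \<Longrightarrow> y (T i \<omega>) \<notin> A"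
  shows "obs_time (\<lambda>i. T i \<omega>) A y = ereal (T m \<omega>)" unfolding obs_time_def
proof (rule antisym)
  show "(INF i\<in>{i. 1 \<le> i \<and> y (T i \<omega>) \<in> A}. ereal (T i \<omega>)) \<le> ereal (T m \<omega>)" by (rule INF_lower) (use m in simp)
  show "ereal (T m \<omega>) \<le> (INF i\<in>{i. 1 \<le> i \<and> y (T i \<omega>) \<in> A}. ereal (T i \<omega>))"
  proof (rule INF_greatest)
    fix i assume i: "i \<in> {i. 1 \<le> i \<and> y (T i \<omega>) \<in> A}"
    then have "m \<le> i" using m(3)[of i] by (cases "i < m") auto
    then show "ereal (T m \<omega>) \<le> ereal (T i \<omega>)" using T_strict_mono[OF \<omega>, of m i] by (cases "m = i") auto
  qed
qed

lemma obs_time_cases: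
  assumes \<omega>: "\<omega> \<in> space M"
  obtains "\<And>i. 1 \<le> i \<Longrightarrow> y (T i \<omega>) \<notin> A" "obs_time (\<lambda>i. T i \<omega>) A y = \<infinity>"
  | m where "1 \<le> m" "y (T m \<omega>) \<in> A" "\<And>i. 1 \<le> i \<Longrightarrow> i < m \<Longrightarrow> y (T i \<omega>) \<notin> A" "obs_time (\<lambda>i. T i \<omega>) A y = ereal (T m \<omega>)"
proof (cases "\<exists>i. 1 \<le> i \<and> y (T i \<omega>) \<in> A")
  case True
  define m where "m = (LEAST i. 1 \<le> i \<and> y (T i \<omega>) \<in> A)"
  have m: "1 \<le> m" "y (T m \<omega>) \<in> A" using LeastI_ex[OF True] unfolding m_def by auto
  have l: "y (T i \<omega>) \<notin> A" if "1 \<le> i" "i < m" for i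
    using not_less_Least[of i "\<lambda>i. 1 \<le> i \<and> y (T i \<omega>) \<in> A"] that unfolding m_def[symmetric] by auto
  show thesis by (rule that(2)[OF m l obs_time_eq[where y=y, OF \<omega> m l]])
next
  case False
  then have "{i. 1 \<le> i \<and> y (T i \<omega>) \<in> A} = {}" by auto
  then have "obs_time (\<lambda>i. T i \<omega>) A y = \<infinity>" unfolding obs_time_def by (simp only: image_empty) (simp add: top_ereal_def)
  then show thesis using that(1) False by blast
qed

text \<open>Each block updates path and regulator as in \<open>reg_below_step\<close>. The chain
  starts after the push that brings a negative start to \<open>0\<close>, so the amount
  \<open>max (- (x + X 0 \<omega>)) 0\<close> is subtracted from the regulator.\<close>

lemma chain_path:
  fixes x q \<eta> a :: real
  assumes \<omega>: "\<omega> \<in> space M"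
  defines "w \<equiv> \<lambda>u. x + X u \<omega>"
  defines "c \<equiv> chain q \<eta> a (max (x + X 0 \<omega>) 0) (\<lambda>i. V i \<omega>)"
  shows "snd (c n) = refl_below w (T n \<omega>) \<and>
    fst (c n) = exp (- q * T n \<omega> - \<eta> * (reg_below w (T n \<omega>) - max (- (x + X 0 \<omega>)) 0)) * of_bool (\<forall>i. 1 \<le> i \<longrightarrow> i \<le> n \<longrightarrow> refl_below w (T i \<omega>) \<le> a)"
    (is "?P n")
    and "weight q \<eta> (snd (c n)) (V n \<omega>) * exp (- q * T n \<omega> - \<eta> * (reg_below w (T n \<omega>) - max (- (x + X 0 \<omega>)) 0))
      = exp (- q * T (Suc n) \<omega> - \<eta> * (reg_below w (T (Suc n) \<omega>) - max (- (x + X 0 \<omega>)) 0))" (is "?Q n")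
    and "step (snd (c n)) (V n \<omega>) = refl_below w (T (Suc n) \<omega>)"
proof -
  have st: "step (refl_below w (T n \<omega>)) (V n \<omega>) = refl_below w (T (Suc n) \<omega>)"
    and wt: "max 0 (fst (snd (V n \<omega>)) - refl_below w (T n \<omega>)) = reg_below w (T (Suc n) \<omega>) - reg_below w (T n \<omega>)"
    and gp: "max 0 (fst (V n \<omega>)) = T (Suc n) \<omega> - T n \<omega>" for n
  proof -
    have g: "0 < gap n \<omega>" by (rule gap_pos[OF \<omega>])
    have T: "T (Suc n) \<omega> = T n \<omega> + gap n \<omega>" by (simp add: gap_def)
    note s = reg_below_step[OF \<omega> T_nonneg[OF \<omega>, of n] less_imp_le[OF g], of x, folded w_def]
    show "step (refl_below w (T n \<omega>)) (V n \<omega>) = refl_below w (T (Suc n) \<omega>)" unfolding T s(2) step_def V_def by simp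
    show "max 0 (fst (snd (V n \<omega>)) - refl_below w (T n \<omega>)) = reg_below w (T (Suc n) \<omega>) - reg_below w (T n \<omega>)"
      unfolding T s(1) V_def by simp
    show "max 0 (fst (V n \<omega>)) = T (Suc n) \<omega> - T n \<omega>" using g unfolding T V_def by simp
  qed
  have wt': "weight q \<eta> (refl_below w (T n \<omega>)) (V n \<omega>) = exp (- q * (T (Suc n) \<omega> - T n \<omega>) - \<eta> * (reg_below w (T (Suc n) \<omega>) - reg_below w (T n \<omega>)))" for n
    unfolding weight_def wt gp ..
  have wt'': "weight q \<eta> (refl_below w (T n \<omega>)) (V n \<omega>) * exp (- q * T n \<omega> - \<eta> * (reg_below w (T n \<omega>) - max (- (x + X 0 \<omega>)) 0))
      = exp (- q * T (Suc n) \<omega> - \<eta> * (reg_below w (T (Suc n) \<omega>) - max (- (x + X 0 \<omega>)) 0))" for n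
    unfolding wt' exp_add[symmetric] by (rule arg_cong[of _ _ exp]) (simp add: algebra_simps)
  have all: "(\<forall>i. 1 \<le> i \<longrightarrow> i \<le> Suc n \<longrightarrow> P i) \<longleftrightarrow> (\<forall>i. 1 \<le> i \<longrightarrow> i \<le> n \<longrightarrow> P i) \<and> P (Suc n)" for P n
    by (auto simp: le_Suc_eq)
  have P: "?P n" for n
  proof (induction n)
    case 0
    have "\<not> (1 \<le> i \<and> i \<le> (0::nat))" for i by simp
    then show ?case using \<omega> unfolding c_def by (auto simp: T_0 refl_below_def reg_below_def w_def max_def)
  next
    case (Suc n)
    have "snd (c (Suc n)) = step (snd (c n)) (V n \<omega>)"
      and f: "fst (c (Suc n)) = fst (c n) * weight q \<eta> (snd (c n)) (V n \<omega>) * of_bool (step (snd (c n)) (V n \<omega>) \<le> a)"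
      by (simp_all add: c_def)
    then have 1: "snd (c (Suc n)) = refl_below w (T (Suc n) \<omega>)" using Suc st by simp
    have "fst (c (Suc n)) = weight q \<eta> (refl_below w (T n \<omega>)) (V n \<omega>) * exp (- q * T n \<omega> - \<eta> * (reg_below w (T n \<omega>) - max (- (x + X 0 \<omega>)) 0))
       * (of_bool (\<forall>i. 1 \<le> i \<longrightarrow> i \<le> n \<longrightarrow> refl_below w (T i \<omega>) \<le> a) * of_bool (refl_below w (T (Suc n) \<omega>) \<le> a))"
      unfolding f using Suc st[of n] by simp
    then show ?case using 1 unfolding wt'' all of_bool_conj by blast
  qed
  then show "?P n" by blast
  show "step (snd (c n)) (V n \<omega>) = refl_below w (T (Suc n) \<omega>)" using P[of n] st[of n] by simp
  show "?Q n" using P[of n] wt''[of n] by simp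
qed

lemma reward_path:
  fixes x :: real
  assumes \<omega>: "\<omega> \<in> space M"
  defines "w \<equiv> \<lambda>u. x + X u \<omega>"
  shows "exp (- \<eta> * max (- (x + X 0 \<omega>)) 0) * reward q \<eta> \<theta> a (max (x + X 0 \<omega>) 0) (\<lambda>i. V i \<omega>) n
    = of_bool ((\<forall>i. 1 \<le> i \<longrightarrow> i \<le> n \<longrightarrow> refl_below w (T i \<omega>) \<le> a) \<and> a < refl_below w (T (Suc n) \<omega>))
      * exp (- q * T (Suc n) \<omega> - \<eta> * reg_below w (T (Suc n) \<omega>) - \<theta> * (refl_below w (T (Suc n) \<omega>) - a))"
proof -
  let ?r = "max (- (x + X 0 \<omega>)) 0"
  let ?e = "\<lambda>n. exp (- q * T n \<omega> - \<eta> * (reg_below w (T n \<omega>) - ?r))"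
  let ?b = "of_bool (\<forall>i. 1 \<le> i \<longrightarrow> i \<le> n \<longrightarrow> refl_below w (T i \<omega>) \<le> a) :: real"
  note c = chain_path[OF \<omega>, of q \<eta> a x n, folded w_def]
  have rw: "reward q \<eta> \<theta> a (max (x + X 0 \<omega>) 0) (\<lambda>i. V i \<omega>) n = ?b * ?e (Suc n) * payoff a \<theta> (refl_below w (T (Suc n) \<omega>))"
    unfolding reward_def c(3) c(2)[symmetric] using c(1) by simp
  have r: "exp (- \<eta> * ?r) * ?e (Suc n) = exp (- q * T (Suc n) \<omega> - \<eta> * reg_below w (T (Suc n) \<omega>))"
    unfolding exp_add[symmetric] by (rule arg_cong[of _ _ exp]) (simp add: algebra_simps)
  have l: "e * (b * f * (o' * g)) = b * o' * ((e * f) * g)" for e b f o' g :: real by (simp only: mult_ac)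
  have "exp (- \<eta> * ?r) * reward q \<eta> \<theta> a (max (x + X 0 \<omega>) 0) (\<lambda>i. V i \<omega>) n
     = ?b * of_bool (a < refl_below w (T (Suc n) \<omega>))
       * ((exp (- \<eta> * ?r) * ?e (Suc n)) * exp (- \<theta> * (refl_below w (T (Suc n) \<omega>) - a)))"
    unfolding rw payoff_def by (rule l)
  also have "(exp (- \<eta> * ?r) * ?e (Suc n)) * exp (- \<theta> * (refl_below w (T (Suc n) \<omega>) - a))
    = exp (- q * T (Suc n) \<omega> - \<eta> * reg_below w (T (Suc n) \<omega>) - \<theta> * (refl_below w (T (Suc n) \<omega>) - a))"
    unfolding r unfolding exp_add[symmetric] by (rule arg_cong[of _ _ exp]) (simp add: algebra_simps)
  finally show ?thesis unfolding of_bool_conj .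
qed

definition below_integrand :: "real \<Rightarrow> real \<Rightarrow> real \<Rightarrow> real \<Rightarrow> real \<Rightarrow> 'a \<Rightarrow> real" where
  "below_integrand a q \<eta> \<theta> x \<omega> = (let Ta = obs_time (\<lambda>i. T i \<omega>) {a<..} (refl_below (\<lambda>t. x + X t \<omega>)); t = real_of_ereal Ta in
     of_bool (Ta < \<infinity>) * exp (- q * t - \<eta> * reg_below (\<lambda>t. x + X t \<omega>) t - \<theta> * (refl_below (\<lambda>t. x + X t \<omega>) t - a)))"

lemma E_below_eq: "E_below M X T a q \<eta> \<theta> x = expectation (below_integrand a q \<eta> \<theta> x)"
  unfolding E_below_def set_lebesgue_integral_def Let_def below_integrand_def
  by (rule Bochner_Integration.integral_cong) (auto simp: indicator_def)

lemma reward_sums_path: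
  assumes \<omega>: "\<omega> \<in> space M"
  shows "(\<lambda>N. \<Sum>n<N. exp (- \<eta> * max (- (x + X 0 \<omega>)) 0) * reward q \<eta> \<theta> a (max (x + X 0 \<omega>) 0) (\<lambda>i. V i \<omega>) n)
    \<longlonglongrightarrow> below_integrand a q \<eta> \<theta> x \<omega>"
proof -
  define w where "w = (\<lambda>u. x + X u \<omega>)"
  define b where "b n \<longleftrightarrow> (\<forall>i. 1 \<le> i \<longrightarrow> i \<le> n \<longrightarrow> refl_below w (T i \<omega>) \<le> a) \<and> a < refl_below w (T (Suc n) \<omega>)" for n
  define e where "e n = exp (- q * T n \<omega> - \<eta> * reg_below w (T n \<omega>) - \<theta> * (refl_below w (T n \<omega>) - a))" for n
  have r: "exp (- \<eta> * max (- (x + X 0 \<omega>)) 0) * reward q \<eta> \<theta> a (max (x + X 0 \<omega>) 0) (\<lambda>i. V i \<omega>) n = of_bool (b n) * e (Suc n)" for n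
    unfolding reward_path[OF \<omega>] b_def e_def w_def ..
  show ?thesis
  proof (cases rule: obs_time_cases[OF \<omega>, of "refl_below w" "{a<..}"])
    case 1
    then have "\<not> b n" for n unfolding b_def by (metis greaterThan_iff le_add1 plus_1_eq_Suc)
    then show ?thesis using 1(2) unfolding r below_integrand_def Let_def w_def[symmetric] by simp
  next
    case (2 m)
    then have m: "1 \<le> m" "a < refl_below w (T m \<omega>)" and l: "\<And>i. 1 \<le> i \<Longrightarrow> i < m \<Longrightarrow> refl_below w (T i \<omega>) \<le> a" by force+
    have b: "b n \<longleftrightarrow> n = m - 1" for n
    proof
      assume "b n"
      then have "\<not> m \<le> n" "\<not> Suc n < m" unfolding b_def using m l[of "Suc n"] by (force, force)
      then show "n = m - 1" using m by simp
    next
      assume "n = m - 1"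
      then show "b n" unfolding b_def using m l by (auto simp: Suc_diff_le)
    qed
    have "(\<Sum>n<N. of_bool (b n) * e (Suc n)) = e m" if "m \<le> N" for N
    proof -
      have "(\<Sum>n<N. of_bool (b n) * e (Suc n)) = (\<Sum>n<N. if n = m - 1 then e m else 0)"
        unfolding b using m by (intro sum.cong) (auto simp: Suc_diff_le)
      also have "\<dots> = e m" using m that by (subst sum.delta) auto
      finally show ?thesis .
    qed
    then have "(\<lambda>N. \<Sum>n<N. of_bool (b n) * e (Suc n)) \<longlonglongrightarrow> e m"
      by (intro tendsto_eventually eventually_sequentiallyI)
    moreover have "below_integrand a q \<eta> \<theta> x \<omega> = e m"
      unfolding below_integrand_def Let_def w_def[symmetric] e_def 2(4) by simp
    ultimately show ?thesis unfolding r by simp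
  qed
qed

lemma reg_below_nonneg: "0 \<le> reg_below w t" by (simp add: reg_below_def)

lemma below_integrand_range:
  assumes \<omega>: "\<omega> \<in> space M" and "0 \<le> q" "0 \<le> \<eta>" "0 \<le> \<theta>"
  shows "0 \<le> below_integrand a q \<eta> \<theta> x \<omega>" "below_integrand a q \<eta> \<theta> x \<omega> \<le> 1"
proof -
  define w where "w = (\<lambda>u. x + X u \<omega>)"
  show "0 \<le> below_integrand a q \<eta> \<theta> x \<omega>" unfolding below_integrand_def Let_def by simp
  show "below_integrand a q \<eta> \<theta> x \<omega> \<le> 1"
  proof (cases rule: obs_time_cases[OF \<omega>, of "refl_below w" "{a<..}"])
    case 1
    then show ?thesis unfolding below_integrand_def Let_def w_def[symmetric] by simp
  next
    case (2 m)
    have "0 \<le> q * T m \<omega>" "0 \<le> \<eta> * reg_below w (T m \<omega>)" "0 \<le> \<theta> * (refl_below w (T m \<omega>) - a)"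
      using assms 2(2) T_nonneg[OF \<omega>] by (auto simp: reg_below_nonneg)
    then show ?thesis unfolding below_integrand_def Let_def w_def[symmetric] 2(4) by simp
  qed
qed

text \<open>The prefactor discounts the push from \<open>x < 0\<close> to \<open>0\<close> at time
  \<open>0\<close>, which the chain does not see. Rewards are non-negative and sum to
  \<open>below_integrand\<close>, which is at most \<open>1\<close>; so dominated convergence
  applies.\<close>

lemma reward_series:
  assumes q: "0 \<le> q" and \<eta>: "0 \<le> \<eta>" and \<theta>: "0 \<le> \<theta>"
  shows "(\<lambda>N. exp (- \<eta> * max (- x) 0) * (\<Sum>n<N. expectation (\<lambda>\<omega>. reward q \<eta> \<theta> a (max x 0) (\<lambda>i. V i \<omega>) n))) \<longlonglongrightarrow> E_below M X T a q \<eta> \<theta> x"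
    and "below_integrand a q \<eta> \<theta> x \<in> borel_measurable M"
proof -
  let ?r = "\<lambda>n \<omega>. reward q \<eta> \<theta> a (max x 0) (\<lambda>i. V i \<omega>) n"
  have [measurable]: "X 0 \<in> borel_measurable M" by (rule measurable_X) simp
  have [measurable]: "(\<lambda>\<omega>. reward q \<eta> \<theta> a (max (x + X 0 \<omega>) 0) (\<lambda>i. V i \<omega>) n) \<in> borel_measurable M" for n
    by (intro measurable_reward measurable_V) measurable
  have rm [measurable]: "(\<lambda>\<omega>. ?r n \<omega>) \<in> borel_measurable M" for n
    by (intro measurable_reward measurable_V) measurable
  show bm: "below_integrand a q \<eta> \<theta> x \<in> borel_measurable M"
    by (rule borel_measurable_LIMSEQ_real[OF reward_sums_path]) measurable
  have ir: "integrable M (?r n)" for n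
    using reward_range[OF q \<eta> \<theta>] by (intro integrable_const_bound[of _ 1] rm) auto
  have ae: "AE \<omega> in M. (\<lambda>N. \<Sum>n<N. exp (- \<eta> * max (- x) 0) * ?r n \<omega>) \<longlonglongrightarrow> below_integrand a q \<eta> \<theta> x \<omega>"
    using X_0 AE_space
  proof eventually_elim
    case (elim \<omega>)
    then show ?case using reward_sums_path[of \<omega> \<eta> x q \<theta> a] by simp
  qed
  have "(\<lambda>N. expectation (\<lambda>\<omega>. \<Sum>n<N. exp (- \<eta> * max (- x) 0) * ?r n \<omega>)) \<longlonglongrightarrow> expectation (below_integrand a q \<eta> \<theta> x)"
  proof (rule integral_dominated_convergence[where w="\<lambda>_. 1"])
    show "AE \<omega> in M. norm (\<Sum>n<N. exp (- \<eta> * max (- x) 0) * ?r n \<omega>) \<le> 1" for N using ae AE_space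
    proof eventually_elim
      case (elim \<omega>)
      have p: "0 \<le> exp (- \<eta> * max (- x) 0) * ?r n \<omega>" for n using reward_range[OF q \<eta> \<theta>] by simp
      have "(\<Sum>n<N. exp (- \<eta> * max (- x) 0) * ?r n \<omega>) \<le> below_integrand a q \<eta> \<theta> x \<omega>"
        by (rule LIMSEQ_le_const[OF elim(1)]) (intro exI[of _ N] allI impI sum_mono2 p; auto)
      then show ?case using below_integrand_range(2)[OF elim(2) q \<eta> \<theta>, of a x] sum_nonneg[of "{..<N}", OF p] by simp
    qed
  qed (use ae bm in auto)
  moreover have "expectation (\<lambda>\<omega>. \<Sum>n<N. exp (- \<eta> * max (- x) 0) * ?r n \<omega>) = exp (- \<eta> * max (- x) 0) * (\<Sum>n<N. expectation (?r n))" for N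
    using ir by (simp add: Bochner_Integration.integral_sum sum_distrib_left)
  ultimately show "(\<lambda>N. exp (- \<eta> * max (- x) 0) * (\<Sum>n<N. expectation (?r n))) \<longlonglongrightarrow> E_below M X T a q \<eta> \<theta> x"
    unfolding E_below_eq by simp
qed

lemma E_below_renewal:
  assumes q: "0 \<le> q" and \<eta>: "0 \<le> \<eta>" and \<theta>: "0 \<le> \<theta>"
    and F: "F \<in> borel_measurable borel" "\<And>y. \<bar>F y\<bar> \<le> B"
    and fix_eq: "\<And>s. 0 \<le> s \<Longrightarrow> s \<le> a \<Longrightarrow> renewal q \<eta> \<theta> a \<beta> F s = F s"
    and contr: "\<And>s. 0 \<le> s \<Longrightarrow> s \<le> a \<Longrightarrow> (\<integral>v. weight q \<eta> s v * of_bool (step s v \<le> a) \<partial>block_law) \<le> c" and c: "0 \<le> c" "c < 1"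
  shows "\<beta> * E_below M X T a q \<eta> \<theta> x = exp (- \<eta> * max (- x) 0) * renewal q \<eta> \<theta> a \<beta> F (max x 0)"
proof -
  have "(\<lambda>N. exp (- \<eta> * max (- x) 0) * (\<Sum>n<N. \<beta> * expectation (\<lambda>\<omega>. reward q \<eta> \<theta> a (max x 0) (\<lambda>i. V i \<omega>) n)))
     \<longlonglongrightarrow> exp (- \<eta> * max (- x) 0) * renewal q \<eta> \<theta> a \<beta> F (max x 0)"
    by (intro tendsto_mult tendsto_const renewal_limit[OF q \<eta> \<theta> F fix_eq contr c])
  moreover have "(\<lambda>N. exp (- \<eta> * max (- x) 0) * (\<Sum>n<N. \<beta> * expectation (\<lambda>\<omega>. reward q \<eta> \<theta> a (max x 0) (\<lambda>i. V i \<omega>) n)))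
     \<longlonglongrightarrow> \<beta> * E_below M X T a q \<eta> \<theta> x"
    using tendsto_mult[OF tendsto_const[of \<beta>] reward_series(1)[OF q \<eta> \<theta>, of x a]]
    by (simp add: sum_distrib_left mult_ac)
  ultimately show ?thesis by (rule LIMSEQ_unique[rotated])
qed

end

section \<open>The renewal operator as an iterated integral over depth and rise\<close>

lemma integral_exp_exp_law:
  assumes c: "0 < c" and \<eta>: "0 \<le> \<eta>"
  shows "integrable (exp_law c) (\<lambda>x. exp (- \<eta> * x))" "(\<integral>x. exp (- \<eta> * x) \<partial>exp_law c) = c / (c + \<eta>)"
proof -
  interpret E: prob_space "exp_law c" by (rule prob_space_exponential_density[OF c])
  show i: "integrable (exp_law c) (\<lambda>x. exp (- \<eta> * x))"
  proof (rule E.integrable_const_bound[of _ 1])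
    show "AE x in exp_law c. norm (exp (- \<eta> * x)) \<le> 1" using AE_exp_law_pos by eventually_elim (use \<eta> in simp)
  qed simp
  have "ennreal (\<integral>x. exp (- \<eta> * x) \<partial>exp_law c) = ennreal (c / (c + \<eta>))"
    using nn_integral_eq_integral[OF i] nn_integral_exp_exp_law[of "- \<eta>" c] c \<eta> by simp
  then show "(\<integral>x. exp (- \<eta> * x) \<partial>exp_law c) = c / (c + \<eta>)" using c \<eta> by (subst (asm) ennreal_inj) auto
qed

text \<open>If \<open>U' = c (U - u)\<close> then \<open>- exp (- c x) U x\<close> is an antiderivative of \<open>c exp (- c x) u x\<close>.\<close>

lemma integral_exp_law_split:
  fixes u U :: "real \<Rightarrow> real"
  assumes c: "0 < c" and \<eta>: "0 \<le> \<eta>" and s: "0 \<le> s"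
    and u: "u \<in> borel_measurable borel" "\<And>x. 0 \<le> x \<Longrightarrow> x \<le> s \<Longrightarrow> \<bar>u x\<bar> \<le> B"
    and S: "finite S" and U: "continuous_on {0..s} U"
    and U': "\<And>x. 0 < x \<Longrightarrow> x < s \<Longrightarrow> x \<notin> S \<Longrightarrow> (U has_real_derivative c * (U x - u x)) (at x)"
  shows "(\<integral>x. (if x \<le> s then u x else v * exp (- \<eta> * (x - s))) \<partial>exp_law c) = U 0 + exp (- c * s) * (v * c / (c + \<eta>) - U s)"
proof -
  interpret E: prob_space "exp_law c" by (rule prob_space_exponential_density[OF c])
  \<comment> \<open>The tail expression is extended to the whole half-line, where its mean is
    explicit; \<open>w\<close> is the correction up to \<open>s\<close>. The first term of
    \<open>G\<close> integrates the tail part of \<open>w\<close>, the second the part with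
    \<open>u\<close>.\<close>
  define w where "w x = u x - v * exp (- \<eta> * (x - s))" for x
  define G where "G x = v * c / (c + \<eta>) * exp (\<eta> * s) * exp (- (c + \<eta>) * x) - exp (- c * x) * U x" for x
  have [measurable]: "u \<in> borel_measurable borel" by (rule u(1))
  then have wm [measurable]: "w \<in> borel_measurable borel" unfolding w_def[abs_def] by measurable
  have wb: "\<bar>w x\<bar> \<le> B + \<bar>v\<bar> * exp (\<eta> * s)" if x: "0 \<le> x" "x \<le> s" for x
  proof -
    have "- \<eta> * (x - s) \<le> \<eta> * s" using \<eta> x by (simp add: algebra_simps)
    then have "\<bar>v\<bar> * exp (- \<eta> * (x - s)) \<le> \<bar>v\<bar> * exp (\<eta> * s)" by (intro mult_left_mono) auto
    moreover have "\<bar>w x\<bar> \<le> \<bar>u x\<bar> + \<bar>v\<bar> * exp (- \<eta> * (x - s))" unfolding w_def by (rule order_trans[OF abs_triangle_ineq4]) (simp add: abs_mult)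
    ultimately show ?thesis using u(2)[OF x] by linarith
  qed
  have si: "set_integrable lborel {0..s} (\<lambda>x. c * exp (- c * x) * w x)" unfolding set_integrable_def
  proof (rule integrableI_bounded_set_indicator[where B="c * (B + \<bar>v\<bar> * exp (\<eta> * s))"])
    show "AE x\<in>{0..s} in lborel. norm (c * exp (- c * x) * w x) \<le> c * (B + \<bar>v\<bar> * exp (\<eta> * s))"
    proof (rule AE_I2, rule impI)
      fix x assume x: "x \<in> {0..s}"
      have "exp (- c * x) * \<bar>w x\<bar> \<le> 1 * (B + \<bar>v\<bar> * exp (\<eta> * s))" using x c wb[of x] by (intro mult_mono) auto
      then show "norm (c * exp (- c * x) * w x) \<le> c * (B + \<bar>v\<bar> * exp (\<eta> * s))" using c by (simp add: abs_mult)
    qed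
  qed (use s in auto)
  have "((\<lambda>x. c * exp (- c * x) * w x) has_integral (G s - G 0)) {0..s}"
  proof (rule fundamental_theorem_of_calculus_interior_strong[OF S s])
    fix x assume x: "x \<in> {0<..<s} - S"
    have "(G has_real_derivative v * c / (c + \<eta>) * exp (\<eta> * s) * (exp (- (c + \<eta>) * x) * - (c + \<eta>))
        - (exp (- c * x) * - c * U x + c * (U x - u x) * exp (- c * x))) (at x)"
      unfolding G_def[abs_def] using x c \<eta> by (auto intro!: derivative_eq_intros U')
    moreover have "v * c / (c + \<eta>) * exp (\<eta> * s) * (exp (- (c + \<eta>) * x) * - (c + \<eta>)) = - (v * c) * (exp (- c * x) * exp (- \<eta> * (x - s)))"
    proof -
      have "exp (\<eta> * s) * exp (- (c + \<eta>) * x) = exp (- c * x) * exp (- \<eta> * (x - s))"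
        unfolding exp_add[symmetric] by (rule arg_cong[of _ _ exp]) (simp add: algebra_simps)
      moreover have "v * c / (c + \<eta>) * E * (F * - (c + \<eta>)) = - (v * c) * (E * F)" for E F :: real
        using c \<eta> by (simp add: field_simps)
      ultimately show ?thesis by (simp only:)
    qed
    ultimately have "(G has_real_derivative c * exp (- c * x) * w x) (at x)"
      unfolding w_def by (simp add: algebra_simps)
    then show "(G has_vector_derivative c * exp (- c * x) * w x) (at x)" by (simp add: has_real_derivative_iff_has_vector_derivative)
  next
    show "continuous_on {0..s} G" unfolding G_def[abs_def] by (intro continuous_intros U)
  qed
  then have "(LINT x:{0..s}|lborel. c * exp (- c * x) * w x) = G s - G 0"
    using set_borel_integral_eq_integral(2)[OF si] by (simp add: integral_unique)
  moreover have "(\<integral>x. indicator {0..s} x * w x \<partial>exp_law c) = (LINT x:{0..s}|lborel. c * exp (- c * x) * w x)"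
  proof -
    have "(\<integral>x. indicator {0..s} x * w x \<partial>exp_law c) = (\<integral>x. exponential_density c x *\<^sub>R (indicator {0..s} x * w x) \<partial>lborel)"
      using c by (intro integral_density) (auto simp: exponential_density_nonneg)
    also have "\<dots> = (\<integral>x. indicator {0..s} x *\<^sub>R (c * exp (- c * x) * w x) \<partial>lborel)"
    proof (rule Bochner_Integration.integral_cong[OF refl])
      fix x :: real
      have "- x * c = - c * x" by simp
      then show "exponential_density c x *\<^sub>R (indicator {0..s} x * w x) = indicator {0..s} x *\<^sub>R (c * exp (- c * x) * w x)"
        by (cases "x \<in> {0..s}") (simp_all add: exponential_density_def)
    qed
    finally show ?thesis unfolding set_lebesgue_integral_def .
  qed
  ultimately have fin: "(\<integral>x. indicator {0..s} x * w x \<partial>exp_law c) = G s - G 0" by simp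
  have "(\<integral>x. (if x \<le> s then u x else v * exp (- \<eta> * (x - s))) \<partial>exp_law c)
      = (\<integral>x. v * exp (\<eta> * s) * exp (- \<eta> * x) + indicator {0..s} x * w x \<partial>exp_law c)"
  proof (rule integral_cong_AE)
    show "AE x in exp_law c. (if x \<le> s then u x else v * exp (- \<eta> * (x - s))) = v * exp (\<eta> * s) * exp (- \<eta> * x) + indicator {0..s} x * w x"
      using AE_exp_law_pos
    proof eventually_elim
      case (elim x)
      have "exp (- \<eta> * (x - s)) = exp (\<eta> * s) * exp (- \<eta> * x)"
        unfolding exp_add[symmetric] by (simp add: algebra_simps)
      then have e: "v * exp (- \<eta> * (x - s)) = v * exp (\<eta> * s) * exp (- \<eta> * x)" by (simp only: mult.assoc)
      show ?case unfolding w_def e using elim by (cases "x \<le> s") simp_all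
    qed
  qed (measurable; simp)+
  also have "\<dots> = v * exp (\<eta> * s) * (c / (c + \<eta>)) + (G s - G 0)"
  proof -
    have "integrable (exp_law c) (\<lambda>x. indicator {0..s} x * w x)"
    proof (rule E.integrable_const_bound[of _ "B + \<bar>v\<bar> * exp (\<eta> * s)"])
      have "0 \<le> B + \<bar>v\<bar> * exp (\<eta> * s)" using wb[of 0] s by simp
      then show "AE x in exp_law c. norm (indicator {0..s} x * w x) \<le> B + \<bar>v\<bar> * exp (\<eta> * s)"
        using wb by (intro AE_I2) (auto simp: indicator_def)
    qed simp
    then show ?thesis using integral_exp_exp_law[OF c \<eta>]
      by (subst Bochner_Integration.integral_add) (auto simp: fin)
  qed
  also have "\<dots> = U 0 + exp (- c * s) * (v * c / (c + \<eta>) - U s)"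
  proof -
    have "exp (\<eta> * s) * exp (- (c + \<eta>) * s) = exp (- c * s)"
      unfolding exp_add[symmetric] by (simp add: algebra_simps)
    then have "v * c / (c + \<eta>) * exp (\<eta> * s) * exp (- (c + \<eta>) * s) = v * c / (c + \<eta>) * exp (- c * s)" by (simp only: mult.assoc)
    then show ?thesis unfolding G_def by (simp add: algebra_simps)
  qed
  finally show ?thesis .
qed

lemma measurable_integral_shift:
  fixes g :: "real \<Rightarrow> real"
  assumes "prob_space \<nu>" and [measurable_cong]: "sets \<nu> = sets borel" and [measurable]: "g \<in> borel_measurable borel"
  shows "(\<lambda>z. \<integral>d. g (z + d) \<partial>\<nu>) \<in> borel_measurable borel"
proof -
  interpret prob_space \<nu> by fact
  show ?thesis by (rule borel_measurable_lebesgue_integral) measurable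
qed

context observed_Levy
begin

lemma integral_block_law:
  fixes F :: "real \<times> real \<Rightarrow> real"
  assumes q: "0 \<le> q" and F: "F \<in> borel_measurable borel" "\<And>z. \<bar>F z\<bar> \<le> B"
  shows "(\<integral>v. exp (- q * max 0 (fst v)) * F (snd v) \<partial>block_law) = l / (l + q) * (\<integral>z. F z \<partial>dr_law (l + q))"
proof -
  have lq: "0 < l + q" using rate_pos q by simp
  interpret E: prob_space "exp_law l" by (rule prob_space_exponential_density[OF rate_pos])
  interpret P: pair_prob_space "exp_law l" M ..
  define G where "G t = expectation (\<lambda>\<omega>. F (dip X 0 (max 0 t) \<omega>, rise X 0 (max 0 t) \<omega>))" for t
  note dr = integral_dr_law[OF lq F, folded G_def]
  have [measurable]: "G \<in> borel_measurable borel" using dr(2) by (simp add: G_def[abs_def])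
  have snd_m: "snd \<in> measurable borel (borel :: (real \<times> real) measure)"
    by (intro borel_measurable_continuous_onI continuous_intros)
  have Hm: "(\<lambda>v. exp (- q * max 0 (fst v)) * F (snd v)) \<in> borel_measurable borel"
    using measurable_compose[OF snd_m F(1)] measurable_triple(1) by measurable
  have bm: "block \<in> borel_measurable (exp_law l \<Otimes>\<^sub>M M)" by (rule measurable_exp_pair[OF measurable_block])
  have "(\<integral>v. exp (- q * max 0 (fst v)) * F (snd v) \<partial>block_law)
    = (\<integral>z. exp (- q * max 0 (fst (block z))) * F (snd (block z)) \<partial>(exp_law l \<Otimes>\<^sub>M M))"
    unfolding block_law_def by (rule integral_distr[OF bm Hm])
  also have "\<dots> = (\<integral>t. \<integral>\<omega>. exp (- q * max 0 (fst (block (t, \<omega>)))) * F (snd (block (t, \<omega>))) \<partial>M \<partial>exp_law l)"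
  proof (rule P.integral_fst'[symmetric], rule P.P.integrable_const_bound[of _ B])
    show "AE z in exp_law l \<Otimes>\<^sub>M M. norm (exp (- q * max 0 (fst (block z))) * F (snd (block z))) \<le> B"
    proof (rule AE_I2)
      fix z
      have "\<bar>exp (- q * max 0 (fst (block z))) * F (snd (block z))\<bar> \<le> 1 * B"
        unfolding abs_mult using q F(2) by (intro mult_mono) auto
      then show "norm (exp (- q * max 0 (fst (block z))) * F (snd (block z))) \<le> B" by simp
    qed
  qed (rule measurable_compose[OF bm Hm])
  also have "\<dots> = (\<integral>t. exp (- q * max 0 t) * G t \<partial>exp_law l)" unfolding block_def G_def by simp
  also have "\<dots> = (\<integral>t. exponential_density l t * (exp (- q * max 0 t) * G t) \<partial>lborel)"
    using rate_pos by (subst integral_density) (auto simp: exponential_density_nonneg)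
  also have "\<dots> = (\<integral>t. l / (l + q) * (exponential_density (l + q) t * G t) \<partial>lborel)"
  proof (rule Bochner_Integration.integral_cong[OF refl])
    fix t :: real
    have "exp (- t * l) * exp (- q * t) = exp (- t * (l + q))" unfolding exp_add[symmetric] by (simp add: algebra_simps)
    then show "exponential_density l t * (exp (- q * max 0 t) * G t) = l / (l + q) * (exponential_density (l + q) t * G t)"
      using lq by (simp add: exponential_density_def max_def)
  qed
  also have "\<dots> = l / (l + q) * (\<integral>t. exponential_density (l + q) t * G t \<partial>lborel)" by simp
  also have "(\<integral>t. exponential_density (l + q) t * G t \<partial>lborel) = (\<integral>t. G t \<partial>exp_law (l + q))"
    using lq by (subst integral_density) (auto simp: exponential_density_nonneg)
  finally show ?thesis using dr(1) by simp
qed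

lemma integral_dr_law_iterated:
  fixes F :: "real \<times> real \<Rightarrow> real"
  assumes p: "0 < p" and F: "F \<in> borel_measurable borel" "\<And>z. \<bar>F z\<bar> \<le> B"
  shows "(\<integral>z. F z \<partial>dr_law p) = (\<integral>r. \<integral>d. F (r, d) \<partial>dip_law M (neg X) p \<partial>dip_law M X p)"
proof -
  interpret N: cadlag_Levy M "neg X" by (rule uminus)
  interpret D1: prob_space "dip_law M X p" by (rule prob_space_dip_law[OF p])
  interpret D2: prob_space "dip_law M (neg X) p" by (rule N.prob_space_dip_law[OF p])
  interpret P: pair_prob_space "dip_law M X p" "dip_law M (neg X) p" ..
  have "sets (dip_law M X p \<Otimes>\<^sub>M dip_law M (neg X) p) = sets borel"
    unfolding borel_prod[symmetric] by (intro sets_pair_measure_cong sets_dip_law)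
  then have "F \<in> borel_measurable (dip_law M X p \<Otimes>\<^sub>M dip_law M (neg X) p)"
    using F(1) measurable_cong_sets by blast
  then show ?thesis unfolding Wiener_Hopf[OF p]
    using F(2) by (intro P.integral_fst'[symmetric] P.P.integrable_const_bound[of _ B]) auto
qed

definition gext :: "real \<Rightarrow> real \<Rightarrow> real \<Rightarrow> (real \<Rightarrow> real) \<Rightarrow> real \<Rightarrow> real" where
  "gext \<theta> a \<beta> F y = (if a < y then \<beta> * exp (- \<theta> * (y - a)) else F y)"

lemma renewal_eq:
  assumes q: "0 \<le> q" and \<eta>: "0 \<le> \<eta>" and \<theta>: "0 \<le> \<theta>" and F [measurable]: "F \<in> borel_measurable borel" and FB: "\<And>y. \<bar>F y\<bar> \<le> B"
  shows "renewal q \<eta> \<theta> a \<beta> F s = l / (l + q) *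
    (\<integral>r. exp (- \<eta> * max 0 (r - s)) * (\<integral>d. gext \<theta> a \<beta> F (max 0 (s - r) + d) \<partial>dip_law M (neg X) (l + q)) \<partial>dip_law M X (l + q))"
proof -
  have lq: "0 < l + q" using rate_pos q by simp
  have [measurable]: "gext \<theta> a \<beta> F \<in> borel_measurable borel" unfolding gext_def[abs_def] by measurable
  define G where "G z = exp (- \<eta> * max 0 (fst z - s)) * gext \<theta> a \<beta> F (max 0 (s - fst z) + snd z)" for z :: "real \<times> real"
  have Gm: "G \<in> borel_measurable borel"
    using measurable_fst_borel measurable_snd_borel unfolding G_def[abs_def] by measurable
  have B0: "0 \<le> B" using FB[of 0] by simp
  have gb: "\<bar>gext \<theta> a \<beta> F y\<bar> \<le> \<bar>\<beta>\<bar> + B" for y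
  proof (cases "a < y")
    case True
    then have "\<bar>\<beta>\<bar> * exp (- \<theta> * (y - a)) \<le> \<bar>\<beta>\<bar> * 1" using \<theta> by (intro mult_left_mono) auto
    then show ?thesis using True B0 by (simp add: gext_def abs_mult)
  next
    case False then show ?thesis using FB[of y] by (simp add: gext_def)
  qed
  have Gb: "\<bar>G z\<bar> \<le> \<bar>\<beta>\<bar> + B" for z
  proof -
    have "\<bar>G z\<bar> \<le> 1 * (\<bar>\<beta>\<bar> + B)" unfolding G_def abs_mult using \<eta> gb by (intro mult_mono) auto
    then show ?thesis by simp
  qed
  have e: "exp (- q * max 0 t - \<eta> * m) = exp (- q * max 0 t) * exp (- \<eta> * m)" for t m
    unfolding exp_add[symmetric] by simp
  have "renewal q \<eta> \<theta> a \<beta> F s = (\<integral>v. exp (- q * max 0 (fst v)) * G (snd v) \<partial>block_law)"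
    unfolding renewal_def weight_def e G_def step_def payoff_def gext_def by (intro Bochner_Integration.integral_cong) auto
  also have "\<dots> = l / (l + q) * (\<integral>z. G z \<partial>dr_law (l + q))" by (rule integral_block_law[OF q Gm Gb])
  finally show ?thesis unfolding integral_dr_law_iterated[OF lq Gm Gb] by (simp add: G_def)
qed

lemma contraction_eq:
  assumes q: "0 \<le> q" and \<eta>: "0 \<le> \<eta>"
  shows "(\<integral>v. weight q \<eta> s v * of_bool (step s v \<le> a) \<partial>block_law) = l / (l + q) *
    (\<integral>r. exp (- \<eta> * max 0 (r - s)) * (\<integral>d. of_bool (max 0 (s - r) + d \<le> a) \<partial>dip_law M (neg X) (l + q)) \<partial>dip_law M X (l + q))"
proof -
  have "(\<integral>v. weight q \<eta> s v * of_bool (step s v \<le> a) \<partial>block_law) = renewal q \<eta> 0 a 0 (\<lambda>_. 1) s"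
    unfolding renewal_def by (intro Bochner_Integration.integral_cong) auto
  moreover have "gext 0 a 0 (\<lambda>_. 1) y = of_bool (y \<le> a)" for y by (simp add: gext_def)
  ultimately show ?thesis using renewal_eq[OF q \<eta>, of 0 "\<lambda>_. 1" 1 a 0 s] by simp
qed

text \<open>Survival of one step requires the rise to be at most \<open>a\<close>, and a depth
  beyond \<open>a\<close> is discounted at least as a start from \<open>a\<close> would be. Depth
  and rise are independent, so the bound is a product; the strict inequality will come from the
  second factor for \<open>X\<close> and from the first for \<open>neg X\<close>.\<close>

lemma contraction_le:
  assumes q: "0 \<le> q" and \<eta>: "0 \<le> \<eta>" and s: "s \<le> a"
  shows "(\<integral>v. weight q \<eta> s v * of_bool (step s v \<le> a) \<partial>block_law)
    \<le> (\<integral>r. exp (- \<eta> * max 0 (r - a)) \<partial>dip_law M X (l + q)) * (\<integral>d. of_bool (d \<le> a) \<partial>dip_law M (neg X) (l + q))"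
proof -
  let ?\<mu> = "dip_law M X (l + q)" and ?\<nu> = "dip_law M (neg X) (l + q)" and ?e = "\<lambda>r. exp (- \<eta> * max 0 (r - a))"
  let ?f = "\<lambda>r. exp (- \<eta> * max 0 (r - s)) * (\<integral>d. of_bool (max 0 (s - r) + d \<le> a) \<partial>?\<nu>)"
  have lq: "0 < l + q" using rate_pos q by simp
  interpret N: cadlag_Levy M "neg X" by (rule uminus)
  interpret D1: prob_space ?\<mu> by (rule prob_space_dip_law[OF lq])
  interpret D2: prob_space ?\<nu> by (rule N.prob_space_dip_law[OF lq])
  define c :: real where "c = (\<integral>d. of_bool (d \<le> a) \<partial>?\<nu>)"
  have "(\<lambda>d. of_bool (d \<le> a) :: real) \<in> borel_measurable borel" unfolding of_bool_def by measurable
  then have io: "integrable ?\<nu> (\<lambda>d. of_bool (d \<le> a) :: real)" by (intro D2.integrable_const_bound[of _ 1]) auto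
  have ie: "integrable ?\<mu> ?e" using \<eta> by (intro D1.integrable_const_bound[of _ 1]) (auto intro!: AE_I2)
  have c0: "0 \<le> c" unfolding c_def by (rule Bochner_Integration.integral_nonneg) simp
  have le: "?f r \<le> ?e r * c" for r
  proof (rule mult_mono)
    have "max 0 (r - a) \<le> max 0 (r - s)" using s by auto
    then have "\<eta> * max 0 (r - a) \<le> \<eta> * max 0 (r - s)" using \<eta> by (intro mult_left_mono)
    then show "exp (- \<eta> * max 0 (r - s)) \<le> ?e r" by simp
    show "(\<integral>d. of_bool (max 0 (s - r) + d \<le> a) \<partial>?\<nu>) \<le> c" unfolding c_def by (rule integral_mono_AE'[OF io]) (auto intro!: AE_I2)
  qed (auto intro: Bochner_Integration.integral_nonneg)
  have "(\<integral>r. ?f r \<partial>?\<mu>) \<le> (\<integral>r. ?e r * c \<partial>?\<mu>)"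
    using le c0 by (intro integral_mono_AE' integrable_mult_left ie AE_I2) auto
  moreover have "0 \<le> (\<integral>r. ?f r \<partial>?\<mu>)" by (auto intro!: Bochner_Integration.integral_nonneg mult_nonneg_nonneg)
  moreover have "l / (l + q) \<le> 1" using q rate_pos by simp
  ultimately have "l / (l + q) * (\<integral>r. ?f r \<partial>?\<mu>) \<le> 1 * (\<integral>r. ?e r * c \<partial>?\<mu>)" by (intro mult_mono) auto
  then show ?thesis unfolding contraction_eq[OF q \<eta>] c_def by simp
qed

lemma E_above_eq: "E_above M X T a q \<eta> \<theta> x = E_below M (neg X) T a q \<eta> \<theta> (a - x)"
proof -
  have reg: "reg_above a (\<lambda>t. x + X t \<omega>) t = reg_below (\<lambda>t. a - x + - X t \<omega>) t"
    and rfl: "refl_above a (\<lambda>t. x + X t \<omega>) t = a - refl_below (\<lambda>t. a - x + - X t \<omega>) t" if \<omega>: "\<omega> \<in> space M" and t: "0 \<le> t" for \<omega> t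
  proof -
    obtain C where "\<forall>y\<in>(\<lambda>s. X s \<omega>) ` {0..t}. y \<le> C"
      using bounded_imp_bdd_above[OF path_bounded[OF \<omega>, of t]] unfolding bdd_above_def by blast
    then have "bdd_above ((\<lambda>t. x + X t \<omega>) ` {0..t})" by (intro bdd_aboveI[of _ "x + C"]) auto
    from reg_above_eq[OF this t, of a] show r: "reg_above a (\<lambda>t. x + X t \<omega>) t = reg_below (\<lambda>t. a - x + - X t \<omega>) t"
      by (simp add: algebra_simps)
    show "refl_above a (\<lambda>t. x + X t \<omega>) t = a - refl_below (\<lambda>t. a - x + - X t \<omega>) t"
      unfolding refl_above_def refl_below_def r by simp
  qed
  have ot: "obs_time (\<lambda>i. T i \<omega>) {..<0} (refl_above a (\<lambda>t. x + X t \<omega>)) = obs_time (\<lambda>i. T i \<omega>) {a<..} (refl_below (\<lambda>t. a - x + - X t \<omega>))"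
    if \<omega>: "\<omega> \<in> space M" for \<omega> unfolding obs_time_def using rfl[OF \<omega> T_nonneg[OF \<omega>]] by simp
  have nn: "0 \<le> real_of_ereal (obs_time (\<lambda>i. T i \<omega>) A y)" if \<omega>: "\<omega> \<in> space M" for \<omega> A y
    unfolding obs_time_def using T_nonneg[OF \<omega>] by (intro real_of_ereal_pos INF_greatest) simp
  show ?thesis unfolding E_above_def E_below_def Let_def set_lebesgue_integral_def
  proof (rule Bochner_Integration.integral_cong[OF refl], goal_cases)
    case (1 \<omega>)
    note \<omega> = this
    define t where "t = real_of_ereal (obs_time (\<lambda>i. T i \<omega>) {a<..} (refl_below (\<lambda>t. a - x + - X t \<omega>)))"
    have t: "0 \<le> t" unfolding t_def by (rule nn[OF \<omega>])
    have "exp (- q * t - \<eta> * reg_above a (\<lambda>t. x + X t \<omega>) t + \<theta> * refl_above a (\<lambda>t. x + X t \<omega>) t)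
      = exp (- q * t - \<eta> * reg_below (\<lambda>t. a - x + - X t \<omega>) t - \<theta> * (refl_below (\<lambda>t. a - x + - X t \<omega>) t - a))"
      unfolding reg[OF \<omega> t] rfl[OF \<omega> t] by (rule arg_cong[of _ _ exp]) (simp add: algebra_simps)
    then show ?case unfolding ot[OF \<omega>] t_def[symmetric] using \<omega> ot[OF \<omega>] by (simp add: indicator_def)
  qed
qed

end

section \<open>Solving the renewal equations\<close>

lemma continuous_bounded_Icc:
  fixes f :: "real \<Rightarrow> real"
  assumes "continuous_on {c..d} f"
  obtains B where "0 \<le> B" "\<And>y. c \<le> y \<Longrightarrow> y \<le> d \<Longrightarrow> \<bar>f y\<bar> \<le> B"
proof -
  have "compact (f ` {c..d})" by (intro compact_continuous_image assms) auto
  then obtain B where "\<forall>y\<in>f ` {c..d}. norm y \<le> B" using compact_imp_bounded bounded_iff by metis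
  then have "\<bar>f y\<bar> \<le> max B 0" if "c \<le> y" "y \<le> d" for y using that by (force simp: max_def)
  then show thesis by (intro that[of "max B 0"]) auto
qed

context scale_setup
begin

text \<open>The origin is excluded because \<open>W\<close> may jump there from \<open>0\<close> to
  \<open>W 0 > 0\<close>, which gives \<open>Z\<close> a kink.\<close>

lemma Z_deriv_neq:
  assumes x: "x \<noteq> 0"
  shows "((\<lambda>x. Z x \<theta>) has_real_derivative \<theta> * Z x \<theta> - \<psi>q \<theta> * W x) (at x)"
proof (cases "0 < x")
  case False
  then have n: "x < 0" using x by simp
  have "((\<lambda>x. exp (\<theta> * x)) has_real_derivative \<theta> * Z x \<theta> - \<psi>q \<theta> * W x) (at x)"
    using n by (auto intro!: derivative_eq_intros simp: Z_neg W_neg)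
  moreover have "\<forall>\<^sub>F y in nhds x. Z y \<theta> = exp (\<theta> * y)"
    using order_tendstoD(2)[OF filterlim_ident n] by eventually_elim (simp add: Z_neg)
  ultimately show ?thesis using DERIV_cong_ev[OF refl _ refl, of "\<lambda>y. Z y \<theta>" "\<lambda>y. exp (\<theta> * y)" x] by blast
qed (rule Z_deriv)

abbreviation \<nu> :: "real measure" where "\<nu> \<equiv> dip_law M (neg X) (l + q)"

lemma sup_law_Phi: "\<nu> = distr (exp_law \<Phi>) borel (\<lambda>x. x)"
  unfolding \<Phi>_def by (rule sup_law[OF lq])

lemma integral_sup_law:
  fixes f :: "real \<Rightarrow> real"
  assumes "f \<in> borel_measurable borel"
  shows "(\<integral>x. f x \<partial>\<nu>) = (\<integral>x. f x \<partial>exp_law \<Phi>)" unfolding sup_law_Phi using assms by (subst integral_distr) auto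

abbreviation dip_kernel :: "real \<Rightarrow> real \<Rightarrow> real \<Rightarrow> real" where
  "dip_kernel \<theta> x r \<equiv> (if r \<le> x then - l * Z (x - r) \<theta> else (\<psi>q \<theta> - l) * exp (\<theta> * (x - r)))"

lemma dip_kernel_measurable [measurable]: "dip_kernel \<theta> x \<in> borel_measurable borel"
proof -
  have [measurable]: "(\<lambda>r. Z (x - r) \<theta>) \<in> borel_measurable borel" by (rule measurable_compose[OF _ Z_measurable]) simp
  show ?thesis by measurable
qed

lemma dip_kernel_integrable:
  assumes \<theta>: "0 \<le> \<theta>" shows "integrable \<mu> (dip_kernel \<theta> x)"
proof -
  interpret mu: prob_space \<mu> by (rule prob_space_\<mu>)
  obtain B where B: "0 \<le> B" "\<And>y. 0 \<le> y \<Longrightarrow> y \<le> \<bar>x\<bar> \<Longrightarrow> \<bar>Z y \<theta>\<bar> \<le> B"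
    using continuous_bounded_Icc[OF continuous_on_subset[OF Z_cont subset_UNIV]] by blast
  show ?thesis
  proof (rule mu.integrable_const_bound[of _ "l * B + \<bar>\<psi>q \<theta> - l\<bar>"])
    show "AE r in \<mu>. norm (dip_kernel \<theta> x r) \<le> l * B + \<bar>\<psi>q \<theta> - l\<bar>" using AE_dip_law_nonneg
    proof eventually_elim
      case (elim r)
      show ?case
      proof (cases "r \<le> x")
        case True
        then have "l * \<bar>Z (x - r) \<theta>\<bar> \<le> l * B" using B(2)[of "x - r"] elim l by (intro mult_left_mono) auto
        moreover have "norm (dip_kernel \<theta> x r) = l * \<bar>Z (x - r) \<theta>\<bar>" using True l by (simp add: abs_mult)
        ultimately show ?thesis using abs_ge_zero[of "\<psi>q \<theta> - l"] by linarith
      next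
        case False
        then have "\<bar>\<psi>q \<theta> - l\<bar> * exp (\<theta> * (x - r)) \<le> \<bar>\<psi>q \<theta> - l\<bar> * 1"
          using \<theta> by (intro mult_left_mono) (auto simp: mult_nonneg_nonpos)
        moreover have "0 \<le> l * B" using l B(1) by simp
        ultimately show ?thesis using False by (simp add: abs_mult)
      qed
    qed
  qed (simp add: dip_kernel_measurable)
qed

end

section \<open>Reflection at \<open>0\<close> from below\<close>

locale observed_scale = scale_setup M X W q l + arrivals: Poisson_arrivals M l T
  for M :: "'a measure" and X W q l and T :: "nat \<Rightarrow> 'a \<Rightarrow> real" +
  assumes indep: "indep_of_arrivals M X T"
begin

sublocale up: observed_Levy M X l T by unfold_locales (rule indep)

sublocale dn: observed_Levy M "neg X" l T by (rule up.observed_uminus)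

text \<open>The value function is sought as \<open>C * Z y \<eta>\<close>. Integrating it over the
  exponential rise from \<open>z\<close> amounts to solving
  \<open>U' = \<Phi> * (U - C * Z)\<close>, and the hypothesis on \<open>C\<close> is the boundary
  condition at \<open>a\<close>, where the exponential excess over \<open>a\<close> has mean payoff
  \<open>\<beta> * \<Phi> / (\<Phi> + \<theta>)\<close>.\<close>

lemma below_inner:
  assumes \<theta>: "0 \<le> \<theta>" and z: "0 \<le> z" "z \<le> a" and ne: "\<eta> \<noteq> \<Phi>"
    and C: "C * (\<Phi> + \<theta>) * (\<psi>q \<eta> * Z a \<Phi> - l * Z a \<eta>) = l * (\<eta> - \<Phi>) * \<beta>"
  defines "F \<equiv> \<lambda>y. of_bool (0 \<le> y \<and> y \<le> a) * (C * Z y \<eta>)"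
  shows "(\<integral>d. up.gext \<theta> a \<beta> F (z + d) \<partial>\<nu>) = C * \<Phi> / (l * (\<eta> - \<Phi>)) * (\<psi>q \<eta> * Z z \<Phi> - l * Z z \<eta>)"
proof -
  \<comment> \<open>By \<open>Z_deriv\<close> the combination
    \<open>\<psi>q \<eta> * Z \<Phi> - l * Z \<eta>\<close> has derivative \<open>\<Phi>\<close>
    times itself minus \<open>l * (\<eta> - \<Phi>) * Z \<eta>\<close>; the factor \<open>K\<close>
    turns the last term into \<open>\<Phi> * C * Z \<eta>\<close>.\<close>
  define K where "K = C * \<Phi> / (l * (\<eta> - \<Phi>))"
  define U where "U d = K * (\<psi>q \<eta> * Z (z + d) \<Phi> - l * Z (z + d) \<eta>)" for d
  have Zs [measurable]: "(\<lambda>d. Z (z + d) \<alpha>) \<in> borel_measurable borel" for \<alpha> by (rule measurable_compose[OF _ Z_measurable]) simp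
  have Fm: "F \<in> borel_measurable borel" unfolding F_def of_bool_def by measurable
  have gm: "(\<lambda>d. up.gext \<theta> a \<beta> F (z + d)) \<in> borel_measurable borel" using Fm unfolding up.gext_def by measurable
  obtain B where B: "\<And>y. 0 \<le> y \<Longrightarrow> y \<le> a \<Longrightarrow> \<bar>C * Z y \<eta>\<bar> \<le> B"
    using continuous_bounded_Icc[of 0 a "\<lambda>y. C * Z y \<eta>"] continuous_on_subset[OF Z_cont subset_UNIV]
    by (metis continuous_on_mult_left)
  have "(\<integral>d. up.gext \<theta> a \<beta> F (z + d) \<partial>\<nu>) = (\<integral>d. up.gext \<theta> a \<beta> F (z + d) \<partial>exp_law \<Phi>)"
    by (rule integral_sup_law[OF gm])
  also have "\<dots> = (\<integral>d. (if d \<le> a - z then C * Z (z + d) \<eta> else \<beta> * exp (- \<theta> * (d - (a - z)))) \<partial>exp_law \<Phi>)"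
  proof (rule integral_cong_AE)
    show "AE d in exp_law \<Phi>. up.gext \<theta> a \<beta> F (z + d) = (if d \<le> a - z then C * Z (z + d) \<eta> else \<beta> * exp (- \<theta> * (d - (a - z))))"
      using AE_exp_law_pos by eventually_elim (use z in \<open>auto simp: up.gext_def F_def algebra_simps\<close>)
    show "(\<lambda>d. if d \<le> a - z then C * Z (z + d) \<eta> else \<beta> * exp (- \<theta> * (d - (a - z)))) \<in> borel_measurable (exp_law \<Phi>)"
      by measurable
  qed (use gm in simp)
  also have "\<dots> = U 0 + exp (- \<Phi> * (a - z)) * (\<beta> * \<Phi> / (\<Phi> + \<theta>) - U (a - z))"
  proof (rule integral_exp_law_split[OF Phi_pos \<theta>, where S="{}" and B=B])
    show "continuous_on {0..a - z} U" unfolding U_def[abs_def]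
      by (intro continuous_intros continuous_on_compose2[OF Z_cont]) auto
    fix d assume d: "0 < d" "d < a - z"
    have D: "((\<lambda>d. Z (z + d) \<alpha>) has_real_derivative (\<alpha> * Z (z + d) \<alpha> - \<psi>q \<alpha> * W (z + d)) * 1) (at d)" for \<alpha>
      using d z by (intro DERIV_chain2[where g="\<lambda>d. z + d"] Z_deriv) (auto intro!: derivative_eq_intros)
    have "(U has_real_derivative K * (\<psi>q \<eta> * ((\<Phi> * Z (z + d) \<Phi> - \<psi>q \<Phi> * W (z + d)) * 1) - l * ((\<eta> * Z (z + d) \<eta> - \<psi>q \<eta> * W (z + d)) * 1))) (at d)"
      unfolding U_def[abs_def] by (intro DERIV_cmult DERIV_diff D)
    moreover have "K * (\<psi>q \<eta> * ((\<Phi> * Z (z + d) \<Phi> - \<psi>q \<Phi> * W (z + d)) * 1) - l * ((\<eta> * Z (z + d) \<eta> - \<psi>q \<eta> * W (z + d)) * 1)) = \<Phi> * (U d - C * Z (z + d) \<eta>)"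
    proof -
      have "\<Phi> * C = K * l * (\<eta> - \<Phi>)" using ne l by (simp add: K_def)
      then have "\<Phi> * (U d - C * Z (z + d) \<eta>) = \<Phi> * U d - K * l * (\<eta> - \<Phi>) * Z (z + d) \<eta>"
        by (simp only: right_diff_distrib mult.assoc[symmetric])
      then show ?thesis unfolding U_def psi_q_Phi by (simp add: algebra_simps)
    qed
    ultimately show "(U has_real_derivative \<Phi> * (U d - C * Z (z + d) \<eta>)) (at d)" by simp
  qed (use z B in auto)
  \<comment> \<open>This makes the boundary bracket vanish and leaves \<open>U 0\<close>.\<close>
  also have "U (a - z) = \<beta> * \<Phi> / (\<Phi> + \<theta>)"
  proof -
    define N d P where "N = l * (\<eta> - \<Phi>)" and "d = \<psi>q \<eta> * Z a \<Phi> - l * Z a \<eta>" and "P = \<Phi> + \<theta>"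
    have N: "N \<noteq> 0" and P: "P \<noteq> 0" using ne l \<theta> Phi_pos by (auto simp: N_def P_def)
    have "C * d = N * \<beta> / P" using C P unfolding N_def[symmetric] d_def[symmetric] P_def[symmetric] by (simp add: field_simps)
    then have "C * \<Phi> / N * d = \<Phi> * (N * \<beta> / P) / N" by (metis (no_types, opaque_lifting) mult.assoc mult.commute times_divide_eq_right)
    also have "\<dots> = \<beta> * \<Phi> / P" using N by simp
    finally show ?thesis unfolding U_def K_def N_def d_def P_def by simp
  qed
  finally show ?thesis unfolding U_def K_def by simp
qed

text \<open>As a function of the depth, the inner integral is a combination of dip kernels at \<eta>
  and \<Phi>. For a depth beyond \<open>s\<close> the path is pushed to \<open>0\<close>, where
  \<open>Z\<close> is \<open>1\<close>, and the discount of the push reproduces the exponential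
  branch of the kernel at \<eta>; the one at \<Phi> vanishes there.\<close>

lemma below_fixed_point:
  assumes \<theta>: "0 \<le> \<theta>" and \<eta>: "0 \<le> \<eta>" and ne: "\<eta> \<noteq> \<Phi>" and s: "0 \<le> s" "s \<le> a"
    and C: "C * (\<Phi> + \<theta>) * (\<psi>q \<eta> * Z a \<Phi> - l * Z a \<eta>) = l * (\<eta> - \<Phi>) * \<beta>"
  defines "F \<equiv> \<lambda>y. of_bool (0 \<le> y \<and> y \<le> a) * (C * Z y \<eta>)"
  shows "F \<in> borel_measurable borel" "\<exists>B. \<forall>y. \<bar>F y\<bar> \<le> B" "up.renewal q \<eta> \<theta> a \<beta> F s = C * Z s \<eta>"
proof -
  define K where "K = C * \<Phi> / (l * (\<eta> - \<Phi>))"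
  interpret Nd: prob_space \<nu> by (rule dn.prob_space_dip_law[OF lq])
  show Fm: "F \<in> borel_measurable borel" unfolding F_def of_bool_def by measurable
  obtain B where B: "0 \<le> B" "\<And>y. 0 \<le> y \<Longrightarrow> y \<le> a \<Longrightarrow> \<bar>C * Z y \<eta>\<bar> \<le> B"
    using continuous_bounded_Icc[of 0 a "\<lambda>y. C * Z y \<eta>"] continuous_on_subset[OF Z_cont subset_UNIV]
    by (metis continuous_on_mult_left)
  have FB: "\<bar>F y\<bar> \<le> B" for y using B unfolding F_def by auto
  then show "\<exists>B. \<forall>y. \<bar>F y\<bar> \<le> B" by blast
  have gm: "up.gext \<theta> a \<beta> F \<in> borel_measurable borel" using Fm unfolding up.gext_def[abs_def] by measurable
  have im: "(\<lambda>z. \<integral>d. up.gext \<theta> a \<beta> F (z + d) \<partial>\<nu>) \<in> borel_measurable borel"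
    by (rule measurable_integral_shift[OF Nd.prob_space_axioms sets_dip_law gm])
  have "(\<integral>r. exp (- \<eta> * max 0 (r - s)) * (\<integral>d. up.gext \<theta> a \<beta> F (max 0 (s - r) + d) \<partial>\<nu>) \<partial>\<mu>)
    = (\<integral>r. K * (dip_kernel \<eta> s r + (- \<psi>q \<eta> / l) * dip_kernel \<Phi> s r) \<partial>\<mu>)"
  proof (rule integral_cong_AE)
    show "(\<lambda>r. exp (- \<eta> * max 0 (r - s)) * (\<integral>d. up.gext \<theta> a \<beta> F (max 0 (s - r) + d) \<partial>\<nu>)) \<in> borel_measurable \<mu>"
      using measurable_compose[OF _ im, of "\<lambda>r. max 0 (s - r)" borel] by simp
    show "(\<lambda>r. K * (dip_kernel \<eta> s r + (- \<psi>q \<eta> / l) * dip_kernel \<Phi> s r)) \<in> borel_measurable \<mu>"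
      using dip_kernel_measurable[of \<eta> s] dip_kernel_measurable[of \<Phi> s] by simp
    show "AE r in \<mu>. exp (- \<eta> * max 0 (r - s)) * (\<integral>d. up.gext \<theta> a \<beta> F (max 0 (s - r) + d) \<partial>\<nu>)
       = K * (dip_kernel \<eta> s r + (- \<psi>q \<eta> / l) * dip_kernel \<Phi> s r)" using AE_dip_law_nonneg
    proof eventually_elim
      case (elim r)
      have m: "0 \<le> max 0 (s - r)" "max 0 (s - r) \<le> a" using elim s by auto
      show ?case unfolding below_inner[OF \<theta> m ne C, folded F_def K_def] psi_q_Phi
        using l by (cases "r \<le> s") (simp_all add: max_def field_simps)
    qed
  qed
  also have "\<dots> = K * ((\<integral>r. dip_kernel \<eta> s r \<partial>\<mu>) + (- \<psi>q \<eta> / l) * (\<integral>r. dip_kernel \<Phi> s r \<partial>\<mu>))"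
    using dip_kernel_integrable[OF \<eta>, of s] dip_kernel_integrable[OF less_imp_le[OF Phi_pos], of s]
    by (subst integral_mult_right_zero, subst Bochner_Integration.integral_add) auto
  \<comment> \<open>The coefficient \<open>- \<psi>q \<eta> / l\<close> cancels the two terms with
    \<open>W\<close>, and the \<open>Z\<close> term at \<Phi> carries the factor
    \<open>\<Phi> - \<Phi>\<close>.\<close>
  also have "\<dots> = K * ((l + q) / \<Phi> * (\<eta> - \<Phi>) * Z s \<eta>)"
    unfolding dip_integral_Z[OF \<eta>, of s] dip_integral_Z[OF less_imp_le[OF Phi_pos], of s] unfolding psi_q_Phi
    using l Phi_pos by (simp add: field_simps)
  also have "l / (l + q) * \<dots> = C * Z s \<eta>"
  proof -
    define e where "e = \<eta> - \<Phi>"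
    have "e \<noteq> 0" using ne by (simp add: e_def)
    moreover have "l' / p * (C * f / (l' * e) * (p / f * e * z)) = C * z" if "l' \<noteq> 0" "p \<noteq> 0" "f \<noteq> 0" "e \<noteq> 0" for l' p f e z :: real
      using that by simp
    ultimately show ?thesis unfolding K_def e_def[symmetric] using l lq Phi_pos by simp
  qed
  finally show "up.renewal q \<eta> \<theta> a \<beta> F s = C * Z s \<eta>" unfolding up.renewal_eq[OF q \<eta> \<theta> Fm FB] .
qed

text \<open>The rise is exponential with parameter \<Phi>, so the chain leaves the interval in one
  step with probability at least \<open>exp (- \<Phi> * a)\<close>.\<close>

lemma contraction_below:
  assumes \<eta>: "0 \<le> \<eta>" and a: "0 < a"
  shows "\<exists>c\<ge>0. c < 1 \<and> (\<forall>s\<le>a. (\<integral>v. weight q \<eta> s v * of_bool (step s v \<le> a) \<partial>up.block_law) \<le> c)"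
proof -
  interpret mu: prob_space \<mu> by (rule prob_space_\<mu>)
  define c :: real where "c = (\<integral>d. of_bool (d \<le> a) \<partial>\<nu>)"
  have "c = (\<integral>d. (if d \<le> a then 1 else 0 * exp (- 0 * (d - a))) \<partial>exp_law \<Phi>)"
    unfolding c_def by (subst integral_sup_law) (auto simp: of_bool_def intro!: Bochner_Integration.integral_cong)
  also have "\<dots> = 1 + exp (- \<Phi> * a) * (0 * \<Phi> / (\<Phi> + 0) - 1)"
    by (rule integral_exp_law_split[OF Phi_pos, where S="{}" and B=1 and U="\<lambda>_. 1" and u="\<lambda>_. 1"]) (use a in auto)
  finally have c: "c = 1 - exp (- \<Phi> * a)" by simp
  have c0: "0 \<le> c" unfolding c_def by (rule Bochner_Integration.integral_nonneg) simp
  have "(\<integral>r. exp (- \<eta> * max 0 (r - a)) \<partial>\<mu>) \<le> (\<integral>r. 1 \<partial>\<mu>)"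
    by (rule integral_mono_AE') (use \<eta> in \<open>auto intro!: AE_I2\<close>)
  then have "(\<integral>r. exp (- \<eta> * max 0 (r - a)) \<partial>\<mu>) \<le> 1" using mu.prob_space by simp
  then have "(\<integral>r. exp (- \<eta> * max 0 (r - a)) \<partial>\<mu>) * c \<le> 1 * c" using c0 by (intro mult_right_mono)
  then show ?thesis
    using up.contraction_le[OF q \<eta>, of _ a, folded c_def] c0 c by (intro exI[of _ c]) (auto intro: order_trans)
qed

text \<open>\<open>C * Z y \<eta>\<close> solves the renewal equation, which has a unique bounded
  solution. With \<beta> = 1 this evaluates the expectation; with \<beta> = 0 it forces
  \<open>C = 0\<close>.\<close>

lemma E_below_Z:
  assumes a: "0 < a" and x: "x \<le> a" and \<theta>: "0 \<le> \<theta>" and \<eta>: "0 \<le> \<eta>" and ne: "\<eta> \<noteq> \<Phi>"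
    and C: "C * (\<Phi> + \<theta>) * (\<psi>q \<eta> * Z a \<Phi> - l * Z a \<eta>) = l * (\<eta> - \<Phi>) * \<beta>"
  shows "\<beta> * E_below M X T a q \<eta> \<theta> x = C * Z x \<eta>"
proof -
  define F where "F = (\<lambda>y. of_bool (0 \<le> y \<and> y \<le> a) * (C * Z y \<eta>))"
  note fp = below_fixed_point[OF \<theta> \<eta> ne _ _ C, folded F_def]
  have "\<exists>B. \<forall>y. \<bar>F y\<bar> \<le> B" using fp(2)[of 0] a unfolding F_def by simp
  then obtain B where B: "\<And>y. \<bar>F y\<bar> \<le> B" by blast
  obtain c where c: "0 \<le> c" "c < 1" "\<And>s. s \<le> a \<Longrightarrow> (\<integral>v. weight q \<eta> s v * of_bool (step s v \<le> a) \<partial>up.block_law) \<le> c"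
    using contraction_below[OF \<eta> a] by blast
  have "\<beta> * E_below M X T a q \<eta> \<theta> x = exp (- \<eta> * max (- x) 0) * up.renewal q \<eta> \<theta> a \<beta> F (max x 0)"
  proof (rule up.E_below_renewal[OF q \<eta> \<theta> _ B _ c(3) c(1,2)])
    show "F \<in> borel_measurable borel" using fp(1)[of 0] a by simp
    show "up.renewal q \<eta> \<theta> a \<beta> F s = F s" if "0 \<le> s" "s \<le> a" for s using fp(3)[OF that] that by (simp add: F_def)
  qed
  also have "\<dots> = exp (- \<eta> * max (- x) 0) * (C * Z (max x 0) \<eta>)" using x a by (subst fp(3)) auto
  \<comment> \<open>For a negative start the discount of the initial push is
    \<open>exp (\<eta> * x)\<close>, which is \<open>Z x \<eta>\<close>.\<close>
  also have "\<dots> = C * Z x \<eta>" by (cases "x \<le> 0") (auto simp: max_def Z_neg)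
  finally show ?thesis .
qed

end

section \<open>Reflection at \<open>a\<close> from above\<close>

context observed_scale
begin

text \<open>For \<open>neg X\<close> the rise of a block has the law \<mu> of the depth of
  \<open>X\<close>. Below level \<open>0\<close> the payoff is the exponential branch of the kernel
  at \<theta>, while the kernel at \<Phi> has no such branch; so a multiple \<open>B\<close> of
  \<open>Z y \<Phi>\<close> can be added freely, to be fixed by the boundary condition at
  \<open>a\<close>.\<close>

lemma above_inner:
  fixes \<beta> B a \<theta> z :: real
  assumes \<theta>: "0 \<le> \<theta>" and z: "0 \<le> z" and ne: "\<theta> \<noteq> \<Phi>"
  defines "V \<equiv> \<lambda>y. l / (l - \<psi>q \<theta>) * (\<beta> * Z y \<theta> + B * Z y \<Phi>)"
  defines "F \<equiv> \<lambda>y. of_bool (0 \<le> y \<and> y \<le> a) * V (a - y)"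
  shows "(\<integral>r. dn.gext \<theta> a \<beta> F (z + r) \<partial>\<mu>)
    = (l + q) / \<Phi> * (\<beta> * ((\<theta> - \<Phi>) * Z (a - z) \<theta> - \<psi>q \<theta> * W (a - z)) - B * l * W (a - z)) / (\<psi>q \<theta> - l)"
proof -
  have m: "\<psi>q \<theta> - l \<noteq> 0" using psi_q_eq_iff[OF \<theta>] ne by auto
  have Vm: "V \<in> borel_measurable borel" unfolding V_def by measurable
  have Fm: "F \<in> borel_measurable borel"
    using measurable_compose[OF _ Vm, of "\<lambda>y. a - y" borel] unfolding F_def of_bool_def by measurable
  have gm: "(\<lambda>d. dn.gext \<theta> a \<beta> F (z + d)) \<in> borel_measurable borel" using Fm unfolding dn.gext_def by measurable
  have "(\<integral>r. dn.gext \<theta> a \<beta> F (z + r) \<partial>\<mu>)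
    = (\<integral>r. \<beta> / (\<psi>q \<theta> - l) * dip_kernel \<theta> (a - z) r + B / (\<psi>q \<theta> - l) * dip_kernel \<Phi> (a - z) r \<partial>\<mu>)"
  proof (rule integral_cong_AE)
    show "(\<lambda>r. dn.gext \<theta> a \<beta> F (z + r)) \<in> borel_measurable \<mu>" using gm by simp
    show "(\<lambda>r. \<beta> / (\<psi>q \<theta> - l) * dip_kernel \<theta> (a - z) r + B / (\<psi>q \<theta> - l) * dip_kernel \<Phi> (a - z) r) \<in> borel_measurable \<mu>"
      using dip_kernel_measurable[of \<theta> "a - z"] dip_kernel_measurable[of \<Phi> "a - z"] by simp
    show "AE r in \<mu>. dn.gext \<theta> a \<beta> F (z + r) = \<beta> / (\<psi>q \<theta> - l) * dip_kernel \<theta> (a - z) r + B / (\<psi>q \<theta> - l) * dip_kernel \<Phi> (a - z) r"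
      using AE_dip_law_nonneg
    proof eventually_elim
      case (elim r)
      show ?case
      proof (cases "r \<le> a - z")
        case True
        have e: "a - (z + r) = a - z - r" by simp
        have "dn.gext \<theta> a \<beta> F (z + r) = V (a - z - r)" using True elim z unfolding dn.gext_def F_def e by simp
        also have "\<dots> = \<beta> / (\<psi>q \<theta> - l) * (- l * Z (a - z - r) \<theta>) + B / (\<psi>q \<theta> - l) * (- l * Z (a - z - r) \<Phi>)"
        proof -
          have d: "l / (l - \<psi>q \<theta>) = - l / (\<psi>q \<theta> - l)" by (metis minus_diff_eq minus_divide_divide minus_minus)
          have "- l / n * (\<beta> * z + B * z') = \<beta> / n * (- l * z) + B / n * (- l * z')" for n z z' :: real
            by (simp add: add_divide_distrib diff_divide_distrib algebra_simps)
          then show ?thesis unfolding V_def d .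
        qed
        finally show ?thesis using True by simp
      next
        case False
        have "dn.gext \<theta> a \<beta> F (z + r) = \<beta> * exp (\<theta> * (a - z - r))" using False unfolding dn.gext_def by (simp add: algebra_simps)
        then show ?thesis using False m by (simp add: psi_q_Phi)
      qed
    qed
  qed
  also have "\<dots> = \<beta> / (\<psi>q \<theta> - l) * (\<integral>r. dip_kernel \<theta> (a - z) r \<partial>\<mu>) + B / (\<psi>q \<theta> - l) * (\<integral>r. dip_kernel \<Phi> (a - z) r \<partial>\<mu>)"
    using dip_kernel_integrable[OF \<theta>, of "a - z"] dip_kernel_integrable[OF less_imp_le[OF Phi_pos], of "a - z"]
    by (subst Bochner_Integration.integral_add) auto
  also have "\<dots> = (l + q) / \<Phi> * (\<beta> * ((\<theta> - \<Phi>) * Z (a - z) \<theta> - \<psi>q \<theta> * W (a - z)) - B * l * W (a - z)) / (\<psi>q \<theta> - l)"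
    unfolding dip_integral_Z[OF \<theta>, of "a - z"] dip_integral_Z[OF less_imp_le[OF Phi_pos], of "a - z"] unfolding psi_q_Phi
    by (simp add: add_divide_distrib diff_divide_distrib algebra_simps)
  finally show ?thesis .
qed

lemma uminus_uminus_X: "(\<lambda>t \<omega>. - (- X t \<omega>)) = X" by simp

text \<open>With \<open>g\<close> the mean over the depth when \<open>X\<close> stands at a given
  level, the integral over the exponential supremum is governed by
  \<open>U' = \<Phi> * (U - g)\<close>, solved by the multiple \<open>(l + q) / l\<close> of the
  ansatz \<open>V\<close>. The hypothesis on \<open>B\<close> is the boundary condition at
  \<open>a\<close>.\<close>

lemma above_fixed_point:
  fixes \<beta> B :: real
  assumes \<theta>: "0 \<le> \<theta>" and \<eta>: "0 \<le> \<eta>" and ne: "\<theta> \<noteq> \<Phi>" and s: "0 \<le> s" and a: "0 < a"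
    and B: "B * (\<Phi> * Z a \<Phi> - l * W a + \<eta> * Z a \<Phi>) = \<beta> * (W a * \<psi>q \<theta> - (\<theta> + \<eta>) * Z a \<theta>)"
  defines "V \<equiv> \<lambda>y. l / (l - \<psi>q \<theta>) * (\<beta> * Z y \<theta> + B * Z y \<Phi>)"
  defines "F \<equiv> \<lambda>y. of_bool (0 \<le> y \<and> y \<le> a) * V (a - y)"
  shows "F \<in> borel_measurable borel" "\<exists>B. \<forall>y. \<bar>F y\<bar> \<le> B" "dn.renewal q \<eta> \<theta> a \<beta> F s = V (a - s)"
proof -
  define g where "g y = (l + q) / \<Phi> * (\<beta> * ((\<theta> - \<Phi>) * Z y \<theta> - \<psi>q \<theta> * W y) - B * l * W y) / (\<psi>q \<theta> - l)" for y
  have m: "\<psi>q \<theta> - l \<noteq> 0" using psi_q_eq_iff[OF \<theta>] ne by auto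
  have k: "l / (l - \<psi>q \<theta>) = - l / (\<psi>q \<theta> - l)" by (metis minus_diff_eq minus_divide_divide minus_minus)
  interpret mu: prob_space \<mu> by (rule prob_space_\<mu>)
  have Vm: "V \<in> borel_measurable borel" unfolding V_def by measurable
  have Vc: "continuous_on A V" for A
    unfolding V_def by (intro continuous_intros continuous_on_subset[OF Z_cont subset_UNIV])
  show Fm: "F \<in> borel_measurable borel"
    using measurable_compose[OF _ Vm, of "\<lambda>y. a - y" borel] unfolding F_def of_bool_def by measurable
  obtain D where D: "0 \<le> D" "\<And>y. 0 \<le> y \<Longrightarrow> y \<le> a \<Longrightarrow> \<bar>V y\<bar> \<le> D" using continuous_bounded_Icc[OF Vc] by blast
  have FB: "\<bar>F y\<bar> \<le> D" for y using D unfolding F_def by auto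
  then show "\<exists>B. \<forall>y. \<bar>F y\<bar> \<le> B" by blast
  have gm: "g \<in> borel_measurable borel" unfolding g_def[abs_def] by measurable
  have dgm: "dn.gext \<theta> a \<beta> F \<in> borel_measurable borel" using Fm unfolding dn.gext_def[abs_def] by measurable
  have im: "(\<lambda>z. \<integral>r. dn.gext \<theta> a \<beta> F (z + r) \<partial>\<mu>) \<in> borel_measurable borel"
    by (rule measurable_integral_shift[OF mu.prob_space_axioms sets_dip_law dgm])
  \<comment> \<open>The position of \<open>X\<close> itself. It may be negative: a start
    \<open>x < 0\<close> is allowed, and nothing is observed at time \<open>0\<close>.\<close>
  define y where "y = a - s"
  have sy: "s = a - y" by (simp add: y_def)
  obtain D1 where D1: "\<And>u. y \<le> u \<Longrightarrow> u \<le> a \<Longrightarrow> \<bar>W (max 0 u)\<bar> \<le> D1"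
  proof -
    have "continuous_on {y..a} (\<lambda>u. W (max 0 u))" by (intro continuous_on_compose2[OF W_cont] continuous_intros) auto
    then show thesis using continuous_bounded_Icc that by blast
  qed
  have D1': "\<bar>W u\<bar> \<le> D1" if "y \<le> u" "u \<le> a" for u
    using D1[OF that] W_neg[of u] abs_ge_zero[of "W (max 0 u)"] by (cases "u < 0") (auto simp: max_def)
  obtain D2 where D2: "\<And>u. y \<le> u \<Longrightarrow> u \<le> a \<Longrightarrow> \<bar>(\<theta> - \<Phi>) * \<beta> * Z u \<theta>\<bar> \<le> D2"
    using continuous_bounded_Icc[of y a "\<lambda>u. (\<theta> - \<Phi>) * \<beta> * Z u \<theta>"] continuous_on_subset[OF Z_cont subset_UNIV]
    by (metis continuous_on_mult_left)
  have gb: "\<bar>g u\<bar> \<le> \<bar>(l + q) / \<Phi>\<bar> * (D2 + \<bar>\<beta> * \<psi>q \<theta> + B * l\<bar> * D1) / \<bar>\<psi>q \<theta> - l\<bar>" if "y \<le> u" "u \<le> a" for u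
  proof -
    have "\<beta> * ((\<theta> - \<Phi>) * Z u \<theta> - \<psi>q \<theta> * W u) - B * l * W u = (\<theta> - \<Phi>) * \<beta> * Z u \<theta> - (\<beta> * \<psi>q \<theta> + B * l) * W u"
      by (simp add: algebra_simps)
    then have "\<bar>\<beta> * ((\<theta> - \<Phi>) * Z u \<theta> - \<psi>q \<theta> * W u) - B * l * W u\<bar> \<le> \<bar>(\<theta> - \<Phi>) * \<beta> * Z u \<theta>\<bar> + \<bar>\<beta> * \<psi>q \<theta> + B * l\<bar> * \<bar>W u\<bar>"
      by (metis abs_mult abs_triangle_ineq4)
    also have "\<dots> \<le> D2 + \<bar>\<beta> * \<psi>q \<theta> + B * l\<bar> * D1" by (intro add_mono mult_left_mono D2 D1' that) auto
    finally show ?thesis unfolding g_def abs_mult abs_divide by (intro divide_right_mono mult_left_mono) auto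
  qed
  define U where "U S = (l + q) / l * V (y + S)" for S
  \<comment> \<open>Beyond \<open>a\<close> the exponential excess goes into the regulator and is
    discounted to \<open>\<Phi> / (\<Phi> + \<eta>)\<close> on average. This equation makes the
    boundary bracket of \<open>integral_exp_law_split\<close> vanish.\<close>
  have Va: "g a * \<Phi> / (\<Phi> + \<eta>) = (l + q) / l * V a"
  proof -
    have "\<beta> * ((\<theta> - \<Phi>) * Z a \<theta> - \<psi>q \<theta> * W a) - B * l * W a = - (\<Phi> + \<eta>) * (\<beta> * Z a \<theta> + B * Z a \<Phi>)"
      using B by (simp add: algebra_simps)
    then have ga: "g a = (l + q) / \<Phi> * (- (\<Phi> + \<eta>) * (\<beta> * Z a \<theta> + B * Z a \<Phi>)) / (\<psi>q \<theta> - l)" unfolding g_def by simp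
    have "\<Phi> + \<eta> \<noteq> 0" using \<eta> Phi_pos by simp
    moreover have "p / f * (- P * z) / n * f / P = p / l * (- l / n * z)" if "P \<noteq> 0" "f \<noteq> 0" for p f P n z :: real
      using that l by simp
    ultimately show ?thesis unfolding V_def k ga using less_imp_neq[OF Phi_pos] by metis
  qed
  have Vd: "(V has_real_derivative \<Phi> * V u - l * \<Phi> / (l + q) * g u) (at u)" if "u \<noteq> 0" for u
  proof -
    have "(V has_real_derivative l / (l - \<psi>q \<theta>) * (\<beta> * (\<theta> * Z u \<theta> - \<psi>q \<theta> * W u) + B * (\<Phi> * Z u \<Phi> - \<psi>q \<Phi> * W u))) (at u)"
      unfolding V_def using that by (intro DERIV_cmult DERIV_add Z_deriv_neq)
    moreover have "l / (l - \<psi>q \<theta>) * (\<beta> * (\<theta> * Z u \<theta> - \<psi>q \<theta> * W u) + B * (\<Phi> * Z u \<Phi> - \<psi>q \<Phi> * W u)) = \<Phi> * V u - l * \<Phi> / (l + q) * g u"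
    proof -
      have "l * \<Phi> / (l + q) * g u = l * (\<beta> * ((\<theta> - \<Phi>) * Z u \<theta> - \<psi>q \<theta> * W u) - B * l * W u) / (\<psi>q \<theta> - l)"
      proof -
        have "l * f / p * (p / f * x / n) = l * x / n" if "p \<noteq> 0" "f \<noteq> 0" for f p x n :: real using that by simp
        then show ?thesis unfolding g_def using lq Phi_pos by simp
      qed
      then show ?thesis unfolding V_def k psi_q_Phi by (simp add: add_divide_distrib diff_divide_distrib algebra_simps)
    qed
    ultimately show ?thesis by simp
  qed
  have "(\<integral>r. exp (- \<eta> * max 0 (r - s)) * (\<integral>d. dn.gext \<theta> a \<beta> F (max 0 (s - r) + d) \<partial>\<mu>) \<partial>\<nu>)
    = (\<integral>r. exp (- \<eta> * max 0 (r - s)) * (\<integral>d. dn.gext \<theta> a \<beta> F (max 0 (s - r) + d) \<partial>\<mu>) \<partial>exp_law \<Phi>)"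
    using measurable_compose[OF _ im, of "\<lambda>r. max 0 (s - r)" borel] by (intro integral_sup_law) simp
  also have "\<dots> = (\<integral>r. (if r \<le> s then g (y + r) else g a * exp (- \<eta> * (r - s))) \<partial>exp_law \<Phi>)"
  proof (rule Bochner_Integration.integral_cong[OF refl])
    fix r
    have "(\<integral>d. dn.gext \<theta> a \<beta> F (max 0 (s - r) + d) \<partial>\<mu>) = g (a - max 0 (s - r))"
      unfolding g_def F_def V_def by (rule above_inner[OF \<theta> _ ne]) simp
    then show "exp (- \<eta> * max 0 (r - s)) * (\<integral>d. dn.gext \<theta> a \<beta> F (max 0 (s - r) + d) \<partial>\<mu>) = (if r \<le> s then g (y + r) else g a * exp (- \<eta> * (r - s)))"
      by (simp add: max_def y_def algebra_simps)
  qed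
  also have "\<dots> = U 0 + exp (- \<Phi> * s) * (g a * \<Phi> / (\<Phi> + \<eta>) - U s)"
  \<comment> \<open>The exceptional point is where \<open>y + r\<close> crosses \<open>0\<close>,
    the possible kink of \<open>V\<close>.\<close>
  proof (rule integral_exp_law_split[OF Phi_pos \<eta> s, where S="{- y}"])
    show "(\<lambda>r. g (y + r)) \<in> borel_measurable borel" by (rule measurable_compose[OF _ gm]) simp
    show "\<bar>g (y + r)\<bar> \<le> \<bar>(l + q) / \<Phi>\<bar> * (D2 + \<bar>\<beta> * \<psi>q \<theta> + B * l\<bar> * D1) / \<bar>\<psi>q \<theta> - l\<bar>" if "0 \<le> r" "r \<le> s" for r
      by (rule gb) (use that sy in auto)
    show "continuous_on {0..s} U" unfolding U_def[abs_def]
      by (intro continuous_intros continuous_on_compose2[OF Vc[of UNIV]]) auto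
    fix r assume r: "r \<notin> {- y}"
    have "((\<lambda>r. V (y + r)) has_real_derivative (\<Phi> * V (y + r) - l * \<Phi> / (l + q) * g (y + r)) * 1) (at r)"
      using r by (intro DERIV_chain2[where g="\<lambda>r. y + r"] Vd) (auto intro!: derivative_eq_intros)
    then have "(U has_real_derivative (l + q) / l * ((\<Phi> * V (y + r) - l * \<Phi> / (l + q) * g (y + r)) * 1)) (at r)"
      unfolding U_def[abs_def] by (rule DERIV_cmult)
    moreover have "(l + q) / l * ((\<Phi> * V (y + r) - l * \<Phi> / (l + q) * g (y + r)) * 1) = \<Phi> * (U r - g (y + r))"
    proof -
      have "p / l * (f * v - l * f / p * w) = f * (p / l * v - w)" if "p \<noteq> 0" for f p v w :: real
        using that l by (simp add: algebra_simps)
      then show ?thesis unfolding U_def using lq by simp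
    qed
    ultimately show "(U has_real_derivative \<Phi> * (U r - g (y + r))) (at r)" by simp
  qed simp
  also have "\<dots> = (l + q) / l * V y" unfolding Va U_def by (simp add: y_def)
  finally show "dn.renewal q \<eta> \<theta> a \<beta> F s = V (a - s)"
    unfolding dn.renewal_eq[OF q \<eta> \<theta> Fm FB] uminus_uminus_X y_def using l lq by simp
qed

text \<open>The strict loss comes from the regulator: the supremum exceeds \<open>a\<close> with
  positive probability, and the excess is discounted by \<eta> > 0.\<close>

lemma contraction_above:
  assumes \<eta>: "0 < \<eta>" and a: "0 < a"
  shows "\<exists>c\<ge>0. c < 1 \<and> (\<forall>s\<le>a. (\<integral>v. weight q \<eta> s v * of_bool (step s v \<le> a) \<partial>dn.block_law) \<le> c)"
proof -
  interpret mu: prob_space \<mu> by (rule prob_space_\<mu>)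
  define c :: real where "c = (\<integral>r. exp (- \<eta> * max 0 (r - a)) \<partial>\<nu>)"
  have "c = (\<integral>r. (if r \<le> a then 1 else 1 * exp (- \<eta> * (r - a))) \<partial>exp_law \<Phi>)"
    unfolding c_def by (subst integral_sup_law) (auto simp: max_def intro!: Bochner_Integration.integral_cong)
  also have "\<dots> = 1 + exp (- \<Phi> * a) * (1 * \<Phi> / (\<Phi> + \<eta>) - 1)"
    by (rule integral_exp_law_split[OF Phi_pos, where S="{}" and B=1 and U="\<lambda>_. 1" and u="\<lambda>_. 1"]) (use a \<eta> in auto)
  finally have c: "c = 1 + exp (- \<Phi> * a) * (\<Phi> / (\<Phi> + \<eta>) - 1)" by simp
  have c0: "0 \<le> c" unfolding c_def by (rule Bochner_Integration.integral_nonneg) simp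
  have "exp (- \<Phi> * a) * (\<Phi> / (\<Phi> + \<eta>) - 1) < 0" using \<eta> Phi_pos by (intro mult_pos_neg) (auto simp: field_simps)
  then have c1: "c < 1" unfolding c by simp
  have "(\<integral>d. of_bool (d \<le> a) \<partial>\<mu>) \<le> (\<integral>d. (1 :: real) \<partial>\<mu>)" by (rule integral_mono_AE') (auto intro!: AE_I2)
  then have "(\<integral>d. of_bool (d \<le> a) \<partial>\<mu>) \<le> (1 :: real)" using mu.prob_space by simp
  then have "c * (\<integral>d. of_bool (d \<le> a) \<partial>\<mu>) \<le> c * 1" using c0 by (intro mult_left_mono)
  then show ?thesis using dn.contraction_le[OF q less_imp_le[OF \<eta>], of _ a, folded c_def] c0 c1
    unfolding uminus_uminus_X by (intro exI[of _ c]) (auto intro: order_trans)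
qed

lemma E_above_Z:
  assumes a: "0 < a" and x: "x \<le> a" and \<theta>: "0 \<le> \<theta>" and \<eta>: "0 < \<eta>" and ne: "\<theta> \<noteq> \<Phi>"
    and B: "B * (\<Phi> * Z a \<Phi> - l * W a + \<eta> * Z a \<Phi>) = \<beta> * (W a * \<psi>q \<theta> - (\<theta> + \<eta>) * Z a \<theta>)"
  shows "\<beta> * E_above M X T a q \<eta> \<theta> x = l / (l - \<psi>q \<theta>) * (\<beta> * Z x \<theta> + B * Z x \<Phi>)"
proof -
  define V where "V = (\<lambda>y. l / (l - \<psi>q \<theta>) * (\<beta> * Z y \<theta> + B * Z y \<Phi>))"
  define F where "F = (\<lambda>y. of_bool (0 \<le> y \<and> y \<le> a) * V (a - y))"
  note fp = above_fixed_point[OF \<theta> less_imp_le[OF \<eta>] ne _ a B]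
  have ren: "dn.renewal q \<eta> \<theta> a \<beta> F s = V (a - s)" if "0 \<le> s" for s using fp(3)[OF that] unfolding F_def V_def .
  have "\<exists>D. \<forall>y. \<bar>F y\<bar> \<le> D" using fp(2)[of 0] unfolding F_def V_def by simp
  then obtain D where D: "\<And>y. \<bar>F y\<bar> \<le> D" by blast
  obtain c where c: "0 \<le> c" "c < 1" "\<And>s. s \<le> a \<Longrightarrow> (\<integral>v. weight q \<eta> s v * of_bool (step s v \<le> a) \<partial>dn.block_law) \<le> c"
    using contraction_above[OF \<eta> a] by blast
  have "\<beta> * E_above M X T a q \<eta> \<theta> x = \<beta> * E_below M (neg X) T a q \<eta> \<theta> (a - x)" by (simp only: up.E_above_eq)
  also have "\<dots> = exp (- \<eta> * max (- (a - x)) 0) * dn.renewal q \<eta> \<theta> a \<beta> F (max (a - x) 0)"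
  proof (rule dn.E_below_renewal[OF q less_imp_le[OF \<eta>] \<theta> _ D _ c(3) c(1,2)])
    show "F \<in> borel_measurable borel" using fp(1)[of 0] unfolding F_def V_def by simp
    show "dn.renewal q \<eta> \<theta> a \<beta> F s = F s" if "0 \<le> s" "s \<le> a" for s using ren[OF that(1)] that by (simp add: F_def)
  qed
  also have "\<dots> = V x" using x by (subst ren) (auto simp: max_def)
  finally show ?thesis unfolding V_def .
qed

end

section \<open>Limits in the parameters\<close>

lemma (in observed_Levy) E_below_tendsto:
  assumes q: "0 \<le> q" and u: "\<And>n. 0 \<le> u n" "u \<longlonglongrightarrow> \<eta>" and v: "\<And>n. 0 \<le> v n" "v \<longlonglongrightarrow> \<theta>"
  shows "(\<lambda>n. E_below M X T a q (u n) (v n) x) \<longlonglongrightarrow> E_below M X T a q \<eta> \<theta> x" unfolding E_below_eq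
proof (rule integral_dominated_convergence[where w="\<lambda>_. 1"])
  have \<eta>: "0 \<le> \<eta>" and \<theta>: "0 \<le> \<theta>" using LIMSEQ_le_const[OF u(2)] LIMSEQ_le_const[OF v(2)] u(1) v(1) by blast+
  show "below_integrand a q \<eta> \<theta> x \<in> borel_measurable M" "below_integrand a q (u n) (v n) x \<in> borel_measurable M" for n
    using reward_series(2) q u v \<eta> \<theta> by auto
  show "AE \<omega> in M. (\<lambda>n. below_integrand a q (u n) (v n) x \<omega>) \<longlonglongrightarrow> below_integrand a q \<eta> \<theta> x \<omega>"
    unfolding below_integrand_def Let_def by (intro AE_I2 tendsto_intros u v)
  show "AE \<omega> in M. norm (below_integrand a q (u n) (v n) x \<omega>) \<le> 1" for n
    using below_integrand_range[OF _ q u(1)[of n] v(1)[of n]] by (intro AE_I2) simp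
qed simp

lemma (in scale_setup) kappa_continuous: "continuous_on {0..} \<kappa>"
  unfolding continuous_on_sequentially
proof (intro allI ballI impI)
  fix u :: "nat \<Rightarrow> real" and \<eta> assume "\<eta> \<in> {0..}" and u: "(\<forall>n. u n \<in> {0..}) \<and> u \<longlonglongrightarrow> \<eta>"
  interpret mu: prob_space \<mu> by (rule prob_space_\<mu>)
  show "(\<kappa> \<circ> u) \<longlonglongrightarrow> \<kappa> \<eta>" unfolding comp_def kappa_def
  proof (rule integral_dominated_convergence[where w="\<lambda>_. 1"])
    show "AE r in \<mu>. (\<lambda>n. exp (- u n * r)) \<longlonglongrightarrow> exp (- \<eta> * r)" using u by (intro AE_I2 tendsto_intros) blast
    show "AE r in \<mu>. norm (exp (- u n * r)) \<le> 1" for n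
      using AE_dip_law_nonneg by eventually_elim (use u in auto)
  qed auto
qed

lemma at_Ici_neq_bot: "0 \<le> x \<Longrightarrow> at x within {0::real..} \<noteq> bot"
proof -
  assume "0 \<le> x"
  then have "at_right x \<le> at x within {0..}" by (intro at_le) auto
  then show ?thesis using trivial_limit_at_right_real[of x] by (metis bot.extremum_uniqueI)
qed

lemma vector_derivative_Ici:
  fixes f :: "real \<Rightarrow> real"
  assumes "0 \<le> x" "(f has_real_derivative D) (at x within {0..})"
  shows "vector_derivative f (at x within {0..}) = D" using assms at_Ici_neq_bot
  by (intro vector_derivative_within) (auto simp: has_real_derivative_iff_has_vector_derivative)

context scale_setup
begin

text \<open>By \<open>kappa_Phi\<close> the difference quotient of \<open>\<psi>q\<close> at \<Phi>
  is \<open>(l + q) / \<Phi> / \<kappa> u\<close>, so differentiability reduces to continuity of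
  \<open>\<kappa>\<close>.\<close>

lemma psi_q_deriv: "(\<psi>q has_real_derivative (l + q) / \<Phi> / \<kappa> \<Phi>) (at \<Phi> within {0..})"
  unfolding has_field_derivative_iff
proof (rule Lim_transform_eventually)
  have pos: "0 < \<kappa> u" if "0 \<le> u" for u by (rule kappa_pos[OF lq that])
  have "(\<kappa> \<longlongrightarrow> \<kappa> \<Phi>) (at \<Phi> within {0..})" using kappa_continuous Phi_pos by (simp add: continuous_on)
  then show "((\<lambda>u. (l + q) / \<Phi> / \<kappa> u) \<longlongrightarrow> (l + q) / \<Phi> / \<kappa> \<Phi>) (at \<Phi> within {0..})"
    using pos[of \<Phi>] Phi_pos by (intro tendsto_intros) auto
  show "\<forall>\<^sub>F u in at \<Phi> within {0..}. (l + q) / \<Phi> / \<kappa> u = (\<psi>q u - \<psi>q \<Phi>) / (u - \<Phi>)" unfolding eventually_at_filter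
  proof (intro always_eventually allI impI)
    fix u assume u: "u \<noteq> \<Phi>" "u \<in> {0..}"
    have "(\<psi>q u - \<psi>q \<Phi>) * \<kappa> u = (l + q) / \<Phi> * (u - \<Phi>)" using kappa_Phi[of u] u by (simp add: psi_q_Phi)
    moreover have "A = c / k * n" if "A * k = c * n" "0 < k" for A c n k :: real
      using that by (simp add: field_simps)
    ultimately have "\<psi>q u - \<psi>q \<Phi> = (l + q) / \<Phi> / \<kappa> u * (u - \<Phi>)" using pos[of u] u by (metis atLeast_iff)
    then show "(l + q) / \<Phi> / \<kappa> u = (\<psi>q u - \<psi>q \<Phi>) / (u - \<Phi>)" using u by simp
  qed
qed

lemma J_deriv_parameter: "\<exists>D. ((\<lambda>\<theta>. J \<theta> y) has_real_derivative D) (at \<theta>)"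
proof -
  have "((\<lambda>\<theta>. integral (cbox 0 y) (\<lambda>x. exp (- \<theta> * x) * W x)) has_field_derivative
      integral (cbox 0 y) (\<lambda>x. exp (- \<theta> * x) * - x * W x)) (at \<theta> within UNIV)"
  proof (rule leibniz_rule_field_derivative)
    show "continuous_on (UNIV \<times> cbox 0 y) (\<lambda>(\<theta>, x). exp (- \<theta> * x) * - x * W x)" unfolding case_prod_unfold
      by (intro continuous_intros continuous_on_compose2[OF W_cont]) auto
    show "(\<lambda>x. exp (- \<theta> * x) * W x) integrable_on cbox 0 y" for \<theta>
      using integrable_continuous_interval[OF W_exp_cont] by simp
    fix \<theta> x
    show "((\<lambda>\<theta>. exp (- \<theta> * x) * W x) has_real_derivative exp (- \<theta> * x) * - x * W x) (at \<theta> within UNIV)"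
      by (auto intro!: derivative_eq_intros)
  qed auto
  then show ?thesis unfolding J_def by auto
qed

lemma Z_deriv_parameter: "\<exists>D. ((\<lambda>\<theta>. Z x \<theta>) has_real_derivative D) (at \<Phi> within {0..})"
proof -
  obtain D where D: "((\<lambda>\<theta>. J \<theta> (max 0 x)) has_real_derivative D) (at \<Phi> within {0..})"
    using J_deriv_parameter has_field_derivative_at_within by blast
  have "\<exists>D. ((\<lambda>\<theta>. exp (\<theta> * x) * (1 - \<psi>q \<theta> * J \<theta> (max 0 x))) has_real_derivative D) (at \<Phi> within {0..})"
    by (rule exI, (rule derivative_intros psi_q_deriv D)+)
  then show ?thesis unfolding Z_eq .
qed

lemma Z_tendsto_Phi: "((\<lambda>u. Z x u) \<longlongrightarrow> Z x \<Phi>) (at \<Phi> within {0..})"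
  using Z_deriv_parameter[of x] DERIV_continuous continuous_within by blast

text \<open>The numerator vanishes at \<Phi>, so the quotient is a difference quotient, and its
  limit is the derivative by which \<open>scale_Z_tilde\<close> is defined on the diagonal.\<close>

lemma Z_tilde_tendsto:
  "((\<lambda>u. (\<psi>q u * Z y \<Phi> - l * Z y u) / (u - \<Phi>)) \<longlongrightarrow> scale_Z_tilde psi q W y \<Phi> \<Phi>) (at \<Phi> within {0..})"
proof -
  obtain D where D: "((\<lambda>\<theta>. Z y \<theta>) has_real_derivative D) (at \<Phi> within {0..})" using Z_deriv_parameter by blast
  define E where "E = (l + q) / \<Phi> / \<kappa> \<Phi>"
  have "((\<lambda>u. \<psi>q u * Z y \<Phi> - l * Z y u) has_real_derivative E * Z y \<Phi> - l * D) (at \<Phi> within {0..})"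
    unfolding E_def by (intro DERIV_diff DERIV_cmult D DERIV_cmult_right psi_q_deriv)
  then have "((\<lambda>u. (\<psi>q u * Z y \<Phi> - l * Z y u) / (u - \<Phi>)) \<longlongrightarrow> E * Z y \<Phi> - l * D) (at \<Phi> within {0..})"
    unfolding has_field_derivative_iff by (simp add: psi_q_Phi)
  moreover have "scale_Z_tilde psi q W y \<Phi> \<Phi> = E * Z y \<Phi> - l * D" unfolding scale_Z_tilde_def E_def
    using vector_derivative_Ici[OF less_imp_le[OF Phi_pos] psi_q_deriv] vector_derivative_Ici[OF less_imp_le[OF Phi_pos] D]
    by (simp add: psi_q_Phi)
  ultimately show ?thesis by simp
qed

end

lemma quot_lim_eqI:
  assumes v: "0 \<le> v"
    and "d v \<noteq> 0 \<Longrightarrow> n v / d v = L" "d v = 0 \<Longrightarrow> n v = 0"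
    and "d v = 0 \<Longrightarrow> ((\<lambda>u. n u / d u) \<longlongrightarrow> L) (at v within {0..})"
  shows "quot_lim n d v = L" unfolding quot_lim_def using assms tendsto_Lim[OF at_Ici_neq_bot[OF v]] by auto

section \<open>Non-vanishing denominators and exceptional parameters\<close>

context observed_scale
begin

lemma E_below_tendsto_at:
  assumes \<theta>: "0 \<le> \<theta>"
  shows "((\<lambda>\<eta>. E_below M X T a q \<eta> \<theta> x) \<longlongrightarrow> E_below M X T a q \<eta> \<theta> x) (at \<eta> within {0..})"
  unfolding tendsto_at_iff_sequentially comp_def using \<theta> by (auto intro!: up.E_below_tendsto q)

lemma E_above_tendsto_at:
  assumes \<theta>: "0 \<le> \<theta>" and \<eta>: "0 \<le> \<eta>"
  shows "((\<lambda>\<eta>. E_above M X T a q \<eta> \<theta> x) \<longlongrightarrow> E_above M X T a q \<eta> \<theta> x) (at \<eta> within {0..})"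
    and "((\<lambda>\<theta>. E_above M X T a q \<eta> \<theta> x) \<longlongrightarrow> E_above M X T a q \<eta> \<theta> x) (at \<theta> within {0..})"
  unfolding tendsto_at_iff_sequentially comp_def up.E_above_eq using \<theta> \<eta> by (auto intro!: dn.E_below_tendsto q)

text \<open>At a zero, \<beta> = 0 and \<open>C = 1\<close> would satisfy the boundary condition, a
  non-trivial solution of the homogeneous equation; at \<open>x = 0\<close> this reads
  \<open>0 = 1\<close>.\<close>

lemma below_denominator:
  assumes a: "0 < a" and \<eta>: "0 \<le> \<eta>" "\<eta> \<noteq> \<Phi>"
  shows "\<psi>q \<eta> * Z a \<Phi> - l * Z a \<eta> \<noteq> 0"
proof
  assume "\<psi>q \<eta> * Z a \<Phi> - l * Z a \<eta> = 0"
  then have "0 * E_below M X T a q \<eta> 0 0 = 1 * Z 0 \<eta>" using a \<eta> by (intro E_below_Z) auto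
  then show False by simp
qed

lemma E_below_quotient:
  assumes a: "0 < a" and x: "x \<le> a" and \<theta>: "0 \<le> \<theta>" and \<eta>: "0 \<le> \<eta>" "\<eta> \<noteq> \<Phi>"
  shows "E_below M X T a q \<eta> \<theta> x = l * (\<eta> - \<Phi>) * Z x \<eta> / ((\<Phi> + \<theta>) * (\<psi>q \<eta> * Z a \<Phi> - l * Z a \<eta>))"
proof -
  define D where "D = (\<Phi> + \<theta>) * (\<psi>q \<eta> * Z a \<Phi> - l * Z a \<eta>)"
  have D: "D \<noteq> 0" using below_denominator[OF a \<eta>] \<theta> Phi_pos by (simp add: D_def)
  have "1 * E_below M X T a q \<eta> \<theta> x = l * (\<eta> - \<Phi>) / D * Z x \<eta>"
    by (rule E_below_Z[OF a x \<theta> \<eta>]) (use D in \<open>simp add: mult.assoc D_def[symmetric]\<close>)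
  then show ?thesis unfolding D_def by simp
qed

text \<open>The limit is taken in the product of expectation and denominator. At
  \<open>x = 0\<close>, where \<open>Z\<close> is \<open>1\<close>, the product is non-zero, so the
  limiting denominator does not vanish and can be divided by.\<close>

lemma E_below_Phi:
  assumes a: "0 < a" and x: "x \<le> a" and \<theta>: "0 \<le> \<theta>"
  shows "E_below M X T a q \<Phi> \<theta> x = l / (\<Phi> + \<theta>) * (Z x \<Phi> / scale_Z_tilde psi q W a \<Phi> \<Phi>)"
proof -
  let ?D = "scale_Z_tilde psi q W a \<Phi> \<Phi>"
  have E: "E_below M X T a q \<Phi> \<theta> x * ?D = l / (\<Phi> + \<theta>) * Z x \<Phi>" if x: "x \<le> a" for x
  proof (rule tendsto_unique[OF at_Ici_neq_bot[OF less_imp_le[OF Phi_pos]]])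
    show "((\<lambda>u. l / (\<Phi> + \<theta>) * Z x u) \<longlongrightarrow> l / (\<Phi> + \<theta>) * Z x \<Phi>) (at \<Phi> within {0..})"
      by (intro tendsto_mult tendsto_const Z_tendsto_Phi)
    show "((\<lambda>u. l / (\<Phi> + \<theta>) * Z x u) \<longlongrightarrow> E_below M X T a q \<Phi> \<theta> x * ?D) (at \<Phi> within {0..})"
    proof (rule Lim_transform_eventually[OF tendsto_mult[OF E_below_tendsto_at[OF \<theta>] Z_tilde_tendsto]])
      show "\<forall>\<^sub>F u in at \<Phi> within {0..}. E_below M X T a q u \<theta> x * ((\<psi>q u * Z a \<Phi> - l * Z a u) / (u - \<Phi>)) = l / (\<Phi> + \<theta>) * Z x u"
        unfolding eventually_at_filter
      proof (intro always_eventually allI impI)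
        fix u assume u: "u \<noteq> \<Phi>" "u \<in> {0..}"
        have "l * n * z / (P * d) * (d / n) = l / P * z" if "n \<noteq> 0" "d \<noteq> 0" for n z P d :: real
          using that by simp
        from this[of "u - \<Phi>" "\<psi>q u * Z a \<Phi> - l * Z a u"]
        show "E_below M X T a q u \<theta> x * ((\<psi>q u * Z a \<Phi> - l * Z a u) / (u - \<Phi>)) = l / (\<Phi> + \<theta>) * Z x u"
          using u below_denominator[OF a, of u] E_below_quotient[OF a x \<theta>, of u] by simp
      qed
    qed
  qed
  have "?D \<noteq> 0" using E[of 0] a l \<theta> Phi_pos by auto
  then have "E_below M X T a q \<Phi> \<theta> x = l / (\<Phi> + \<theta>) * Z x \<Phi> / ?D" using E[OF x] by (intro eq_divide_imp)
  then show ?thesis by simp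
qed

lemma below_result:
  assumes a: "0 < a" and x: "x \<le> a" and \<theta>: "0 \<le> \<theta>" and \<eta>: "0 \<le> \<eta>"
  shows "quot_lim (\<lambda>v. l * (v - \<Phi>) * Z x v) (\<lambda>v. (\<Phi> + \<theta>) * (\<psi>q v * Z a \<Phi> - l * Z a v)) \<eta> = E_below M X T a q \<eta> \<theta> x"
    and "E_below M X T a q \<eta> \<theta> x = l / (\<Phi> + \<theta>) * (Z x \<eta> / scale_Z_tilde psi q W a \<eta> \<Phi>)"
proof -
  have ev: "\<forall>\<^sub>F u in at \<Phi> within {0..}. E_below M X T a q u \<theta> x = l * (u - \<Phi>) * Z x u / ((\<Phi> + \<theta>) * (\<psi>q u * Z a \<Phi> - l * Z a u))"
    unfolding eventually_at_filter
    by (intro always_eventually allI impI) (rule E_below_quotient[OF a x \<theta>]; simp)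
  show "quot_lim (\<lambda>v. l * (v - \<Phi>) * Z x v) (\<lambda>v. (\<Phi> + \<theta>) * (\<psi>q v * Z a \<Phi> - l * Z a v)) \<eta> = E_below M X T a q \<eta> \<theta> x"
  proof (cases "\<eta> = \<Phi>")
    case True
    then show ?thesis using Lim_transform_eventually[OF E_below_tendsto_at[OF \<theta>] ev] \<eta>
      by (intro quot_lim_eqI) (auto simp: psi_q_Phi)
  next
    case False
    have "(\<Phi> + \<theta>) * (\<psi>q \<eta> * Z a \<Phi> - l * Z a \<eta>) \<noteq> 0" using below_denominator[OF a \<eta> False] \<theta> Phi_pos by simp
    then show ?thesis unfolding quot_lim_def using E_below_quotient[OF a x \<theta> \<eta> False] by simp
  qed
  show "E_below M X T a q \<eta> \<theta> x = l / (\<Phi> + \<theta>) * (Z x \<eta> / scale_Z_tilde psi q W a \<eta> \<Phi>)"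
  proof (cases "\<eta> = \<Phi>")
    case True then show ?thesis using E_below_Phi[OF a x \<theta>] by simp
  next
    case False
    have "l * n * z / (P * d) = l / P * (z / (d / n))" if "n \<noteq> 0" for n z P d :: real using that by simp
    from this[of "\<eta> - \<Phi>" "Z x \<eta>" "\<Phi> + \<theta>" "\<psi>q \<eta> * Z a \<Phi> - l * Z a \<eta>"] show ?thesis
      unfolding scale_Z_tilde_def E_below_quotient[OF a x \<theta> \<eta> False] using False by (simp add: psi_q_Phi)
  qed
qed

definition above_num :: "real \<Rightarrow> real \<Rightarrow> real \<Rightarrow> real" where "above_num a u v = W a * \<psi>q u - (u + v) * Z a u"
definition above_den :: "real \<Rightarrow> real \<Rightarrow> real" where "above_den a v = \<Phi> * Z a \<Phi> - l * W a + v * Z a \<Phi>"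

lemma above_den_eq: "0 < a \<Longrightarrow> above_den a v = deriv (\<lambda>y. Z y \<Phi>) a + v * Z a \<Phi>"
  using DERIV_imp_deriv[OF Z_deriv[of a \<Phi>]] by (simp add: above_den_def psi_q_Phi)

text \<open>The argument of \<open>below_denominator\<close> again, with \<beta> = 0 and
  \<open>B = 1\<close> at \<theta> = 0.\<close>

lemma above_denominator:
  assumes a: "0 < a" and v: "0 < v" shows "above_den a v \<noteq> 0"
proof
  assume "above_den a v = 0"
  then have "0 * E_above M X T a q v 0 0 = l / (l - \<psi>q 0) * (0 * Z 0 0 + 1 * Z 0 \<Phi>)"
    using a v Phi_pos by (intro E_above_Z) (auto simp: above_den_def)
  moreover have "l - \<psi>q 0 \<noteq> 0" using psi_q_eq_iff[of 0] Phi_pos by auto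
  ultimately show False using l by simp
qed

lemma E_above_quotient:
  assumes a: "0 < a" and x: "x \<le> a" and \<theta>: "0 \<le> \<theta>" "\<theta> \<noteq> \<Phi>" and v: "0 < v"
  shows "E_above M X T a q v \<theta> x = l / (l - \<psi>q \<theta>) * (Z x \<theta> + Z x \<Phi> * (above_num a \<theta> v / above_den a v))"
proof -
  have "1 * E_above M X T a q v \<theta> x = l / (l - \<psi>q \<theta>) * (1 * Z x \<theta> + above_num a \<theta> v / above_den a v * Z x \<Phi>)"
    using above_denominator[OF a v] by (intro E_above_Z a x \<theta> v) (auto simp: above_num_def above_den_def)
  then show ?thesis by (simp add: mult.commute)
qed

text \<open>At \<open>\<eta> = 0\<close> the convergence of the inner quotient is read off from the continuity of the left-hand
  side at \<open>x = 0\<close>, where \<open>Z x \<theta> = Z x \<Phi> = 1\<close>.\<close>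

lemma above_quotient_lim:
  assumes a: "0 < a" and x: "x \<le> a" and \<theta>: "0 \<le> \<theta>" "\<theta> \<noteq> \<Phi>" and \<eta>: "0 \<le> \<eta>"
  shows "E_above M X T a q \<eta> \<theta> x = l / (l - \<psi>q \<theta>) * (Z x \<theta> + Z x \<Phi> * quot_lim (above_num a \<theta>) (above_den a) \<eta>)"
proof (cases "\<eta> = 0")
  case False
  then show ?thesis using \<eta> above_denominator[OF a, of \<eta>] E_above_quotient[OF a x \<theta>, of \<eta>] by (simp add: quot_lim_def)
next
  case True
  let ?F = "at 0 within {0::real..}"
  define k where "k = l / (l - \<psi>q \<theta>)"
  have "l - \<psi>q \<theta> \<noteq> 0" using psi_q_eq_iff[OF \<theta>(1)] \<theta>(2) by auto
  then have k: "k \<noteq> 0" using l by (simp add: k_def)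
  have ev: "\<forall>\<^sub>F v in ?F. above_den a v \<noteq> 0 \<and> E_above M X T a q v \<theta> x = k * (Z x \<theta> + Z x \<Phi> * (above_num a \<theta> v / above_den a v))"
    if "x \<le> a" for x unfolding eventually_at_filter k_def
    by (intro always_eventually allI impI conjI above_denominator E_above_quotient a that \<theta>) auto
  define L where "L = E_above M X T a q 0 \<theta> 0 / k - 1"
  have L: "((\<lambda>v. above_num a \<theta> v / above_den a v) \<longlongrightarrow> L) ?F" unfolding L_def
  proof (rule Lim_transform_eventually)
    show "((\<lambda>v. E_above M X T a q v \<theta> 0 / k - 1) \<longlongrightarrow> E_above M X T a q 0 \<theta> 0 / k - 1) ?F"
      by (intro tendsto_intros E_above_tendsto_at \<theta> k) simp
    show "\<forall>\<^sub>F v in ?F. E_above M X T a q v \<theta> 0 / k - 1 = above_num a \<theta> v / above_den a v"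
      using ev[of 0] a by (auto elim!: eventually_mono simp: k)
  qed
  have cont: "(above_num a \<theta> \<longlongrightarrow> above_num a \<theta> 0) ?F" "(above_den a \<longlongrightarrow> above_den a 0) ?F"
    unfolding above_num_def[abs_def] above_den_def[abs_def] by (intro tendsto_intros)+
  \<comment> \<open>If the denominator vanishes at \<open>0\<close>, so does the numerator; then
    \<open>quot_lim\<close> reads the quotient as the limit \<open>L\<close>.\<close>
  have n0: "L * above_den a 0 = above_num a \<theta> 0"
  proof (rule tendsto_unique[OF at_Ici_neq_bot])
    show "(above_num a \<theta> \<longlongrightarrow> L * above_den a 0) ?F"
      by (rule Lim_transform_eventually[OF tendsto_mult[OF L cont(2)]])
        (use ev[of 0] a in \<open>auto elim!: eventually_mono\<close>)
  qed (simp, rule cont(1))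
  have Q: "quot_lim (above_num a \<theta>) (above_den a) 0 = L"
    using n0 L by (intro quot_lim_eqI) (auto simp: field_simps)
  have "E_above M X T a q 0 \<theta> x = k * (Z x \<theta> + Z x \<Phi> * L)"
  proof (rule tendsto_unique[OF at_Ici_neq_bot])
    show "((\<lambda>v. E_above M X T a q v \<theta> x) \<longlongrightarrow> E_above M X T a q 0 \<theta> x) ?F"
      by (rule E_above_tendsto_at[OF \<theta>(1)]) simp
    show "((\<lambda>v. E_above M X T a q v \<theta> x) \<longlongrightarrow> k * (Z x \<theta> + Z x \<Phi> * L)) ?F"
      by (rule Lim_transform_eventually[OF tendsto_mult[OF tendsto_const[of k] tendsto_add[OF tendsto_const[of "Z x \<theta>"] tendsto_mult[OF tendsto_const[of "Z x \<Phi>"] L]]]])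
        (use ev[OF x] in \<open>auto elim!: eventually_mono\<close>)
  qed simp
  then show ?thesis unfolding True Q k_def .
qed

text \<open>At \<theta> = \<Phi> the numerator is exactly minus the denominator. Hence the outer
  numerator vanishes there together with \<open>l - \<psi>q \<theta>\<close>, and the outer quotient
  is of the form \<open>0/0\<close>.\<close>

lemma above_quotient_Phi:
  assumes a: "0 < a" and \<eta>: "0 \<le> \<eta>"
  shows "quot_lim (above_num a \<Phi>) (above_den a) \<eta> = - 1"
proof -
  have e: "above_num a \<Phi> v = - above_den a v" for v
    by (simp add: above_num_def above_den_def psi_q_Phi algebra_simps)
  show ?thesis
  proof (rule quot_lim_eqI[OF \<eta>])
    assume "above_den a \<eta> = 0"
    then have \<eta>0: "\<eta> = 0" using above_denominator[OF a, of \<eta>] \<eta> by force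
    show "((\<lambda>u. above_num a \<Phi> u / above_den a u) \<longlongrightarrow> - 1) (at \<eta> within {0..})"
    proof (rule Lim_transform_eventually[OF tendsto_const])
      show "\<forall>\<^sub>F u in at \<eta> within {0..}. - 1 = above_num a \<Phi> u / above_den a u" unfolding eventually_at_filter \<eta>0
        by (intro always_eventually allI impI) (use above_denominator[OF a] e in auto)
    qed
  qed (auto simp: e)
qed

text \<open>Away from \<Phi> this is \<open>above_quotient_lim\<close>; at \<Phi> the outer quotient
  is a limit in \<theta>, found from the continuity of the expectation in \<theta>.\<close>

lemma above_result:
  assumes a: "0 < a" and x: "x \<le> a" and \<theta>: "0 \<le> \<theta>" and \<eta>: "0 \<le> \<eta>"
  shows "quot_lim (\<lambda>u. l * (Z x u + Z x \<Phi> * quot_lim (above_num a u) (above_den a) \<eta>)) (\<lambda>u. l - \<psi>q u) \<theta> = E_above M X T a q \<eta> \<theta> x"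
proof (rule quot_lim_eqI[OF \<theta>])
  assume "l - \<psi>q \<theta> \<noteq> 0"
  then have "\<theta> \<noteq> \<Phi>" using psi_q_Phi by auto
  from above_quotient_lim[OF a x \<theta> this \<eta>]
  show "l * (Z x \<theta> + Z x \<Phi> * quot_lim (above_num a \<theta>) (above_den a) \<eta>) / (l - \<psi>q \<theta>) = E_above M X T a q \<eta> \<theta> x" by simp
next
  assume "l - \<psi>q \<theta> = 0"
  then have \<theta>\<Phi>: "\<theta> = \<Phi>" using psi_q_eq_iff[OF \<theta>] by simp
  show "l * (Z x \<theta> + Z x \<Phi> * quot_lim (above_num a \<theta>) (above_den a) \<eta>) = 0"
    unfolding \<theta>\<Phi> above_quotient_Phi[OF a \<eta>] by simp
  show "((\<lambda>u. l * (Z x u + Z x \<Phi> * quot_lim (above_num a u) (above_den a) \<eta>) / (l - \<psi>q u)) \<longlongrightarrow> E_above M X T a q \<eta> \<theta> x) (at \<theta> within {0..})"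
  proof (rule Lim_transform_eventually[OF E_above_tendsto_at(2)[OF \<theta> \<eta>]])
    show "\<forall>\<^sub>F u in at \<theta> within {0..}. E_above M X T a q \<eta> u x = l * (Z x u + Z x \<Phi> * quot_lim (above_num a u) (above_den a) \<eta>) / (l - \<psi>q u)"
      unfolding eventually_at_filter \<theta>\<Phi>
    proof (intro always_eventually allI impI)
      fix u assume "u \<noteq> \<Phi>" "u \<in> {0..}"
      then show "E_above M X T a q \<eta> u x = l * (Z x u + Z x \<Phi> * quot_lim (above_num a u) (above_den a) \<eta>) / (l - \<psi>q u)"
        using above_quotient_lim[OF a x, of u \<eta>] \<eta> by simp
    qed
  qed
qed

end

theorem theorem3p3:
  fixes M :: "'a measure" and X :: "real \<Rightarrow> 'a \<Rightarrow> real" and T :: "nat \<Rightarrow> 'a \<Rightarrow> real"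
    and l q a x \<theta> \<eta> :: real and W :: "real \<Rightarrow> real"
  defines "\<psi> \<equiv> Laplace_exponent M X"
  defines "\<psi>q \<equiv> psi_q \<psi> q"
  defines "\<Phi> \<equiv> Phi \<psi> (l + q)"
  defines "Z \<equiv> scale_Z \<psi> q W"
  defines "Zt \<equiv> scale_Z_tilde \<psi> q W"
  assumes "spectrally_negative_Levy M X"
    and "Poisson_arrivals M l T"
    and "indep_of_arrivals M X T"
    and "is_scale_function \<psi> q W"
    and "0 < a" and "0 \<le> \<theta>" and "0 \<le> \<eta>" and "0 \<le> q" and "x \<le> a"
  shows "E_below M X T a q \<eta> \<theta> x =
           quot_lim (\<lambda>v. l * (v - \<Phi>) * Z x v)
                    (\<lambda>v. (\<Phi> + \<theta>) * (\<psi>q v * Z a \<Phi> - l * Z a v)) \<eta> \<and>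
         quot_lim (\<lambda>v. l * (v - \<Phi>) * Z x v)
                  (\<lambda>v. (\<Phi> + \<theta>) * (\<psi>q v * Z a \<Phi> - l * Z a v)) \<eta> =
           l / (\<Phi> + \<theta>) * (Z x \<eta> / Zt a \<eta> \<Phi>) \<and>
         E_above M X T a q \<eta> \<theta> x =
           quot_lim
             (\<lambda>u. l * (Z x u + Z x \<Phi> *
                quot_lim (\<lambda>v. W a * \<psi>q u - (u + v) * Z a u)
                         (\<lambda>v. deriv (\<lambda>y. Z y \<Phi>) a + v * Z a \<Phi>) \<eta>))
             (\<lambda>u. l - \<psi>q u) \<theta>"
proof -
  interpret spectrally_negative_Levy M X by fact
  interpret arr: Poisson_arrivals M l T by fact
  interpret S: observed_scale M X W q l T by unfold_locales (use assms arr.rate_pos in \<open>auto simp: \<psi>_def\<close>)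
  have \<Phi>: "\<Phi> = S.\<Phi>" unfolding \<Phi>_def \<psi>_def by (rule S.Phi_eq)
  have n: "S.above_num a u = (\<lambda>v. W a * \<psi>q u - (u + v) * Z a u)" for u
    by (simp add: S.above_num_def fun_eq_iff \<psi>q_def Z_def \<psi>_def)
  have d: "S.above_den a = (\<lambda>v. deriv (\<lambda>y. Z y \<Phi>) a + v * Z a \<Phi>)"
    by (simp add: S.above_den_eq[OF \<open>0 < a\<close>] fun_eq_iff Z_def \<psi>_def \<Phi>)
  note b = S.below_result[OF \<open>0 < a\<close> \<open>x \<le> a\<close> \<open>0 \<le> \<theta>\<close> \<open>0 \<le> \<eta>\<close>]
  note ab = S.above_result[OF \<open>0 < a\<close> \<open>x \<le> a\<close> \<open>0 \<le> \<theta>\<close> \<open>0 \<le> \<eta>\<close>, unfolded n d]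
  show ?thesis using b ab unfolding \<psi>q_def Z_def Zt_def \<psi>_def \<Phi> by simp
qed

end
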